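(* The problem C-$\langle \mathcal{P}_r \rightarrow \mathcal{T}_s \rangle$ is in $\mathsf{P}$: when the virtual graph is a path and the substrate graph is a tree, a minimum-cost feasible mapping (or the fact that none exists) can be computed in time $\mathcal{O}(n_r^2 n_s)$.
   Context: Uniform-demand Virtual Network Embedding (uniVNE). An instance consists of a virtual graph $\mathcal{G}_r=(V_r,E_r)$ (undirected, simple, connected, $n_r=|V_r|$ nodes) and a substrate graph $\mathcal{G}_s=(V_s,E_s)$ (undirected, simple, connected, $n_s=|V_s|$ nodes) with capacities $c(u)\in\mathbb{N}^+$ for $u\in V_s$ and $c(e)\in\mathbb{N}^+$ for $e\in E_s$. A mapping is a pair $m=(m_V,m_E)$ where $m_V:V_r\to V_s$ and $m_E$ assigns to each virtual edge $(\bar u,\bar v)\in E_r$ a loop-free path of $\mathcal{G}_s$ connecting $m_V(\bar u)$ and $m_V(\bar v)$ (the empty path if these coincide). The mapping is feasible if every $u\in V_s$ satisfies $|m_V^{-1}(u)|\le c(u)$ and every $e\in E_s$ belongs to at most $c(e)$ of the paths $m_E(\bar e)$. In C-uniVNE one is additionally given nonnegative integer costs $w(u)$, $u\in V_s$, and $w(e)$, $e\in E_s$ (and a budget $\Gamma$); the cost of $m$ is $\sum_{\bar u\in V_r} w(m_V(\bar u))+\sum_{\bar e\in E_r}\sum_{e\in m_E(\bar e)} w(e)$, and the task is to decide whether a feasible mapping of cost at most $\Gamma$ exists, equivalently to find a minimum-cost feasible mapping. *)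

theory Defs
  imports Main
begin

section \<open>Finite simple undirected graphs\<close>

text \<open>A graph is a vertex set with a set of two-element vertex sets.  Paths are nonempty
  lists of vertices; the empty path at a vertex \<open>x\<close> is \<open>[x]\<close>, which has no edges.\<close>

definition simple_graph :: "'a set \<Rightarrow> 'a set set \<Rightarrow> bool" where
  "simple_graph V E \<longleftrightarrow> finite V \<and> V \<noteq> {} \<and> (\<forall>e\<in>E. e \<subseteq> V \<and> card e = 2)"

definition path_edges :: "'a list \<Rightarrow> 'a set set" where
  "path_edges p = {{p ! i, p ! Suc i} | i. Suc i < length p}"

definition loop_free_path :: "'a set \<Rightarrow> 'a set set \<Rightarrow> 'a list \<Rightarrow> bool" where
  "loop_free_path V E p \<longleftrightarrow> p \<noteq> [] \<and> distinct p \<and> set p \<subseteq> V \<and> path_edges p \<subseteq> E"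

definition connected_graph :: "'a set \<Rightarrow> 'a set set \<Rightarrow> bool" where
  "connected_graph V E \<longleftrightarrow>
     (\<forall>u\<in>V. \<forall>v\<in>V. \<exists>p. loop_free_path V E p \<and> hd p = u \<and> last p = v)"

definition acyclic_graph :: "'a set \<Rightarrow> 'a set set \<Rightarrow> bool" where
  "acyclic_graph V E \<longleftrightarrow>
     \<not> (\<exists>p. loop_free_path V E p \<and> 3 \<le> length p \<and> {last p, hd p} \<in> E)"

definition tree_graph :: "'a set \<Rightarrow> 'a set set \<Rightarrow> bool" where
  "tree_graph V E \<longleftrightarrow> simple_graph V E \<and> connected_graph V E \<and> acyclic_graph V E"

definition path_graph :: "'a set \<Rightarrow> 'a set set \<Rightarrow> bool" where
  "path_graph V E \<longleftrightarrow> (\<exists>p. p \<noteq> [] \<and> distinct p \<and> set p = V \<and> path_edges p = E)"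


section \<open>Uniform-demand virtual network embedding with costs\<close>

record ('a, 'b) cvne =
  VR :: "'a set"
  ER :: "'a set set"
  VS :: "'b set"
  ES :: "'b set set"
  node_cap :: "'b \<Rightarrow> nat"
  edge_cap :: "'b set \<Rightarrow> nat"
  node_cost :: "'b \<Rightarrow> nat"
  edge_cost :: "'b set \<Rightarrow> nat"

definition valid_cvne :: "('a, 'b) cvne \<Rightarrow> bool" where
  "valid_cvne I \<longleftrightarrow>
     simple_graph (VR I) (ER I) \<and> connected_graph (VR I) (ER I) \<and>
     simple_graph (VS I) (ES I) \<and> connected_graph (VS I) (ES I) \<and>
     (\<forall>u\<in>VS I. 0 < node_cap I u) \<and> (\<forall>e\<in>ES I. 0 < edge_cap I e)"

definition path_to_tree :: "('a, 'b) cvne \<Rightarrow> bool" where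
  "path_to_tree I \<longleftrightarrow>
     valid_cvne I \<and> path_graph (VR I) (ER I) \<and> tree_graph (VS I) (ES I)"

type_synonym ('a, 'b) mapping = "('a \<Rightarrow> 'b) \<times> ('a set \<Rightarrow> 'b list)"

text \<open>Virtual edges are unordered, so the path of an edge may be listed in either direction.
  If both endpoints are mapped to \<open>x\<close>, distinctness forces the path \<open>[x]\<close>.\<close>

definition is_mapping :: "('a, 'b) cvne \<Rightarrow> ('a, 'b) mapping \<Rightarrow> bool" where
  "is_mapping I m \<longleftrightarrow>
     (\<forall>a\<in>VR I. fst m a \<in> VS I) \<and>
     (\<forall>f\<in>ER I. loop_free_path (VS I) (ES I) (snd m f) \<and>
        {hd (snd m f), last (snd m f)} = fst m ` f)"

definition feasible :: "('a, 'b) cvne \<Rightarrow> ('a, 'b) mapping \<Rightarrow> bool" where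
  "feasible I m \<longleftrightarrow>
     is_mapping I m \<and>
     (\<forall>u\<in>VS I. card {a \<in> VR I. fst m a = u} \<le> node_cap I u) \<and>
     (\<forall>e\<in>ES I. card {f \<in> ER I. e \<in> path_edges (snd m f)} \<le> edge_cap I e)"

definition cost :: "('a, 'b) cvne \<Rightarrow> ('a, 'b) mapping \<Rightarrow> nat" where
  "cost I m = (\<Sum>a\<in>VR I. node_cost I (fst m a)) +
     (\<Sum>f\<in>ER I. \<Sum>e\<in>path_edges (snd m f). edge_cost I e)"

definition min_cost_feasible :: "('a, 'b) cvne \<Rightarrow> ('a, 'b) mapping \<Rightarrow> bool" where
  "min_cost_feasible I m \<longleftrightarrow>
     feasible I m \<and> (\<forall>m'. feasible I m' \<longrightarrow> cost I m \<le> cost I m')"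


section \<open>Random access machines\<close>

text \<open>Structured programs for a random access machine over the natural numbers.  A program
  uses finitely many registers; memory is addressed indirectly through registers.  The
  arithmetic consists of addition and truncated subtraction only, and every instruction and
  every test takes one step.  Without multiplication, numbers gain at most one bit per step, so
  this uniform cost measure and Turing machine time are polynomially related.\<close>

record ram_state =
  reg :: "nat \<Rightarrow> nat"
  mem :: "nat \<Rightarrow> nat"

datatype ram =
    RConst nat nat
  | RAdd nat nat nat
  | RSub nat nat nat
  | RLoad nat nat
  | RStore nat nat
  | RSeq ram ram
  | RIf nat ram ram
  | RWhile nat ram

definition set_reg :: "nat \<Rightarrow> nat \<Rightarrow> ram_state \<Rightarrow> ram_state" where
  "set_reg r v s = s\<lparr>reg := (reg s)(r := v)\<rparr>"

definition set_mem :: "nat \<Rightarrow> nat \<Rightarrow> ram_state \<Rightarrow> ram_state" where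
  "set_mem a v s = s\<lparr>mem := (mem s)(a := v)\<rparr>"

text \<open>\<open>exec p s t s'\<close>: started in state \<open>s\<close>, program \<open>p\<close> halts after exactly \<open>t\<close> steps in
  state \<open>s'\<close>.  A test succeeds if the tested register is nonzero.\<close>

inductive exec :: "ram \<Rightarrow> ram_state \<Rightarrow> nat \<Rightarrow> ram_state \<Rightarrow> bool" where
  exec_Const: "exec (RConst r k) s 1 (set_reg r k s)"
| exec_Add: "exec (RAdd r a b) s 1 (set_reg r (reg s a + reg s b) s)"
| exec_Sub: "exec (RSub r a b) s 1 (set_reg r (reg s a - reg s b) s)"
| exec_Load: "exec (RLoad r a) s 1 (set_reg r (mem s (reg s a)) s)"
| exec_Store: "exec (RStore a b) s 1 (set_mem (reg s a) (reg s b) s)"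
| exec_Seq: "exec p s t s' \<Longrightarrow> exec q s' u s'' \<Longrightarrow> exec (RSeq p q) s (t + u) s''"
| exec_IfTrue: "reg s a \<noteq> 0 \<Longrightarrow> exec p s t s' \<Longrightarrow> exec (RIf a p q) s (1 + t) s'"
| exec_IfFalse: "reg s a = 0 \<Longrightarrow> exec q s t s' \<Longrightarrow> exec (RIf a p q) s (1 + t) s'"
| exec_WhileTrue: "reg s a \<noteq> 0 \<Longrightarrow> exec p s t s' \<Longrightarrow> exec (RWhile a p) s' u s'' \<Longrightarrow>
    exec (RWhile a p) s (1 + t + u) s''"
| exec_WhileFalse: "reg s a = 0 \<Longrightarrow> exec (RWhile a p) s 1 s"

inductive_cases exec_elims:
  "exec (RConst r k) s t s'"
  "exec (RAdd r a b) s t s'"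
  "exec (RSub r a b) s t s'"
  "exec (RLoad r a) s t s'"
  "exec (RStore a b) s t s'"
  "exec (RSeq p q) s t s'"
  "exec (RIf a p q) s t s'"
  "exec (RWhile a p) s t s'"

lemma exec_deterministic:
  "exec p s t s' \<Longrightarrow> exec p s u s'' \<Longrightarrow> t = u \<and> s' = s''"
proof (induction arbitrary: u s'' rule: exec.induct)
  case (exec_Const r k s)
  show ?case
    by (rule exec_elims(1)[OF exec_Const.prems]) simp
next
  case (exec_Add r a b s)
  show ?case
    by (rule exec_elims(2)[OF exec_Add.prems]) simp
next
  case (exec_Sub r a b s)
  show ?case
    by (rule exec_elims(3)[OF exec_Sub.prems]) simp
next
  case (exec_Load r a s)
  show ?case
    by (rule exec_elims(4)[OF exec_Load.prems]) simp
next
  case (exec_Store a b s)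
  show ?case
    by (rule exec_elims(5)[OF exec_Store.prems]) simp
next
  case (exec_Seq p s t s' q v s1)
  from exec_Seq.prems obtain t2 r v2
    where u: "u = t2 + v2" and p: "exec p s t2 r" and q: "exec q r v2 s''"
    by (rule exec_elims(6))
  from exec_Seq.IH(1)[OF p] have t: "t = t2" and r: "s' = r" by simp_all
  from exec_Seq.IH(2)[OF q[folded r]] t u show ?case by simp
next
  case (exec_IfTrue s a p t s' q)
  show ?case
  proof (rule exec_elims(7)[OF exec_IfTrue.prems])
    fix t2
    assume "u = Suc t2" and x: "exec p s t2 s''"
    with exec_IfTrue.IH[OF x] show ?case by simp
  qed (use exec_IfTrue.hyps(1) in simp_all)
next
  case (exec_IfFalse s a q t s' p)
  show ?case
  proof (rule exec_elims(7)[OF exec_IfFalse.prems])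
    fix t2
    assume "u = Suc t2" and x: "exec q s t2 s''"
    with exec_IfFalse.IH[OF x] show ?case by simp
  qed (use exec_IfFalse.hyps(1) in simp_all)
next
  case (exec_WhileTrue s a p t s' v s1)
  have "\<exists>t2 r v2. u = 1 + t2 + v2 \<and> exec p s t2 r \<and> exec (RWhile a p) r v2 s''"
  proof (rule exec_elims(8)[OF exec_WhileTrue.prems])
    fix t2 r v2
    assume "u = Suc (t2 + v2)" "exec p s t2 r" "exec (RWhile a p) r v2 s''"
    then show ?thesis by (intro exI[of _ t2] exI[of _ r] exI[of _ v2]) simp
  qed (use exec_WhileTrue.hyps(1) in simp)
  then obtain t2 r v2
    where u: "u = 1 + t2 + v2" and p: "exec p s t2 r" and q: "exec (RWhile a p) r v2 s''"
    by (elim exE conjE)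
  from exec_WhileTrue.IH(1)[OF p] have t: "t = t2" and r: "s' = r" by simp_all
  from exec_WhileTrue.IH(2)[OF q[folded r]] t u show ?case by simp
next
  case (exec_WhileFalse s a p)
  show ?case
    by (rule exec_elims(8)[OF exec_WhileFalse.prems]) (use exec_WhileFalse.hyps in simp_all)
qed

text \<open>Input and output are lists of numbers, stored in the memory cells \<open>0, 1, \<dots>\<close>, with the
  length of the list in register \<open>0\<close>.\<close>

definition ram_input :: "nat list \<Rightarrow> ram_state" where
  "ram_input xs =
     \<lparr>reg = (\<lambda>r. if r = 0 then length xs else 0),
      mem = (\<lambda>a. if a < length xs then xs ! a else 0)\<rparr>"

definition ram_output :: "ram_state \<Rightarrow> nat list" where
  "ram_output s = map (mem s) [0..<reg s 0]"

definition computes_within :: "ram \<Rightarrow> nat list \<Rightarrow> nat \<Rightarrow> nat list \<Rightarrow> bool" where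
  "computes_within p xs T ys \<longleftrightarrow>
     (\<exists>t s. exec p (ram_input xs) t s \<and> t \<le> T \<and> ram_output s = ys)"

text \<open>The languages over the binary alphabet that are decided in time polynomial in the
  length of the input string.\<close>

definition class_P :: "bool list set set" where
  "class_P = {L. \<exists>p c k. \<forall>x.
     computes_within p (map of_bool x) (c * length x ^ k + c) [of_bool (x \<in> L)]}"


section \<open>Encodings\<close>

text \<open>Binary digits of a number, most significant digit first, without leading zeros.\<close>

fun binary :: "nat \<Rightarrow> bool list" where
  "binary n = (if n = 0 then [] else binary (n div 2) @ [odd n])"

declare binary.simps [simp del]

text \<open>Self-delimiting code: each binary digit is preceded by \<open>True\<close>, and \<open>False\<close> ends the
  number.\<close>

definition encode_nat :: "nat \<Rightarrow> bool list" where
  "encode_nat n = concat (map (\<lambda>b. [True, b]) (binary n)) @ [False]"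

definition encode_nats :: "nat list \<Rightarrow> bool list" where
  "encode_nats xs = concat (map encode_nat xs)"

definition lists_edges :: "('a \<times> 'a) list \<Rightarrow> 'a set set \<Rightarrow> bool" where
  "lists_edges es E \<longleftrightarrow>
     distinct (map (\<lambda>(u, v). {u, v}) es) \<and> set (map (\<lambda>(u, v). {u, v}) es) = E"

text \<open>The nodes of both graphs are numbered from \<open>0\<close>; the edges are listed in an arbitrary
  order, each once, with arbitrary orientation.\<close>

definition encodes_cvne :: "nat list \<Rightarrow> (nat, nat) cvne \<Rightarrow> bool" where
  "encodes_cvne xs I \<longleftrightarrow>
     (\<exists>nr ns vs es.
        VR I = {..<nr} \<and> VS I = {..<ns} \<and>
        lists_edges vs (ER I) \<and> lists_edges es (ES I) \<and>
        xs = [nr, length vs] @ concat (map (\<lambda>(a, b). [a, b]) vs) @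
             [ns] @ concat (map (\<lambda>u. [node_cap I u, node_cost I u]) [0..<ns]) @
             [length es] @
             concat (map (\<lambda>(u, v). [u, v, edge_cap I {u, v}, edge_cost I {u, v}]) es))"

definition encodes_mapping :: "nat list \<Rightarrow> (nat, nat) cvne \<Rightarrow> (nat, nat) mapping \<Rightarrow> bool" where
  "encodes_mapping ys I m \<longleftrightarrow>
     (\<exists>vs. lists_edges vs (ER I) \<and>
        ys = map (fst m) [0..<card (VR I)] @
             concat (map (\<lambda>(a, b). [a, b, length (snd m {a, b})] @ snd m {a, b}) vs))"

definition is_answer :: "(nat, nat) cvne \<Rightarrow> nat list \<Rightarrow> bool" where
  "is_answer I ys \<longleftrightarrow>
     (if \<exists>m. feasible I m
      then \<exists>m zs. min_cost_feasible I m \<and> encodes_mapping zs I m \<and> ys = 1 # zs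
      else ys = [0])"

text \<open>The decision problem: binary encodings of an instance with path as virtual graph and
  tree as substrate, followed by a budget \<open>\<Gamma>\<close> that some feasible mapping respects.\<close>

definition C_path_to_tree :: "bool list set" where
  "C_path_to_tree =
     {encode_nats (xs @ [\<Gamma>]) | xs \<Gamma>.
        \<exists>I. path_to_tree I \<and> encodes_cvne xs I \<and> (\<exists>m. feasible I m \<and> cost I m \<le> \<Gamma>)}"

end

theory Submission imports Defs begin

text \<open>
  A mapping of a virtual path is, at no loss, a tour through the tree: the list of the hosts of
  successive virtual nodes, with every virtual edge routed along the tree path.  If \<open>k\<close> of the \<open>n\<close>
  virtual nodes and \<open>j\<close> of the two ends of the tour lie behind a tree edge, then the tour crosses
  this edge at least \<open>charge n k j \<in> {0, 1, 2}\<close> times.  Conversely, partial tours below a node and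
  below one of its children are joined by reversal and concatenation such that no edge is crossed
  more often than charged.  So capacities and costs of a tour depend on the pairs \<open>(k, j)\<close> only, and
  contracting the tree leaf by leaf with a table of \<open>3 (n + 1)\<close> entries per node gives an optimal
  tour; every one of the \<open>O(n\<^sub>s)\<close> contractions takes \<open>O(n\<^sub>r\<^sup>2)\<close> steps, and writing out the
  paths of an optimal mapping takes \<open>O(n\<^sub>r n\<^sub>s)\<close> steps.

  The algorithm is a program in a language of counting loops, whose running time is a polynomial in
  the loop bounds; a compiler to the machine preserves results and time up to a constant factor.
\<close>

section \<open>Crossing numbers of tours and their joins\<close>

section \<open>Crossings of a walk\<close>

text \<open>Joining is harmless because pieces are inserted only at a passage through the node
  \<open>u\<close>: for an edge whose far side a piece never visits, the piece reads as a block of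
  \<open>False\<close> next to a \<open>False\<close> and adds no change. Hence the words carry
  explicit letters for passages, and these letters vanish once all \<open>n\<close> nodes are
  placed, because an edge with every node behind it must be free. In a table, \<open>j\<close> is a
  format of the two lists and not a verified count of ends; even \<open>k = 0\<close> with
  \<open>j = 2\<close> has a partial tour. The proof therefore consists of two one-sided statements:
  every finite entry belongs to a partial tour that costs at most what is recorded, and at the true
  pair \<open>(k, j)\<close> of a feasible tour the record is at most what this tour pays inside.
  The bounds meet at the root only. Since the machine can neither multiply nor divide, the pair is
  coded as \<open>3 * k + j\<close>, so that adding pairs is adding numbers without carry.
  Unverified inputs are covered by the elimination itself: if it succeeds with one edge less than
  nodes, the graph is a tree, and it succeeds on every tree.\<close>

fun changes :: "bool list \<Rightarrow> nat" where
  "changes [] = 0"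
| "changes [x] = 0"
| "changes (x # y # zs) = of_bool (x \<noteq> y) + changes (y # zs)"

lemma changes_split: "changes (xs @ y # zs) = changes (xs @ [y]) + changes (y # zs)"
proof (induction xs)
  case (Cons x xs)
  then show ?case by (cases xs) auto
qed simp

lemma changes_snoc2: "changes (xs @ [x, y]) = changes (xs @ [x]) + of_bool (x \<noteq> y)"
  using changes_split[of xs x "[y]"] by simp

lemma changes_rev [simp]: "changes (rev xs) = changes xs"
proof (induction xs rule: changes.induct)
  case (3 x y zs)
  have "changes (rev (x # y # zs)) = changes (rev zs @ [y, x])" by simp
  also have "\<dots> = changes (rev (y # zs)) + of_bool (y \<noteq> x)" by (simp only: changes_snoc2 rev.simps)
  finally show ?case using 3 by auto
qed simp_all

lemma changes_const: "set xs \<subseteq> {b} \<Longrightarrow> changes xs = 0"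
  by (induction xs rule: changes.induct) auto

lemma changes_const_Cons: "set xs \<subseteq> {b} \<Longrightarrow> changes (b # xs) = 0"
  by (rule changes_const[of _ b]) auto

text \<open>A triangle inequality for neighbouring letters. It is used to drop passage letters, and
  with them the visits to \<open>u\<close> that a completed tour does not make.\<close>

lemma changes_delete: "changes (xs @ zs) \<le> changes (xs @ y # zs)"
proof (induction xs rule: changes.induct)
  case 1
  then show ?case by (cases zs) auto
next
  case (2 x)
  then show ?case by (cases zs) auto
qed auto

lemma changes_eq_card: "changes w = card {i. Suc i < length w \<and> w ! i \<noteq> w ! Suc i}"
proof (induction w rule: changes.induct)
  case (3 x y zs)
  let ?S = "{i. Suc i < length (y # zs) \<and> (y # zs) ! i \<noteq> (y # zs) ! Suc i}"
  have "{i. Suc i < length (x # y # zs) \<and> (x # y # zs) ! i \<noteq> (x # y # zs) ! Suc i} =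
      (if x \<noteq> y then {0} else {}) \<union> Suc ` ?S" (is "?L = ?R")
  proof (rule set_eqI)
    fix i show "i \<in> ?L \<longleftrightarrow> i \<in> ?R" by (cases i) (auto simp: image_iff)
  qed
  moreover have "finite ?S" by (rule finite_subset[of _ "{..<length (y # zs)}"]) auto
  ultimately show ?case using 3 by (auto simp: card_image)
qed auto

lemma changes_parity: "w \<noteq> [] \<Longrightarrow> even (changes w) \<longleftrightarrow> hd w = last w"
  by (induction w rule: changes.induct) auto

lemma changes_0_const: "changes w = 0 \<Longrightarrow> w \<noteq> [] \<Longrightarrow> set w = {hd w}"
  by (induction w rule: changes.induct) (auto split: if_splits)

text \<open>A tour of \<open>n\<close> virtual nodes of which \<open>k\<close> lie behind an edge, \<open>j\<close> counting the ends of
  the tour there, has to cross that edge \<open>charge n k j\<close> times.\<close>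

definition charge :: "nat \<Rightarrow> nat \<Rightarrow> nat \<Rightarrow> nat" where
  "charge n k j = (if k = 0 \<or> k = n then 0 else if j = 1 then 1 else 2)"

text \<open>A constant word has all or none of the nodes behind the edge, where the charge is 0.
  Otherwise there is a change, and by parity a single change means that the two ends lie on
  different sides, which is the case \<open>j = 1\<close>. So 2 is charged only where two changes
  exist.\<close>

lemma charge_le_changes:
  assumes "w \<noteq> []"
  shows "charge (length w) (length (filter id w)) (of_bool (hd w) + of_bool (last w)) \<le> changes w"
proof (cases "changes w = 0")
  case True
  then have "set w = {hd w}" using assms by (rule changes_0_const)
  then have "filter id w = [] \<or> filter id w = w"
    by (cases "hd w") (auto simp: filter_empty_conv filter_id_conv)
  then show ?thesis by (auto simp: charge_def)
next
  case False
  then show ?thesis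
    using changes_parity[OF assms] by (cases "changes w = 1") (auto simp: charge_def)
qed

text \<open>A partial tour of the part of the tree below \<open>u\<close> is a pair of lists \<open>(X, Y)\<close>, both read
  in the direction away from \<open>u\<close>.  With \<open>j = 0\<close> ends below \<open>u\<close>, \<open>X\<close> is a round trip; with
  \<open>j = 1\<close>, \<open>X\<close> is the remainder of the tour, and with \<open>j = 2\<close> the tour is
  \<open>rev X @ \<dots> @ Y\<close>, where the dots are spent outside.  \<open>merge_tours\<close> joins the partial tours
  of a node and of one of its children, using reversal of the first argument only.\<close>

definition merge_tours :: "nat \<Rightarrow> nat \<Rightarrow> 'a list \<times> 'a list \<Rightarrow> 'a list \<times> 'a list \<Rightarrow> 'a list \<times> 'a list" where
  "merge_tours j1 j2 A B =
     (if j2 = 0 then (rev (fst B) @ fst A, snd A)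
      else if j1 = 0 then (rev (fst A) @ fst B, snd B)
      else (fst A, fst B))"

text \<open>The word of a partial tour records membership in a set that does not contain \<open>u\<close>; the
  added letters \<open>False\<close> stand for the passages through \<open>u\<close>.  They are absent when the tour is
  complete.\<close>

definition word_changes :: "nat \<Rightarrow> nat \<Rightarrow> bool list \<times> bool list \<Rightarrow> nat" where
  "word_changes n j A =
     (if length (fst A) + length (snd A) = n then changes (rev (fst A) @ snd A)
      else changes ((if j = 0 then [False] else []) @ rev (fst A) @ False # snd A))"

definition tour_shape :: "nat \<Rightarrow> 'a list \<times> 'a list \<Rightarrow> bool" where
  "tour_shape j A \<longleftrightarrow> j \<le> 2 \<and> (j < 2 \<longrightarrow> snd A = [])"

lemma changes_rev_snoc: "changes (rev xs @ [y]) = changes (y # xs)"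
  by (metis changes_rev rev.simps(2))

text \<open>A stay outside the set that borders on a passage letter cannot be told from the passage
  itself. This and the next two lemmas treat stays before the letter, at the front of the word and
  at its end.\<close>

lemma changes_collapse_before:
  "set fs \<subseteq> {False} \<Longrightarrow> changes (xs @ fs @ False # ys) = changes (xs @ False # ys)"
proof (induction fs arbitrary: xs)
  case (Cons f fs)
  have "changes (xs @ (f # fs) @ False # ys) = changes ((xs @ [False]) @ fs @ False # ys)"
    using Cons.prems by simp
  also have "\<dots> = changes ((xs @ [False]) @ False # ys)" using Cons by (intro Cons.IH) auto
  also have "\<dots> = changes (xs @ False # ys)"
    using changes_split[of xs False "False # ys"] changes_split[of xs False ys] by simp
  finally show ?case .
qed simp

lemma changes_collapse_front:
  "set fs \<subseteq> {False} \<Longrightarrow> changes (False # fs @ ys) = changes (False # ys)"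
  by (induction fs) auto

lemma changes_collapse_after:
  "set fs \<subseteq> {False} \<Longrightarrow> changes (xs @ False # fs) = changes (xs @ [False])"
  using changes_split[of xs False fs] changes_const_Cons[of fs False] by simp

lemma changes_le_Cons: "changes w \<le> changes (x # w)"
  using changes_delete[of "[]" w x] by simp

text \<open>The edge in question lies inside the part of the parent, so the lists of the child read
  as \<open>False\<close> and collapse at the passage through \<open>u\<close> where they are
  inserted. If \<open>A\<close> is already complete, there is no room left for
  \<open>B\<close>.\<close>

lemma word_changes_outer:
  assumes B: "set (fst B) \<subseteq> {False}" "set (snd B) \<subseteq> {False}"
    and sh: "tour_shape j1 A" "tour_shape j2 B" "j1 + j2 \<le> 2"
    and len: "length (fst A) + length (snd A) + length (fst B) + length (snd B) \<le> n"
  shows "word_changes n (j1 + j2) (merge_tours j1 j2 A B) \<le> word_changes n j1 A"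
proof -
  obtain X Y where A_eq: "A = (X, Y)" by (cases A)
  obtain X' Y' where B_eq: "B = (X', Y')" by (cases B)
  note eqs = A_eq B_eq
  consider "j2 = 0" "Y' = []" | "j2 > 0" "j1 = 0" "Y = []" | "j1 = 1" "j2 = 1" "Y = []" "Y' = []"
    using sh eqs unfolding tour_shape_def by fastforce
  note cases = this
  let ?M = "merge_tours j1 j2 A B"
  let ?W = "\<lambda>j C. changes ((if j = (0::nat) then [False] else []) @ rev (fst C) @ False # snd C)"
  show ?thesis
  proof (cases "length X + length Y = n")
    case True
    then have nil: "X' = []" "Y' = []" using len eqs by auto
    from cases show ?thesis
      by cases (use True nil in \<open>auto simp: word_changes_def merge_tours_def eqs\<close>)
  next
    case False
    have "?W (j1 + j2) ?M \<le> ?W j1 A"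
      using cases
    proof cases
      case 1
      have "changes ((if j1 = 0 then [False] else []) @ rev X @ X' @ False # Y)
         = changes (((if j1 = 0 then [False] else []) @ rev X) @ False # Y)"
        using changes_collapse_before[of X' "(if j1 = 0 then [False] else []) @ rev X" Y] B
        by (simp only: eqs append_assoc fst_conv)
      then show ?thesis using 1 by (simp add: merge_tours_def eqs)
    next
      case 2
      \<comment> \<open>An added leading \<open>False\<close> can only raise the count, and it
        absorbs the first list of the child. What remains is the round trip of the parent read
        backwards, which has equally many changes.\<close>
      have "changes (rev X' @ X @ False # Y') \<le> changes (False # rev X' @ X @ False # Y')"
        by (rule changes_le_Cons)
      also have "\<dots> = changes (False # X @ False # Y')"
        using B by (intro changes_collapse_front) (simp add: eqs)
      also have "\<dots> = changes ((False # X) @ [False])"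
        using changes_collapse_after[of Y' "False # X"] B by (simp add: eqs)
      also have "\<dots> = changes (False # rev X @ [False])"
        using changes_rev[of "False # X @ [False]"] by simp
      finally show ?thesis using 2 by (simp add: merge_tours_def eqs)
    next
      case 3
      then show ?thesis using changes_collapse_after[of X' "rev X"] B
        by (simp add: merge_tours_def eqs)
    qed
    \<comment> \<open>Erasing the passage letters does not raise the count, so a join that completes
      the tour is covered too.\<close>
    moreover have "changes (rev (fst ?M) @ snd ?M) \<le> ?W (j1 + j2) ?M"
      using changes_delete[of "rev (fst ?M)" "snd ?M" False]
        changes_le_Cons[of "rev (fst ?M) @ False # snd ?M" False] by (auto intro: order_trans)
    ultimately show ?thesis using False by (simp add: word_changes_def eqs split del: if_split) (simp split: if_splits)
  qed
qed

text \<open>Now the edge lies inside the part of the child, and the parent contributes the blocks of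
  \<open>False\<close>. A round trip of the child is inserted in reverse, hence the comparison up to
  reversal.\<close>

lemma word_changes_inner:
  assumes A: "set (fst A) \<subseteq> {False}" "set (snd A) \<subseteq> {False}"
    and sh: "tour_shape j1 A" "tour_shape j2 B" "j1 + j2 \<le> 2"
    and len: "length (fst A) + length (snd A) + length (fst B) + length (snd B) \<le> n"
  shows "word_changes n (j1 + j2) (merge_tours j1 j2 A B) \<le> word_changes n j2 B"
proof -
  obtain X Y where A_eq: "A = (X, Y)" by (cases A)
  obtain X' Y' where B_eq: "B = (X', Y')" by (cases B)
  note eqs = A_eq B_eq
  consider "j2 = 0" "Y' = []" | "j2 > 0" "j1 = 0" "Y = []" | "j1 = 1" "j2 = 1" "Y = []" "Y' = []"
    using sh eqs unfolding tour_shape_def by fastforce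
  note cases = this
  let ?M = "merge_tours j1 j2 A B"
  let ?W = "\<lambda>j C. changes ((if j = (0::nat) then [False] else []) @ rev (fst C) @ False # snd C)"
  show ?thesis
  proof (cases "length X' + length Y' = n")
    case True
    then have nil: "X = []" "Y = []" using len eqs by auto
    from cases show ?thesis
      by cases (use True nil in \<open>auto simp: word_changes_def merge_tours_def eqs\<close>)
  next
    case False
    have "?W (j1 + j2) ?M \<le> ?W j2 B"
      using cases
    proof cases
      case 1
      have "changes ((if j1 = 0 then [False] else []) @ rev X @ X' @ False # Y)
          \<le> changes (False # rev X @ X' @ False # Y)" using changes_le_Cons[of _ False] by simp
      also have "\<dots> = changes (False # X' @ False # Y)"
        using A by (intro changes_collapse_front) (simp add: eqs)
      also have "\<dots> = changes ((False # X') @ [False])"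
        using changes_collapse_after[of Y "False # X'"] A by (simp add: eqs)
      also have "\<dots> = changes (False # rev X' @ [False])"
        using changes_rev[of "False # X' @ [False]"] by simp
      finally show ?thesis using 1 by (simp add: merge_tours_def eqs)
    next
      case 2
      have "changes (rev X' @ X @ False # Y') = changes (rev X' @ False # Y')"
        using changes_collapse_before[of X "rev X'" Y'] A by (simp add: eqs)
      then show ?thesis using 2 by (simp add: merge_tours_def eqs)
    next
      case 3
      have "changes (rev X @ False # X') \<le> changes (False # rev X @ False # X')"
        by (rule changes_le_Cons)
      also have "\<dots> = changes (False # X')"
        using changes_collapse_front[of "rev X" "False # X'"] A by (simp add: eqs)
      finally show ?thesis using 3 by (simp add: merge_tours_def eqs changes_rev_snoc)
    qed
    moreover have "changes (rev (fst ?M) @ snd ?M) \<le> ?W (j1 + j2) ?M"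
      using changes_delete[of "rev (fst ?M)" "snd ?M" False]
        changes_le_Cons[of "rev (fst ?M) @ False # snd ?M" False] by (auto intro: order_trans)
    ultimately show ?thesis using False by (simp add: word_changes_def eqs split del: if_split) (simp split: if_splits)
  qed
qed

lemma changes_block:
  assumes "set xs \<subseteq> {True}"
  shows "changes (xs @ [False]) \<le> 1" "changes (False # xs) \<le> 1"
proof -
  show 1: "changes (xs @ [False]) \<le> 1" using assms
    by (induction xs rule: changes.induct) auto
  show "changes (False # xs) \<le> 1"
    using 1 assms changes_rev[of "rev xs @ [False]"] changes_const[of xs True]
    by (cases xs) (auto simp: changes_const_Cons)
qed

text \<open>For the contracted edge itself, the child contributes blocks of \<open>True\<close>. A
  round trip is one block with two borders; one end below gives a block at an end of the tour with
  one border; two ends give two such blocks. If all \<open>n\<close> nodes lie below, the lists of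
  the parent are empty and the completed word has no passage letters, which gives the charge
  0.\<close>

lemma word_changes_new:
  assumes A: "set (fst A) \<subseteq> {False}" "set (snd A) \<subseteq> {False}"
    and B: "set (fst B) \<subseteq> {True}" "set (snd B) \<subseteq> {True}"
    and sh: "tour_shape j1 A" "tour_shape j2 B" "j1 + j2 \<le> 2"
    and len: "length (fst A) + length (snd A) + length (fst B) + length (snd B) \<le> n"
  shows "word_changes n (j1 + j2) (merge_tours j1 j2 A B) \<le> charge n (length (fst B) + length (snd B)) j2"
proof -
  obtain X Y where A_eq: "A = (X, Y)" by (cases A)
  obtain X' Y' where B_eq: "B = (X', Y')" by (cases B)
  note eqs = A_eq B_eq
  have F: "set (rev X) \<subseteq> {False}" "set X \<subseteq> {False}" "set Y \<subseteq> {False}" and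
    T: "set X' \<subseteq> {True}" "set (rev X') \<subseteq> {True}" "set Y' \<subseteq> {True}"
    using A B eqs by auto
  consider "j2 = 0" "Y' = []" | "j2 > 0" "j1 = 0" "Y = []" | "j1 = 1" "j2 = 1" "Y = []" "Y' = []"
    using sh eqs unfolding tour_shape_def by fastforce
  note cases = this
  let ?M = "merge_tours j1 j2 A B"
  let ?W = "\<lambda>j C. changes ((if j = (0::nat) then [False] else []) @ rev (fst C) @ False # snd C)"
  have le: "word_changes n (j1 + j2) ?M \<le> ?W (j1 + j2) ?M"
    using changes_delete[of "rev (fst ?M)" "snd ?M" False]
        changes_le_Cons[of "rev (fst ?M) @ False # snd ?M" False]
    by (auto intro: order_trans simp: word_changes_def)
  consider "length X' + length Y' = 0" | "length X' + length Y' = n" |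
     "length X' + length Y' \<noteq> 0" "length X' + length Y' \<noteq> n" by blast
  then show ?thesis
  proof cases
    case 1
    then have "set ((if j1 + j2 = 0 then [False] else []) @ rev (fst ?M) @ False # snd ?M) \<subseteq> {False}"
      using F by (auto simp: merge_tours_def eqs)
    from changes_const[OF this] le show ?thesis by simp
  next
    case 2
    then have nil: "X = []" "Y = []" using len eqs by auto
    from cases have "length (fst ?M) + length (snd ?M) = n \<and> set (rev (fst ?M) @ snd ?M) \<subseteq> {True}"
      by cases (use 2 T nil in \<open>auto simp: merge_tours_def eqs\<close>)
    then have "length (fst ?M) + length (snd ?M) = n" "set (rev (fst ?M) @ snd ?M) \<subseteq> {True}" by auto
    with changes_const[OF this(2)] show ?thesis by (simp add: word_changes_def)
  next
    case 3
    have two: "changes (xs @ False # ys) \<le> 2" if "set xs \<subseteq> {True}" "set ys \<subseteq> {True}" for xs ys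
      using changes_split[of xs False ys] changes_block[OF that(1)] changes_block[OF that(2)] by simp
    have "?W (j1 + j2) ?M \<le> (if j2 = 1 then 1 else 2)"
      using cases
    proof cases
      case 1
      have "changes ((if j1 = 0 then [False] else []) @ rev X @ X' @ False # Y)
          \<le> changes (False # rev X @ X' @ False # Y)" using changes_le_Cons[of _ False] by simp
      also have "\<dots> = changes (False # X' @ False # Y)"
        using F by (intro changes_collapse_front) (simp add: eqs)
      also have "\<dots> = changes ((False # X') @ [False])"
        using changes_collapse_after[of Y "False # X'"] F by (simp add: eqs)
      also have "\<dots> \<le> 1 + changes (X' @ [False])" by (cases X') auto
      also have "\<dots> \<le> 2" using changes_block(1)[OF T(1)] by simp
      finally show ?thesis using 1 by (simp add: merge_tours_def eqs)
    next
      case 2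
      have "changes (rev X' @ X @ False # Y') = changes (rev X' @ False # Y')"
        using changes_collapse_before[of X "rev X'" Y'] F by (simp add: eqs)
      also have "\<dots> \<le> (if j2 = 1 then 1 else 2)"
        using two[OF T(2,3)] changes_block(1)[OF T(2)] sh 2 by (auto simp: tour_shape_def eqs)
      finally show ?thesis using 2 by (simp add: merge_tours_def eqs)
    next
      case 3
      have "changes (rev X @ False # X') \<le> changes (False # rev X @ False # X')"
        by (rule changes_le_Cons)
      also have "\<dots> = changes (False # X')"
        using changes_collapse_front[of "rev X" "False # X'"] F by (simp add: eqs)
      finally show ?thesis using 3 changes_block(2)[OF T(1)] by (simp add: merge_tours_def eqs)
    qed
    from order_trans[OF le this] 3 show ?thesis by (auto simp: charge_def eqs split del: if_split)
  qed
qed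

section \<open>Trees in elimination order\<close>

text \<open>The nodes of a tree with \<open>N\<close> nodes are numbered such that every node \<open>r < N - 1\<close> is
  smaller than its parent \<open>P r\<close>.  \<open>merged P i u\<close> is the part of the tree that has been
  contracted into \<open>u\<close> after the edges above the nodes \<open>0, \<dots>, i - 1\<close> have been contracted.\<close>

fun merged :: "(nat \<Rightarrow> nat) \<Rightarrow> nat \<Rightarrow> nat \<Rightarrow> nat set" where
  "merged P 0 u = {u}"
| "merged P (Suc i) u = (if u = P i then merged P i u \<union> merged P i i else merged P i u)"

text \<open>Descendants have smaller numbers and are contracted by stage \<open>r\<close>, so this
  is the subtree rooted at \<open>r\<close>: one side of the edge between \<open>r\<close> and
  \<open>P r\<close>.\<close>

abbreviation below :: "(nat \<Rightarrow> nat) \<Rightarrow> nat \<Rightarrow> nat set" where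
  "below P r \<equiv> merged P r r"

locale ordered_tree =
  fixes N :: nat and P :: "nat \<Rightarrow> nat"
  assumes N_pos: "0 < N"
    and parent: "r < N - 1 \<Longrightarrow> r < P r" "r < N - 1 \<Longrightarrow> P r < N"
begin

lemma self_in_merged: "u \<in> merged P i u"
  by (induction i) auto

lemma merged_le: "i \<le> N - 1 \<Longrightarrow> u \<ge> i \<Longrightarrow> a \<in> merged P i u \<Longrightarrow> a = u \<or> a < i"
proof (induction i arbitrary: u)
  case (Suc i)
  from Suc.IH[of u] Suc.IH[of i] Suc.prems show ?case by (auto split: if_splits)
qed simp

lemma merged_disjoint:
  "i \<le> N - 1 \<Longrightarrow> u \<ge> i \<Longrightarrow> v \<ge> i \<Longrightarrow> u \<noteq> v \<Longrightarrow> merged P i u \<inter> merged P i v = {}"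
proof (induction i arbitrary: u v)
  case (Suc i)
  from Suc.IH[of u v] Suc.IH[of i v] Suc.IH[of u i] Suc.prems show ?case
    by (auto split: if_splits)
qed simp

lemma Union_merged: "i \<le> N - 1 \<Longrightarrow> (\<Union>u\<in>{i..<N}. merged P i u) = {..<N}"
proof (induction i)
  case (Suc i)
  have "{i..<N} = insert i {Suc i..<N}" using Suc.prems by auto
  then have "(\<Union>u\<in>{i..<N}. merged P i u) = merged P i i \<union> (\<Union>u\<in>{Suc i..<N}. merged P i u)" by simp
  also have "\<dots> = (\<Union>u\<in>{Suc i..<N}. merged P (Suc i) u)"
    using parent[of i] Suc.prems by (auto split: if_splits)
  finally show ?case using Suc by simp
qed auto

lemma merged_root: "merged P (N - 1) (N - 1) = {..<N}"
proof -
  have "{N - 1..<N} = {N - 1}" using N_pos by auto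
  then show ?thesis using Union_merged[of "N - 1"] by simp
qed

lemma merged_subset: "i \<le> N - 1 \<Longrightarrow> i \<le> u \<Longrightarrow> u < N \<Longrightarrow> merged P i u \<subseteq> {..<N}"
  using Union_merged[of i] by auto

lemma finite_merged [simp]: "finite (merged P i u)"
  by (induction i arbitrary: u) auto

text \<open>Apart from its top node, a contracted part is a union of whole subtrees. Hence nothing
  of another part lies behind an edge inside it.\<close>

lemma below_subset_merged:
  "i \<le> N - 1 \<Longrightarrow> u \<ge> i \<Longrightarrow> z \<in> merged P i u \<Longrightarrow> z \<noteq> u \<Longrightarrow> below P z \<subseteq> merged P i u - {u}"
proof (induction i arbitrary: u)
  case (Suc i)
  have less: "x < i \<or> x = i" if "x \<in> merged P i i" for x
    using merged_le[of i i x] that Suc.prems by auto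
  show ?case
  proof (cases "z \<in> merged P i u")
    case True
    then show ?thesis using Suc.IH[of u] Suc.prems by auto
  next
    case False
    then have z: "u = P i" "z \<in> merged P i i" using Suc.prems by (auto split: if_splits)
    have "below P z \<subseteq> merged P i i"
      using z Suc.IH[of i] Suc.prems by (cases "z = i") auto
    then show ?thesis using z less Suc.prems by fastforce
  qed
qed simp

lemma merged_parent:
  "a < i \<Longrightarrow> i \<le> N - 1 \<Longrightarrow> u \<ge> i \<Longrightarrow> a \<in> merged P i u \<longleftrightarrow> P a \<in> merged P i u"
proof (induction i arbitrary: u)
  case (Suc i)
  show ?case
  proof (cases "a = i")
    case True
    have 1: "a \<notin> merged P i u"
      using merged_disjoint[of i u i] self_in_merged[of i i] Suc.prems True by auto
    have 2: "P a \<in> merged P (Suc i) u \<longleftrightarrow> u = P a"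
      using merged_disjoint[of "Suc i" u "P a"] self_in_merged[of "P a" "Suc i"] parent(1)[of i]
        Suc.prems True by auto
    show ?thesis using 1 2 True self_in_merged[of i i] by auto
  next
    case False
    then show ?thesis using Suc.IH[of u] Suc.IH[of i] Suc.prems by auto
  qed
qed simp

text \<open>A larger \<open>a\<close> is outside the subtree together with its parent; for a smaller
  \<open>a\<close>, contraction keeps both in the same part. So the cut around a subtree consists of
  a single tree edge, on which both translations between mappings and tours rest.\<close>

lemma in_below_iff_parent:
  assumes "a < N - 1" "r < N" "a \<noteq> r"
  shows "a \<in> below P r \<longleftrightarrow> P a \<in> below P r"
proof (cases "a < r")
  case True
  then show ?thesis using merged_parent[of a r r] assms by auto
next
  case False
  then show ?thesis using merged_le[of r r a] merged_le[of r r "P a"] parent(1)[of a] assms by fastforce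
qed

lemma below_le: "r < N \<Longrightarrow> a \<in> below P r \<Longrightarrow> a \<le> r"
  using merged_le[of r r a] by (cases "r = 0") fastforce+

end

section \<open>Tours of a tree\<close>

text \<open>The substrate tree with node capacities \<open>cp\<close>, node costs \<open>nw\<close>, and capacities \<open>ec\<close> and
  costs \<open>ew\<close> of the edges between \<open>r\<close> and \<open>P r\<close>; \<open>n\<close> virtual nodes are to be placed.\<close>

locale tour_problem = ordered_tree +
  fixes n :: nat and cp nw ec ew :: "nat \<Rightarrow> nat"
  assumes n_pos: "0 < n"
begin

text \<open>Tree paths use an edge exactly for those virtual edges whose hosts it separates, so this
  is the load of the edge above \<open>r\<close>.\<close>

definition crossings :: "nat \<Rightarrow> nat list \<Rightarrow> nat" where
  "crossings r L = changes (map (\<lambda>x. x \<in> below P r) L)"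

definition feasible_tour :: "nat list \<Rightarrow> bool" where
  "feasible_tour L \<longleftrightarrow> length L = n \<and> set L \<subseteq> {..<N} \<and> (\<forall>r<N. count_list L r \<le> cp r) \<and>
     (\<forall>r<N - 1. crossings r L \<le> ec r)"

definition tour_cost :: "nat list \<Rightarrow> nat" where
  "tour_cost L = sum_list (map nw L) + (\<Sum>r<N - 1. ew r * crossings r L)"

definition word :: "nat \<Rightarrow> nat list \<times> nat list \<Rightarrow> bool list \<times> bool list" where
  "word z A = (map (\<lambda>x. x \<in> below P z) (fst A), map (\<lambda>x. x \<in> below P z) (snd A))"

definition partial_crossings :: "nat \<Rightarrow> nat \<Rightarrow> nat list \<times> nat list \<Rightarrow> nat" where
  "partial_crossings j z A = word_changes n j (word z A)"

text \<open>The nodes \<open>z\<close> of \<open>C - {u}\<close> stand for the contracted edges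
  above them; the edge above \<open>u\<close> is not paid for yet. The number \<open>c\<close>
  bounds the cost from above, so that joins need inequalities only.\<close>

definition partial_tour :: "nat set \<Rightarrow> nat \<Rightarrow> nat \<Rightarrow> nat \<Rightarrow> nat \<Rightarrow> nat list \<times> nat list \<Rightarrow> bool" where
  "partial_tour C u k j c A \<longleftrightarrow>
     length (fst A) + length (snd A) = k \<and> k \<le> n \<and> set (fst A) \<union> set (snd A) \<subseteq> C \<and> tour_shape j A \<and>
     (\<forall>r\<in>C. count_list (fst A) r + count_list (snd A) r \<le> cp r) \<and>
     (\<forall>z\<in>C - {u}. partial_crossings j z A \<le> ec z) \<and>
     sum_list (map nw (fst A)) + sum_list (map nw (snd A)) +
       (\<Sum>z\<in>C - {u}. ew z * partial_crossings j z A) \<le> c"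

lemma word_merge: "word z (merge_tours j1 j2 A B) = merge_tours j1 j2 (word z A) (word z B)"
  by (simp add: word_def merge_tours_def rev_map)

text \<open>Edges of the united part belong to the part of the parent, to the part of the child, or
  are the new edge. On the old ones no crossing number grows, and the new one is bounded by its
  charge, so the cost bounds simply add up.\<close>

lemma partial_tour_merge:
  assumes i: "i < N - 1"
    and A: "partial_tour (merged P i (P i)) (P i) k1 j1 c1 A"
    and B: "partial_tour (merged P i i) i k2 j2 c2 B"
    and jk: "j1 + j2 \<le> 2" "k1 + k2 \<le> n" and ch: "charge n k2 j2 \<le> ec i"
  shows "partial_tour (merged P (Suc i) (P i)) (P i) (k1 + k2) (j1 + j2)
    (c1 + (c2 + charge n k2 j2 * ew i)) (merge_tours j1 j2 A B)"
proof -
  let ?C = "merged P i (P i)" and ?D = "merged P i i" and ?M = "merge_tours j1 j2 A B"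
  have Pi: "i < P i" "P i < N" using parent i by auto
  have disj: "?C \<inter> ?D = {}" using merged_disjoint[of i "P i" i] Pi i by auto
  have C': "merged P (Suc i) (P i) = ?C \<union> ?D" by simp
  have sh: "tour_shape j1 A" "tour_shape j2 B" using A B by (auto simp: partial_tour_def)
  have sets: "set (fst A) \<union> set (snd A) \<subseteq> ?C" "set (fst B) \<union> set (snd B) \<subseteq> ?D"
    and len: "length (fst A) + length (snd A) = k1" "length (fst B) + length (snd B) = k2"
    using A B by (auto simp: partial_tour_def)
  have lenw: "length (fst (word z A)) + length (snd (word z A)) + length (fst (word z B)) +
      length (snd (word z B)) \<le> n" for z using len jk by (simp add: word_def)
  have shw: "tour_shape j1 (word z A)" "tour_shape j2 (word z B)" for z
    using sh by (auto simp: tour_shape_def word_def)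
  have outer: "partial_crossings (j1 + j2) z ?M \<le> partial_crossings j1 z A" if "z \<in> ?C - {P i}" for z
  proof -
    have "below P z \<subseteq> ?C" using below_subset_merged[of i "P i" z] that i Pi by auto
    then have "set (fst (word z B)) \<subseteq> {False}" "set (snd (word z B)) \<subseteq> {False}"
      using sets disj by (auto simp: word_def)
    from word_changes_outer[OF this shw jk(1) lenw] show ?thesis
      by (simp add: partial_crossings_def word_merge)
  qed
  have outD: "set (fst (word z A)) \<subseteq> {False}" "set (snd (word z A)) \<subseteq> {False}" if "z \<in> ?D" for z
  proof -
    have "below P z \<subseteq> ?D" using below_subset_merged[of i i z] that i by (cases "z = i") auto
    then show "set (fst (word z A)) \<subseteq> {False}" "set (snd (word z A)) \<subseteq> {False}"
      using sets disj by (auto simp: word_def)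
  qed
  have inner: "partial_crossings (j1 + j2) z ?M \<le> partial_crossings j2 z B" if "z \<in> ?D" for z
    using word_changes_inner[OF outD[OF that] shw jk(1) lenw]
    by (simp add: partial_crossings_def word_merge)
  have new: "partial_crossings (j1 + j2) i ?M \<le> charge n k2 j2"
  proof -
    have T: "set (fst (word i B)) \<subseteq> {True}" "set (snd (word i B)) \<subseteq> {True}"
      using sets by (auto simp: word_def)
    have "length (fst (word i B)) + length (snd (word i B)) = k2" using len by (simp add: word_def)
    with word_changes_new[OF outD T shw jk(1) lenw] self_in_merged show ?thesis
      by (simp add: partial_crossings_def word_merge)
  qed
  have sC: "(\<Sum>z\<in>?C - {P i}. ew z * partial_crossings (j1 + j2) z ?M)
      \<le> (\<Sum>z\<in>?C - {P i}. ew z * partial_crossings j1 z A)"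
    by (intro sum_mono mult_left_mono outer) auto
  have sD: "(\<Sum>z\<in>?D - {i}. ew z * partial_crossings (j1 + j2) z ?M)
      \<le> (\<Sum>z\<in>?D - {i}. ew z * partial_crossings j2 z B)"
    by (intro sum_mono mult_left_mono inner) auto
  have split: "?C \<union> ?D - {P i} = (?C - {P i}) \<union> insert i (?D - {i})"
    using disj self_in_merged[of i i] self_in_merged[of "P i" i] by auto
  have "(\<Sum>z\<in>?C \<union> ?D - {P i}. ew z * partial_crossings (j1 + j2) z ?M) =
    (\<Sum>z\<in>?C - {P i}. ew z * partial_crossings (j1 + j2) z ?M) +
    (\<Sum>z\<in>insert i (?D - {i}). ew z * partial_crossings (j1 + j2) z ?M)"
    unfolding split using disj self_in_merged[of i i] by (intro sum.union_disjoint) auto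
  also have "\<dots> = (\<Sum>z\<in>?C - {P i}. ew z * partial_crossings (j1 + j2) z ?M) +
     (ew i * partial_crossings (j1 + j2) i ?M + (\<Sum>z\<in>?D - {i}. ew z * partial_crossings (j1 + j2) z ?M))"
    by (subst sum.insert) auto
  also have "\<dots> \<le> (\<Sum>z\<in>?C - {P i}. ew z * partial_crossings j1 z A) +
     (charge n k2 j2 * ew i + (\<Sum>z\<in>?D - {i}. ew z * partial_crossings j2 z B))"
    unfolding mult.commute[of "charge n k2 j2"] by (intro add_mono sC sD mult_le_mono2 new)
  finally have edges: "(\<Sum>z\<in>?C \<union> ?D - {P i}. ew z * partial_crossings (j1 + j2) z ?M) \<le> \<dots>" .
  have nodes: "sum_list (map nw (fst ?M)) + sum_list (map nw (snd ?M)) =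
     sum_list (map nw (fst A)) + sum_list (map nw (snd A)) +
     (sum_list (map nw (fst B)) + sum_list (map nw (snd B)))"
    using sh jk by (auto simp: merge_tours_def tour_shape_def rev_map[symmetric])
  have counts: "count_list (fst ?M) r + count_list (snd ?M) r =
     count_list (fst A) r + count_list (snd A) r + (count_list (fst B) r + count_list (snd B) r)" for r
    using sh jk by (auto simp: merge_tours_def tour_shape_def)
  have zero: "r \<in> ?C \<Longrightarrow> count_list (fst B) r + count_list (snd B) r = 0"
     "r \<in> ?D \<Longrightarrow> count_list (fst A) r + count_list (snd A) r = 0" for r
    using sets disj by (auto simp: count_list_0_iff)
  have "length (fst ?M) + length (snd ?M) = k1 + k2" "set (fst ?M) \<union> set (snd ?M) \<subseteq> ?C \<union> ?D"
    "tour_shape (j1 + j2) ?M"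
    using sh jk len sets by (auto simp: merge_tours_def tour_shape_def)
  moreover have "\<forall>r\<in>?C \<union> ?D. count_list (fst ?M) r + count_list (snd ?M) r \<le> cp r"
    unfolding counts using zero A B by (auto simp: partial_tour_def)
  moreover have "\<forall>z\<in>?C \<union> ?D - {P i}. partial_crossings (j1 + j2) z ?M \<le> ec z"
  proof
    fix z assume "z \<in> ?C \<union> ?D - {P i}"
    then consider "z \<in> ?C - {P i}" | "z \<in> ?D - {i}" | "z = i" by blast
    then show "partial_crossings (j1 + j2) z ?M \<le> ec z"
    proof cases
      case 1
      moreover have "partial_crossings j1 z A \<le> ec z" using A 1 by (simp add: partial_tour_def)
      ultimately show ?thesis using outer[of z] by linarith
    next
      case 2
      moreover have "partial_crossings j2 z B \<le> ec z" using B 2 by (simp add: partial_tour_def)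
      ultimately show ?thesis using inner[of z] by simp
    next
      case 3
      then show ?thesis using new ch by simp
    qed
  qed
  ultimately show ?thesis
    using edges nodes A B jk unfolding C' partial_tour_def by linarith
qed

text \<open>A single node has no edges to cross, so every format is realised by placing all copies
  in the first list.\<close>

lemma partial_tour_initial:
  assumes "k \<le> cp u" "k \<le> n" "j \<le> 2"
  shows "partial_tour (merged P 0 u) u k j (k * nw u) (replicate k u, [])"
proof -
  have "count_list (replicate k u) u = k" by (induction k) auto
  then show ?thesis using assms by (auto simp: partial_tour_def tour_shape_def sum_list_replicate)
qed

text \<open>With \<open>n\<close> nodes placed there are no passage letters, so the partial
  crossings are those of the tour \<open>rev X @ Y\<close> itself.\<close>

lemma partial_tour_root:
  assumes "partial_tour (merged P (N - 1) (N - 1)) (N - 1) n 2 c (X, Y)"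
  shows "feasible_tour (rev X @ Y)" "tour_cost (rev X @ Y) \<le> c"
proof -
  have eq: "{..<N} - {N - 1} = {..<N - 1}" using N_pos by auto
  have "partial_crossings 2 z (X, Y) = crossings z (rev X @ Y)" for z
    using assms by (simp add: partial_crossings_def word_changes_def word_def crossings_def
      partial_tour_def rev_map)
  then show "feasible_tour (rev X @ Y)" "tour_cost (rev X @ Y) \<le> c"
    using assms unfolding partial_tour_def merged_root eq
    by (auto simp: feasible_tour_def tour_cost_def rev_map[symmetric])
qed

section \<open>Lower bounds: what a given tour pays inside a contracted part\<close>

definition inside :: "nat set \<Rightarrow> nat list \<Rightarrow> nat" where
  "inside C L = length (filter (\<lambda>x. x \<in> C) L)"

definition ends_inside :: "nat set \<Rightarrow> nat list \<Rightarrow> nat" where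
  "ends_inside C L = of_bool (hd L \<in> C) + of_bool (last L \<in> C)"

definition inside_cost :: "nat set \<Rightarrow> nat \<Rightarrow> nat list \<Rightarrow> nat" where
  "inside_cost C u L = sum_list (map nw (filter (\<lambda>x. x \<in> C) L)) + (\<Sum>z\<in>C - {u}. ew z * crossings z L)"

lemma inside_le: "inside C L \<le> length L"
  by (simp add: inside_def)

lemma ends_inside_le: "ends_inside C L \<le> 2"
  by (simp add: ends_inside_def)

lemma inside_union: "C \<inter> D = {} \<Longrightarrow> inside (C \<union> D) L = inside C L + inside D L"
  unfolding inside_def by (induction L) auto

lemma ends_inside_union: "C \<inter> D = {} \<Longrightarrow> ends_inside (C \<union> D) L = ends_inside C L + ends_inside D L"
  by (auto simp: ends_inside_def)

lemma filter_cost_union: "C \<inter> D = {} \<Longrightarrow> sum_list (map nw (filter (\<lambda>x. x \<in> C \<union> D) L)) =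
  sum_list (map nw (filter (\<lambda>x. x \<in> C) L)) + sum_list (map nw (filter (\<lambda>x. x \<in> D) L))"
  by (induction L) auto

lemma charge_le_crossings:
  assumes "length L = n"
  shows "charge n (inside (below P i) L) (ends_inside (below P i) L) \<le> crossings i L"
proof -
  let ?w = "map (\<lambda>x. x \<in> below P i) L"
  have ne: "L \<noteq> []" using assms n_pos by auto
  have "length (filter id ?w) = inside (below P i) L"
    by (simp add: inside_def filter_map comp_def)
  moreover have "of_bool (hd ?w) + of_bool (last ?w) = ends_inside (below P i) L"
    using ne by (simp add: ends_inside_def hd_map last_map)
  ultimately show ?thesis
    using charge_le_changes[of ?w] ne assms by (simp add: crossings_def)
qed

text \<open>The cost of a tour splits exactly over disjoint parts; the inequality comes from the new
  edge alone, whose crossings are replaced by the charge.\<close>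

lemma inside_cost_merge:
  assumes i: "i < N - 1" and L: "length L = n"
  shows "inside_cost (merged P i (P i)) (P i) L + (inside_cost (merged P i i) i L +
      charge n (inside (merged P i i) L) (ends_inside (merged P i i) L) * ew i)
    \<le> inside_cost (merged P (Suc i) (P i)) (P i) L"
proof -
  let ?C = "merged P i (P i)" and ?D = "merged P i i"
  have Pi: "i < P i" "P i < N" using parent i by auto
  have disj: "?C \<inter> ?D = {}" using merged_disjoint[of i "P i" i] Pi i by auto
  have split: "?C \<union> ?D - {P i} = (?C - {P i}) \<union> insert i (?D - {i})"
    using disj self_in_merged[of i i] self_in_merged[of "P i" i] by auto
  have "(\<Sum>z\<in>?C \<union> ?D - {P i}. ew z * crossings z L) =
    (\<Sum>z\<in>?C - {P i}. ew z * crossings z L) + (\<Sum>z\<in>insert i (?D - {i}). ew z * crossings z L)"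
    unfolding split using disj self_in_merged[of i i] by (intro sum.union_disjoint) auto
  also have "(\<Sum>z\<in>insert i (?D - {i}). ew z * crossings z L) =
     ew i * crossings i L + (\<Sum>z\<in>?D - {i}. ew z * crossings z L)"
    by (subst sum.insert) auto
  finally have "inside_cost (?C \<union> ?D) (P i) L = inside_cost ?C (P i) L + inside_cost ?D i L + ew i * crossings i L"
    unfolding inside_cost_def filter_cost_union[OF disj] by simp
  then show ?thesis
    using mult_le_mono2[OF charge_le_crossings[OF L, of i], of "ew i"]
    unfolding mult.commute[of "charge n _ _"] merged.simps if_P[OF refl] by linarith
qed

lemma inside_cost_root:
  assumes "feasible_tour L"
  shows "inside_cost (merged P (N - 1) (N - 1)) (N - 1) L = tour_cost L"
    "inside (merged P (N - 1) (N - 1)) L = n" "ends_inside (merged P (N - 1) (N - 1)) L = 2"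
proof -
  have eq: "{..<N} - {N - 1} = {..<N - 1}" using N_pos by auto
  have fl: "filter (\<lambda>x. x \<in> {..<N}) L = L" using assms
    by (intro filter_True) (auto simp: feasible_tour_def)
  have "hd L \<in> set L" "last L \<in> set L" using assms n_pos by (auto simp: feasible_tour_def intro!: hd_in_set last_in_set)
  then show "inside_cost (merged P (N - 1) (N - 1)) (N - 1) L = tour_cost L"
    "inside (merged P (N - 1) (N - 1)) L = n" "ends_inside (merged P (N - 1) (N - 1)) L = 2"
    unfolding inside_cost_def tour_cost_def merged_root eq fl inside_def ends_inside_def
    using assms by (auto simp: feasible_tour_def)
qed

lemma inside_initial: "inside (merged P 0 u) L = count_list L u"
  by (induction L) (auto simp: inside_def)

lemma inside_cost_initial: "inside_cost (merged P 0 u) u L = count_list L u * nw u"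
  by (induction L) (auto simp: inside_cost_def)

end

section \<open>Embeddings of a path as tours\<close>

section \<open>Paths and edges\<close>

lemma path_edges_Nil [simp]: "path_edges [] = {}"
  by (simp add: path_edges_def)

lemma path_edges_single [simp]: "path_edges [x] = {}"
  by (simp add: path_edges_def)

lemma path_edges_Cons2 [simp]: "path_edges (x # y # zs) = insert {x, y} (path_edges (y # zs))"
proof (rule set_eqI)
  fix e
  have "(\<exists>i. e = {(x # y # zs) ! i, (x # y # zs) ! Suc i} \<and> Suc i < length (x # y # zs)) \<longleftrightarrow>
    e = {x, y} \<or> (\<exists>i. e = {(y # zs) ! i, (y # zs) ! Suc i} \<and> Suc i < length (y # zs))" (is "?l \<longleftrightarrow> ?r")
  proof
    assume ?l
    then obtain i where i: "e = {(x # y # zs) ! i, (x # y # zs) ! Suc i}" "Suc i < length (x # y # zs)" by auto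
    then show ?r by (cases i) auto
  next
    assume ?r
    then show ?l
    proof
      assume "e = {x, y}"
      then show ?l by (intro exI[of _ 0]) simp
    next
      assume "\<exists>i. e = {(y # zs) ! i, (y # zs) ! Suc i} \<and> Suc i < length (y # zs)"
      then obtain i where "e = {(y # zs) ! i, (y # zs) ! Suc i}" "Suc i < length (y # zs)" by auto
      then show ?l by (intro exI[of _ "Suc i"]) simp
    qed
  qed
  then show "e \<in> path_edges (x # y # zs) \<longleftrightarrow> e \<in> insert {x, y} (path_edges (y # zs))"
    by (simp add: path_edges_def)
qed

lemma path_edges_snoc: "p \<noteq> [] \<Longrightarrow> path_edges (p @ [x]) = insert {last p, x} (path_edges p)"
proof (induction p)
  case (Cons y p)
  then show ?case by (cases p) auto
qed simp

lemma path_edges_map: "path_edges (map f p) = (`) f ` path_edges p"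
  by (induction p rule: induct_list012) simp_all

lemma path_edges_rev [simp]: "path_edges (rev p) = path_edges p"
proof (induction p)
  case (Cons x p)
  note Cons_IH = Cons.IH
  show ?case
  proof (cases p)
    case (Cons y ys)
    then show ?thesis using Cons_IH path_edges_snoc[of "rev p" x] by (simp add: last_rev insert_commute)
  qed simp
qed simp

lemma path_edges_finite [simp]: "finite (path_edges p)"
  by (induction p rule: induct_list012) simp_all

text \<open>The smaller of two different nodes cannot be an ancestor of the larger, so it may step
  up to its parent; the two ends meet at their lowest common ancestor. The first number is fuel,
  which lets a loop with a fixed bound follow the recursion.\<close>

fun tree_path :: "(nat \<Rightarrow> nat) \<Rightarrow> nat \<Rightarrow> nat \<Rightarrow> nat \<Rightarrow> nat list" where
  "tree_path P 0 a b = [a]"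
| "tree_path P (Suc k) a b = (if a = b then [a] else if a < b then a # tree_path P k (P a) b
     else tree_path P k a (P b) @ [b])"

context ordered_tree
begin

lemma tree_path_props:
  assumes "a < N" "b < N" "(N - 1 - a) + (N - 1 - b) \<le> k"
  defines "p \<equiv> tree_path P k a b"
  shows "p \<noteq> []" "hd p = a" "last p = b" "distinct p" "set p \<subseteq> {min a b..<N}"
     "path_edges p = {{r, P r} | r. r < N - 1 \<and> (a \<in> below P r) \<noteq> (b \<in> below P r)}"
proof -
  have "tree_path P k a b \<noteq> [] \<and> hd (tree_path P k a b) = a \<and> last (tree_path P k a b) = b \<and>
    distinct (tree_path P k a b) \<and> set (tree_path P k a b) \<subseteq> {min a b..<N} \<and>
     path_edges (tree_path P k a b) = {{r, P r} | r. r < N - 1 \<and> (a \<in> below P r) \<noteq> (b \<in> below P r)}"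
    using assms(1-3)
  proof (induction k arbitrary: a b)
    case 0
    then have "a = b" by auto
    then show ?case using 0 by auto
  next
    case (Suc k)
    \<comment> \<open>The edge above the smaller node \<open>x\<close> separates it from
      \<open>y\<close>, and no other edge separates \<open>x\<close> from its parent. So stepping up
      removes exactly this edge from the separating ones.\<close>
    have edge: "{{r, P r} | r. r < N - 1 \<and> (x \<in> below P r) \<noteq> (y \<in> below P r)} =
       insert {x, P x} {{r, P r} | r. r < N - 1 \<and> (P x \<in> below P r) \<noteq> (y \<in> below P r)}"
      if "x < y" "y < N" for x y
    proof -
      have x: "x < N - 1" using that by auto
      have 1: "x \<in> below P x" "y \<notin> below P x" "P x \<notin> below P x"
        using self_in_merged below_le[of x y] below_le[of x "P x"] parent[OF x] that by force+
      have 2: "x \<in> below P r \<longleftrightarrow> P x \<in> below P r" if "r < N - 1" "r \<noteq> x" for r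
        using in_below_iff_parent[of x r] that x by auto
      show ?thesis using 1 2 x by blast
    qed
    consider "a = b" | "a < b" | "b < a" by linarith
    then show ?case
    proof cases
      case 1
      then show ?thesis using Suc.prems by auto
    next
      case 2
      then have a: "a < P a" "P a < N" using parent[of a] Suc.prems by auto
      have fuel: "(N - 1 - P a) + (N - 1 - b) \<le> k" using 2 a Suc.prems by linarith
      note IH = Suc.IH[OF a(2) Suc.prems(2) fuel]
      let ?p = "tree_path P k (P a) b"
      from IH have "a \<notin> set ?p" using a 2 by fastforce
      moreover have "path_edges (a # ?p) = insert {a, P a} (path_edges ?p)"
        using IH by (cases ?p) auto
      moreover have "set ?p \<subseteq> {a..<N}" using IH a 2 by fastforce
      ultimately show ?thesis using IH 2 edge[OF 2 Suc.prems(2)] Suc.prems by auto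
    next
      case 3
      then have b: "b < P b" "P b < N" using parent[of b] Suc.prems by auto
      have fuel: "(N - 1 - a) + (N - 1 - P b) \<le> k" using 3 b Suc.prems by linarith
      note IH = Suc.IH[OF Suc.prems(1) b(2) fuel]
      let ?p = "tree_path P k a (P b)"
      from IH have "b \<notin> set ?p" using b 3 by fastforce
      moreover have "path_edges (?p @ [b]) = insert {b, P b} (path_edges ?p)"
        using IH by (simp add: path_edges_snoc insert_commute)
      moreover have "set ?p \<subseteq> {b..<N}" using IH b 3 by fastforce
      moreover have "{{r, P r} | r. r < N - 1 \<and> (a \<in> below P r) \<noteq> (b \<in> below P r)} =
       insert {b, P b} {{r, P r} | r. r < N - 1 \<and> (a \<in> below P r) \<noteq> (P b \<in> below P r)}"
        using edge[OF 3 Suc.prems(1)] by (simp only: eq_sym_conv[of "_ \<in> below P _" "a \<in> below P _"] conj_commute)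
      ultimately show ?thesis using IH 3 Suc.prems by auto
    qed
  qed
  then show "p \<noteq> []" "hd p = a" "last p = b" "distinct p" "set p \<subseteq> {min a b..<N}"
     "path_edges p = {{r, P r} | r. r < N - 1 \<and> (a \<in> below P r) \<noteq> (b \<in> below P r)}"
    unfolding p_def by blast+
qed

end

lemma exists_change:
  "xs \<noteq> [] \<Longrightarrow> (hd xs \<in> S) \<noteq> (last xs \<in> S) \<Longrightarrow>
   \<exists>i. Suc i < length xs \<and> (xs ! i \<in> S) \<noteq> (xs ! Suc i \<in> S)"
proof (induction xs)
  case (Cons x xs)
  show ?case
  proof (cases "xs \<noteq> [] \<and> (x \<in> S \<longleftrightarrow> hd xs \<in> S)")
    case True
    with Cons obtain i where "Suc i < length xs" "(xs ! i \<in> S) \<noteq> (xs ! Suc i \<in> S)" by auto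
    then show ?thesis
      by (intro exI[of _ "Suc i"]) (simp only: nth_Cons_Suc length_Cons Suc_less_eq simp_thms)
  next
    case False
    then show ?thesis using Cons.prems by (intro exI[of _ 0]) (cases xs; auto)
  qed
qed simp

lemma separated_doubleton: "{x, y} = {u, v} \<Longrightarrow> (u \<in> S) \<noteq> (v \<in> S) \<Longrightarrow> (x \<in> S) \<noteq> (y \<in> S)"
  by (auto simp: doubleton_eq_iff)

lemma sum_set_distinct: "distinct p \<Longrightarrow> (\<Sum>a\<in>set p. f a) = sum_list (map f p)"
  by (simp add: sum_list_distinct_conv_sum_set)

lemma card_preimage: "distinct p \<Longrightarrow> card {a \<in> set p. l a = r} = count_list (map l p) r"
proof (induction p)
  case (Cons x p)
  have "{a \<in> set (x # p). l a = r} = (if l x = r then insert x {a \<in> set p. l a = r} else {a \<in> set p. l a = r})"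
    by auto
  then show ?case using Cons by auto
qed simp

lemma path_edges_inj:
  "distinct p \<Longrightarrow> Suc i < length p \<Longrightarrow> Suc j < length p \<Longrightarrow> {p ! i, p ! Suc i} = {p ! j, p ! Suc j} \<longleftrightarrow> i = j"
  by (auto simp: doubleton_eq_iff nth_eq_iff_index_eq)

lemma card_path_edges:
  assumes "distinct p"
  shows "card {f \<in> path_edges p. T f} = card {i. Suc i < length p \<and> T {p ! i, p ! Suc i}}"
proof -
  have "bij_betw (\<lambda>i. {p ! i, p ! Suc i}) {i. Suc i < length p \<and> T {p ! i, p ! Suc i}} {f \<in> path_edges p. T f}"
    unfolding bij_betw_def inj_on_def path_edges_def using path_edges_inj[OF assms] by auto
  from bij_betw_same_card[OF this] show ?thesis by simp
qed

section \<open>Mappings and tours\<close>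

locale arranged_instance = ordered_tree N P
  for N :: nat and P :: "nat \<Rightarrow> nat" +
  fixes I :: "(nat, nat) cvne" and p :: "nat list" and Q :: "nat \<Rightarrow> nat"
  assumes p: "p \<noteq> []" "distinct p" "set p = VR I" "path_edges p = ER I"
    and Q: "bij_betw Q {..<N} (VS I)"
    and ES: "ES I = (\<lambda>r. {Q r, Q (P r)}) ` {..<N - 1}"
begin

abbreviation "tree_edge r \<equiv> {Q r, Q (P r)}"

sublocale tour_problem N P "length p" "\<lambda>r. node_cap I (Q r)" "\<lambda>r. node_cost I (Q r)"
   "\<lambda>r. edge_cap I (tree_edge r)" "\<lambda>r. edge_cost I (tree_edge r)"
  by unfold_locales (use p in auto)

lemma Q_inj: "a < N \<Longrightarrow> b < N \<Longrightarrow> Q a = Q b \<longleftrightarrow> a = b"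
  using Q by (auto simp: bij_betw_def inj_on_def)

lemma tree_edge_inj: "inj_on tree_edge {..<N - 1}"
proof (rule inj_onI)
  fix r s assume *: "r \<in> {..<N - 1}" "s \<in> {..<N - 1}" "tree_edge r = tree_edge s"
  then have "{r, P r} = {s, P s}"
    using parent[of r] parent[of s] by (auto simp: doubleton_eq_iff Q_inj)
  then show "r = s" using parent[of r] parent[of s] * by (auto simp: doubleton_eq_iff)
qed

definition uses :: "(nat, nat) mapping \<Rightarrow> nat \<Rightarrow> nat" where
  "uses m r = card {f \<in> ER I. tree_edge r \<in> path_edges (snd m f)}"

lemma uses_eq: "uses m r = card {i. Suc i < length p \<and> tree_edge r \<in> path_edges (snd m {p ! i, p ! Suc i})}"
  unfolding uses_def p(4)[symmetric] by (rule card_path_edges[OF p(2)])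

text \<open>Double counting: edge costs are collected by substrate edge instead of by virtual
  edge.\<close>

lemma cost_eq:
  assumes "\<And>f. f \<in> ER I \<Longrightarrow> path_edges (snd m f) \<subseteq> ES I"
    and l: "\<And>a. a \<in> VR I \<Longrightarrow> Q (l a) = fst m a"
  shows "cost I m = sum_list (map (\<lambda>r. node_cost I (Q r)) (map l p)) + (\<Sum>r<N - 1. edge_cost I (tree_edge r) * uses m r)"
proof -
  have fin: "finite (ER I)" "finite (ES I)" using path_edges_finite[of p] p(4) ES by auto
  have "(\<Sum>f\<in>ER I. \<Sum>e\<in>path_edges (snd m f). edge_cost I e) =
    (\<Sum>f\<in>ER I. \<Sum>e\<in>ES I. if e \<in> path_edges (snd m f) then edge_cost I e else 0)"
    by (rule sum.cong[OF refl])
      (use assms(1) fin in \<open>simp add: sum.inter_restrict[symmetric] Int_absorb1\<close>)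
  also have "\<dots> = (\<Sum>e\<in>ES I. \<Sum>f\<in>ER I. if e \<in> path_edges (snd m f) then edge_cost I e else 0)"
    by (rule sum.swap)
  also have "\<dots> = (\<Sum>e\<in>ES I. edge_cost I e * card {f \<in> ER I. e \<in> path_edges (snd m f)})"
    by (rule sum.cong[OF refl]) (use fin in \<open>simp add: sum.If_cases Int_def\<close>)
  also have "\<dots> = (\<Sum>r<N - 1. edge_cost I (tree_edge r) * uses m r)"
    unfolding ES by (subst sum.reindex[OF tree_edge_inj]) (simp add: uses_def comp_def)
  finally have "cost I m = (\<Sum>a\<in>VR I. node_cost I (fst m a)) + \<dots>" by (simp add: cost_def)
  moreover have "(\<Sum>a\<in>VR I. node_cost I (fst m a)) = sum_list (map (\<lambda>a. node_cost I (Q (l a))) p)"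
    using l sum_set_distinct[OF p(2), of "\<lambda>a. node_cost I (Q (l a))"] p(3) by auto
  ultimately show ?thesis by (simp add: comp_def)
qed

lemma node_load_eq:
  assumes l: "\<And>a. a \<in> VR I \<Longrightarrow> Q (l a) = fst m a \<and> l a < N" and "r < N"
  shows "card {a \<in> VR I. fst m a = Q r} = count_list (map l p) r"
proof -
  have "{a \<in> VR I. fst m a = Q r} = {a \<in> set p. l a = r}"
  proof (rule Collect_cong)
    fix a show "a \<in> VR I \<and> fst m a = Q r \<longleftrightarrow> a \<in> set p \<and> l a = r"
      using l[of a] Q_inj[of "l a" r] assms(2) p(3) by auto
  qed
  then show ?thesis using card_preimage[OF p(2)] by simp
qed

lemma crossings_eq:
  "crossings r L = card {i. Suc i < length L \<and> (L ! i \<in> below P r) \<noteq> (L ! Suc i \<in> below P r)}"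
  unfolding crossings_def changes_eq_card by (intro arg_cong[of _ _ card]) auto

text \<open>Somewhere the path changes sides of the cut around the subtree of \<open>r\<close>. It
  does so along some tree edge, and only the edge above \<open>r\<close> crosses this cut.\<close>

lemma separating_edge_used:
  assumes q: "loop_free_path (VS I) (ES I) q" "{hd q, last q} = {Q a, Q b}"
    and ab: "a < N" "b < N" and r: "r < N - 1" "(a \<in> below P r) \<noteq> (b \<in> below P r)"
  shows "tree_edge r \<in> path_edges q"
proof -
  let ?S = "Q ` below P r"
  have sub: "below P r \<subseteq> {..<N}" using r merged_subset[of r r] by auto
  have mem: "Q x \<in> ?S \<longleftrightarrow> x \<in> below P r" if "x < N" for x
    using that sub Q_inj by fastforce
  have ne: "q \<noteq> []" using q by (simp add: loop_free_path_def)
  have sep: "(hd q \<in> ?S) \<noteq> (last q \<in> ?S)"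
    by (rule separated_doubleton[OF q(2)]) (unfold mem[OF ab(1)] mem[OF ab(2)], rule r(2))
  from exists_change[OF ne sep] obtain i
    where i: "Suc i < length q" "(q ! i \<in> ?S) \<noteq> (q ! Suc i \<in> ?S)" by (elim exE conjE)
  then have e: "{q ! i, q ! Suc i} \<in> path_edges q" by (auto simp: path_edges_def)
  then obtain s where s: "s < N - 1" "{q ! i, q ! Suc i} = tree_edge s"
    using q(1) ES by (auto simp: loop_free_path_def)
  then have "(Q s \<in> ?S) \<noteq> (Q (P s) \<in> ?S)"
    by (intro separated_doubleton[OF s(2)[symmetric] i(2)])
  moreover have "s < N" "P s < N" using s(1) parent[of s] by auto
  ultimately have "(s \<in> below P r) \<noteq> (P s \<in> below P r)" by (simp only: mem not_False_eq_True)
  moreover have "r < N" using r by simp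
  ultimately have "s = r" using in_below_iff_parent[of s r] s(1) by blast
  then show ?thesis using s e by simp
qed

text \<open>Only the hosts are kept. Every crossing of the resulting tour comes from a virtual edge
  whose path had to use that tree edge, so neither loads nor costs grow.\<close>

lemma tour_of_mapping:
  assumes m: "feasible I m"
  shows "\<exists>L. feasible_tour L \<and> tour_cost L \<le> cost I m"
proof -
  define l where "l a = inv_into {..<N} Q (fst m a)" for a
  have l: "Q (l a) = fst m a \<and> l a < N" if "a \<in> VR I" for a
    using f_inv_into_f[of "fst m a" Q "{..<N}"] inv_into_into[of "fst m a" Q "{..<N}"]
      bij_betw_imp_surj_on[OF Q] m that by (simp add: l_def feasible_def is_mapping_def)
  have le: "crossings r (map l p) \<le> uses m r" if r: "r < N - 1" for r
  proof -
    have "tree_edge r \<in> path_edges (snd m {p ! i, p ! Suc i})"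
      if i: "Suc i < length p" and c: "(map l p ! i \<in> below P r) \<noteq> (map l p ! Suc i \<in> below P r)" for i
    proof (rule separating_edge_used[OF _ _ _ _ r])
      have f: "{p ! i, p ! Suc i} \<in> ER I" using i p(4) by (auto simp: path_edges_def)
      have v: "p ! i \<in> VR I" "p ! Suc i \<in> VR I" using i unfolding p(3)[symmetric] by simp_all
      show "loop_free_path (VS I) (ES I) (snd m {p ! i, p ! Suc i})"
        using m f unfolding feasible_def is_mapping_def by blast
      have "{hd (snd m {p ! i, p ! Suc i}), last (snd m {p ! i, p ! Suc i})} = fst m ` {p ! i, p ! Suc i}"
        using m f unfolding feasible_def is_mapping_def by blast
      then show "{hd (snd m {p ! i, p ! Suc i}), last (snd m {p ! i, p ! Suc i})} = {Q (l (p ! i)), Q (l (p ! Suc i))}"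
        using l v by simp
      show "l (p ! i) < N" "l (p ! Suc i) < N" using l v by auto
      show "(l (p ! i) \<in> below P r) \<noteq> (l (p ! Suc i) \<in> below P r)" using c i by simp
    qed
    then have "{i. Suc i < length (map l p) \<and> (map l p ! i \<in> below P r) \<noteq> (map l p ! Suc i \<in> below P r)} \<subseteq>
       {i. Suc i < length p \<and> tree_edge r \<in> path_edges (snd m {p ! i, p ! Suc i})}"
      unfolding length_map by blast
    then show ?thesis unfolding crossings_eq uses_eq
      by (rule card_mono[rotated]) (rule finite_subset[of _ "{..<length p}"], auto)
  qed
  have sub: "path_edges (snd m f) \<subseteq> ES I" if "f \<in> ER I" for f
    using m that by (simp add: feasible_def is_mapping_def loop_free_path_def)
  have "uses m r \<le> edge_cap I (tree_edge r)" if "r < N - 1" for r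
    using m that ES by (auto simp: feasible_def uses_def)
  then have ec: "\<forall>r<N - 1. crossings r (map l p) \<le> edge_cap I (tree_edge r)"
    using le order_trans by blast
  have "\<forall>r<N. count_list (map l p) r \<le> node_cap I (Q r)"
  proof (intro allI impI)
    fix r assume "r < N"
    moreover from this have "Q r \<in> VS I" using bij_betwE[OF Q] by auto
    ultimately show "count_list (map l p) r \<le> node_cap I (Q r)"
      using m node_load_eq[of l m r, OF l] by (fastforce simp: feasible_def)
  qed
  moreover have "set (map l p) \<subseteq> {..<N}" using l p(3) by auto
  ultimately have "feasible_tour (map l p)" using ec by (simp add: feasible_tour_def)
  moreover have "tour_cost (map l p) \<le> cost I m"
    using cost_eq[of m l, OF sub] l le by (auto simp: tour_cost_def intro!: sum_mono)
  ultimately show ?thesis by blast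
qed

text \<open>Only the values on virtual nodes and edges are prescribed, so the result applies to any
  mapping that agrees with the written answer.\<close>

lemma mapping_of_tour:
  assumes L: "feasible_tour L"
    and fst_m: "\<And>i. i < length p \<Longrightarrow> fst m (p ! i) = Q (L ! i)"
    and snd_m: "\<And>i. Suc i < length p \<Longrightarrow>
      snd m {p ! i, p ! Suc i} = map Q (tree_path P (N + N) (L ! i) (L ! Suc i))"
  shows "feasible I m" "cost I m = tour_cost L"
proof -
  have len: "length L = length p" and LN: "\<And>i. i < length p \<Longrightarrow> L ! i < N"
    using L by (metis feasible_tour_def lessThan_iff nth_mem subsetD)+
  define l where "l a = inv_into {..<N} Q (fst m a)" for a
  have lp: "l (p ! i) = L ! i" if "i < length p" for i
    using fst_m[OF that] LN[OF that] Q unfolding l_def bij_betw_def by simp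
  have map_l: "map l p = L" using len lp by (intro nth_equalityI) auto
  have l: "Q (l a) = fst m a \<and> l a < N" if "a \<in> VR I" for a
  proof -
    obtain i where "i < length p" "p ! i = a" using \<open>a \<in> VR I\<close> p(3) by (metis in_set_conv_nth)
    then show ?thesis using lp[of i] fst_m[of i] LN[of i] by simp
  qed
  note tp = tree_path_props[of "L ! i" "L ! Suc i" "N + N" for i]
  define sep where "sep i r \<longleftrightarrow> (L ! i \<in> below P r) \<noteq> (L ! Suc i \<in> below P r)" for i r
  have edges: "path_edges (snd m {p ! i, p ! Suc i}) = tree_edge ` {r. r < N - 1 \<and> sep i r}"
    if i: "Suc i < length p" for i
  proof -
    have Li: "L ! i < N" "L ! Suc i < N" using LN i by auto
    have "{{r, P r} | r. r < N - 1 \<and> sep i r} = (\<lambda>r. {r, P r}) ` {r. r < N - 1 \<and> sep i r}" by blast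
    moreover have "path_edges (tree_path P (N + N) (L ! i) (L ! Suc i)) = {{r, P r} | r. r < N - 1 \<and> sep i r}"
      unfolding sep_def by (rule tp(6)) (use Li in auto)
    ultimately show ?thesis unfolding snd_m[OF i] path_edges_map by (simp add: image_image)
  qed
  have map_ok: "loop_free_path (VS I) (ES I) (snd m f) \<and> {hd (snd m f), last (snd m f)} = fst m ` f"
    if "f \<in> ER I" for f
  proof -
    obtain i where i: "Suc i < length p" "f = {p ! i, p ! Suc i}"
      using \<open>f \<in> ER I\<close> unfolding p(4)[symmetric] path_edges_def by blast
    have Li: "L ! i < N" "L ! Suc i < N" using LN i by auto
    have fuel: "N - 1 - L ! i + (N - 1 - L ! Suc i) \<le> N + N" by simp
    note tpi = tp[OF Li fuel]
    have sub: "set (tree_path P (N + N) (L ! i) (L ! Suc i)) \<subseteq> {..<N}" using tpi(5) by auto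
    then have "distinct (map Q (tree_path P (N + N) (L ! i) (L ! Suc i)))"
      using tpi(4) bij_betw_imp_inj_on[OF Q] by (auto simp: distinct_map intro: inj_on_subset)
    moreover have "Q ` set (tree_path P (N + N) (L ! i) (L ! Suc i)) \<subseteq> VS I"
      using sub bij_betw_imp_surj_on[OF Q] by blast
    moreover have "path_edges (snd m f) \<subseteq> ES I" using edges[OF i(1)] ES i(2) by auto
    ultimately show ?thesis
      using i snd_m[OF i(1)] tpi fst_m[of i] fst_m[of "Suc i"] by (simp add: loop_free_path_def hd_map last_map)
  qed
  have uses: "uses m r = crossings r L" if "r < N - 1" for r
  proof -
    have "tree_edge r \<in> path_edges (snd m {p ! i, p ! Suc i}) \<longleftrightarrow> sep i r"
      if i: "Suc i < length p" for i
      unfolding edges[OF i] using tree_edge_inj \<open>r < N - 1\<close> by (auto simp: inj_on_def image_iff)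
    then have "{i. Suc i < length p \<and> tree_edge r \<in> path_edges (snd m {p ! i, p ! Suc i})} =
       {i. Suc i < length p \<and> sep i r}" by blast
    then show ?thesis unfolding crossings_eq uses_eq len sep_def by simp
  qed
  have "\<forall>u\<in>VS I. card {a \<in> VR I. fst m a = u} \<le> node_cap I u"
  proof
    fix u assume "u \<in> VS I"
    then obtain r where "r < N" "u = Q r" using bij_betw_imp_surj_on[OF Q] by auto
    then show "card {a \<in> VR I. fst m a = u} \<le> node_cap I u"
      using L node_load_eq[of l m r, OF l] map_l by (simp add: feasible_tour_def)
  qed
  moreover have "\<forall>e\<in>ES I. card {f \<in> ER I. e \<in> path_edges (snd m f)} \<le> edge_cap I e"
    using L uses unfolding ES uses_def by (auto simp: feasible_tour_def)
  moreover have "\<forall>a\<in>VR I. fst m a \<in> VS I"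
  proof
    fix a assume "a \<in> VR I"
    then show "fst m a \<in> VS I" using l[of a] bij_betwE[OF Q] by (metis lessThan_iff)
  qed
  ultimately show "feasible I m" using map_ok by (simp add: feasible_def is_mapping_def)
  show "cost I m = tour_cost L"
    using cost_eq[of m l] map_ok l uses by (simp add: map_l tour_cost_def loop_free_path_def)
qed

text \<open>Routes are assigned to edges as sets, so the position on the virtual path has to be
  recovered from the set. It is unique because \<open>p\<close> has no repetitions.\<close>

lemma exists_mapping_of_tour:
  "\<exists>m. (\<forall>i<length p. fst m (p ! i) = Q (L ! i)) \<and>
     (\<forall>i. Suc i < length p \<longrightarrow> snd m {p ! i, p ! Suc i} = map Q (tree_path P (N + N) (L ! i) (L ! Suc i)))"
proof -
  define vi where "vi a = (THE i. i < length p \<and> p ! i = a)" for a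
  define ei where "ei f = (THE i. Suc i < length p \<and> {p ! i, p ! Suc i} = f)" for f
  have "vi (p ! i) = i" if "i < length p" for i
    unfolding vi_def using that p(2) by (intro the_equality) (auto simp: nth_eq_iff_index_eq)
  moreover have "ei {p ! i, p ! Suc i} = i" if "Suc i < length p" for i
    unfolding ei_def using that path_edges_inj[OF p(2)] by (intro the_equality) blast+
  ultimately show ?thesis
    by (intro exI[of _ "(\<lambda>a. Q (L ! vi a), \<lambda>f. map Q (tree_path P (N + N) (L ! ei f) (L ! Suc (ei f))))"]) simp
qed

end

section \<open>Trees and paths as graphs\<close>

section \<open>Leaves of trees\<close>

lemma loop_free_path_mono:
  "loop_free_path V E p \<Longrightarrow> V \<subseteq> V' \<Longrightarrow> E \<subseteq> E' \<Longrightarrow> loop_free_path V' E' p"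
  by (auto simp: loop_free_path_def)

lemma path_edges_append:
  "xs \<noteq> [] \<Longrightarrow> ys \<noteq> [] \<Longrightarrow> path_edges (xs @ ys) = insert {last xs, hd ys} (path_edges xs \<union> path_edges ys)"
proof (induction xs rule: induct_list012)
  case (2 x)
  then show ?case by (cases ys) auto
qed auto

lemma path_edges_mem_subset: "e \<in> path_edges p \<Longrightarrow> e \<subseteq> set p"
  by (induction p rule: induct_list012) auto

lemma inner_vertex_two_edges:
  assumes "distinct q" "v \<in> set q" "v \<noteq> hd q" "v \<noteq> last q"
  obtains a b where "a \<noteq> b" "a \<noteq> v" "b \<noteq> v" "{a, v} \<in> path_edges q" "{v, b} \<in> path_edges q"
proof -
  from assms(2) obtain xs ys where q: "q = xs @ v # ys" by (meson split_list)
  with assms have ne: "xs \<noteq> []" "ys \<noteq> []" by auto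
  then obtain xs' a where xs: "xs = xs' @ [a]" by (metis rev_exhaust)
  from ne obtain b ys' where ys: "ys = b # ys'" by (cases ys) auto
  have "path_edges q = insert {a, v} (path_edges xs \<union> path_edges (v # ys))"
    unfolding q using path_edges_append[of xs "v # ys"] ne xs by simp
  then have "{a, v} \<in> path_edges q" "{v, b} \<in> path_edges q" by (auto simp: ys)
  then show thesis using that assms(1) by (auto simp: q xs ys)
qed

lemma tree_graph_single: "tree_graph {r} {}"
proof -
  have "loop_free_path {r} {} [r]" by (simp add: loop_free_path_def)
  then have "connected_graph {r} {}" unfolding connected_graph_def by (intro ballI exI[of _ "[r]"]) auto
  then show ?thesis by (simp add: tree_graph_def simple_graph_def acyclic_graph_def)
qed

text \<open>A cycle is a list with a closing edge, so the new node could be inner, first or last on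
  it. In each case it would have two different neighbours, while \<open>p\<close> is its only
  one.\<close>

lemma tree_graph_add_leaf:
  assumes T: "tree_graph V E" and v: "v \<notin> V" and p: "p \<in> V"
  shows "tree_graph (insert v V) (insert {v, p} E)"
proof -
  let ?V = "insert v V" and ?E = "insert {v, p} E"
  have EV: "\<And>e. e \<in> E \<Longrightarrow> e \<subseteq> V" using T by (auto simp: tree_graph_def simple_graph_def)
  have onlyp: "a = p" if "{a, v} \<in> ?E" for a using that EV[of "{a, v}"] v by (auto simp: doubleton_eq_iff)
  have simple: "simple_graph ?V ?E" using T v p by (auto simp: tree_graph_def simple_graph_def card_insert_if)
  have old: "\<exists>q. loop_free_path ?V ?E q \<and> hd q = x \<and> last q = y \<and> set q \<subseteq> V" if xy: "x \<in> V" "y \<in> V" for x y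
  proof -
    obtain q where q: "loop_free_path V E q" "hd q = x" "last q = y"
      using T xy unfolding tree_graph_def connected_graph_def by blast
    have "loop_free_path ?V ?E q" by (rule loop_free_path_mono[OF q(1)]) auto
    moreover have "set q \<subseteq> V" using q(1) by (simp add: loop_free_path_def)
    ultimately show ?thesis using q(2,3) by blast
  qed
  have conn: "connected_graph ?V ?E" unfolding connected_graph_def
  proof (intro ballI)
    fix x y assume xy: "x \<in> ?V" "y \<in> ?V"
    have ext: "\<exists>q. loop_free_path ?V ?E q \<and> hd q = v \<and> last q = z" if z: "z \<in> V" for z
    proof -
      obtain q where q: "loop_free_path ?V ?E q" "hd q = p" "last q = z" "set q \<subseteq> V" using old[OF p z] by blast
      then show ?thesis using v path_edges_append[of "[v]" q]
        by (intro exI[of _ "v # q"]) (auto simp: loop_free_path_def)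
    qed
    consider "x \<in> V" "y \<in> V" | "x = v" "y = v" | "x = v" "y \<in> V" | "x \<in> V" "y = v" using xy by blast
    then show "\<exists>q. loop_free_path ?V ?E q \<and> hd q = x \<and> last q = y"
    proof cases
      case 1
      then show ?thesis using old by blast
    next
      case 2
      then show ?thesis by (intro exI[of _ "[v]"]) (auto simp: loop_free_path_def)
    next
      case 3
      then show ?thesis using ext by blast
    next
      case 4
      then obtain q where "loop_free_path ?V ?E q \<and> hd q = v \<and> last q = x" using ext by blast
      then show ?thesis using 4 by (intro exI[of _ "rev q"]) (auto simp: loop_free_path_def hd_rev last_rev)
    qed
  qed
  have "acyclic_graph ?V ?E" unfolding acyclic_graph_def
  proof
    assume "\<exists>c. loop_free_path ?V ?E c \<and> 3 \<le> length c \<and> {last c, hd c} \<in> ?E"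
    then obtain c where c: "loop_free_path ?V ?E c" "3 \<le> length c" "{last c, hd c} \<in> ?E" by blast
    have d: "distinct c" and pe: "path_edges c \<subseteq> ?E" using c by (auto simp: loop_free_path_def)
    obtain a b ys where cc: "c = a # b # ys" "ys \<noteq> []" using c(2)
      by (cases c; cases "tl c"; cases "tl (tl c)") auto
    obtain zs y z where cz: "c = zs @ [y, z]" "zs \<noteq> []"
    proof -
      obtain c' z where "c = c' @ [z]" using cc(1) by (metis list.distinct(1) rev_exhaust)
      moreover have "c' \<noteq> []" using calculation c(2) by auto
      moreover obtain zs y where "c' = zs @ [y]" using \<open>c' \<noteq> []\<close> by (metis rev_exhaust)
      ultimately show ?thesis using that[of zs y z] c(2) by (cases "zs = []") auto
    qed
    show False
    proof (cases "v \<in> set c")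
      case False
      have old_edge: "e \<in> E" if "e \<in> ?E" "e \<subseteq> set c" for e using that False by auto
      have "last c \<in> set c" "hd c \<in> set c" using cc by auto
      then have "{last c, hd c} \<in> E" by (intro old_edge[OF c(3)]) simp
      moreover have "path_edges c \<subseteq> E"
      proof
        fix e assume e: "e \<in> path_edges c"
        show "e \<in> E" by (rule old_edge[OF subsetD[OF pe e] path_edges_mem_subset[OF e]])
      qed
      moreover have "set c \<subseteq> V" using c(1) False unfolding loop_free_path_def by blast
      moreover have "c \<noteq> []" using cc by simp
      ultimately have "loop_free_path V E c \<and> 3 \<le> length c \<and> {last c, hd c} \<in> E"
        using c(2) d unfolding loop_free_path_def by blast
      then show False using T unfolding tree_graph_def acyclic_graph_def by blast
    next
      case True
      show False
      proof (cases "v = hd c \<or> v = last c")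
        case False
        then obtain a' b' where "a' \<noteq> b'" "{a', v} \<in> path_edges c" "{v, b'} \<in> path_edges c"
          using inner_vertex_two_edges[OF d True] by metis
        then show False using onlyp[of a'] onlyp[of b'] pe by (auto simp: insert_commute)
      next
        case True
        then show False
        proof
          assume "v = hd c"
          then have "a = v" "{b, v} \<in> ?E" "{last c, v} \<in> ?E" using cc pe c(3) by (auto simp: insert_commute)
          then have "b = last c" using onlyp by metis
          then show False using d cc by auto
        next
          assume "v = last c"
          then have "z = v" using cz by simp
          have "path_edges c = insert {y, z} (path_edges (zs @ [y]))"
            using path_edges_snoc[of "zs @ [y]" z] cz by simp
          then have "{y, v} \<in> ?E" "{hd c, v} \<in> ?E" using cz pe c(3) \<open>z = v\<close> by (auto simp: insert_commute)
          then have "y = hd c" using onlyp by metis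
          then show False using d cz by (cases zs) auto
        qed
      qed
    qed
  qed
  then show ?thesis using simple conn by (simp add: tree_graph_def)
qed

text \<open>A path between other nodes cannot pass through \<open>v\<close>, since an inner node of
  a path has two different neighbours.\<close>

lemma tree_graph_remove_leaf:
  assumes T: "tree_graph V E" and v: "{e \<in> E. v \<in> e} = {{v, p}}" "p \<noteq> v"
  shows "tree_graph (V - {v}) (E - {{v, p}})"
proof -
  let ?V = "V - {v}" and ?E = "E - {{v, p}}"
  have vp: "{v, p} \<in> E" using v by blast
  have onlyp: "a = p" if "{a, v} \<in> E" "a \<noteq> v" for a
  proof -
    have "{a, v} \<in> {e \<in> E. v \<in> e}" using that by auto
    then show ?thesis unfolding v using that by (auto simp: doubleton_eq_iff)
  qed
  have "{v, p} \<subseteq> V" using T vp by (auto simp: tree_graph_def simple_graph_def)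
  then have pV: "p \<in> ?V" using v by auto
  have sub: "e \<subseteq> ?V" if "e \<in> ?E" for e
  proof -
    have "e \<subseteq> V" using that T unfolding tree_graph_def simple_graph_def by blast
    moreover have "v \<notin> e"
    proof
      assume "v \<in> e"
      then have "e \<in> {e \<in> E. v \<in> e}" using that by blast
      then show False using that unfolding v(1) by blast
    qed
    ultimately show ?thesis by blast
  qed
  have "\<forall>e\<in>?E. card e = 2" "finite ?V" using T by (auto simp: tree_graph_def simple_graph_def)
  then have "simple_graph ?V ?E" using pV sub unfolding simple_graph_def by blast
  moreover have "connected_graph ?V ?E" unfolding connected_graph_def
  proof (intro ballI)
    fix x y assume xy: "x \<in> ?V" "y \<in> ?V"
    then obtain q where q: "loop_free_path V E q" "hd q = x" "last q = y"
      using T unfolding tree_graph_def connected_graph_def by blast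
    have d: "distinct q" "path_edges q \<subseteq> E" using q by (auto simp: loop_free_path_def)
    have nv: "v \<notin> set q"
    proof
      assume "v \<in> set q"
      moreover have "v \<noteq> hd q" "v \<noteq> last q" using xy q by auto
      ultimately obtain a b where "a \<noteq> b" "a \<noteq> v" "b \<noteq> v" "{a, v} \<in> path_edges q" "{v, b} \<in> path_edges q"
        using inner_vertex_two_edges[OF d(1)] by metis
      then show False using onlyp[of a] onlyp[of b] d by (auto simp: insert_commute)
    qed
    then have "{v, p} \<notin> path_edges q" using path_edges_mem_subset[of "{v, p}" q] by auto
    then have "loop_free_path ?V ?E q" using q nv unfolding loop_free_path_def by blast
    then show "\<exists>q. loop_free_path ?V ?E q \<and> hd q = x \<and> last q = y" using q by blast
  qed
  moreover have "acyclic_graph ?V ?E"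
    using T loop_free_path_mono[of ?V ?E _ V E] unfolding tree_graph_def acyclic_graph_def by blast
  ultimately show ?thesis by (simp add: tree_graph_def)
qed

lemma connected_has_edge:
  assumes "connected_graph V E" "v \<in> V" "w \<in> V" "v \<noteq> w"
  shows "\<exists>x. {v, x} \<in> E"
proof -
  obtain q where q: "loop_free_path V E q" "hd q = v" "last q = w"
    using assms unfolding connected_graph_def by blast
  then obtain x ys where "q = v # x # ys" using assms(4)
    by (cases q; cases "tl q") (auto simp: loop_free_path_def split: if_splits)
  then show ?thesis using q by (auto simp: loop_free_path_def)
qed

text \<open>The last node of a longest path from \<open>r\<close> is a leaf: a second neighbour
  would prolong the path if it is new, and close a cycle if it lies on the path.\<close>

lemma tree_graph_leaf:
  assumes T: "tree_graph V E" and r: "r \<in> V" "V \<noteq> {r}"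
  shows "\<exists>v\<in>V. \<exists>p\<in>V. v \<noteq> r \<and> p \<noteq> v \<and> {e \<in> E. v \<in> e} = {{v, p}}"
proof -
  have fin: "finite V" and sg: "\<And>e. e \<in> E \<Longrightarrow> e \<subseteq> V \<and> card e = 2"
    using T by (auto simp: tree_graph_def simple_graph_def)
  let ?S = "\<lambda>q. loop_free_path V E q \<and> hd q = r"
  have "?S [r]" using r by (simp add: loop_free_path_def)
  moreover have bound: "\<forall>q. ?S q \<longrightarrow> length q < Suc (card V)"
  proof (intro allI impI)
    fix q assume "?S q"
    then have "card (set q) = length q" "set q \<subseteq> V" by (auto simp: loop_free_path_def distinct_card)
    then show "length q < Suc (card V)" using card_mono[OF fin] by (metis le_imp_less_Suc)
  qed
  ultimately obtain q where q: "?S q" and max: "\<And>q'. ?S q' \<Longrightarrow> length q' \<le> length q"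
    using ex_has_greatest_nat[of ?S "[r]" length "Suc (card V)"] by auto
  obtain w where w: "w \<in> V" "w \<noteq> r" using r by auto
  obtain q2 where q2: "loop_free_path V E q2" "hd q2 = r" "last q2 = w"
    using T r w unfolding tree_graph_def connected_graph_def by blast
  then have "2 \<le> length q2" using w by (cases q2; cases "tl q2") (auto simp: loop_free_path_def)
  then have len: "2 \<le> length q" using max[of q2] q2 by auto
  obtain q' x where qx: "q = q' @ [x]" using len by (cases q rule: rev_exhaust) auto
  have ne: "q' \<noteq> []" using len qx by auto
  have d: "distinct q" "set q \<subseteq> V" "path_edges q \<subseteq> E" "q \<noteq> []" using q by (auto simp: loop_free_path_def)
  let ?p = "last q'"
  have pe: "path_edges q = insert {?p, x} (path_edges q')" using path_edges_snoc[OF ne, of x] qx by simp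
  have edge: "{x, ?p} \<in> E" using pe d by (auto simp: insert_commute)
  have p: "?p \<in> set q'" "?p \<noteq> x" using last_in_set[OF ne] qx d(1) by auto
  have xr: "x \<noteq> r"
  proof -
    have "hd q' = r" using q qx ne by auto
    then have "r \<in> set q'" using ne hd_in_set by blast
    then show ?thesis using d(1) qx by auto
  qed
  have "y = ?p" if y: "{x, y} \<in> E" for y
  proof (rule ccontr)
    assume np: "y \<noteq> ?p"
    have "card {x, y} = 2" "y \<in> V" using sg[OF y] by auto
    then have yx: "y \<noteq> x" by auto
    show False
    proof (cases "y \<in> set q'")
      case False
      have "path_edges (q @ [y]) = insert {x, y} (path_edges q)"
        using path_edges_snoc[of q y] d qx by simp
      then have "loop_free_path V E (q @ [y])" using False yx y d \<open>y \<in> V\<close> qx by (auto simp: loop_free_path_def)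
      moreover have "hd (q @ [y]) = r" using q d by simp
      ultimately show False using max[of "q @ [y]"] by simp
    next
      case True
      then obtain as bs where ab: "q' = as @ y # bs" by (meson split_list)
      then have "bs \<noteq> []" using np by auto
      let ?c = "y # bs @ [x]"
      have qc: "q = as @ ?c" using ab qx by simp
      have "path_edges ?c \<subseteq> path_edges q"
        using path_edges_append[of as ?c] qc by (cases "as = []") auto
      then have "loop_free_path V E ?c" using d qc by (auto simp: loop_free_path_def)
      moreover have "3 \<le> length ?c" using \<open>bs \<noteq> []\<close> by (cases bs) auto
      moreover have "{last ?c, hd ?c} \<in> E" using y by simp
      ultimately show False using T unfolding tree_graph_def acyclic_graph_def by blast
    qed
  qed
  then have only: "e = {x, ?p}" if e: "e \<in> E" "x \<in> e" for e
  proof -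
    obtain y where "e = {x, y}" using sg[OF e(1)] e(2) by (auto simp: card_2_iff)
    then show ?thesis using e \<open>\<And>y. {x, y} \<in> E \<Longrightarrow> y = last q'\<close>[of y] by simp
  qed
  have "{e \<in> E. x \<in> e} = {{x, ?p}}"
  proof
    show "{e \<in> E. x \<in> e} \<subseteq> {{x, ?p}}" using only by (intro subsetI) (elim CollectE conjE, simp only: singleton_iff)
    show "{{x, ?p}} \<subseteq> {e \<in> E. x \<in> e}" using edge by simp
  qed
  moreover have "x \<in> V" "?p \<in> V" using d qx p by auto
  ultimately show ?thesis using p xr by blast
qed

lemma tree_graph_card_edges: "tree_graph V E \<Longrightarrow> finite E \<and> card E = card V - 1"
proof (induction "card V" arbitrary: V E)
  case 0
  then show ?case by (auto simp: tree_graph_def simple_graph_def)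
next
  case (Suc k)
  obtain r where r: "r \<in> V" using Suc by (auto simp: tree_graph_def simple_graph_def)
  have finV: "finite V" using Suc by (auto simp: tree_graph_def simple_graph_def)
  show ?case
  proof (cases "V = {r}")
    case True
    have "e \<notin> E" for e
    proof
      assume "e \<in> E"
      then have "e \<subseteq> {r}" "card e = 2" using Suc.prems True by (auto simp: tree_graph_def simple_graph_def)
      then show False using card_mono[of "{r}" e] by auto
    qed
    then have "E = {}" by auto
    then show ?thesis using True by simp
  next
    case False
    then obtain v p where v: "v \<in> V" "p \<noteq> v" "{e \<in> E. v \<in> e} = {{v, p}}" and vr: "v \<noteq> r"
      using tree_graph_leaf[OF Suc.prems r] by blast
    have vp: "{v, p} \<in> E" using v(3) by blast
    have IH: "finite (E - {{v, p}}) \<and> card (E - {{v, p}}) = card (V - {v}) - 1"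
      using Suc.hyps(1)[OF _ tree_graph_remove_leaf[OF Suc.prems v(3,2)]] v(1) Suc.hyps(2) finV by simp
    have "card V \<ge> 2" using v(1) vr r card_mono[OF finV, of "{v, r}"] by simp
    moreover have fE: "finite E" using IH by simp
    ultimately show ?thesis
      using IH card.remove[OF fE vp] card.remove[OF finV v(1)] by linarith
  qed
qed

section \<open>Paths as trees\<close>

lemma path_tree_graph: "p \<noteq> [] \<Longrightarrow> distinct p \<Longrightarrow> tree_graph (set p) (path_edges p)"
proof (induction p rule: induct_list012)
  case (2 x)
  then show ?case using tree_graph_single[of x] by simp
next
  case (3 x y zs)
  then show ?case using tree_graph_add_leaf[of "set (y # zs)" "path_edges (y # zs)" x y] by simp
qed simp

lemma path_degree:
  assumes "distinct p"
  shows "card {e \<in> path_edges p. v \<in> e} \<le> 2" "card {e \<in> path_edges p. hd p \<in> e} \<le> 1"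
proof -
  have 1: "card {e \<in> path_edges p. hd p \<in> e} \<le> 1"
  proof (cases p rule: remdups_adj.cases)
    case (3 x y zs)
    have "{e \<in> path_edges p. hd p \<in> e} \<subseteq> {{x, y}}"
      using path_edges_mem_subset[of _ "y # zs"] assms 3 by auto
    from card_mono[OF _ this] show ?thesis by simp
  qed auto
  then show "card {e \<in> path_edges p. hd p \<in> e} \<le> 1" .
  show "card {e \<in> path_edges p. v \<in> e} \<le> 2" using assms
  proof (induction p rule: induct_list012)
    case (3 x y zs)
    consider "v \<noteq> x" "v \<noteq> y" | "v = x" | "v = y" "v \<noteq> x" by blast
    then show ?case
    proof cases
      case 1
      then have "{e \<in> path_edges (x # y # zs). v \<in> e} = {e \<in> path_edges (y # zs). v \<in> e}" by auto
      then show ?thesis using 3 by simp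
    next
      case 2
      then have "{e \<in> path_edges (x # y # zs). v \<in> e} \<subseteq> {{x, y}}"
        using path_edges_mem_subset[of _ "y # zs"] 3 by auto
      from card_mono[OF _ this] show ?thesis by simp
    next
      case 3
      have "{e \<in> path_edges (y # zs). y \<in> e} \<subseteq> (if zs = [] then {} else {{y, hd zs}})"
      proof (cases zs)
        case (Cons z zs')
        then show ?thesis using path_edges_mem_subset[of _ zs] "3.prems" by auto
      qed simp
      then have "{e \<in> path_edges (x # y # zs). v \<in> e} \<subseteq> {{x, y}, {y, hd zs}}" using 3 by (auto split: if_splits)
      from card_mono[OF _ this] show ?thesis by (auto intro: order_trans simp: card_insert_if split: if_splits)
    qed
  qed auto
qed

text \<open>This recognises a path by its elimination order. By induction from the root downwards,
  if the parent \<open>t\<close> of \<open>r\<close> is not \<open>Suc r\<close>, then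
  \<open>t - 1\<close> is another child of \<open>t\<close>. Together with its parent edge
  \<open>t\<close> has degree at least 3, and if it is the root, degree at least 2; either
  contradicts a degree bound.\<close>

lemma (in ordered_tree) path_from_degrees:
  assumes Q: "inj_on Q {..<N}"
    and E: "E = (\<lambda>r. {Q r, Q (P r)}) ` {..<N - 1}"
    and deg: "\<And>v. card {e \<in> E. v \<in> e} \<le> 2" "card {e \<in> E. Q (N - 1) \<in> e} \<le> 1"
  shows "r < N - 1 \<Longrightarrow> P r = Suc r"
proof (induction "N - r" arbitrary: r rule: less_induct)
  case less
  have fin: "finite E" using E by simp
  have eq: "Q a = Q b \<longleftrightarrow> a = b" if "a < N" "b < N" for a b using Q that by (auto simp: inj_on_def)
  show ?case
  proof (rule ccontr)
    assume neq: "P r \<noteq> Suc r"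
    define t where "t = P r"
    have t: "Suc r < t" "t < N" using parent[OF less.prems] neq by (auto simp: t_def)
    have Pt: "P (t - 1) = t" using less.hyps[of "t - 1"] t by simp
    have e1: "{Q r, Q t} \<in> {e \<in> E. Q t \<in> e}" using less.prems E t_def by auto
    have e2: "{Q (t - 1), Q t} \<in> {e \<in> E. Q t \<in> e}" using E Pt t by (auto intro!: image_eqI[of _ _ "t - 1"])
    have ne12: "{Q r, Q t} \<noteq> {Q (t - 1), Q t}" using t eq by (auto simp: doubleton_eq_iff)
    show False
    proof (cases "t = N - 1")
      case True
      have "card {{Q r, Q t}, {Q (t - 1), Q t}} \<le> card {e \<in> E. Q t \<in> e}"
        using e1 e2 fin by (intro card_mono) auto
      then show False using deg(2) True ne12 by simp
    next
      case False
      then have t3: "t < N - 1" using t by auto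
      have Pt2: "P t = Suc t" using less.hyps[of t] t t3 by simp
      have e3: "{Q t, Q (Suc t)} \<in> {e \<in> E. Q t \<in> e}" using E Pt2 t3 by (auto intro!: image_eqI[of _ _ t])
      have "{Q r, Q t} \<noteq> {Q t, Q (Suc t)}" "{Q (t - 1), Q t} \<noteq> {Q t, Q (Suc t)}"
        using t t3 eq by (auto simp: doubleton_eq_iff)
      then have "card {{Q r, Q t}, {Q (t - 1), Q t}, {Q t, Q (Suc t)}} = 3" using ne12 by simp
      moreover have "card {{Q r, Q t}, {Q (t - 1), Q t}, {Q t, Q (Suc t)}} \<le> card {e \<in> E. Q t \<in> e}"
        using e1 e2 e3 fin by (intro card_mono) auto
      ultimately show False using deg(1)[of "Q t"] by simp
    qed
  qed
qed

section \<open>Loop programs, their compilation and their running time\<close>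

section \<open>A language of counting loops over arrays\<close>

datatype expr =
    Num nat
  | Var nat
  | Arr nat expr
  | Plus expr expr
  | Minus expr expr

datatype cmd =
    Skip
  | Assign nat expr (infix "::=" 62)
  | Write nat expr expr
  | Seq cmd cmd (infixr ";;" 60)
  | Cond expr cmd cmd
  | For nat nat cmd

datatype store = Store (vars: "nat \<Rightarrow> nat") (arrs: "nat \<Rightarrow> nat \<Rightarrow> nat")

definition set_var :: "nat \<Rightarrow> nat \<Rightarrow> store \<Rightarrow> store" where
  "set_var x v s = Store ((vars s)(x := v)) (arrs s)"

definition set_arr :: "nat \<Rightarrow> nat \<Rightarrow> nat \<Rightarrow> store \<Rightarrow> store" where
  "set_arr k i v s = Store (vars s) ((arrs s)(k := (arrs s k)(i := v)))"

lemma store_simps [simp]: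
  "vars (set_var x v s) = (vars s)(x := v)" "arrs (set_var x v s) = arrs s"
  "vars (set_arr k i v s) = vars s" "arrs (set_arr k i v s) = (arrs s)(k := (arrs s k)(i := v))"
  by (simp_all add: set_var_def set_arr_def)

primrec val :: "expr \<Rightarrow> store \<Rightarrow> nat" where
  "val (Num n) s = n"
| "val (Var x) s = vars s x"
| "val (Arr k e) s = arrs s k (val e s)"
| "val (Plus a b) s = val a s + val b s"
| "val (Minus a b) s = val a s - val b s"

text \<open>The bound of a loop is a variable, read before the first round.\<close>

primrec sem :: "cmd \<Rightarrow> store \<Rightarrow> store" where
  "sem Skip = (\<lambda>s. s)"
| "sem (x ::= e) = (\<lambda>s. set_var x (val e s) s)"
| "sem (Write k i e) = (\<lambda>s. set_arr k (val i s) (val e s) s)"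
| "sem (c ;; d) = (\<lambda>s. sem d (sem c s))"
| "sem (Cond e c d) = (\<lambda>s. if val e s \<noteq> 0 then sem c s else sem d s)"
| "sem (For x y c) =
     (\<lambda>s. ((\<lambda>t. set_var x (Suc (vars (sem c t) x)) (sem c t)) ^^ vars s y) (set_var x 0 s))"

primrec assigned :: "cmd \<Rightarrow> nat set" where
  "assigned Skip = {}"
| "assigned (x ::= e) = {x}"
| "assigned (Write k i e) = {}"
| "assigned (c ;; d) = assigned c \<union> assigned d"
| "assigned (Cond e c d) = assigned c \<union> assigned d"
| "assigned (For x y c) = insert x (assigned c)"

primrec written :: "cmd \<Rightarrow> nat set" where
  "written Skip = {}"
| "written (x ::= e) = {}"
| "written (Write k i e) = {k}"
| "written (c ;; d) = written c \<union> written d"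
| "written (Cond e c d) = written c \<union> written d"
| "written (For x y c) = written c"

primrec bounds :: "cmd \<Rightarrow> nat set" where
  "bounds Skip = {}"
| "bounds (x ::= e) = {}"
| "bounds (Write k i e) = {}"
| "bounds (c ;; d) = bounds c \<union> bounds d"
| "bounds (Cond e c d) = bounds c \<union> bounds d"
| "bounds (For x y c) = insert y (bounds c)"

lemma vars_sem: "v \<notin> assigned c \<Longrightarrow> vars (sem c s) v = vars s v"
proof (induction c arbitrary: s)
  case (For x y c)
  have "vars (((\<lambda>t. set_var x (Suc (vars (sem c t) x)) (sem c t)) ^^ n) (set_var x 0 s)) v = vars s v" for n
    by (induction n) (use For in auto)
  then show ?case by simp
qed auto

lemma arrs_sem: "k \<notin> written c \<Longrightarrow> arrs (sem c s) k = arrs s k"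
proof (induction c arbitrary: s)
  case (For x y c)
  have "arrs (((\<lambda>t. set_var x (Suc (vars (sem c t) x)) (sem c t)) ^^ n) (set_var x 0 s)) k = arrs s k" for n
    by (induction n) (use For in auto)
  then show ?case by simp
qed auto

text \<open>Framing is built in: each round may assume that variables and arrays untouched by the
  loop have their initial contents, so an invariant has to mention only what changes.\<close>

lemma sem_For_invariant:
  assumes base: "I 0 (set_var x 0 s)"
    and step: "\<And>i t. i < vars s y \<Longrightarrow> I i t \<Longrightarrow> vars t x = i \<Longrightarrow>
      (\<And>v. v \<notin> assigned (For x y c) \<Longrightarrow> vars t v = vars s v) \<Longrightarrow>
      (\<And>k. k \<notin> written c \<Longrightarrow> arrs t k = arrs s k) \<Longrightarrow> I (Suc i) (set_var x (Suc i) (sem c t))"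
    and x: "x \<notin> assigned c"
  shows "I (vars s y) (sem (For x y c) s)"
proof -
  let ?f = "\<lambda>t. set_var x (Suc (vars (sem c t) x)) (sem c t)"
  have "n \<le> vars s y \<Longrightarrow> I n ((?f ^^ n) (set_var x 0 s)) \<and> vars ((?f ^^ n) (set_var x 0 s)) x = n \<and>
    (\<forall>v. v \<notin> assigned (For x y c) \<longrightarrow> vars ((?f ^^ n) (set_var x 0 s)) v = vars s v) \<and>
    (\<forall>k. k \<notin> written c \<longrightarrow> arrs ((?f ^^ n) (set_var x 0 s)) k = arrs s k)" for n
  proof (induction n)
    case (Suc n)
    let ?t = "(?f ^^ n) (set_var x 0 s)"
    from Suc have IH: "I n ?t" "vars ?t x = n" "\<And>v. v \<notin> assigned (For x y c) \<Longrightarrow> vars ?t v = vars s v"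
      "\<And>k. k \<notin> written c \<Longrightarrow> arrs ?t k = arrs s k" by auto
    have "vars (sem c ?t) x = n" using vars_sem[OF x] IH(2) by simp
    then have "?f ?t = set_var x (Suc n) (sem c ?t)" by simp
    moreover have "I (Suc n) (set_var x (Suc n) (sem c ?t))" by (rule step) (use IH Suc.prems in auto)
    moreover have "\<forall>v. v \<notin> assigned (For x y c) \<longrightarrow> vars (sem c ?t) v = vars s v"
      using vars_sem[of _ c ?t] IH(3) by auto
    moreover have "\<forall>k. k \<notin> written c \<longrightarrow> arrs (sem c ?t) k = arrs s k" using arrs_sem[of _ c ?t] IH(4) by auto
    ultimately show ?case by simp
  qed (use base in auto)
  then show ?thesis by simp
qed

section \<open>Compilation\<close>

text \<open>Array \<open>k < 32\<close> of the store occupies the cells \<open>L + 32 * i + k\<close>, where register \<open>0\<close> holds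
  the length \<open>L\<close> of the input.  Variable \<open>x\<close> is kept in register \<open>2 * x\<close>; the odd registers are
  used for the evaluation of expressions.\<close>

definition represents :: "nat \<Rightarrow> ram_state \<Rightarrow> store \<Rightarrow> bool" where
  "represents L \<sigma> s \<longleftrightarrow> vars s 0 = L \<and> (\<forall>x. reg \<sigma> (2 * x) = vars s x) \<and>
     (\<forall>k<32. \<forall>i. mem \<sigma> (L + 32 * i + k) = arrs s k i)"

primrec straight :: "ram \<Rightarrow> bool" where
  "straight (RConst r k) = True"
| "straight (RAdd r a b) = True"
| "straight (RSub r a b) = True"
| "straight (RLoad r a) = True"
| "straight (RStore a b) = True"
| "straight (RSeq p q) = (straight p \<and> straight q)"
| "straight (RIf a p q) = False"
| "straight (RWhile a p) = False"

primrec effect :: "ram \<Rightarrow> ram_state \<Rightarrow> ram_state" where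
  "effect (RConst r k) s = set_reg r k s"
| "effect (RAdd r a b) s = set_reg r (reg s a + reg s b) s"
| "effect (RSub r a b) s = set_reg r (reg s a - reg s b) s"
| "effect (RLoad r a) s = set_reg r (mem s (reg s a)) s"
| "effect (RStore a b) s = set_mem (reg s a) (reg s b) s"
| "effect (RSeq p q) s = effect q (effect p s)"
| "effect (RIf a p q) s = s"
| "effect (RWhile a p) s = s"

primrec steps :: "ram \<Rightarrow> nat" where
  "steps (RConst r k) = 1"
| "steps (RAdd r a b) = 1"
| "steps (RSub r a b) = 1"
| "steps (RLoad r a) = 1"
| "steps (RStore a b) = 1"
| "steps (RSeq p q) = steps p + steps q"
| "steps (RIf a p q) = 0"
| "steps (RWhile a p) = 0"

lemma exec_straight: "straight p \<Longrightarrow> exec p s (steps p) (effect p s)"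
  by (induction p arbitrary: s) (auto intro: exec.intros simp del: One_nat_def)

lemma exec_straight': "straight p \<Longrightarrow> steps p = T \<Longrightarrow> exec p s T (effect p s)"
  using exec_straight by blast

lemma reg_set [simp]: "reg (set_reg r v s) = (reg s)(r := v)" "mem (set_reg r v s) = mem s"
  "mem (set_mem a v s) = (mem s)(a := v)" "reg (set_mem a v s) = reg s"
  by (simp_all add: set_reg_def set_mem_def)

text \<open>The number 32 is a power of two, so scaling an index takes five doublings on a machine
  without multiplication. The register \<open>r + 2\<close> is the next odd one and serves as
  scratch space.\<close>

definition address :: "nat \<Rightarrow> nat \<Rightarrow> ram" where
  "address r k = RSeq (RAdd r r r) (RSeq (RAdd r r r) (RSeq (RAdd r r r) (RSeq (RAdd r r r)
     (RSeq (RAdd r r r) (RSeq (RConst (r + 2) k) (RSeq (RAdd r r (r + 2)) (RAdd r r 0)))))))"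

lemma effect_address [simp]:
  "r \<noteq> 0 \<Longrightarrow> reg (effect (address r k) \<sigma>) = (reg \<sigma>)(r + 2 := k, r := reg \<sigma> 0 + (32 * reg \<sigma> r + k))"
  "mem (effect (address r k) \<sigma>) = mem \<sigma>"
  by (auto simp: address_def fun_eq_iff)

lemma straight_address [simp]: "straight (address r k)" "steps (address r k) = 8"
  by (simp_all add: address_def)

text \<open>The odd registers form an evaluation stack of which \<open>d\<close> is the height. The
  machine has no move instruction, so copying a register is done by adding it to 0.\<close>

primrec comp_expr :: "expr \<Rightarrow> nat \<Rightarrow> ram" where
  "comp_expr (Num n) d = RConst (2 * d + 1) n"
| "comp_expr (Var x) d = RSeq (RConst (2 * d + 1) 0) (RAdd (2 * d + 1) (2 * d + 1) (2 * x))"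
| "comp_expr (Arr k e) d =
     RSeq (comp_expr e d) (RSeq (address (2 * d + 1) k) (RLoad (2 * d + 1) (2 * d + 1)))"
| "comp_expr (Plus a b) d =
     RSeq (comp_expr a d) (RSeq (comp_expr b (Suc d)) (RAdd (2 * d + 1) (2 * d + 1) (2 * d + 3)))"
| "comp_expr (Minus a b) d =
     RSeq (comp_expr a d) (RSeq (comp_expr b (Suc d)) (RSub (2 * d + 1) (2 * d + 1) (2 * d + 3)))"

primrec compile :: "cmd \<Rightarrow> ram" where
  "compile Skip = RConst 1 0"
| "compile (x ::= e) = RSeq (comp_expr e 0) (RSeq (RConst 3 0) (RAdd (2 * x) 1 3))"
| "compile (Write k i e) =
     RSeq (comp_expr i 0) (RSeq (address 1 k) (RSeq (comp_expr e 1) (RStore 1 3)))"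
| "compile (c ;; d) = RSeq (compile c) (compile d)"
| "compile (Cond e c d) = RSeq (comp_expr e 0) (RIf 1 (compile c) (compile d))"
| "compile (For x y c) = RSeq (RSeq (RConst (2 * x) 0) (RSub 1 (2 * y) (2 * x)))
     (RWhile 1 (RSeq (compile c)
       (RSeq (RConst 3 1) (RSeq (RAdd (2 * x) (2 * x) 3) (RSub 1 (2 * y) (2 * x))))))"

primrec expr_ok :: "expr \<Rightarrow> bool" where
  "expr_ok (Num n) = True"
| "expr_ok (Var x) = True"
| "expr_ok (Arr k e) = (k < 32 \<and> expr_ok e)"
| "expr_ok (Plus a b) = (expr_ok a \<and> expr_ok b)"
| "expr_ok (Minus a b) = (expr_ok a \<and> expr_ok b)"

primrec cmd_ok :: "cmd \<Rightarrow> bool" where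
  "cmd_ok Skip = True"
| "cmd_ok (x ::= e) = (x \<noteq> 0 \<and> expr_ok e)"
| "cmd_ok (Write k i e) = (k < 32 \<and> expr_ok i \<and> expr_ok e)"
| "cmd_ok (c ;; d) = (cmd_ok c \<and> cmd_ok d)"
| "cmd_ok (Cond e c d) = (expr_ok e \<and> cmd_ok c \<and> cmd_ok d)"
| "cmd_ok (For x y c) = (x \<noteq> 0 \<and> x \<noteq> y \<and> x \<notin> assigned c \<and> y \<notin> assigned c \<and> cmd_ok c)"

primrec expr_time :: "expr \<Rightarrow> nat" where
  "expr_time (Num n) = 1"
| "expr_time (Var x) = 2"
| "expr_time (Arr k e) = expr_time e + 9"
| "expr_time (Plus a b) = expr_time a + expr_time b + 1"
| "expr_time (Minus a b) = expr_time a + expr_time b + 1"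

text \<open>The running time is determined by the loop bounds if these are not assigned to.\<close>

primrec time_bound :: "cmd \<Rightarrow> (nat \<Rightarrow> nat) \<Rightarrow> nat" where
  "time_bound Skip env = 1"
| "time_bound (x ::= e) env = expr_time e + 2"
| "time_bound (Write k i e) env = expr_time i + expr_time e + 9"
| "time_bound (c ;; d) env = time_bound c env + time_bound d env"
| "time_bound (Cond e c d) env = expr_time e + 1 + time_bound c env + time_bound d env"
| "time_bound (For x y c) env = 3 + env y * (time_bound c env + 4)"

text \<open>The last conjunct protects the lower part of the evaluation stack: it keeps the value of
  a first operand while the second is computed.\<close>

lemma exec_comp_expr:
  "expr_ok e \<Longrightarrow> represents L \<sigma> s \<Longrightarrow> \<exists>\<sigma>'. exec (comp_expr e d) \<sigma> (expr_time e) \<sigma>' \<and> represents L \<sigma>' s \<and>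
     reg \<sigma>' (2 * d + 1) = val e s \<and> (\<forall>j<d. reg \<sigma>' (2 * j + 1) = reg \<sigma> (2 * j + 1))"
proof (induction e arbitrary: \<sigma> d)
  case (Num n)
  have "exec (comp_expr (Num n) d) \<sigma> 1 (effect (comp_expr (Num n) d) \<sigma>)"
    using exec_straight[of "comp_expr (Num n) d" \<sigma>] by simp
  moreover have "2 * x \<noteq> 2 * d + 1" for x by presburger
  ultimately show ?case using Num by (intro exI[of _ "effect (comp_expr (Num n) d) \<sigma>"]) (auto simp: represents_def)
next
  case (Var x)
  have "exec (comp_expr (Var x) d) \<sigma> 2 (effect (comp_expr (Var x) d) \<sigma>)"
    by (rule exec_straight') simp_all
  moreover have "2 * x \<noteq> 2 * d + 1" "2 * x \<noteq> Suc (2 * d)" for x by presburger+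
  ultimately show ?case using Var by (intro exI[of _ "effect (comp_expr (Var x) d) \<sigma>"]) (auto simp: represents_def)
next
  case (Arr k e)
  from Arr.IH[of \<sigma> d] Arr.prems obtain \<sigma>1 where
    1: "exec (comp_expr e d) \<sigma> (expr_time e) \<sigma>1" "represents L \<sigma>1 s" "reg \<sigma>1 (2 * d + 1) = val e s"
      "\<forall>j<d. reg \<sigma>1 (2 * j + 1) = reg \<sigma> (2 * j + 1)" by auto
  let ?q = "RSeq (address (2 * d + 1) k) (RLoad (2 * d + 1) (2 * d + 1))"
  have "exec ?q \<sigma>1 9 (effect ?q \<sigma>1)" by (rule exec_straight') simp_all
  then have "exec (comp_expr (Arr k e) d) \<sigma> (expr_time (Arr k e)) (effect ?q \<sigma>1)"
    using exec_Seq[OF 1(1)] by simp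
  moreover have "2 * x \<noteq> 2 * d + 1" "2 * x \<noteq> Suc (2 * d)" "2 * x \<noteq> Suc (Suc (Suc (2 * d)))" for x by presburger+
  moreover have "reg \<sigma>1 0 = L" using 1(2) by (auto simp: represents_def dest: spec[of _ 0])
  moreover have "mem \<sigma>1 (L + 32 * val e s + k) = arrs s k (val e s)"
    using 1(2) Arr.prems by (auto simp: represents_def)
  ultimately show ?case using 1
    by (intro exI[of _ "effect ?q \<sigma>1"]) (auto simp: represents_def add.assoc)
next
  case (Plus a b)
  from Plus.IH(1)[of \<sigma> d] Plus.prems obtain \<sigma>1 where
    1: "exec (comp_expr a d) \<sigma> (expr_time a) \<sigma>1" "represents L \<sigma>1 s" "reg \<sigma>1 (2 * d + 1) = val a s"
      "\<forall>j<d. reg \<sigma>1 (2 * j + 1) = reg \<sigma> (2 * j + 1)" by auto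
  from Plus.IH(2)[of \<sigma>1 "Suc d"] Plus.prems 1 obtain \<sigma>2 where
    2: "exec (comp_expr b (Suc d)) \<sigma>1 (expr_time b) \<sigma>2" "represents L \<sigma>2 s" "reg \<sigma>2 (2 * d + 3) = val b s"
      "\<forall>j<Suc d. reg \<sigma>2 (2 * j + 1) = reg \<sigma>1 (2 * j + 1)" by (auto simp: numeral_3_eq_3)
  let ?q = "RAdd (2 * d + 1) (2 * d + 1) (2 * d + 3)"
  have "exec ?q \<sigma>2 1 (effect ?q \<sigma>2)" using exec_straight[of ?q \<sigma>2] by simp
  from exec_Seq[OF 1(1) exec_Seq[OF 2(1) this]]
  have "exec (comp_expr (Plus a b) d) \<sigma> (expr_time (Plus a b)) (effect ?q \<sigma>2)" by simp
  moreover have "2 * x \<noteq> 2 * d + 1" "2 * x \<noteq> Suc (2 * d)" for x by presburger+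
  moreover have "reg \<sigma>2 (2 * d + 1) = val a s" using 1(3) 2(4) by auto
  ultimately show ?case using 1 2 by (intro exI[of _ "effect ?q \<sigma>2"]) (auto simp: represents_def)
next
  case (Minus a b)
  from Minus.IH(1)[of \<sigma> d] Minus.prems obtain \<sigma>1 where
    1: "exec (comp_expr a d) \<sigma> (expr_time a) \<sigma>1" "represents L \<sigma>1 s" "reg \<sigma>1 (2 * d + 1) = val a s"
      "\<forall>j<d. reg \<sigma>1 (2 * j + 1) = reg \<sigma> (2 * j + 1)" by auto
  from Minus.IH(2)[of \<sigma>1 "Suc d"] Minus.prems 1 obtain \<sigma>2 where
    2: "exec (comp_expr b (Suc d)) \<sigma>1 (expr_time b) \<sigma>2" "represents L \<sigma>2 s" "reg \<sigma>2 (2 * d + 3) = val b s"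
      "\<forall>j<Suc d. reg \<sigma>2 (2 * j + 1) = reg \<sigma>1 (2 * j + 1)" by (auto simp: numeral_3_eq_3)
  let ?q = "RSub (2 * d + 1) (2 * d + 1) (2 * d + 3)"
  have "exec ?q \<sigma>2 1 (effect ?q \<sigma>2)" using exec_straight[of ?q \<sigma>2] by simp
  from exec_Seq[OF 1(1) exec_Seq[OF 2(1) this]]
  have "exec (comp_expr (Minus a b) d) \<sigma> (expr_time (Minus a b)) (effect ?q \<sigma>2)" by simp
  moreover have "2 * x \<noteq> 2 * d + 1" "2 * x \<noteq> Suc (2 * d)" for x by presburger+
  moreover have "reg \<sigma>2 (2 * d + 1) = val a s" using 1(3) 2(4) by auto
  ultimately show ?case using 1 2 by (intro exI[of _ "effect ?q \<sigma>2"]) (auto simp: represents_def)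
qed

lemma interleaved_eq_iff:
  assumes "b < 32" "b' < 32"
  shows "32 * a + b = 32 * a' + b' \<longleftrightarrow> a = a' \<and> b = (b' :: nat)"
proof
  assume eq: "32 * a + b = 32 * a' + b'"
  have "(32 * a + b) div 32 = a" "(32 * a' + b') div 32 = a'" using assms by simp_all
  then show "a = a' \<and> b = b'" using eq by simp
qed simp

text \<open>Time bounds refer to a start store, so a program can be cut where loop bounds are
  assigned and the times of the pieces added. Within a piece the bounds stay fixed and
  \<open>time_bound\<close> applies.\<close>

definition runs :: "nat \<Rightarrow> cmd \<Rightarrow> store \<Rightarrow> nat \<Rightarrow> bool" where
  "runs L c s T \<longleftrightarrow> (\<forall>\<sigma>. represents L \<sigma> s \<longrightarrow>
     (\<exists>t \<sigma>'. exec (compile c) \<sigma> t \<sigma>' \<and> represents L \<sigma>' (sem c s) \<and> t \<le> T))"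

lemma runs_mono: "runs L c s T \<Longrightarrow> T \<le> T' \<Longrightarrow> runs L c s T'"
  unfolding runs_def by (meson order_trans)

lemma runs_Seq: "runs L c s T \<Longrightarrow> runs L d (sem c s) U \<Longrightarrow> runs L (c ;; d) s (T + U)"
  unfolding runs_def by (auto intro!: add_mono) (metis add_mono exec_Seq)

lemma runs_Cond:
  assumes "expr_ok e" "val e s \<noteq> 0 \<Longrightarrow> runs L c s T" "val e s = 0 \<Longrightarrow> runs L d s T"
  shows "runs L (Cond e c d) s (expr_time e + 1 + T)"
  unfolding runs_def
proof (intro allI impI)
  fix \<sigma> assume "represents L \<sigma> s"
  from exec_comp_expr[OF assms(1) this, of 0] obtain \<sigma>1 where
    1: "exec (comp_expr e 0) \<sigma> (expr_time e) \<sigma>1" "represents L \<sigma>1 s" "reg \<sigma>1 1 = val e s" by auto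
  show "\<exists>t \<sigma>'. exec (compile (Cond e c d)) \<sigma> t \<sigma>' \<and> represents L \<sigma>' (sem (Cond e c d) s) \<and> t \<le> expr_time e + 1 + T"
  proof (cases "val e s = 0")
    case True
    with assms(3) 1(2) obtain t \<sigma>' where 2: "exec (compile d) \<sigma>1 t \<sigma>'" "represents L \<sigma>' (sem d s)" "t \<le> T"
      unfolding runs_def by blast
    have "exec (compile (Cond e c d)) \<sigma> (expr_time e + (1 + t)) \<sigma>'"
      using exec_Seq[OF 1(1) exec_IfFalse[OF _ 2(1)]] 1(3) True by simp
    then show ?thesis using 2 True by (intro exI[of _ "expr_time e + (1 + t)"] exI[of _ \<sigma>']) simp
  next
    case False
    with assms(2) 1(2) obtain t \<sigma>' where 2: "exec (compile c) \<sigma>1 t \<sigma>'" "represents L \<sigma>' (sem c s)" "t \<le> T"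
      unfolding runs_def by blast
    have "exec (compile (Cond e c d)) \<sigma> (expr_time e + (1 + t)) \<sigma>'"
      using exec_Seq[OF 1(1) exec_IfTrue[OF _ 2(1)]] 1(3) False by simp
    then show ?thesis using 2 False by (intro exI[of _ "expr_time e + (1 + t)"] exI[of _ \<sigma>']) simp
  qed
qed

lemma time_bound_cong: "(\<And>y. y \<in> bounds c \<Longrightarrow> env y = env' y) \<Longrightarrow> time_bound c env = time_bound c env'"
  by (induction c) auto

lemma runs_time_bound:
  "cmd_ok c \<Longrightarrow> bounds c \<inter> assigned c = {} \<Longrightarrow> runs L c s (time_bound c (vars s))"
proof (induction c arbitrary: s)
  case Skip
  have "exec (compile Skip) \<sigma> 1 (effect (compile Skip) \<sigma>)" for \<sigma>
    using exec_straight[of "compile Skip"] by simp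
  moreover have "represents L (effect (compile Skip) \<sigma>) s" if "represents L \<sigma> s" for \<sigma>
    using that by (auto simp: represents_def)
  ultimately show ?case unfolding runs_def by fastforce
next
  case (Assign x e)
  show ?case unfolding runs_def
  proof (intro allI impI)
    fix \<sigma> assume "represents L \<sigma> s"
    from exec_comp_expr[OF _ this, of e 0] Assign obtain \<sigma>1 where
      1: "exec (comp_expr e 0) \<sigma> (expr_time e) \<sigma>1" "represents L \<sigma>1 s" "reg \<sigma>1 1 = val e s" by auto
    let ?q = "RSeq (RConst 3 0) (RAdd (2 * x) 1 3)"
    have "exec ?q \<sigma>1 2 (effect ?q \<sigma>1)" by (rule exec_straight') simp_all
    from exec_Seq[OF 1(1) this] have "exec (compile (x ::= e)) \<sigma> (expr_time e + 2) (effect ?q \<sigma>1)" by simp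
    moreover have "2 * z \<noteq> 3" for z :: nat by presburger
    then have "represents L (effect ?q \<sigma>1) (sem (x ::= e) s)"
      using 1 Assign.prems by (auto simp: represents_def)
    ultimately show "\<exists>t \<sigma>'. exec (compile (x ::= e)) \<sigma> t \<sigma>' \<and> represents L \<sigma>' (sem (x ::= e) s) \<and> t \<le> time_bound (x ::= e) (vars s)"
      by (intro exI[of _ "expr_time e + 2"] exI[of _ "effect ?q \<sigma>1"]) simp
  qed
next
  case (Write k i e)
  show ?case unfolding runs_def
  proof (intro allI impI)
    fix \<sigma> assume "represents L \<sigma> s"
    from exec_comp_expr[OF _ this, of i 0] Write obtain \<sigma>1 where
      1: "exec (comp_expr i 0) \<sigma> (expr_time i) \<sigma>1" "represents L \<sigma>1 s" "reg \<sigma>1 1 = val i s" by auto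
    let ?q = "address 1 k"
    have 2: "exec ?q \<sigma>1 8 (effect ?q \<sigma>1)" by (rule exec_straight') simp_all
    have "reg \<sigma>1 0 = L" using 1(2) by (auto simp: represents_def dest: spec[of _ 0])
    then have adr: "reg (effect ?q \<sigma>1) 1 = L + 32 * val i s + k"
      using 1(3) by simp
    have "2 * z \<noteq> 3" "2 * z \<noteq> Suc 0" "2 * z \<noteq> Suc (Suc (Suc 0))" for z :: nat by presburger+
    then have "represents L (effect ?q \<sigma>1) s" using 1(2) by (auto simp: represents_def)
    from exec_comp_expr[OF _ this, of e 1] Write obtain \<sigma>2 where
      3: "exec (comp_expr e 1) (effect ?q \<sigma>1) (expr_time e) \<sigma>2" "represents L \<sigma>2 s" "reg \<sigma>2 3 = val e s"
        "reg \<sigma>2 1 = L + 32 * val i s + k" using adr by (auto simp: numeral_3_eq_3)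
    have "exec (RStore 1 3) \<sigma>2 1 (set_mem (L + 32 * val i s + k) (val e s) \<sigma>2)"
      using exec_Store[of 1 3 \<sigma>2] 3 by simp
    from exec_Seq[OF 1(1) exec_Seq[OF 2 exec_Seq[OF 3(1) this]]]
    have "exec (compile (Write k i e)) \<sigma> (expr_time i + (8 + (expr_time e + 1))) (set_mem (L + 32 * val i s + k) (val e s) \<sigma>2)"
      by simp
    moreover have "represents L (set_mem (L + 32 * val i s + k) (val e s) \<sigma>2) (sem (Write k i e) s)"
      using 3(2) Write.prems by (auto simp: represents_def add.assoc interleaved_eq_iff)
    ultimately show "\<exists>t \<sigma>'. exec (compile (Write k i e)) \<sigma> t \<sigma>' \<and> represents L \<sigma>' (sem (Write k i e) s) \<and> t \<le> time_bound (Write k i e) (vars s)"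
      by (intro exI[of _ "expr_time i + (8 + (expr_time e + 1))"] exI conjI) auto
  qed
next
  case (Seq c d)
  have "runs L c s (time_bound c (vars s))" using Seq by auto
  moreover have "time_bound d (vars (sem c s)) = time_bound d (vars s)"
    using Seq.prems by (intro time_bound_cong vars_sem) auto
  then have "runs L d (sem c s) (time_bound d (vars s))" using Seq.IH(2)[of "sem c s"] Seq.prems by auto
  ultimately show ?case using runs_Seq by simp
next
  case (Cond e c d)
  have "runs L c s (time_bound c (vars s) + time_bound d (vars s))"
    by (rule runs_mono[OF Cond.IH(1)]) (use Cond.prems in auto)
  moreover have "runs L d s (time_bound c (vars s) + time_bound d (vars s))"
    by (rule runs_mono[OF Cond.IH(2)]) (use Cond.prems in auto)
  ultimately show ?case using runs_Cond[of e s L c "time_bound c (vars s) + time_bound d (vars s)" d] Cond.prems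
    by (simp add: add.assoc)
next
  case (For x y c)
  define T where "T = time_bound c (vars s)"
  let ?f = "\<lambda>t. set_var x (Suc (vars (sem c t) x)) (sem c t)"
  let ?inc = "RSeq (RConst 3 1) (RSeq (RAdd (2 * x) (2 * x) 3) (RSub 1 (2 * y) (2 * x)))"
  let ?loop = "RWhile 1 (RSeq (compile c) ?inc)"
  have xy: "x \<noteq> 0" "x \<noteq> y" "x \<notin> assigned c" "y \<notin> assigned c" "x \<notin> bounds c" using For.prems by auto
  \<comment> \<open>Generalised to a loop in progress: register 1 holds the difference between bound
    and counter, which is the number \<open>n\<close> of rounds left. A round costs one test and
    three steps in addition to the body.\<close>
  have loop: "\<exists>t \<sigma>'. exec ?loop \<sigma> t \<sigma>' \<and> represents L \<sigma>' ((?f ^^ n) s') \<and> t \<le> n * (T + 4) + 1"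
    if "represents L \<sigma> s'" "vars s' y - vars s' x = n" "reg \<sigma> 1 = n" "\<And>v. v \<in> bounds c \<Longrightarrow> vars s' v = vars s v"
    for n \<sigma> s'
    using that
  proof (induction n arbitrary: \<sigma> s')
    case 0
    then have "exec ?loop \<sigma> 1 \<sigma>" by (intro exec_WhileFalse) simp
    then show ?case using 0 by (intro exI[of _ 1] exI[of _ \<sigma>]) simp
  next
    case (Suc n)
    have "time_bound c (vars s') = T" unfolding T_def using Suc.prems(4) by (intro time_bound_cong) auto
    then have "runs L c s' T" using For.IH[of s'] For.prems by auto
    then obtain t1 \<sigma>1 where 1: "exec (compile c) \<sigma> t1 \<sigma>1" "represents L \<sigma>1 (sem c s')" "t1 \<le> T"
      using Suc.prems(1) unfolding runs_def by blast
    let ?\<sigma>2 = "effect ?inc \<sigma>1"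
    have 2: "exec ?inc \<sigma>1 3 ?\<sigma>2" by (rule exec_straight') simp_all
    have odd: "2 * z \<noteq> 3" "2 * z \<noteq> Suc 0" for z :: nat by presburger+
    have v: "vars (sem c s') x = vars s' x" "vars (sem c s') y = vars s' y" using xy vars_sem by auto
    have rep: "represents L ?\<sigma>2 (?f s')" using 1(2) odd xy by (auto simp: represents_def)
    have r: "reg ?\<sigma>2 1 = n" using 1(2) odd xy v Suc.prems(2) by (auto simp: represents_def)
    have d: "vars (?f s') y - vars (?f s') x = n" using v xy Suc.prems(2) by simp
    have b: "vars (?f s') v = vars s v" if "v \<in> bounds c" for v
      using that For.prems xy Suc.prems(4)[OF that] vars_sem[of v c s'] by auto
    from Suc.IH[OF rep d r b] obtain t2 \<sigma>3 where
      3: "exec ?loop ?\<sigma>2 t2 \<sigma>3" "represents L \<sigma>3 ((?f ^^ n) (?f s'))" "t2 \<le> n * (T + 4) + 1" by blast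
    have "exec ?loop \<sigma> (1 + (t1 + 3) + t2) \<sigma>3"
      by (rule exec_WhileTrue[OF _ exec_Seq[OF 1(1) 2] 3(1)]) (use Suc.prems in simp)
    moreover have "(?f ^^ Suc n) s' = (?f ^^ n) (?f s')" by (simp only: funpow_Suc_right o_apply)
    ultimately show ?case using 1(3) 3 by (intro exI[of _ "1 + (t1 + 3) + t2"] exI[of _ \<sigma>3]) (simp del: funpow.simps)
  qed
  show ?case unfolding runs_def
  proof (intro allI impI)
    fix \<sigma> assume rep: "represents L \<sigma> s"
    let ?init = "RSeq (RConst (2 * x) 0) (RSub 1 (2 * y) (2 * x))"
    let ?\<sigma>1 = "effect ?init \<sigma>"
    have 1: "exec ?init \<sigma> 2 ?\<sigma>1" by (rule exec_straight') simp_all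
    have "2 * z \<noteq> Suc 0" for z :: nat by presburger
    then have 2: "represents L ?\<sigma>1 (set_var x 0 s)" "reg ?\<sigma>1 1 = vars s y"
      using rep xy by (auto simp: represents_def)
    have "vars (set_var x 0 s) y - vars (set_var x 0 s) x = vars s y" using xy by simp
    from loop[OF 2(1) this 2(2)] xy obtain t \<sigma>' where
      3: "exec ?loop ?\<sigma>1 t \<sigma>'" "represents L \<sigma>' ((?f ^^ vars s y) (set_var x 0 s))" "t \<le> vars s y * (T + 4) + 1"
      by fastforce
    have "exec (compile (For x y c)) \<sigma> (2 + t) \<sigma>'" using exec_Seq[OF 1 3(1)] by simp
    then show "\<exists>t \<sigma>'. exec (compile (For x y c)) \<sigma> t \<sigma>' \<and> represents L \<sigma>' (sem (For x y c) s) \<and> t \<le> time_bound (For x y c) (vars s)"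
      using 3 by (intro exI[of _ "2 + t"] exI[of _ \<sigma>']) (simp add: T_def)
  qed
qed

section \<open>Input and output\<close>

definition initial_store :: "nat list \<Rightarrow> store" where
  "initial_store xs = Store (\<lambda>x. if x = 0 then length xs else 0)
     (\<lambda>k i. if k = 0 \<and> i < length xs then xs ! i else 0)"

definition copy_input_step :: ram where
  "copy_input_step = RSeq (RLoad 5 1) (RSeq (RConst 7 0) (RSeq (RAdd 7 7 1) (RSeq (RAdd 7 7 7) (RSeq (RAdd 7 7 7)
     (RSeq (RAdd 7 7 7) (RSeq (RAdd 7 7 7) (RSeq (RAdd 7 7 7) (RSeq (RAdd 7 7 0) (RSeq (RStore 7 5)
     (RSeq (RConst 9 1) (RSeq (RAdd 1 1 9) (RSub 3 0 1))))))))))))"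

definition copy_input :: ram where
  "copy_input = RSeq (RSeq (RConst 1 0) (RSub 3 0 1)) (RWhile 3 copy_input_step)"

text \<open>Cell \<open>i\<close> of array 0 has an address of at least \<open>length xs\<close>,
  beyond the raw input, so no number is overwritten before it is copied.\<close>

lemma exec_copy_input:
  "\<exists>t \<sigma>. exec copy_input (ram_input xs) t \<sigma> \<and> represents (length xs) \<sigma> (initial_store xs) \<and>
     t \<le> 3 + 14 * length xs"
proof -
  let ?L = "length xs"
  define inv where "inv i \<sigma> \<longleftrightarrow> reg \<sigma> 0 = ?L \<and> (\<forall>x. x \<noteq> 0 \<longrightarrow> reg \<sigma> (2 * x) = 0) \<and> reg \<sigma> 1 = i \<and>
    reg \<sigma> 3 = ?L - i \<and> (\<forall>a<?L. mem \<sigma> a = xs ! a) \<and>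
    (\<forall>k<32. \<forall>j. mem \<sigma> (?L + 32 * j + k) = (if k = 0 \<and> j < i then xs ! j else 0))" for i and \<sigma> :: ram_state
  have odd: "2 * x \<noteq> Suc 0" "2 * x \<noteq> 3" "2 * x \<noteq> 5" "2 * x \<noteq> 7" "2 * x \<noteq> 9" for x :: nat by presburger+
  have loop: "\<exists>t \<sigma>'. exec (RWhile 3 copy_input_step) \<sigma> t \<sigma>' \<and> inv ?L \<sigma>' \<and> t \<le> 14 * n + 1"
    if "inv i \<sigma>" "i \<le> ?L" "n = ?L - i" for n i and \<sigma> :: ram_state
    using that
  proof (induction n arbitrary: i \<sigma>)
    case 0
    then show ?case using exec_WhileFalse[of \<sigma> 3 copy_input_step]
      by (intro exI[of _ 1] exI[of _ \<sigma>]) (auto simp: inv_def)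
  next
    case (Suc n)
    let ?\<sigma>1 = "effect copy_input_step \<sigma>"
    have 1: "exec copy_input_step \<sigma> 13 ?\<sigma>1"
      by (rule exec_straight') (simp_all add: copy_input_step_def)
    have i: "i < ?L" using Suc by simp
    have adr: "32 * j + k = 32 * i \<longleftrightarrow> j = i \<and> k = 0" if "k < 32" for j k
      using interleaved_eq_iff[of k 0 j i] that by simp
    have "reg ?\<sigma>1 = (reg \<sigma>)(5 := xs ! i, 7 := ?L + 32 * i, 9 := 1, 1 := Suc i, 3 := ?L - Suc i)"
      "mem ?\<sigma>1 = (mem \<sigma>)(?L + 32 * i := xs ! i)"
      using Suc.prems i by (auto simp: inv_def copy_input_step_def fun_eq_iff)
    then have inv1: "inv (Suc i) ?\<sigma>1" using Suc.prems adr odd by (auto simp: inv_def add.assoc)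
    from Suc.IH[OF inv1] Suc.prems i obtain t \<sigma>' where
      2: "exec (RWhile 3 copy_input_step) ?\<sigma>1 t \<sigma>'" "inv ?L \<sigma>'" "t \<le> 14 * n + 1" by force
    have "exec (RWhile 3 copy_input_step) \<sigma> (1 + 13 + t) \<sigma>'"
      by (rule exec_WhileTrue[OF _ 1 2(1)]) (use Suc.prems i in \<open>auto simp: inv_def\<close>)
    then show ?case using 2 by (intro exI[of _ "1 + 13 + t"] exI[of _ \<sigma>']) simp
  qed
  let ?init = "RSeq (RConst 1 0) (RSub 3 0 1)"
  let ?\<sigma>0 = "effect ?init (ram_input xs)"
  have 0: "exec ?init (ram_input xs) 2 ?\<sigma>0" by (rule exec_straight') simp_all
  have "inv 0 ?\<sigma>0" using odd by (auto simp: inv_def ram_input_def)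
  from loop[OF this] obtain t \<sigma>' where
    1: "exec (RWhile 3 copy_input_step) ?\<sigma>0 t \<sigma>'" "inv ?L \<sigma>'" "t \<le> 14 * ?L + 1" by auto
  have "represents ?L \<sigma>' (initial_store xs)"
    unfolding represents_def
  proof (intro conjI allI impI)
    fix x show "reg \<sigma>' (2 * x) = vars (initial_store xs) x"
      using 1(2) by (cases "x = 0") (simp_all add: inv_def initial_store_def)
  next
    fix k i :: nat assume "k < 32"
    then show "mem \<sigma>' (?L + 32 * i + k) = arrs (initial_store xs) k i"
      using 1(2) unfolding inv_def initial_store_def store.sel by blast
  qed (simp add: initial_store_def)
  then show ?thesis using exec_Seq[OF 0 1(1)] 1(3) unfolding copy_input_def
    by (intro exI[of _ "2 + t"] exI[of _ \<sigma>']) simp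
qed

definition copy_output_step :: "nat \<Rightarrow> nat \<Rightarrow> ram" where
  "copy_output_step k x = RSeq (RConst 7 0) (RSeq (RAdd 7 7 1) (RSeq (address 7 k) (RSeq (RLoad 5 7)
     (RSeq (RStore 1 5) (RSeq (RConst 9 1) (RSeq (RAdd 1 1 9) (RSub 3 (2 * x) 1)))))))"

definition copy_output :: "nat \<Rightarrow> nat \<Rightarrow> ram" where
  "copy_output k x = RSeq (RSeq (RConst 1 0) (RSub 3 (2 * x) 1))
     (RSeq (RWhile 3 (copy_output_step k x)) (RSeq (RConst 7 0) (RAdd 0 7 (2 * x))))"

text \<open>The output is written from address 0 upwards and may overwrite the arrays. Round
  \<open>i\<close> reads at \<open>L + 32 * i + k\<close>, an address not below \<open>i\<close>,
  which therefore still has its old contents.\<close>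

lemma exec_copy_output:
  assumes rep: "represents L \<sigma> s" and k: "k < 32" and x: "x \<noteq> 0"
  shows "\<exists>t \<sigma>'. exec (copy_output k x) \<sigma> t \<sigma>' \<and> ram_output \<sigma>' = map (arrs s k) [0..<vars s x] \<and>
    t \<le> 5 + 16 * vars s x"
proof -
  let ?n = "vars s x"
  define inv where "inv i \<tau> \<longleftrightarrow> reg \<tau> 0 = L \<and> reg \<tau> (2 * x) = ?n \<and> reg \<tau> 1 = i \<and> reg \<tau> 3 = ?n - i \<and>
    (\<forall>a<i. mem \<tau> a = arrs s k a) \<and> (\<forall>a\<ge>i. mem \<tau> a = mem \<sigma> a)" for i and \<tau> :: ram_state
  have odd: "2 * x \<noteq> Suc 0" "2 * x \<noteq> 3" "2 * x \<noteq> 5" "2 * x \<noteq> 7" "2 * x \<noteq> 9" for x :: nat by presburger+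
  let ?step = "copy_output_step k x"
  have loop: "\<exists>t \<tau>'. exec (RWhile 3 ?step) \<tau> t \<tau>' \<and> inv ?n \<tau>' \<and> t \<le> 16 * n + 1"
    if "inv i \<tau>" "i \<le> ?n" "n = ?n - i" for n i and \<tau> :: ram_state
    using that
  proof (induction n arbitrary: i \<tau>)
    case 0
    then show ?case using exec_WhileFalse[of \<tau> 3 ?step]
      by (intro exI[of _ 1] exI[of _ \<tau>]) (auto simp: inv_def)
  next
    case (Suc n)
    let ?\<tau>1 = "effect ?step \<tau>"
    have 1: "exec ?step \<tau> 15 ?\<tau>1"
      by (rule exec_straight') (simp_all add: copy_output_step_def)
    have i: "i < ?n" using Suc by simp
    have "mem \<tau> (L + 32 * i + k) = arrs s k i" using rep Suc.prems k by (auto simp: inv_def represents_def)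
    moreover have "reg \<tau> 1 = i" "reg \<tau> 0 = L" "reg \<tau> (2 * x) = ?n" using Suc.prems by (auto simp: inv_def)
    ultimately have "reg ?\<tau>1 = (reg \<tau>)(7 := L + (32 * i + k), 5 := arrs s k i, 9 := 1, 1 := Suc i, 3 := ?n - Suc i)"
      "mem ?\<tau>1 = (mem \<tau>)(i := arrs s k i)"
      using odd x by (auto simp: copy_output_step_def fun_eq_iff add.assoc)
    then have inv1: "inv (Suc i) ?\<tau>1" using Suc.prems odd x by (auto simp: inv_def less_Suc_eq)
    from Suc.IH[OF inv1] Suc.prems i obtain t \<tau>' where
      2: "exec (RWhile 3 ?step) ?\<tau>1 t \<tau>'" "inv ?n \<tau>'" "t \<le> 16 * n + 1" by force
    have "exec (RWhile 3 ?step) \<tau> (1 + 15 + t) \<tau>'"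
      by (rule exec_WhileTrue[OF _ 1 2(1)]) (use Suc.prems i in \<open>auto simp: inv_def\<close>)
    then show ?case using 2 by (intro exI[of _ "1 + 15 + t"] exI[of _ \<tau>']) simp
  qed
  let ?init = "RSeq (RConst 1 0) (RSub 3 (2 * x) 1)"
  let ?\<sigma>0 = "effect ?init \<sigma>"
  have 0: "exec ?init \<sigma> 2 ?\<sigma>0" by (rule exec_straight') simp_all
  have "reg \<sigma> (2 * y) = vars s y" for y using rep by (simp add: represents_def)
  from this[of 0] this[of x] have "inv 0 ?\<sigma>0" using odd x rep by (auto simp: inv_def represents_def)
  from loop[OF this] obtain t \<tau> where
    1: "exec (RWhile 3 ?step) ?\<sigma>0 t \<tau>" "inv ?n \<tau>" "t \<le> 16 * ?n + 1" by auto
  let ?fin = "RSeq (RConst 7 0) (RAdd 0 7 (2 * x))"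
  have 2: "exec ?fin \<tau> 2 (effect ?fin \<tau>)" by (rule exec_straight') simp_all
  have "ram_output (effect ?fin \<tau>) = map (arrs s k) [0..<?n]"
    using 1(2) odd x by (auto simp: ram_output_def inv_def)
  then show ?thesis using exec_Seq[OF 0 exec_Seq[OF 1(1) 2]] 1(3) unfolding copy_output_def
    by (intro exI[of _ "2 + (t + 2)"] exI[of _ "effect ?fin \<tau>"]) simp
qed

lemma computes_within_compile:
  assumes c: "runs (length xs) c (initial_store xs) T" and k: "k < 32" and x: "x \<noteq> 0"
  shows "computes_within (RSeq copy_input (RSeq (compile c) (copy_output k x))) xs
    (8 + 14 * length xs + T + 16 * vars (sem c (initial_store xs)) x)
    (map (arrs (sem c (initial_store xs)) k) [0..<vars (sem c (initial_store xs)) x])"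
proof -
  obtain t1 \<sigma>1 where 1: "exec copy_input (ram_input xs) t1 \<sigma>1"
    "represents (length xs) \<sigma>1 (initial_store xs)" "t1 \<le> 3 + 14 * length xs"
    using exec_copy_input by blast
  obtain t2 \<sigma>2 where 2: "exec (compile c) \<sigma>1 t2 \<sigma>2"
    "represents (length xs) \<sigma>2 (sem c (initial_store xs))" "t2 \<le> T"
    using c 1(2) unfolding runs_def by blast
  obtain t3 \<sigma>3 where 3: "exec (copy_output k x) \<sigma>2 t3 \<sigma>3"
    "ram_output \<sigma>3 = map (arrs (sem c (initial_store xs)) k) [0..<vars (sem c (initial_store xs)) x]"
    "t3 \<le> 5 + 16 * vars (sem c (initial_store xs)) x"
    using exec_copy_output[OF 2(2) k x] by blast
  show ?thesis unfolding computes_within_def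
    using exec_Seq[OF 1(1) exec_Seq[OF 2(1) 3(1)]] 1(3) 2(3) 3(2,3)
    by (intro exI[of _ "t1 + (t2 + t3)"] exI[of _ \<sigma>3]) simp
qed

section \<open>Leaf elimination on multigraphs\<close>

section \<open>Peeling leaves\<close>

text \<open>A multigraph on \<open>{..<G}\<close> has the edges \<open>{U e, W e}\<close> for \<open>e < H\<close>.  \<open>Q\<close> is a queue of leaves
  of which the first \<open>i\<close> have been removed, together with the edges \<open>PE 0, \<dots>, PE (i - 1)\<close>; \<open>PA j\<close>
  is the neighbour of \<open>Q j\<close> at the time of its removal.  \<open>DG\<close> and \<open>SE\<close> contain the degrees
  and the sums of the incident edges, so \<open>SE v\<close> is the only edge at a leaf \<open>v\<close>.\<close>

definition incidence :: "(nat \<Rightarrow> nat) \<Rightarrow> (nat \<Rightarrow> nat) \<Rightarrow> nat \<Rightarrow> nat \<Rightarrow> nat" where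
  "incidence U W e v = of_bool (U e = v) + of_bool (W e = v)"

definition peel_state where
  "peel_state G H U W root i DG SE Q PA PE te \<longleftrightarrow>
     i \<le> te \<and> (\<forall>j<te. Q j < G \<and> Q j \<noteq> root) \<and> inj_on Q {..<i} \<and> inj_on PE {..<i} \<and>
     PE ` {..<i} \<subseteq> {..<H} \<and>
     (\<forall>j<i. PA j < G \<and> PA j \<notin> Q ` {..j} \<and> {U (PE j), W (PE j)} = {Q j, PA j} \<and> DG (Q j) = 0) \<and>
     (\<forall>v<G. DG v = (\<Sum>e\<in>{..<H} - PE ` {..<i}. incidence U W e v)) \<and>
     (\<forall>v<G. SE v = (\<Sum>e\<in>{..<H} - PE ` {..<i}. e * incidence U W e v))"

text \<open>Kept apart from \<open>peel_state\<close>, which makes sense for every multigraph and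
  describes what a successful run yields. The present invariant presupposes a tree and shows that
  the run succeeds.\<close>

definition tree_peel_state where
  "tree_peel_state G H U W root i DG Q PE te \<longleftrightarrow>
     inj_on Q {..<te} \<and>
     tree_graph ({..<G} - Q ` {..<i}) ((\<lambda>e. {U e, W e}) ` ({..<H} - PE ` {..<i})) \<and>
     Q ` {i..<te} = {v. v < G \<and> v \<notin> Q ` {..<i} \<and> v \<noteq> root \<and> DG v = (1::nat)}"

text \<open>At degree 1 the sum of incident edge numbers is the only such edge, and the sum of its
  ends minus the leaf is the neighbour. These two sums replace adjacency lists.\<close>

lemma peel_leaf:
  assumes st: "peel_state G H U W root i DG SE Q PA PE te"
    and UW: "\<forall>e<H. U e < G \<and> W e < G"
    and leaf: "i < te" "DG (Q i) = (1::nat)"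
  defines "v \<equiv> Q i" and "e \<equiv> SE (Q i)" and "p \<equiv> U (SE (Q i)) + W (SE (Q i)) - Q i"
    and "R \<equiv> {..<H} - PE ` {..<i}"
  shows "e \<in> R" "v < G" "p < G" "p \<noteq> v" "{U e, W e} = {v, p}" "v \<notin> Q ` {..<i}" "p \<notin> Q ` {..<i}"
    "incidence U W e x = of_bool (x = v) + of_bool (x = p)"
    "\<And>f. f \<in> R \<Longrightarrow> f \<noteq> e \<Longrightarrow> incidence U W f v = 0" "DG p \<ge> 1"
proof -
  have fin: "finite R" by (simp add: R_def)
  have v: "v < G" using st leaf(1) by (simp add: peel_state_def v_def)
  have D: "DG x = (\<Sum>f\<in>R. incidence U W f x)" and S: "SE x = (\<Sum>f\<in>R. f * incidence U W f x)" if "x < G" for x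
    using st that by (simp_all add: peel_state_def R_def)
  \<comment> \<open>A sum of naturals equals 1, so exactly one edge contributes, and with weight 1.
    A loop would contribute 2, so \<open>v\<close> is only one of its two ends.\<close>
  have "(\<Sum>f\<in>R. incidence U W f v) = 1" using D[OF v] leaf(2) by (simp add: v_def)
  then obtain e0 where e0: "e0 \<in> R" "incidence U W e0 v = 1" "\<And>f. f \<in> R \<Longrightarrow> e0 \<noteq> f \<Longrightarrow> incidence U W f v = 0"
    using sum_eq_1_iff[OF fin, of "\<lambda>f. incidence U W f v"] by auto
  have "SE v = (\<Sum>f\<in>R. if f = e0 then e0 else 0)"
    unfolding S[OF v] by (rule sum.cong[OF refl]) (use e0 in auto)
  then have e: "e = e0" using fin e0(1) by (simp add: e_def v_def)
  have uw: "U e < G" "W e < G" using UW e0(1) e by (auto simp: R_def)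
  have "(U e = v \<and> W e \<noteq> v \<and> p = W e) \<or> (W e = v \<and> U e \<noteq> v \<and> p = U e)"
    using e0(2) unfolding e[symmetric]
    by (cases "U e = v"; cases "W e = v") (auto simp: incidence_def p_def v_def e_def)
  then show pv: "p < G" "p \<noteq> v" "{U e, W e} = {v, p}"
    and inc: "\<And>x. incidence U W e x = of_bool (x = v) + of_bool (x = p)"
    using uw by (auto simp: incidence_def)
  show "e \<in> R" using e e0 by simp
  show "v < G" by (rule v)
  show "\<And>f. f \<in> R \<Longrightarrow> f \<noteq> e \<Longrightarrow> incidence U W f v = 0" using e0(3) e by auto
  have "incidence U W e p \<le> (\<Sum>f\<in>R. incidence U W f p)"
    using e0(1) e fin by (intro member_le_sum) auto
  then show Dp: "DG p \<ge> 1" using D[OF pv(1)] inc[of p] pv(2) by simp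
  have z: "\<forall>j<i. DG (Q j) = 0" using st by (simp add: peel_state_def)
  show "v \<notin> Q ` {..<i}" using z leaf(2) by (auto simp: v_def)
  show "p \<notin> Q ` {..<i}" using z Dp by fastforce
qed

text \<open>Correctness of what has been removed does not depend on which neighbours are queued, as
  long as the root stays out: a queued node is removed only if it passes the degree test at its
  turn.\<close>

lemma peel_state_step:
  assumes st: "peel_state G H U W root i DG SE Q PA PE te"
    and UW: "\<forall>e<H. U e < G \<and> W e < G"
    and leaf: "i < te" "DG (Q i) = (1::nat)"
  defines "v \<equiv> Q i" and "e \<equiv> SE (Q i)" and "p \<equiv> U (SE (Q i)) + W (SE (Q i)) - Q i"
  defines "DG' \<equiv> DG(v := 0, p := DG p - 1)" and "SE' \<equiv> SE(v := 0, p := SE p - e)"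
  assumes Q': "(Q' = Q \<and> te' = te) \<or> (p \<noteq> root \<and> Q' = Q(te := p) \<and> te' = Suc te)"
  shows "peel_state G H U W root (Suc i) DG' SE' Q' (PA(i := p)) (PE(i := e)) te'"
proof -
  define R where "R = {..<H} - PE ` {..<i}"
  note L = peel_leaf[OF st UW leaf, folded v_def e_def p_def R_def]
  have fin: "finite R" by (simp add: R_def)
  have PEn: "e \<notin> PE ` {..<i}" "e < H" using L(1) by (auto simp: R_def)
  have R': "{..<H} - (PE(i := e)) ` {..<Suc i} = R - {e}"
    by (auto simp: R_def lessThan_Suc)
  have sums: "(\<Sum>f\<in>R - {e}. g f * incidence U W f x) = (\<Sum>f\<in>R. g f * incidence U W f x) - g e * incidence U W e x" for g :: "nat \<Rightarrow> nat" and x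
    using sum.remove[OF fin L(1), of "\<lambda>f. g f * incidence U W f x"] by simp
  have D: "DG x = (\<Sum>f\<in>R. 1 * incidence U W f x)" and S: "SE x = (\<Sum>f\<in>R. f * incidence U W f x)" if "x < G" for x
    using st that by (simp_all add: peel_state_def R_def)
  have cD: "DG' x = (\<Sum>f\<in>R - {e}. incidence U W f x)" if "x < G" for x
    using sums[of "\<lambda>_. 1" x] D[OF that] L(4,8) leaf(2) by (auto simp: DG'_def v_def)
  have cS: "SE' x = (\<Sum>f\<in>R - {e}. f * incidence U W f x)" if "x < G" for x
    using sums[of "\<lambda>f. f" x] S[OF that] L(4,8) by (auto simp: SE'_def e_def v_def)
  have Qeq: "Q' j = Q j" if "j < te" for j using Q' that by auto
  then have img: "Q' ` {..<j} = Q ` {..<j}" if "j \<le> te" for j using that by (intro image_cong) auto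
  have "inj_on Q {..<Suc i}" using st L(6) by (auto simp: peel_state_def lessThan_Suc v_def)
  then have cQ: "inj_on Q' {..<Suc i}" using Qeq leaf(1) by (auto simp: inj_on_def)
  have cPE: "inj_on (PE(i := e)) {..<Suc i}" "(PE(i := e)) ` {..<Suc i} \<subseteq> {..<H}"
    using st PEn by (auto simp: peel_state_def lessThan_Suc inj_on_def)
  have old: "\<forall>j<te. Q j < G \<and> Q j \<noteq> root" using st by (simp add: peel_state_def)
  have call: "Q' j < G \<and> Q' j \<noteq> root" if "j < te'" for j
  proof (cases "j < te")
    case True
    then show ?thesis using old Qeq by simp
  next
    case False
    then show ?thesis using Q' that L(3) by (auto simp: less_Suc_eq)
  qed
  have cle: "Suc i \<le> te'" using Q' leaf(1) by auto
  have cPA: "(PA(i := p)) j < G \<and> (PA(i := p)) j \<notin> Q' ` {..j} \<and>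
      {U ((PE(i := e)) j), W ((PE(i := e)) j)} = {Q' j, (PA(i := p)) j} \<and> DG' (Q' j) = 0" if "j < Suc i" for j
  proof (cases "j = i")
    case True
    then show ?thesis using L img[of "Suc i"] Qeq[of i] leaf(1)
      by (auto simp: lessThan_Suc_atMost[symmetric] lessThan_Suc v_def DG'_def)
  next
    case False
    then have j: "j < i" using that by simp
    have "DG (Q j) = 0" "PA j < G" "PA j \<notin> Q ` {..j}" "{U (PE j), W (PE j)} = {Q j, PA j}"
      using st j by (auto simp: peel_state_def)
    moreover have "Q j \<noteq> p" using L(7) j by auto
    ultimately show ?thesis using False img[of "Suc j"] Qeq[of j] j leaf(1)
      by (simp add: lessThan_Suc_atMost[symmetric] DG'_def)
  qed
  show ?thesis unfolding peel_state_def R'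
  proof (intro conjI allI impI)
    show "Suc i \<le> te'" by (rule cle)
    show "inj_on Q' {..<Suc i}" by (rule cQ)
    show "inj_on (PE(i := e)) {..<Suc i}" by (rule cPE)
    show "(PE(i := e)) ` {..<Suc i} \<subseteq> {..<H}" by (rule cPE)
  next
    fix j assume "j < te'"
    with call[of j] show "Q' j < G" "Q' j \<noteq> root" by simp_all
  next
    fix j assume "j < Suc i"
    note * = cPA[OF this]
    show "(PA(i := p)) j < G" "(PA(i := p)) j \<notin> Q' ` {..j}"
      "{U ((PE(i := e)) j), W ((PE(i := e)) j)} = {Q' j, (PA(i := p)) j}" "DG' (Q' j) = 0"
      using * by blast+
  next
    fix x assume "x < G"
    then show "DG' x = (\<Sum>f\<in>R - {e}. incidence U W f x)" "SE' x = (\<Sum>f\<in>R - {e}. f * incidence U W f x)"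
      by (rule cD, rule cS)
  qed
qed

text \<open>At least two nodes remain, so the remaining tree has a leaf other than the root, and
  every such leaf is waiting in the queue.\<close>

lemma tree_peel_has_leaf:
  assumes st: "peel_state G H U W root i DG SE Q PA PE te"
    and tr: "tree_peel_state G H U W root i DG Q PE te"
    and UW: "\<forall>e<H. U e < G \<and> W e < G"
    and root: "root < G" and i: "Suc i < G" and inj: "inj_on (\<lambda>e. {U e, W e}) {..<H}"
  shows "i < te \<and> DG (Q i) = (1::nat)"
proof -
  define R where "R = {..<H} - PE ` {..<i}"
  let ?A = "{..<G} - Q ` {..<i}" and ?ed = "\<lambda>e. {U e, W e}"
  have "root \<notin> Q ` {..<i}" using st by (auto simp: peel_state_def) (metis order_less_le_trans)
  then have rA: "root \<in> ?A" using root by simp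
  have "card (Q ` {..<i}) \<le> i" using card_image_le[of "{..<i}" Q] by simp
  then have "card ?A \<ge> 2" using i diff_card_le_card_Diff[of "Q ` {..<i}" "{..<G}"] by simp
  then have ne: "?A \<noteq> {root}" by (intro notI) simp
  have T: "tree_graph ?A (?ed ` R)" using tr by (simp add: tree_peel_state_def R_def)
  from tree_graph_leaf[OF T rA ne] obtain v p where
    v: "v \<in> ?A" "v \<noteq> root" "p \<noteq> v" "{e \<in> ?ed ` R. v \<in> e} = {{v, p}}"
    by (elim bexE conjE)
  then have "{v, p} \<in> {e \<in> ?ed ` R. v \<in> e}" by simp
  then obtain e0 where e0: "e0 \<in> R" "?ed e0 = {v, p}" by auto
  have "incidence U W e0 v = 1" using e0(2) v(3) by (auto simp: incidence_def doubleton_eq_iff)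
  moreover have "incidence U W f v = 0" if "f \<in> R" "e0 \<noteq> f" for f
  proof (rule ccontr)
    assume "incidence U W f v \<noteq> 0"
    then have "?ed f \<in> {e \<in> ?ed ` R. v \<in> e}" using that(1) by (auto simp: incidence_def split: if_splits)
    then have "?ed f = ?ed e0" using v(4) e0(2) by simp
    then show False using inj that e0(1) by (auto simp: inj_on_def R_def)
  qed
  ultimately have "(\<Sum>f\<in>R. incidence U W f v) = 1"
    using e0(1) by (subst sum_eq_1_iff) (auto simp: R_def)
  then have "DG v = 1" using st v(1) by (simp add: peel_state_def R_def)
  then have "v \<in> Q ` {i..<te}" using tr v(1,2) unfolding tree_peel_state_def by blast
  then have lt: "i < te" by auto
  then have "Q i \<in> Q ` {i..<te}" by auto
  then show ?thesis using tr lt unfolding tree_peel_state_def by blast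
qed

lemma tree_peel_state_step:
  assumes st: "peel_state G H U W root i DG SE Q PA PE te"
    and tr: "tree_peel_state G H U W root i DG Q PE te"
    and UW: "\<forall>e<H. U e < G \<and> W e < G"
    and root: "root < G" and inj: "inj_on (\<lambda>e. {U e, W e}) {..<H}"
    and leaf: "i < te" "DG (Q i) = (1::nat)"
  defines "v \<equiv> Q i" and "e \<equiv> SE (Q i)" and "p \<equiv> U (SE (Q i)) + W (SE (Q i)) - Q i"
  defines "DG' \<equiv> DG(v := 0, p := DG p - 1)"
  assumes Q': "if p \<noteq> root \<and> DG' p = 1 then Q' = Q(te := p) \<and> te' = Suc te else Q' = Q \<and> te' = te"
  shows "tree_peel_state G H U W root (Suc i) DG' Q' (PE(i := e)) te'"
proof -
  define R where "R = {..<H} - PE ` {..<i}"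
  let ?A = "{..<G} - Q ` {..<i}" and ?ed = "\<lambda>e. {U e, W e}"
  note L = peel_leaf[OF st UW leaf, folded v_def e_def p_def R_def]
  have R': "{..<H} - (PE(i := e)) ` {..<Suc i} = R - {e}"
    by (auto simp: R_def lessThan_Suc)
  have Qeq: "Q' j = Q j" if "j < te" for j using Q' that by (auto split: if_splits)
  have img: "Q' ` {..<Suc i} = insert v (Q ` {..<i})" using Qeq leaf(1) by (auto simp: lessThan_Suc v_def)
  have A': "{..<G} - insert v (Q ` {..<i}) = ?A - {v}" by auto
  have edR: "?ed ` (R - {e}) = ?ed ` R - {{v, p}}"
    using inj L(1,5) by (auto simp: R_def inj_on_def)
  have only: "{f \<in> ?ed ` R. v \<in> f} = {{v, p}}"
  proof (intro equalityI subsetI)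
    fix f assume "f \<in> {f \<in> ?ed ` R. v \<in> f}"
    then obtain e' where e': "e' \<in> R" "f = ?ed e'" "v \<in> ?ed e'" by blast
    then have "incidence U W e' v \<noteq> 0" by (auto simp: incidence_def)
    then have "e' = e" using L(9)[OF e'(1)] by (cases "e' = e") simp_all
    then show "f \<in> {{v, p}}" using e'(2) L(5) by simp
  next
    fix f assume "f \<in> {{v, p}}"
    then show "f \<in> {f \<in> ?ed ` R. v \<in> f}" using L(1,5) by auto
  qed
  have T': "tree_graph (?A - {v}) (?ed ` (R - {e}))"
    unfolding edR using tree_graph_remove_leaf[OF _ only L(4)] tr by (simp add: tree_peel_state_def R_def)
  have st': "peel_state G H U W root (Suc i) DG' (SE(v := 0, p := SE p - e)) Q' (PA(i := p)) (PE(i := e)) te'"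
    unfolding DG'_def v_def e_def p_def
    by (rule peel_state_step[OF st UW leaf]) (use Q' in \<open>auto simp: v_def p_def split: if_splits\<close>)
  have win: "Q ` {i..<te} = {v. v < G \<and> v \<notin> Q ` {..<i} \<and> v \<noteq> root \<and> DG v = 1}" and injQ: "inj_on Q {..<te}"
    using tr by (auto simp: tree_peel_state_def)
  \<comment> \<open>A neighbour of degree 1 would be isolated after the removal although the root is
    still present. So it was not a queued leaf before, and queueing it now creates no
    duplicate.\<close>
  have Dp: "DG p \<noteq> 1" if pr: "p \<noteq> root"
  proof
    assume "DG p = 1"
    then have 0: "DG' p = 0" by (simp add: DG'_def)
    have "root \<notin> Q ` {..<i}" using st by (auto simp: peel_state_def) (metis order_less_le_trans)
    moreover have "v \<noteq> root" using st leaf(1) by (auto simp: peel_state_def v_def)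
    ultimately have "root \<in> ?A - {v}" "p \<in> ?A - {v}" using root L by auto
    then obtain y where "{p, y} \<in> ?ed ` (R - {e})"
      using connected_has_edge[of "?A - {v}" "?ed ` (R - {e})" p root] T' pr by (auto simp: tree_graph_def)
    then obtain f where f: "f \<in> R - {e}" "p \<in> ?ed f" by auto
    then have "incidence U W f p \<noteq> 0" by (auto simp: incidence_def)
    moreover have "incidence U W f p \<le> (\<Sum>f\<in>R - {e}. incidence U W f p)"
      using f(1) by (intro member_le_sum) (auto simp: R_def)
    moreover have "DG' p = (\<Sum>f\<in>R - {e}. incidence U W f p)"
      using st' L(3) unfolding peel_state_def R' by blast
    ultimately show False using 0 by simp
  qed
  have pn: "p \<notin> Q ` {..<te}" if "p \<noteq> root"
  proof
    assume "p \<in> Q ` {..<te}"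
    moreover have "{..<te} = {..<i} \<union> {i..<te}" using leaf(1) by auto
    ultimately have "p \<in> Q ` {i..<te}" using L(7) by auto
    then show False using Dp that unfolding win by auto
  qed
  have rest: "Q ` {Suc i..<te} = {x. x < G \<and> x \<notin> Q ` {..<i} \<and> x \<noteq> root \<and> DG x = 1} - {v}"
  proof -
    have "{i..<te} = insert i {Suc i..<te}" using leaf(1) by auto
    moreover have "v \<notin> Q ` {Suc i..<te}"
    proof
      assume "v \<in> Q ` {Suc i..<te}"
      then obtain x where "Suc i \<le> x" "x < te" "Q i = Q x" by (auto simp: v_def)
      then show False using inj_onD[OF injQ, of i x] leaf(1) by simp
    qed
    ultimately show ?thesis unfolding win[symmetric] by (auto simp: v_def)
  qed
  have win': "Q' ` {Suc i..<te'} = {x. x < G \<and> x \<notin> insert v (Q ` {..<i}) \<and> x \<noteq> root \<and> DG' x = 1}"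
  proof (cases "p \<noteq> root \<and> DG' p = 1")
    case True
    then have Qt: "Q' = Q(te := p)" "te' = Suc te" using Q' by auto
    have "{Suc i..<te'} = insert te {Suc i..<te}" using leaf(1) Qt by auto
    then have "Q' ` {Suc i..<te'} = insert p (Q ` {Suc i..<te})" using Qt by auto
    also have "\<dots> = {x. x < G \<and> x \<notin> insert v (Q ` {..<i}) \<and> x \<noteq> root \<and> DG' x = 1}"
      unfolding rest using True L(3,4,7) by (auto simp: DG'_def)
    finally show ?thesis .
  next
    case False
    then have Qt: "Q' = Q" "te' = te" using Q' by auto
    show ?thesis unfolding Qt rest using False Dp L(4) by (auto simp: DG'_def)
  qed
  have "inj_on Q' {..<te'}"
  proof (cases "p \<noteq> root \<and> DG' p = 1")
    case True
    then have Qt: "Q' = Q(te := p)" "te' = Suc te" using Q' by auto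
    show ?thesis using injQ pn True unfolding Qt by (auto simp: lessThan_Suc inj_on_def)
  next
    case False
    then show ?thesis using Q' injQ by auto
  qed
  then show ?thesis unfolding tree_peel_state_def R' img A' win'
    by (intro conjI T') simp_all
qed

text \<open>The \<open>G - 1\<close> removed edges are distinct and thus all the edges there are. A
  recorded neighbour had not been removed at that time, so it stands later in the queue: the queue
  is an elimination order.\<close>

lemma peel_state_final:
  assumes st: "peel_state G H U W root (G - 1) DG SE Q PA PE te" and H: "H = G - 1"
    and root: "root < G" and Q: "Q (G - 1) = root"
  shows "bij_betw Q {..<G} {..<G}"
    and "(\<lambda>e. {U e, W e}) ` {..<H} = (\<lambda>j. {Q j, PA j}) ` {..<G - 1}"
    and "\<And>j. j < G - 1 \<Longrightarrow> \<exists>k. j < k \<and> k < G \<and> PA j = Q k"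
    and "\<And>j. j < G - 1 \<Longrightarrow> PE j < H \<and> {U (PE j), W (PE j)} = {Q j, PA j}"
proof -
  have G: "{..<G} = insert (G - 1) {..<G - 1}" using root by auto
  have lt: "\<And>j. j < G - 1 \<Longrightarrow> Q j < G \<and> Q j \<noteq> root" using st by (auto simp: peel_state_def)
  have "inj_on Q {..<G - 1}" using st by (simp add: peel_state_def)
  moreover have "root \<notin> Q ` {..<G - 1}"
  proof
    assume "root \<in> Q ` {..<G - 1}"
    then obtain j where "j < G - 1" "root = Q j" by auto
    then show False using lt[of j] by simp
  qed
  ultimately have inj: "inj_on Q {..<G}" unfolding G using Q by auto
  have "Q j < G" if "j < G" for j using that lt[of j] Q root by (cases "j = G - 1") auto
  then have "Q ` {..<G} \<subseteq> {..<G}" by auto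
  then have "Q ` {..<G} = {..<G}" using inj by (intro card_subset_eq) (auto simp: card_image)
  then show bij: "bij_betw Q {..<G} {..<G}" using inj by (simp add: bij_betw_def)
  have "inj_on PE {..<G - 1}" "PE ` {..<G - 1} \<subseteq> {..<H}" using st by (auto simp: peel_state_def)
  then have PE: "PE ` {..<G - 1} = {..<H}" by (intro card_subset_eq) (auto simp: card_image H)
  show e: "\<And>j. j < G - 1 \<Longrightarrow> PE j < H \<and> {U (PE j), W (PE j)} = {Q j, PA j}"
    using st PE by (auto simp: peel_state_def)
  show "(\<lambda>e. {U e, W e}) ` {..<H} = (\<lambda>j. {Q j, PA j}) ` {..<G - 1}"
    unfolding PE[symmetric] image_image using e by (intro image_cong) auto
  fix j assume j: "j < G - 1"
  have "PA j < G" "PA j \<notin> Q ` {..j}" using st j by (auto simp: peel_state_def)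
  then obtain k where "k < G" "PA j = Q k" using bij_betw_imp_surj_on[OF bij] by (metis imageE lessThan_iff)
  moreover from this have "j < k" using \<open>PA j \<notin> Q ` {..j}\<close> by (metis atMost_iff imageI not_le)
  ultimately show "\<exists>k. j < k \<and> k < G \<and> PA j = Q k" by blast
qed

section \<open>Dynamic programming and its programs\<close>

section \<open>Tables of partial tours\<close>

text \<open>The table entry for \<open>k\<close> placed nodes and \<open>j\<close> ends has index \<open>3 * k + j\<close>.  Entries are
  costs increased by one, and \<open>0\<close> stands for infinity.\<close>

lemma div_mod_3_add:
  fixes a b :: nat
  assumes "a mod 3 \<le> (a + b) mod 3"
  shows "(a + b) div 3 = a div 3 + b div 3 \<and> (a + b) mod 3 = a mod 3 + b mod 3"
proof -
  have m: "(a + b) mod 3 = (a mod 3 + b mod 3) mod 3" by (simp add: mod_add_eq)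
  have "a mod 3 + b mod 3 < 3"
  proof (rule ccontr)
    assume "\<not> a mod 3 + b mod 3 < 3"
    moreover have "a mod 3 < 3" "b mod 3 < 3" by simp_all
    ultimately have "(a mod 3 + b mod 3) mod 3 = a mod 3 + b mod 3 - 3"
      by (subst le_mod_geq) auto
    then show False using m assms \<open>b mod 3 < 3\<close> \<open>\<not> a mod 3 + b mod 3 < 3\<close> by linarith
  qed
  then show ?thesis using m div_add1_eq[of a b 3] by simp
qed

context tour_problem
begin

definition entry_ok :: "nat \<Rightarrow> nat \<Rightarrow> nat \<Rightarrow> nat \<Rightarrow> nat list \<times> nat list \<Rightarrow> bool" where
  "entry_ok i u q c A \<longleftrightarrow> c \<noteq> 0 \<and> partial_tour (merged P i u) u (q div 3) (q mod 3) (c - 1) A"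

definition tour_index :: "nat set \<Rightarrow> nat list \<Rightarrow> nat" where
  "tour_index C L = 3 * inside C L + ends_inside C L"

definition table_complete :: "nat \<Rightarrow> nat \<Rightarrow> (nat \<Rightarrow> nat) \<Rightarrow> bool" where
  "table_complete i u T \<longleftrightarrow> (\<forall>L. feasible_tour L \<longrightarrow> T (tour_index (merged P i u) L) \<noteq> 0 \<and>
     T (tour_index (merged P i u) L) - 1 \<le> inside_cost (merged P i u) u L)"

definition lifted :: "nat \<Rightarrow> (nat \<Rightarrow> nat) \<Rightarrow> nat \<Rightarrow> nat" where
  "lifted i T q = (if T q = 0 \<or> ec i < charge n (q div 3) (q mod 3) then 0
     else T q + charge n (q div 3) (q mod 3) * ew i)"

lemma tour_index_div_mod: "tour_index C L div 3 = inside C L" "tour_index C L mod 3 = ends_inside C L"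
  using ends_inside_le[of C L] by (simp_all add: tour_index_def)

lemma tour_index_less: "length L = n \<Longrightarrow> tour_index C L < 3 * (n + 1)"
  using ends_inside_le[of C L] inside_le[of C L] by (simp add: tour_index_def)

lemma entry_ok_initial:
  "q div 3 \<le> cp u \<Longrightarrow> q < 3 * (n + 1) \<Longrightarrow> entry_ok 0 u q (Suc (q div 3 * nw u)) (replicate (q div 3) u, [])"
  using partial_tour_initial[of "q div 3" u "q mod 3"] by (auto simp: entry_ok_def)

lemma table_complete_initial:
  assumes "u < N" "\<And>q. q < 3 * (n + 1) \<Longrightarrow> q div 3 \<le> cp u \<Longrightarrow> T q = Suc (q div 3 * nw u)"
  shows "table_complete 0 u T"
  unfolding table_complete_def
proof (intro allI impI)
  fix L assume L: "feasible_tour L"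
  have "tour_index (merged P 0 u) L div 3 = count_list L u"
    by (simp only: tour_index_div_mod inside_initial)
  moreover have "count_list L u \<le> cp u" "length L = n" using L assms(1) by (auto simp: feasible_tour_def)
  ultimately show "T (tour_index (merged P 0 u) L) \<noteq> 0 \<and>
     T (tour_index (merged P 0 u) L) - 1 \<le> inside_cost (merged P 0 u) u L"
    using assms(2)[OF tour_index_less[of L]] inside_cost_initial[of u L] by simp
qed

text \<open>The comparison of remainders says that adding the indices makes no carry from the
  \<open>j\<close> digit. Then nodes and ends add separately, and at most two ends result.\<close>

lemma entry_ok_merge:
  assumes i: "i < N - 1" and A: "entry_ok i (P i) q1 c1 A" and B: "entry_ok i i q2 (T q2) B"
    and l: "lifted i T q2 \<noteq> 0" and q: "q1 mod 3 \<le> (q1 + q2) mod 3" "q1 + q2 < 3 * (n + 1)"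
  shows "entry_ok (Suc i) (P i) (q1 + q2) (c1 + lifted i T q2 - 1) (merge_tours (q1 mod 3) (q2 mod 3) A B)"
proof -
  have s: "(q1 + q2) div 3 = q1 div 3 + q2 div 3" "(q1 + q2) mod 3 = q1 mod 3 + q2 mod 3"
    using div_mod_3_add[OF q(1)] by auto
  have "q1 mod 3 + q2 mod 3 \<le> 2" using s(2) mod_less_divisor[of 3 "q1 + q2"] by linarith
  moreover have "q1 div 3 + q2 div 3 \<le> n" using q(2) unfolding s(1)[symmetric] by simp
  ultimately have pt: "partial_tour (merged P (Suc i) (P i)) (P i) (q1 div 3 + q2 div 3) (q1 mod 3 + q2 mod 3)
    (c1 - 1 + (T q2 - 1 + charge n (q2 div 3) (q2 mod 3) * ew i)) (merge_tours (q1 mod 3) (q2 mod 3) A B)"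
    using A B l i by (intro partial_tour_merge) (auto simp: entry_ok_def lifted_def split: if_splits)
  \<comment> \<open>Both summands are shifted by one, so their sum is shifted by two, and 1 is
    subtracted to obtain a table entry again.\<close>
  have c: "c1 - 1 + (T q2 - 1 + charge n (q2 div 3) (q2 mod 3) * ew i) = c1 + lifted i T q2 - 1 - 1"
    "c1 + lifted i T q2 - 1 \<noteq> 0"
    using A B l by (auto simp: entry_ok_def lifted_def split: if_splits)
  show ?thesis unfolding entry_ok_def s by (rule conjI[OF c(2) pt[unfolded c(1)]])
qed

text \<open>A feasible tour splits its index into those of the two parts, without carry because
  numbers of ends add up to at most 2. This split is one of the candidates that \<open>T'\<close>
  must not exceed.\<close>

lemma table_complete_merge:
  assumes i: "i < N - 1" and T1: "table_complete i (P i) T1" and T2: "table_complete i i T2"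
    and T': "\<And>q b. q < 3 * (n + 1) \<Longrightarrow> b \<le> q \<Longrightarrow> b mod 3 \<le> q mod 3 \<Longrightarrow> T1 b \<noteq> 0 \<Longrightarrow>
      lifted i T2 (q - b) \<noteq> 0 \<Longrightarrow> T' q \<noteq> 0 \<and> T' q \<le> T1 b + lifted i T2 (q - b) - 1"
  shows "table_complete (Suc i) (P i) T'"
  unfolding table_complete_def
proof (intro allI impI)
  fix L assume L: "feasible_tour L"
  then have len: "length L = n" and ecL: "crossings i L \<le> ec i" using i by (auto simp: feasible_tour_def)
  let ?C = "merged P i (P i)" and ?D = "merged P i i"
  have disj: "?C \<inter> ?D = {}" using merged_disjoint[of i "P i" i] parent(1)[OF i] i by auto
  define q1 where "q1 = tour_index ?C L"
  define q2 where "q2 = tour_index ?D L"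
  have q: "tour_index (merged P (Suc i) (P i)) L = q1 + q2"
    by (simp add: q1_def q2_def tour_index_def inside_union[OF disj] ends_inside_union[OF disj])
  have "(q1 + q2) mod 3 = ends_inside (?C \<union> ?D) L" using q tour_index_div_mod(2)[of "?C \<union> ?D" L] by simp
  then have m: "q1 mod 3 \<le> (q1 + q2) mod 3"
    unfolding q1_def tour_index_div_mod ends_inside_union[OF disj] by simp
  have less: "q1 + q2 < 3 * (n + 1)" using tour_index_less[OF len] q by metis
  have 1: "T1 q1 \<noteq> 0" "T1 q1 - 1 \<le> inside_cost ?C (P i) L" using T1 L by (auto simp: table_complete_def q1_def)
  have 2: "T2 q2 \<noteq> 0" "T2 q2 - 1 \<le> inside_cost ?D i L" using T2 L by (auto simp: table_complete_def q2_def)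
  let ?c = "charge n (q2 div 3) (q2 mod 3)"
  have c: "?c = charge n (inside ?D L) (ends_inside ?D L)" by (simp only: q2_def tour_index_div_mod)
  have "?c \<le> ec i" using charge_le_crossings[OF len, of i] ecL c by simp
  then have l: "lifted i T2 q2 = T2 q2 + ?c * ew i" using 2(1) by (simp add: lifted_def)
  have "q1 + q2 - q1 = q2" by simp
  then have l': "lifted i T2 (q1 + q2 - q1) = T2 q2 + ?c * ew i" using l by (simp only:)
  have "lifted i T2 (q1 + q2 - q1) \<noteq> 0" unfolding l' using 2(1) by simp
  from T'[OF less le_add1 m 1(1) this]
  have "T' (q1 + q2) \<noteq> 0" "T' (q1 + q2) \<le> T1 q1 + (T2 q2 + ?c * ew i) - 1" unfolding l' by blast+
  moreover have "T1 q1 + (T2 q2 + ?c * ew i) - 1 - 1 = (T1 q1 - 1) + (T2 q2 - 1 + ?c * ew i)"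
    using 1(1) 2(1) by simp
  ultimately show "T' (tour_index (merged P (Suc i) (P i)) L) \<noteq> 0 \<and>
     T' (tour_index (merged P (Suc i) (P i)) L) - 1 \<le> inside_cost (merged P (Suc i) (P i)) (P i) L"
    using inside_cost_merge[OF i len] 1(2) 2(2) unfolding q c by linarith
qed

lemma entry_ok_root:
  assumes "entry_ok (N - 1) (N - 1) (3 * n + 2) c (X, Y)"
  shows "feasible_tour (rev X @ Y) \<and> tour_cost (rev X @ Y) \<le> c - 1"
proof -
  have "(3 * n + 2) div 3 = n" "(3 * n + 2) mod 3 = 2" by presburger+
  then have "partial_tour (merged P (N - 1) (N - 1)) (N - 1) n 2 (c - 1) (X, Y)"
    using assms unfolding entry_ok_def by metis
  from partial_tour_root[OF this] show ?thesis by blast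
qed

lemma table_complete_root:
  assumes "table_complete (N - 1) (N - 1) T" "feasible_tour L"
  shows "T (3 * n + 2) \<noteq> 0 \<and> T (3 * n + 2) - 1 \<le> tour_cost L"
proof -
  have "tour_index (merged P (N - 1) (N - 1)) L = 3 * n + 2"
    unfolding tour_index_def inside_cost_root[OF assms(2)] ..
  then show ?thesis using assms inside_cost_root(1)[OF assms(2)] unfolding table_complete_def by metis
qed

end

section \<open>Auxiliary expressions\<close>

definition Less :: "expr \<Rightarrow> expr \<Rightarrow> expr" where "Less a b = Minus b a"
definition LessEq :: "expr \<Rightarrow> expr \<Rightarrow> expr" where "LessEq a b = Minus (Plus b (Num 1)) a"
definition Equal :: "expr \<Rightarrow> expr \<Rightarrow> expr" where
  "Equal a b = Minus (Num 1) (Plus (Minus a b) (Minus b a))"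
definition NotE :: "expr \<Rightarrow> expr" where "NotE a = Minus (Num 1) a"
definition AndE :: "expr \<Rightarrow> expr \<Rightarrow> expr" where
  "AndE a b = Minus (Num 1) (Plus (Minus (Num 1) a) (Minus (Num 1) b))"

lemma val_tests [simp]:
  "val (Less a b) s = 0 \<longleftrightarrow> \<not> val a s < val b s"
  "val (LessEq a b) s = 0 \<longleftrightarrow> \<not> val a s \<le> val b s"
  "val (Equal a b) s = 0 \<longleftrightarrow> val a s \<noteq> val b s"
  "val (NotE a) s = 0 \<longleftrightarrow> val a s \<noteq> 0"
  "val (AndE a b) s = 0 \<longleftrightarrow> \<not> (val a s \<noteq> 0 \<and> val b s \<noteq> 0)"
  by (auto simp: Less_def LessEq_def Equal_def NotE_def AndE_def)

lemma expr_ok_tests [simp]: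
  "expr_ok (Less a b) = (expr_ok a \<and> expr_ok b)" "expr_ok (LessEq a b) = (expr_ok a \<and> expr_ok b)"
  "expr_ok (Equal a b) = (expr_ok a \<and> expr_ok b)" "expr_ok (NotE a) = expr_ok a"
  "expr_ok (AndE a b) = (expr_ok a \<and> expr_ok b)"
  by (auto simp: Less_def LessEq_def Equal_def NotE_def AndE_def)

lemma expr_time_tests [simp]:
  "expr_time (Less a b) = expr_time a + expr_time b + 1"
  "expr_time (LessEq a b) = expr_time a + expr_time b + 3"
  "expr_time (Equal a b) = 2 * expr_time a + 2 * expr_time b + 5" "expr_time (NotE a) = expr_time a + 2"
  "expr_time (AndE a b) = expr_time a + expr_time b + 7"
  by (auto simp: Less_def LessEq_def Equal_def NotE_def AndE_def)

lemma sem_Cond [simp]: "sem (Cond e c d) s = (if val e s = 0 then sem d s else sem c s)"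
  by simp

lemma sem_Assign [simp]: "sem (x ::= e) s = Store ((vars s)(x := val e s)) (arrs s)"
  by (simp add: set_var_def)

lemma sem_Write [simp]:
  "sem (Write k i e) s = Store (vars s) ((arrs s)(k := (arrs s k)(val i s := val e s)))"
  by (simp add: set_arr_def)

lemma sem_Skip_Seq [simp]: "sem Skip s = s" "sem (c ;; d) s = sem d (sem c s)"
  by simp_all

declare sem.simps [simp del] set_var_def [simp] set_arr_def [simp]

abbreviation "When e c \<equiv> Cond e c Skip"

text \<open>Names in \<open>x\<close> are variables, names in \<open>a\<close> are arrays.  \<open>aX\<close> holds the input.  Peeling the
  tree with edges \<open>aU\<close>, \<open>aW\<close> uses the degrees \<open>aDG\<close> and the sums \<open>aSE\<close> of incident edges; it leaves
  the removed nodes in the queue \<open>aQ\<close>, their neighbours and edges at that time in \<open>aPA\<close> and \<open>aPE\<close>,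
  the positions in the queue in \<open>aRK\<close>, and the parents in terms of these positions in \<open>aPR\<close>.\<close>

abbreviation (input) "xi \<equiv> 10::nat"
abbreviation (input) "xv \<equiv> 11::nat"
abbreviation (input) "xe \<equiv> 12::nat"
abbreviation (input) "xp \<equiv> 13::nat"
abbreviation (input) "xtl \<equiv> 14::nat"
abbreviation (input) "xok \<equiv> 15::nat"
abbreviation (input) "xG \<equiv> 7::nat"
abbreviation (input) "xH \<equiv> 8::nat"
abbreviation (input) "xr \<equiv> 9::nat"
abbreviation (input) "xg \<equiv> 16::nat"

abbreviation (input) "aX \<equiv> 0::nat"
abbreviation (input) "aU \<equiv> 1::nat"
abbreviation (input) "aW \<equiv> 2::nat"
abbreviation (input) "aDG \<equiv> 3::nat"
abbreviation (input) "aSE \<equiv> 4::nat"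
abbreviation (input) "aQ \<equiv> 5::nat"
abbreviation (input) "aPA \<equiv> 6::nat"
abbreviation (input) "aPE \<equiv> 7::nat"
abbreviation (input) "aRK \<equiv> 8::nat"
abbreviation (input) "aPR \<equiv> 9::nat"

section \<open>Arranging a tree\<close>

definition count_end :: "nat \<Rightarrow> cmd" where
  "count_end a = xv ::= Arr a (Var xi) ;; Write aDG (Var xv) (Plus (Arr aDG (Var xv)) (Num 1)) ;;
     Write aSE (Var xv) (Plus (Arr aSE (Var xv)) (Var xi))"

definition degrees :: cmd where
  "degrees = For xi xG (Write aDG (Var xi) (Num 0) ;; Write aSE (Var xi) (Num 0)) ;;
     For xi xH (count_end aU ;; count_end aW)"

lemma degrees_frame [simp]: "assigned degrees = {xi, xv}" "written degrees = {aDG, aSE}"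
  by (auto simp: degrees_def count_end_def)

lemma degrees_correct:
  fixes s defines "U \<equiv> arrs s aU" and "W \<equiv> arrs s aW" and "t \<equiv> sem degrees s"
  assumes UW: "\<forall>e<vars s xH. U e < vars s xG \<and> W e < vars s xG" and v: "v < vars s xG"
  shows "arrs t aDG v = (\<Sum>e<vars s xH. incidence U W e v)"
    and "arrs t aSE v = (\<Sum>e<vars s xH. e * incidence U W e v)"
proof -
  let ?c1 = "For xi xG (Write aDG (Var xi) (Num 0) ;; Write aSE (Var xi) (Num 0))"
  define I1 where "I1 k t \<longleftrightarrow> (\<forall>v<k. arrs t aDG v = 0 \<and> arrs t aSE v = 0)" for k t
  have "I1 (vars s xG) (sem ?c1 s)"
    by (rule sem_For_invariant) (auto simp: I1_def less_Suc_eq)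
  then have z: "arrs (sem ?c1 s) aDG v = 0" "arrs (sem ?c1 s) aSE v = 0" if "v < vars s xG" for v
    using that by (auto simp: I1_def)
  define s1 where "s1 = sem ?c1 s"
  have s1: "vars s1 xH = vars s xH" "vars s1 xG = vars s xG" "arrs s1 aU = U" "arrs s1 aW = W"
    unfolding s1_def U_def W_def by (auto intro!: vars_sem arrs_sem)
  let ?b = "count_end aU ;; count_end aW"
  define I2 where "I2 k t \<longleftrightarrow> (\<forall>v<vars s xG. arrs t aDG v = (\<Sum>e<k. incidence U W e v) \<and>
     arrs t aSE v = (\<Sum>e<k. e * incidence U W e v))" for k t
  have "I2 (vars s1 xH) (sem (For xi xH ?b) s1)"
  proof (rule sem_For_invariant)
    show "I2 0 (set_var xi 0 s1)" using z by (simp add: I2_def s1_def)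
  next
    fix k t
    assume A: "k < vars s1 xH" "I2 k t" "vars t xi = k" and
      F: "\<And>a. a \<notin> written ?b \<Longrightarrow> arrs t a = arrs s1 a"
    have "arrs t aU = U" "arrs t aW = W" using F[of aU] F[of aW] s1 by (simp_all add: count_end_def)
    then show "I2 (Suc k) (set_var xi (Suc k) (sem ?b t))"
      using A UW s1 by (auto simp: I2_def count_end_def incidence_def algebra_simps)
  qed (simp add: count_end_def)
  then show "arrs t aDG v = (\<Sum>e<vars s xH. incidence U W e v)"
    "arrs t aSE v = (\<Sum>e<vars s xH. e * incidence U W e v)"
    using v s1(1) by (simp_all add: I2_def t_def degrees_def s1_def)
qed

text \<open>Failure is only recorded in \<open>xok\<close>, which the loop never sets back. Later
  rounds may compute meaningless values; the number of rounds stays fixed, as counting loops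
  require.\<close>

definition peel_step :: cmd where
  "peel_step = xv ::= Arr aQ (Var xi) ;;
     Cond (AndE (Less (Var xi) (Var xtl)) (Equal (Arr aDG (Var xv)) (Num 1)))
       (xe ::= Arr aSE (Var xv) ;;
        xp ::= Minus (Plus (Arr aU (Var xe)) (Arr aW (Var xe))) (Var xv) ;;
        Write aDG (Var xv) (Num 0) ;;
        Write aDG (Var xp) (Minus (Arr aDG (Var xp)) (Num 1)) ;;
        Write aSE (Var xv) (Num 0) ;;
        Write aSE (Var xp) (Minus (Arr aSE (Var xp)) (Var xe)) ;;
        Write aPA (Var xi) (Var xp) ;;
        Write aPE (Var xi) (Var xe) ;;
        When (AndE (NotE (Equal (Var xp) (Var xr))) (Equal (Arr aDG (Var xp)) (Num 1)))
          (Write aQ (Var xtl) (Var xp) ;; xtl ::= Plus (Var xtl) (Num 1)))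
       (xok ::= Num 0)"

definition peel :: cmd where
  "peel = xtl ::= Num 0 ;;
     For xi xG (When (AndE (NotE (Equal (Var xi) (Var xr))) (Equal (Arr aDG (Var xi)) (Num 1)))
       (Write aQ (Var xtl) (Var xi) ;; xtl ::= Plus (Var xtl) (Num 1))) ;;
     xok ::= Num 1 ;;
     For xi xg peel_step ;;
     Write aQ (Var xg) (Var xr)"

lemma peel_frame [simp]: "assigned peel = {xtl, xi, xok, xv, xe, xp}"
  "written peel = {aQ, aDG, aSE, aPA, aPE}"
  by (auto simp: peel_def peel_step_def)

abbreviation (input) "peeled G H U W r i t \<equiv>
  peel_state G H U W r i (arrs t aDG) (arrs t aSE) (arrs t aQ) (arrs t aPA) (arrs t aPE) (vars t xtl)"

abbreviation (input) "tree_peeled G H U W r i t \<equiv>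
  tree_peel_state G H U W r i (arrs t aDG) (arrs t aQ) (arrs t aPE) (vars t xtl)"

lemma peel_step_correct:
  fixes t
  defines "U \<equiv> arrs t aU" and "W \<equiv> arrs t aW"
  assumes st: "peeled G H U W (vars t xr) (vars t xi) t" and UW: "\<forall>e<H. U e < G \<and> W e < G"
    and c: "vars t xi < vars t xtl" "arrs t aDG (arrs t aQ (vars t xi)) = 1"
  shows "peeled G H U W (vars t xr) (Suc (vars t xi)) (sem peel_step t)"
    and "vars t xr < G \<Longrightarrow> inj_on (\<lambda>e. {U e, W e}) {..<H} \<Longrightarrow> tree_peeled G H U W (vars t xr) (vars t xi) t \<Longrightarrow>
      tree_peeled G H U W (vars t xr) (Suc (vars t xi)) (sem peel_step t)"
    and "vars (sem peel_step t) xok = vars t xok"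
proof -
  define i where "i = vars t xi"
  define v where "v = arrs t aQ i"
  define e where "e = arrs t aSE v"
  define p where "p = U e + W e - v"
  let ?DG = "(arrs t aDG)(v := 0, p := arrs t aDG p - 1)"
  let ?SE = "(arrs t aSE)(v := 0, p := arrs t aSE p - e)"
  have pv: "p \<noteq> v" using peel_leaf(4)[OF st UW c] by (simp add: p_def e_def v_def i_def)
  let ?t' = "sem peel_step t"
  let ?push = "p \<noteq> vars t xr \<and> ?DG p = 1"
  have res: "arrs ?t' aDG = ?DG" "arrs ?t' aSE = ?SE" "arrs ?t' aPA = (arrs t aPA)(i := p)"
    "arrs ?t' aPE = (arrs t aPE)(i := e)"
    "arrs ?t' aQ = (if ?push then (arrs t aQ)(vars t xtl := p) else arrs t aQ)"
    "vars ?t' xtl = (if ?push then Suc (vars t xtl) else vars t xtl)"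
    "vars ?t' xok = vars t xok"
  proof -
    have "vars t xi = i" "arrs t aQ i = v" "arrs t aSE v = e" "arrs t aU e + arrs t aW e - v = p"
      "i < vars t xtl" "arrs t aDG v = 1"
      using c by (simp_all add: i_def v_def e_def p_def U_def W_def)
    then show "arrs ?t' aDG = ?DG" "arrs ?t' aSE = ?SE" "arrs ?t' aPA = (arrs t aPA)(i := p)"
      "arrs ?t' aPE = (arrs t aPE)(i := e)"
      "arrs ?t' aQ = (if ?push then (arrs t aQ)(vars t xtl := p) else arrs t aQ)"
      "vars ?t' xtl = (if ?push then Suc (vars t xtl) else vars t xtl)"
      "vars ?t' xok = vars t xok"
      using pv by (simp_all add: peel_step_def)
  qed
  show "vars ?t' xok = vars t xok" by (rule res)
  note d = v_def e_def p_def i_def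
  show "peeled G H U W (vars t xr) (Suc (vars t xi)) (sem peel_step t)"
    unfolding res(1-4) unfolding d
    by (rule peel_state_step[OF st UW c]) (auto simp: res(5,6) d)
  assume *: "vars t xr < G" "inj_on (\<lambda>e. {U e, W e}) {..<H}" "tree_peeled G H U W (vars t xr) (vars t xi) t"
  show "tree_peeled G H U W (vars t xr) (Suc (vars t xi)) (sem peel_step t)"
    unfolding res(1-4) unfolding d
    by (rule tree_peel_state_step[OF st *(3) UW *(1,2) c]) (auto simp: res(5,6) d)
qed

lemma peel_correct:
  fixes s
  defines "G \<equiv> vars s xG" and "H \<equiv> vars s xH" and "r \<equiv> vars s xr"
    and "U \<equiv> arrs s aU" and "W \<equiv> arrs s aW" and "t \<equiv> sem peel s"
  assumes UW: "\<forall>e<H. U e < G \<and> W e < G" and r: "r < G" and g: "vars s xg = G - 1"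
    and DG: "\<And>v. v < G \<Longrightarrow> arrs s aDG v = (\<Sum>e<H. incidence U W e v)"
    and SE: "\<And>v. v < G \<Longrightarrow> arrs s aSE v = (\<Sum>e<H. e * incidence U W e v)"
  shows "vars t xok = 1 \<Longrightarrow> \<exists>Q. peel_state G H U W r (G - 1) (arrs t aDG) (arrs t aSE) Q (arrs t aPA) (arrs t aPE) (vars t xtl)
      \<and> arrs t aQ = Q(G - 1 := r)"
    and "tree_graph {..<G} ((\<lambda>e. {U e, W e}) ` {..<H}) \<Longrightarrow> inj_on (\<lambda>e. {U e, W e}) {..<H} \<Longrightarrow> vars t xok = 1"
proof -
  let ?b1 = "When (AndE (NotE (Equal (Var xi) (Var xr))) (Equal (Arr aDG (Var xi)) (Num 1)))
       (Write aQ (Var xtl) (Var xi) ;; xtl ::= Plus (Var xtl) (Num 1))"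
  define s0 where "s0 = set_var xtl 0 s"
  define s1 where "s1 = sem (For xi xG ?b1) s0"
  define J where "J k t \<longleftrightarrow> inj_on (arrs t aQ) {..<vars t xtl} \<and>
    arrs t aQ ` {..<vars t xtl} = {v. v < k \<and> v \<noteq> r \<and> arrs s aDG v = 1}" for k t
  have "J (vars s0 xG) s1" unfolding s1_def
  proof (rule sem_For_invariant)
    show "J 0 (set_var xi 0 s0)" by (simp add: J_def s0_def)
  next
    fix k t assume A: "k < vars s0 xG" "J k t" "vars t xi = k" and
      F: "\<And>v. v \<notin> assigned (For xi xG ?b1) \<Longrightarrow> vars t v = vars s0 v" "\<And>a. a \<notin> written ?b1 \<Longrightarrow> arrs t a = arrs s0 a"
    have f: "vars t xr = r" "arrs t aDG = arrs s aDG" using F(1)[of xr] F(2)[of aDG] by (simp_all add: s0_def r_def)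
    show "J (Suc k) (set_var xi (Suc k) (sem ?b1 t))"
    proof (cases "k \<noteq> r \<and> arrs s aDG k = 1")
      case True
      let ?tl = "vars t xtl"
      have "(arrs t aQ)(?tl := k) ` {..<Suc ?tl} = insert k (arrs t aQ ` {..<?tl})"
        by (auto simp: lessThan_Suc)
      moreover have "inj_on ((arrs t aQ)(?tl := k)) {..<Suc ?tl}"
        using A(2) unfolding J_def by (auto simp: lessThan_Suc inj_on_def)
      ultimately show ?thesis using True A f unfolding J_def by (auto simp: less_Suc_eq)
    next
      case False
      then show ?thesis using A f unfolding J_def by (auto simp: less_Suc_eq)
    qed
  qed simp
  then have J1: "J G s1" by (simp add: s0_def G_def)
  define s2 where "s2 = set_var xok 1 s1"
  have fr: "vars s2 xG = G" "vars s2 xH = H" "vars s2 xr = r" "vars s2 xg = G - 1" "arrs s2 aU = U" "arrs s2 aW = W"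
    "arrs s2 aDG = arrs s aDG" "arrs s2 aSE = arrs s aSE" "vars s2 xok = 1" "vars s2 xtl = vars s1 xtl" "arrs s2 aQ = arrs s1 aQ"
    unfolding s2_def s1_def G_def H_def r_def U_def W_def g[unfolded G_def, symmetric]
    by (simp_all add: vars_sem arrs_sem s0_def)
  have init: "peeled G H U W r 0 s2" unfolding fr peel_state_def
  proof (intro conjI allI impI)
    fix j assume "j < vars s1 xtl"
    then have "arrs s1 aQ j \<in> arrs s1 aQ ` {..<vars s1 xtl}" by simp
    then show "arrs s1 aQ j < G" "arrs s1 aQ j \<noteq> r" using J1 unfolding J_def by blast+
  qed (use DG SE in auto)
  have init_tree: "tree_peeled G H U W r 0 s2" if "tree_graph {..<G} ((\<lambda>e. {U e, W e}) ` {..<H})"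
    using J1 that unfolding fr tree_peel_state_def J_def by (auto simp: atLeast0LessThan)
  define tr where "tr \<longleftrightarrow> tree_graph {..<G} ((\<lambda>e. {U e, W e}) ` {..<H}) \<and> inj_on (\<lambda>e. {U e, W e}) {..<H}"
  \<comment> \<open>One invariant for both directions: what the flag guarantees, and that the flag
    stays set on a tree.\<close>
  define I where "I k t \<longleftrightarrow> (vars t xok = 1 \<longrightarrow> peeled G H U W r k t) \<and> (tr \<longrightarrow> vars t xok = 1 \<and> tree_peeled G H U W r k t)" for k t
  define s3 where "s3 = sem (For xi xg peel_step) s2"
  have "I (vars s2 xg) s3" unfolding s3_def
  proof (rule sem_For_invariant)
    show "I 0 (set_var xi 0 s2)" using init init_tree by (simp add: I_def tr_def fr)
  next
    fix k t assume A: "k < vars s2 xg" "I k t" "vars t xi = k" and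
      F: "\<And>v. v \<notin> assigned (For xi xg peel_step) \<Longrightarrow> vars t v = vars s2 v" "\<And>a. a \<notin> written peel_step \<Longrightarrow> arrs t a = arrs s2 a"
    have f: "vars t xr = r" "arrs t aU = U" "arrs t aW = W"
      using F(1)[of xr] F(2)[of aU] F(2)[of aW] fr by (simp_all add: peel_step_def)
    have kG: "Suc k < G" using A(1) fr by simp
    show "I (Suc k) (set_var xi (Suc k) (sem peel_step t))"
    proof (cases "vars t xok = 1 \<and> k < vars t xtl \<and> arrs t aDG (arrs t aQ k) = 1")
      case True
      have st: "peeled G H (arrs t aU) (arrs t aW) (vars t xr) (vars t xi) t" using A True f by (simp add: I_def)
      have UW': "\<forall>e<H. arrs t aU e < G \<and> arrs t aW e < G" using UW f by simp
      have c: "vars t xi < vars t xtl" "arrs t aDG (arrs t aQ (vars t xi)) = 1" using True A(3) by auto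
      note S = peel_step_correct[OF st UW' c, unfolded f A(3)]
      show ?thesis using S A(2) r True by (simp add: I_def tr_def)
    next
      case False
      have "vars (sem peel_step t) xok \<noteq> 1" if "vars t xok \<noteq> 1" using that by (simp add: peel_step_def)
      moreover have "vars (sem peel_step t) xok \<noteq> 1" if "\<not> (k < vars t xtl \<and> arrs t aDG (arrs t aQ k) = 1)"
        using that A(3) by (auto simp: peel_step_def)
      moreover have "\<not> tr"
      proof
        assume "tr"
        then have "k < vars t xtl \<and> arrs t aDG (arrs t aQ k) = 1" "vars t xok = 1"
          using tree_peel_has_leaf[OF _ _ UW r kG] A(2) by (auto simp: I_def tr_def)
        then show False using False by simp
      qed
      ultimately show ?thesis using False by (auto simp: I_def)
    qed
  qed (simp add: peel_step_def)
  then have I3: "I (G - 1) s3" by (simp add: fr)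
  have "vars s3 xg = G - 1" "vars s3 xr = r" unfolding s3_def
    by (simp_all add: vars_sem peel_step_def fr)
  then have t: "t = set_arr aQ (G - 1) r s3"
    by (simp add: t_def peel_def s3_def s2_def s1_def s0_def)
  show "\<exists>Q. peel_state G H U W r (G - 1) (arrs t aDG) (arrs t aSE) Q (arrs t aPA) (arrs t aPE) (vars t xtl)
      \<and> arrs t aQ = Q(G - 1 := r)" if "vars t xok = 1"
    using I3 that unfolding I_def t by (intro exI[of _ "arrs s3 aQ"]) simp
  show "vars t xok = 1" if "tree_graph {..<G} ((\<lambda>e. {U e, W e}) ` {..<H})" "inj_on (\<lambda>e. {U e, W e}) {..<H}"
    using I3 that unfolding I_def tr_def t by simp
qed

definition ranks :: cmd where
  "ranks = For xi xG (Write aRK (Arr aQ (Var xi)) (Var xi)) ;;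
     For xi xg (Write aPR (Var xi) (Arr aRK (Arr aPA (Var xi))))"

lemma ranks_frame [simp]: "assigned ranks = {xi}" "written ranks = {aRK, aPR}"
  by (auto simp: ranks_def)

lemma ranks_correct:
  fixes s defines "Q \<equiv> arrs s aQ" and "t \<equiv> sem ranks s"
  assumes inj: "inj_on Q {..<vars s xG}" and PA: "i < vars s xg" "arrs s aPA i = Q j" "j < vars s xG"
  shows "arrs t aPR i = j"
proof -
  let ?c = "For xi xG (Write aRK (Arr aQ (Var xi)) (Var xi))"
  define I where "I k t \<longleftrightarrow> (\<forall>j<k. arrs t aRK (Q j) = j)" for k t
  have "I (vars s xG) (sem ?c s)"
  proof (rule sem_For_invariant)
    fix k t assume A: "k < vars s xG" "I k t" "vars t xi = k" and
      F: "\<And>a. a \<notin> written (Write aRK (Arr aQ (Var xi)) (Var xi)) \<Longrightarrow> arrs t a = arrs s a"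
    have "arrs t aQ = Q" using F[of aQ] by (simp add: Q_def)
    moreover have "Q j \<noteq> Q k" if "j < k" for j using inj_onD[OF inj, of j k] that A(1) by auto
    ultimately show "I (Suc k) (set_var xi (Suc k) (sem (Write aRK (Arr aQ (Var xi)) (Var xi)) t))"
      using A by (auto simp: I_def less_Suc_eq)
  qed (simp_all add: I_def)
  then have rk: "arrs (sem ?c s) aRK (Q j) = j" using PA by (simp add: I_def)
  define s1 where "s1 = sem ?c s"
  define I2 where "I2 k t \<longleftrightarrow> (\<forall>i<k. arrs t aPR i = arrs s1 aRK (arrs s1 aPA i))" for k t
  have "I2 (vars s1 xg) (sem (For xi xg (Write aPR (Var xi) (Arr aRK (Arr aPA (Var xi))))) s1)"
    by (rule sem_For_invariant) (auto simp: I2_def less_Suc_eq)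
  moreover have "arrs s1 aPA = arrs s aPA" "vars s1 xg = vars s xg" by (simp_all add: s1_def vars_sem arrs_sem)
  ultimately show ?thesis using PA rk by (simp add: I2_def t_def ranks_def s1_def)
qed

definition arrange :: cmd where "arrange = peel ;; ranks"

lemma arrange_frame [simp]: "assigned arrange = {xtl, xi, xok, xv, xe, xp}"
  "written arrange = {aQ, aDG, aSE, aPA, aPE, aRK, aPR}"
  by (auto simp: arrange_def)

lemma arrange_correct:
  fixes s
  defines "G \<equiv> vars s xG" and "H \<equiv> vars s xH" and "r \<equiv> vars s xr"
    and "U \<equiv> arrs s aU" and "W \<equiv> arrs s aW" and "t \<equiv> sem arrange s"
  defines "Q \<equiv> arrs t aQ" and "P \<equiv> arrs t aPR" and "PE \<equiv> arrs t aPE"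
  assumes UW: "\<forall>e<H. U e < G \<and> W e < G" and r: "r < G" and g: "vars s xg = G - 1"
    and DG: "\<And>v. v < G \<Longrightarrow> arrs s aDG v = (\<Sum>e<H. incidence U W e v)"
    and SE: "\<And>v. v < G \<Longrightarrow> arrs s aSE v = (\<Sum>e<H. e * incidence U W e v)"
  shows "vars t xok = 1 \<Longrightarrow> H = G - 1 \<Longrightarrow> ordered_tree G P \<and> bij_betw Q {..<G} {..<G} \<and> Q (G - 1) = r \<and>
     (\<lambda>e. {U e, W e}) ` {..<H} = (\<lambda>j. {Q j, Q (P j)}) ` {..<G - 1} \<and>
     (\<forall>j<G - 1. PE j < H \<and> {U (PE j), W (PE j)} = {Q j, Q (P j)})"
    and "tree_graph {..<G} ((\<lambda>e. {U e, W e}) ` {..<H}) \<Longrightarrow> inj_on (\<lambda>e. {U e, W e}) {..<H} \<Longrightarrow> vars t xok = 1"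
proof -
  let ?t1 = "sem peel s"
  have t: "t = sem ranks ?t1" by (simp add: t_def arrange_def)
  note pc = peel_correct[of s, folded G_def H_def r_def U_def W_def, OF UW r g DG SE]
  have ok: "vars t xok = vars ?t1 xok" unfolding t by (simp add: vars_sem)
  show "vars t xok = 1" if "tree_graph {..<G} ((\<lambda>e. {U e, W e}) ` {..<H})" "inj_on (\<lambda>e. {U e, W e}) {..<H}"
    using pc(2)[OF _ _ that] ok by simp
  assume "vars t xok = 1" and H: "H = G - 1"
  then obtain Q0 where Q0: "peel_state G H U W r (G - 1) (arrs ?t1 aDG) (arrs ?t1 aSE) Q0 (arrs ?t1 aPA) (arrs ?t1 aPE) (vars ?t1 xtl)"
    "arrs ?t1 aQ = Q0(G - 1 := r)" using pc(1) ok by auto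
  have Qt: "Q = arrs ?t1 aQ" "PE = arrs ?t1 aPE" unfolding Q_def PE_def t by (simp_all add: arrs_sem)
  have eqj: "Q j = Q0 j" if "j < G - 1" for j using that by (simp add: Qt Q0(2))
  \<comment> \<open>The root is written to position \<open>G - 1\<close>, while the queue must not
    contain the root. Moving the end of the queue to \<open>G - 1\<close> leaves this position
    out.\<close>
  have st: "peel_state G H U W r (G - 1) (arrs ?t1 aDG) (arrs ?t1 aSE) Q (arrs ?t1 aPA) PE (G - 1)"
  proof -
    have "Q ` {..<G - 1} = Q0 ` {..<G - 1}" "\<And>j. j < G - 1 \<Longrightarrow> Q ` {..j} = Q0 ` {..j}" using eqj by (auto intro!: image_cong)
    moreover have "inj_on Q {..<G - 1} = inj_on Q0 {..<G - 1}" by (rule inj_on_cong) (use eqj in auto)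
    ultimately show ?thesis using Q0(1) eqj unfolding peel_state_def Qt(2) by auto
  qed
  have Qr: "Q (G - 1) = r" by (simp add: Qt Q0(2))
  note fin = peel_state_final[OF st H r Qr]
  have g1: "vars ?t1 xG = G" "vars ?t1 xg = G - 1" using g by (simp_all add: vars_sem G_def)
  have P: "j < P j \<and> P j < G \<and> arrs ?t1 aPA j = Q (P j)" if j: "j < G - 1" for j
  proof -
    obtain k where k: "j < k" "k < G" "arrs ?t1 aPA j = Q k" using fin(3)[OF j] by blast
    have "P j = k" unfolding P_def t
      by (rule ranks_correct) (use bij_betw_imp_inj_on[OF fin(1)] g1 j k Qt in auto)
    then show ?thesis using k by simp
  qed
  have "ordered_tree G P" by unfold_locales (use r P in auto)
  moreover have "(\<lambda>j. {Q j, arrs ?t1 aPA j}) ` {..<G - 1} = (\<lambda>j. {Q j, Q (P j)}) ` {..<G - 1}"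
    using P by (intro image_cong) auto
  ultimately show "ordered_tree G P \<and> bij_betw Q {..<G} {..<G} \<and> Q (G - 1) = r \<and>
     (\<lambda>e. {U e, W e}) ` {..<H} = (\<lambda>j. {Q j, Q (P j)}) ` {..<G - 1} \<and>
     (\<forall>j<G - 1. PE j < H \<and> {U (PE j), W (PE j)} = {Q j, Q (P j)})"
    using fin(1,2,4) Qr P by auto
qed

section \<open>Linked lists\<close>

abbreviation (input) "xN \<equiv> 1::nat"
abbreviation (input) "xQ \<equiv> 18::nat"
abbreviation (input) "xq \<equiv> 20::nat"
abbreviation (input) "xb \<equiv> 21::nat"
abbreviation (input) "xz \<equiv> 22::nat"
abbreviation (input) "xa \<equiv> 23::nat"
abbreviation (input) "xbest \<equiv> 24::nat"
abbreviation (input) "xbq \<equiv> 25::nat"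
abbreviation (input) "xra \<equiv> 26::nat"
abbreviation (input) "xrb \<equiv> 27::nat"
abbreviation (input) "xny \<equiv> 28::nat"
abbreviation (input) "xhp \<equiv> 29::nat"
abbreviation (input) "xBp \<equiv> 30::nat"
abbreviation (input) "xBi \<equiv> 31::nat"
abbreviation (input) "xj \<equiv> 32::nat"
abbreviation (input) "xk \<equiv> 33::nat"
abbreviation (input) "xc \<equiv> 34::nat"

text \<open>\<open>aNC\<close>, \<open>aNW\<close>, \<open>aEC\<close>, \<open>aEW\<close> are the capacities and costs of nodes and edges.  The table of a
  node starts at its entry of \<open>aBS\<close>; table entries are a cost in \<open>aTC\<close> and pointers \<open>aTX\<close>, \<open>aTY\<close> to
  two linked lists with heads \<open>aHD\<close> and tails \<open>aTL\<close>.  \<open>aLC\<close> is a child's table after the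
  edge to its parent is paid for, \<open>aJJ q\<close> is \<open>q mod 3\<close>, and \<open>aXX q\<close> is the charge at index \<open>q\<close>.\<close>

abbreviation (input) "aNC \<equiv> 11::nat"
abbreviation (input) "aNW \<equiv> 12::nat"
abbreviation (input) "aEC \<equiv> 13::nat"
abbreviation (input) "aEW \<equiv> 14::nat"
abbreviation (input) "aBS \<equiv> 15::nat"
abbreviation (input) "aTC \<equiv> 16::nat"
abbreviation (input) "aTX \<equiv> 17::nat"
abbreviation (input) "aTY \<equiv> 18::nat"
abbreviation (input) "aLC \<equiv> 19::nat"
abbreviation (input) "aJJ \<equiv> 20::nat"
abbreviation (input) "aXX \<equiv> 21::nat"
abbreviation (input) "aHD \<equiv> 22::nat"
abbreviation (input) "aTL \<equiv> 23::nat"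

text \<open>The pointer 0 is the empty list. Tails point downwards, so a list whose head is
  allocated lies entirely among the allocated cells.\<close>

fun list_at :: "(nat \<Rightarrow> nat) \<Rightarrow> (nat \<Rightarrow> nat) \<Rightarrow> nat \<Rightarrow> nat list \<Rightarrow> bool" where
  "list_at HD TL p [] \<longleftrightarrow> p = 0"
| "list_at HD TL p (x # xs) \<longleftrightarrow> p \<noteq> 0 \<and> HD p = x \<and> TL p < p \<and> list_at HD TL (TL p) xs"

abbreviation "heap_list t p xs \<equiv> list_at (arrs t aHD) (arrs t aTL) p xs \<and> p \<le> vars t xhp"

text \<open>Allocated cells are never changed. Lists of different table entries can therefore share
  their tails, and old entries survive all later joins.\<close>

definition heap_extends :: "store \<Rightarrow> store \<Rightarrow> bool" where
  "heap_extends s t \<longleftrightarrow> vars s xhp \<le> vars t xhp \<and>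
     (\<forall>x\<le>vars s xhp. arrs t aHD x = arrs s aHD x \<and> arrs t aTL x = arrs s aTL x)"

lemma heap_extends_trans: "heap_extends s t \<Longrightarrow> heap_extends t u \<Longrightarrow> heap_extends s u"
  by (auto simp: heap_extends_def)

lemma heap_extends_eq:
  "vars t xhp = vars s xhp \<Longrightarrow> arrs t aHD = arrs s aHD \<Longrightarrow> arrs t aTL = arrs s aTL \<Longrightarrow> heap_extends s t"
  by (simp add: heap_extends_def)

lemma list_at_extends: "list_at (arrs s aHD) (arrs s aTL) p xs \<Longrightarrow> p \<le> vars s xhp \<Longrightarrow> heap_extends s t \<Longrightarrow>
  list_at (arrs t aHD) (arrs t aTL) p xs"
proof (induction xs arbitrary: p)
  case (Cons x xs)
  then show ?case by (auto simp: heap_extends_def)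
qed simp

lemma heap_list_extends: "heap_list s p xs \<Longrightarrow> heap_extends s t \<Longrightarrow> heap_list t p xs"
  using list_at_extends by (auto simp: heap_extends_def)

definition revapp_step :: cmd where
  "revapp_step = When (Var xra) (
     xhp ::= Plus (Var xhp) (Num 1) ;;
     Write aHD (Var xhp) (Arr aHD (Var xra)) ;;
     Write aTL (Var xhp) (Var xrb) ;;
     xrb ::= Var xhp ;;
     xra ::= Arr aTL (Var xra))"

text \<open>The only list operation that joins require: the first list is copied in reverse onto the
  second, which is shared. This costs \<open>O(n)\<close> steps per table entry.\<close>

definition revapp :: cmd where "revapp = For xz xN revapp_step"

lemma revapp_frame [simp]: "assigned revapp = {xz, xhp, xrb, xra}" "written revapp = {aHD, aTL}"
  by (auto simp: revapp_def revapp_step_def)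

lemma revapp_correct:
  assumes A: "heap_list s (vars s xra) A" and B: "heap_list s (vars s xrb) B"
    and len: "length A \<le> vars s xN"
  shows "heap_list (sem revapp s) (vars (sem revapp s) xrb) (rev A @ B)" "heap_extends s (sem revapp s)"
proof -
  define I where "I k t \<longleftrightarrow> heap_extends s t \<and> heap_list t (vars t xra) (drop k A) \<and>
     heap_list t (vars t xrb) (rev (take k A) @ B)" for k t
  have "I (vars s xN) (sem (For xz xN revapp_step) s)"
  proof (rule sem_For_invariant)
    show "I 0 (set_var xz 0 s)" using A B by (simp add: I_def heap_extends_def)
  next
    fix k t assume I: "I k t"
    show "I (Suc k) (set_var xz (Suc k) (sem revapp_step t))"
    proof (cases "k < length A")
      case False
      then have "vars t xra = 0" using I by (simp add: I_def)
      then have "sem revapp_step t = t" by (simp add: revapp_step_def)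
      then show ?thesis using I False by (simp add: I_def heap_extends_def)
    next
      case True
      then have d: "drop k A = A ! k # drop (Suc k) A" "take (Suc k) A = take k A @ [A ! k]"
        by (simp_all add: Cons_nth_drop_Suc take_Suc_conv_app_nth)
      let ?h = "Suc (vars t xhp)" and ?t' = "sem revapp_step t"
      have ra: "vars t xra \<noteq> 0" "arrs t aHD (vars t xra) = A ! k" "arrs t aTL (vars t xra) < vars t xra"
        "list_at (arrs t aHD) (arrs t aTL) (arrs t aTL (vars t xra)) (drop (Suc k) A)" "vars t xra \<le> vars t xhp"
        using I unfolding I_def d by simp_all
      have res: "vars ?t' xhp = ?h" "arrs ?t' aHD = (arrs t aHD)(?h := A ! k)"
        "arrs ?t' aTL = (arrs t aTL)(?h := vars t xrb)" "vars ?t' xrb = ?h" "vars ?t' xra = arrs t aTL (vars t xra)"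
        using ra by (simp_all add: revapp_step_def)
      have ext: "heap_extends t ?t'" using res by (simp add: heap_extends_def)
      have "heap_list t (arrs t aTL (vars t xra)) (drop (Suc k) A)" using ra by simp
      from heap_list_extends[OF this ext] have 1: "heap_list ?t' (vars ?t' xra) (drop (Suc k) A)" using res by simp
      have rb: "heap_list t (vars t xrb) (rev (take k A) @ B)" using I by (simp add: I_def)
      have 2: "heap_list ?t' (vars ?t' xrb) (rev (take (Suc k) A) @ B)"
        using heap_list_extends[OF rb ext] rb res unfolding d by simp
      have "heap_extends s ?t'" using I ext heap_extends_trans unfolding I_def by blast
      then show ?thesis using 1 2 by (simp add: I_def heap_extends_def)
    qed
  qed (simp add: revapp_step_def)
  then show "heap_list (sem revapp s) (vars (sem revapp s) xrb) (rev A @ B)" "heap_extends s (sem revapp s)"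
    using len by (simp_all add: I_def revapp_def)
qed

section \<open>Dynamic programming\<close>

text \<open>Quotients, remainders and charges of all indices are tabulated by counting along,
  because the machine cannot divide.\<close>

definition index_tables :: cmd where
  "index_tables = xj ::= Num 0 ;; xk ::= Num 0 ;;
     For xq xQ (
       Write aJJ (Var xq) (Var xj) ;;
       Cond (AndE (Var xk) (NotE (Equal (Var xk) (Var xN))))
         (Cond (Equal (Var xj) (Num 1)) (Write aXX (Var xq) (Num 1)) (Write aXX (Var xq) (Num 2)))
         (Write aXX (Var xq) (Num 0)) ;;
       Cond (Equal (Var xj) (Num 2)) (xj ::= Num 0 ;; xk ::= Plus (Var xk) (Num 1))
         (xj ::= Plus (Var xj) (Num 1)))"

text \<open>A single list of copies of the node grows along the row and all entries point into it,
  so a row takes constant time per entry. The cost starts at 1 because of the shift of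
  entries.\<close>

definition initial_row_step :: cmd where
  "initial_row_step =
     Cond (LessEq (Var xk) (Arr aNC (Var xi)))
       (Write aTC (Plus (Var xBi) (Var xq)) (Var xc) ;; Write aTX (Plus (Var xBi) (Var xq)) (Var xra) ;;
        Write aTY (Plus (Var xBi) (Var xq)) (Num 0))
       (Write aTC (Plus (Var xBi) (Var xq)) (Num 0)) ;;
     Cond (Equal (Var xj) (Num 2))
       (xhp ::= Plus (Var xhp) (Num 1) ;; Write aHD (Var xhp) (Var xi) ;; Write aTL (Var xhp) (Var xra) ;;
        xra ::= Var xhp ;; xc ::= Plus (Var xc) (Arr aNW (Var xi)) ;;
        xj ::= Num 0 ;; xk ::= Plus (Var xk) (Num 1))
       (xj ::= Plus (Var xj) (Num 1))"

definition initial_row :: cmd where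
  "initial_row = Write aBS (Var xi) (Var xBi) ;; xra ::= Num 0 ;; xc ::= Num 1 ;; xj ::= Num 0 ;; xk ::= Num 0 ;;
     For xq xQ initial_row_step ;; xBi ::= Plus (Var xBi) (Var xQ)"

definition initial_tables :: cmd where
  "initial_tables = xhp ::= Num 0 ;; xBi ::= Num 0 ;; For xi xG initial_row"

definition lift_child :: cmd where
  "lift_child = For xq xQ (
     xc ::= Arr aTC (Plus (Var xBi) (Var xq)) ;; xv ::= Arr aXX (Var xq) ;;
     Cond (AndE (Var xc) (LessEq (Var xv) (Arr aEC (Var xi))))
       (When (Equal (Var xv) (Num 1)) (xc ::= Plus (Var xc) (Arr aEW (Var xi))) ;;
        When (Equal (Var xv) (Num 2)) (xc ::= Plus (Var xc) (Plus (Arr aEW (Var xi)) (Arr aEW (Var xi)))) ;;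
        Write aLC (Var xq) (Var xc))
       (Write aLC (Var xq) (Num 0)))"

definition find_best_step :: cmd where
  "find_best_step = When (AndE (LessEq (Var xb) (Var xa)) (AndE (LessEq (Arr aJJ (Var xb)) (Arr aJJ (Var xa)))
       (AndE (Arr aTC (Plus (Var xBp) (Var xb))) (Arr aLC (Minus (Var xa) (Var xb))))))
     (xc ::= Minus (Plus (Arr aTC (Plus (Var xBp) (Var xb))) (Arr aLC (Minus (Var xa) (Var xb)))) (Num 1) ;;
      When (NotE (AndE (Var xbest) (LessEq (Var xbest) (Var xc)))) (xbest ::= Var xc ;; xbq ::= Var xb))"

definition find_best :: cmd where
  "find_best = xbest ::= Num 0 ;; For xb xQ find_best_step"

text \<open>Arguments of \<open>revapp\<close> for the three cases of \<open>merge_tours\<close>.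
  With one end on each side nothing is reversed, so the first list is empty.\<close>

definition choose_lists :: cmd where
  "choose_lists = xv ::= Plus (Var xBp) (Var xbq) ;; xe ::= Plus (Var xBi) (Minus (Var xa) (Var xbq)) ;;
      Cond (NotE (Arr aJJ (Minus (Var xa) (Var xbq))))
        (xra ::= Arr aTX (Var xe) ;; xrb ::= Arr aTX (Var xv) ;; xny ::= Arr aTY (Var xv))
        (Cond (NotE (Arr aJJ (Var xbq)))
          (xra ::= Arr aTX (Var xv) ;; xrb ::= Arr aTX (Var xe) ;; xny ::= Arr aTY (Var xe))
          (xra ::= Num 0 ;; xrb ::= Arr aTX (Var xv) ;; xny ::= Arr aTX (Var xe)))"

definition build_entry :: cmd where
  "build_entry = When (Var xbest)
     (choose_lists ;; revapp ;;
      Write aTX (Plus (Var xBp) (Var xa)) (Var xrb) ;; Write aTY (Plus (Var xBp) (Var xa)) (Var xny)) ;;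
     Write aTC (Plus (Var xBp) (Var xa)) (Var xbest)"

text \<open>The table of the parent is overwritten in place. An entry depends on entries with
  indices up to its own, so the indices are treated from the largest to the smallest. Finding the
  best split and copying a list take \<open>O(n)\<close> steps, and there are \<open>O(n)\<close>
  entries.\<close>

definition merge_row_step :: cmd where
  "merge_row_step = xa ::= Minus (Minus (Var xQ) (Num 1)) (Var xq) ;; find_best ;; build_entry"

definition merge_row :: cmd where
  "merge_row = xBi ::= Arr aBS (Var xi) ;; xBp ::= Arr aBS (Arr aPR (Var xi)) ;; lift_child ;;
     For xq xQ merge_row_step"

definition merge_all :: cmd where "merge_all = For xi xg merge_row"

lemma dp_frames [simp]:
  "assigned index_tables = {xj, xk, xq}" "written index_tables = {aJJ, aXX}"
  "assigned initial_row_step = {xra, xc, xj, xk, xhp}" "written initial_row_step = {aTC, aTX, aTY, aHD, aTL}"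
  "assigned find_best_step = {xc, xbest, xbq}" "written find_best_step = {}"
  "assigned initial_row = {xra, xc, xj, xk, xq, xhp, xBi}"
  "written initial_row = {aBS, aTC, aTX, aTY, aHD, aTL}"
  "assigned initial_tables = {xra, xc, xj, xk, xq, xhp, xBi, xi}"
  "written initial_tables = {aBS, aTC, aTX, aTY, aHD, aTL}"
  "assigned lift_child = {xq, xc, xv}" "written lift_child = {aLC}"
  "assigned find_best = {xbest, xb, xc, xbq}" "written find_best = {}"
  "assigned build_entry = {xv, xe, xra, xrb, xny, xz, xhp}" "written build_entry = {aHD, aTL, aTX, aTY, aTC}"
  "assigned merge_row_step = {xa, xbest, xb, xc, xbq, xv, xe, xra, xrb, xny, xz, xhp}"
  "written merge_row_step = {aHD, aTL, aTX, aTY, aTC}"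
  "assigned merge_row = {xa, xbest, xb, xc, xbq, xv, xe, xra, xrb, xny, xz, xhp, xBi, xBp, xq}"
  "written merge_row = {aHD, aTL, aTX, aTY, aTC, aLC}"
  "assigned merge_all = {xi, xa, xbest, xb, xc, xbq, xv, xe, xra, xrb, xny, xz, xhp, xBi, xBp, xq}"
  "written merge_all = {aHD, aTL, aTX, aTY, aTC, aLC}"
  by (auto simp: index_tables_def initial_row_def initial_row_step_def initial_tables_def lift_child_def
    find_best_def find_best_step_def build_entry_def choose_lists_def merge_row_step_def merge_row_def merge_all_def)

lemma row_index_eq:
  fixes w :: nat
  assumes "q < w" "q' < w"
  shows "u * w + q = u' * w + q' \<longleftrightarrow> u = u' \<and> q = q'"
proof
  assume eq: "u * w + q = u' * w + q'"
  have "(u * w + q) div w = u" "(u' * w + q') div w = u'" using assms by simp_all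
  then show "u = u' \<and> q = q'" using eq by simp
qed simp

context tour_problem
begin

definition width :: nat where "width = 3 * (n + 1)"

lemma width_pos: "0 < width" by (simp add: width_def)

definition dp_data :: "store \<Rightarrow> bool" where
  "dp_data t \<longleftrightarrow> vars t xG = N \<and> vars t xg = N - 1 \<and> vars t xN = n \<and> vars t xQ = width \<and>
     (\<forall>r<N - 1. arrs t aPR r = P r \<and> arrs t aEC r = ec r \<and> arrs t aEW r = ew r) \<and>
     (\<forall>r<N. arrs t aNC r = cp r \<and> arrs t aNW r = nw r)"

lemma dp_data_cong:
  "dp_data s \<Longrightarrow> (\<And>v. v \<in> {xG, xg, xN, xQ} \<Longrightarrow> vars t v = vars s v) \<Longrightarrow>
   (\<And>a. a \<in> {aPR, aEC, aEW, aNC, aNW} \<Longrightarrow> arrs t a = arrs s a) \<Longrightarrow> dp_data t"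
  by (simp add: dp_data_def)

definition index_ok :: "store \<Rightarrow> bool" where
  "index_ok t \<longleftrightarrow> (\<forall>q<width. arrs t aJJ q = q mod 3 \<and> arrs t aXX q = charge n (q div 3) (q mod 3))"

definition entry :: "store \<Rightarrow> nat \<Rightarrow> nat \<Rightarrow> nat \<Rightarrow> bool" where
  "entry t i u q \<longleftrightarrow> (let x = u * width + q in arrs t aTC x \<noteq> 0 \<longrightarrow>
     (\<exists>X Y. heap_list t (arrs t aTX x) X \<and> heap_list t (arrs t aTY x) Y \<and> entry_ok i u q (arrs t aTC x) (X, Y)))"

lemma entry_cong:
  "entry s i u q \<Longrightarrow> heap_extends s t \<Longrightarrow> arrs t aTC (u * width + q) = arrs s aTC (u * width + q) \<Longrightarrow>
   arrs t aTX (u * width + q) = arrs s aTX (u * width + q) \<Longrightarrow>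
   arrs t aTY (u * width + q) = arrs s aTY (u * width + q) \<Longrightarrow> entry t i u q"
  unfolding entry_def Let_def using heap_list_extends[of s _ _ t] by metis

lemma Suc_div_mod_3:
  fixes q :: nat
  shows "Suc q div 3 = (if q mod 3 = 2 then Suc (q div 3) else q div 3)"
    "Suc q mod 3 = (if q mod 3 = 2 then 0 else Suc (q mod 3))"
  by (simp_all add: div_Suc mod_Suc)

lemma index_tables_correct:
  assumes "dp_data s"
  shows "index_ok (sem index_tables s)"
proof -
  let ?s1 = "sem (xj ::= Num 0 ;; xk ::= Num 0) s"
  obtain c where c: "index_tables = xj ::= Num 0 ;; xk ::= Num 0 ;; For xq xQ c"
      "c = Write aJJ (Var xq) (Var xj) ;;
       Cond (AndE (Var xk) (NotE (Equal (Var xk) (Var xN))))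
         (Cond (Equal (Var xj) (Num 1)) (Write aXX (Var xq) (Num 1)) (Write aXX (Var xq) (Num 2)))
         (Write aXX (Var xq) (Num 0)) ;;
       Cond (Equal (Var xj) (Num 2)) (xj ::= Num 0 ;; xk ::= Plus (Var xk) (Num 1))
         (xj ::= Plus (Var xj) (Num 1))"
    by (simp add: index_tables_def)
  define I where "I k t \<longleftrightarrow> vars t xj = k mod 3 \<and> vars t xk = k div 3 \<and>
    (\<forall>q<k. arrs t aJJ q = q mod 3 \<and> arrs t aXX q = charge n (q div 3) (q mod 3))" for k t
  have "I (vars ?s1 xQ) (sem (For xq xQ c) ?s1)"
  proof (rule sem_For_invariant)
    fix k t assume A: "I k t" "vars t xq = k" and F: "\<And>v. v \<notin> assigned (For xq xQ c) \<Longrightarrow> vars t v = vars ?s1 v"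
    have "vars t xN = n" using F[of xN] assms by (simp add: c dp_data_def)
    then show "I (Suc k) (set_var xq (Suc k) (sem c t))"
      using A by (auto simp: I_def c less_Suc_eq charge_def Suc_div_mod_3)
  qed (simp_all add: I_def c)
  moreover have "vars ?s1 xQ = width" using assms by (simp add: dp_data_def)
  ultimately show ?thesis by (simp add: index_ok_def I_def c)
qed

lemma initial_tables_correct:
  fixes s defines "t \<equiv> sem initial_tables s"
  assumes d: "dp_data s"
  shows "\<forall>u<N. (\<forall>q<width. entry t 0 u q) \<and> table_complete 0 u (\<lambda>q. arrs t aTC (u * width + q)) \<and>
    arrs t aBS u = u * width"
proof -
  define row where "row u t \<longleftrightarrow> (\<forall>q<width. entry t 0 u q \<and>
    (q div 3 \<le> cp u \<longrightarrow> arrs t aTC (u * width + q) = Suc (q div 3 * nw u)))" for u t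
  let ?s1 = "sem (xhp ::= Num 0 ;; xBi ::= Num 0) s"
  define I where "I k t \<longleftrightarrow> vars t xBi = k * width \<and> (\<forall>u<k. row u t \<and> arrs t aBS u = u * width)" for k t
  have "I (vars ?s1 xG) (sem (For xi xG initial_row) ?s1)"
  proof (rule sem_For_invariant)
    fix k t assume A: "k < vars ?s1 xG" "I k t" "vars t xi = k" and
      F: "\<And>v. v \<notin> assigned (For xi xG initial_row) \<Longrightarrow> vars t v = vars ?s1 v"
        "\<And>a. a \<notin> written initial_row \<Longrightarrow> arrs t a = arrs ?s1 a"
    have dt: "dp_data t" by (rule dp_data_cong[OF d]) (use F in auto)
    have k: "k < N" using A(1) d by (simp add: dp_data_def)
    let ?p = "Write aBS (Var xi) (Var xBi) ;; xra ::= Num 0 ;; xc ::= Num 1 ;; xj ::= Num 0 ;; xk ::= Num 0"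
    define t1 where "t1 = sem ?p t"
    have t1: "vars t1 xQ = width" "vars t1 xhp = vars t xhp" "arrs t1 aHD = arrs t aHD" "arrs t1 aTL = arrs t aTL"
      "arrs t1 aTC = arrs t aTC" "arrs t1 aTX = arrs t aTX" "arrs t1 aTY = arrs t aTY" "arrs t1 aBS = (arrs t aBS)(k := k * width)"
      "vars t1 xi = k" "vars t1 xBi = k * width" "vars t1 xra = 0" "vars t1 xc = 1" "vars t1 xj = 0" "vars t1 xk = 0"
      using dt A by (simp_all add: t1_def dp_data_def I_def)
    have d1: "dp_data t1" by (rule dp_data_cong[OF dt]) (auto simp: t1_def)
    define J where "J m r \<longleftrightarrow> heap_extends t r \<and> vars r xj = m mod 3 \<and> vars r xk = m div 3 \<and>
      heap_list r (vars r xra) (replicate (m div 3) k) \<and> vars r xc = Suc (m div 3 * nw k) \<and>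
      (\<forall>x. (\<forall>q<m. x \<noteq> k * width + q) \<longrightarrow> arrs r aTC x = arrs t aTC x \<and> arrs r aTX x = arrs t aTX x \<and> arrs r aTY x = arrs t aTY x) \<and>
      (\<forall>q<m. entry r 0 k q \<and> (q div 3 \<le> cp k \<longrightarrow> arrs r aTC (k * width + q) = Suc (q div 3 * nw k)))" for m r
    define t2 where "t2 = sem (For xq xQ initial_row_step) t1"
    have J: "J (vars t1 xQ) t2" unfolding t2_def
    proof (rule sem_For_invariant)
      show "J 0 (set_var xq 0 t1)" using t1 by (simp add: J_def heap_extends_def)
    next
      fix m r assume B: "m < vars t1 xQ" "J m r" "vars r xq = m" and
        G: "\<And>v. v \<notin> assigned (For xq xQ initial_row_step) \<Longrightarrow> vars r v = vars t1 v"
          "\<And>a. a \<notin> written initial_row_step \<Longrightarrow> arrs r a = arrs t1 a"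
      have m: "m < width" using B(1) t1 by simp
      have g: "vars r xi = k" "vars r xBi = k * width" "arrs r aNC k = cp k" "arrs r aNW k = nw k"
        using G(1)[of xi] G(1)[of xBi] G(2)[of aNC] G(2)[of aNW] t1 d1 k
        by (simp_all add: initial_row_step_def dp_data_def)
      let ?x = "k * width + m" and ?r' = "sem initial_row_step r" and ?last = "m mod 3 = 2"
      have j: "vars r xj = m mod 3" "vars r xk = m div 3" "vars r xc = Suc (m div 3 * nw k)"
        using B(2) by (simp_all add: J_def)
      have res: "arrs ?r' aTC = (arrs r aTC)(?x := if m div 3 \<le> cp k then Suc (m div 3 * nw k) else 0)"
        "arrs ?r' aTX = (if m div 3 \<le> cp k then (arrs r aTX)(?x := vars r xra) else arrs r aTX)"
        "arrs ?r' aTY = (if m div 3 \<le> cp k then (arrs r aTY)(?x := 0) else arrs r aTY)"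
        "vars ?r' xhp = (if ?last then Suc (vars r xhp) else vars r xhp)"
        "arrs ?r' aHD = (if ?last then (arrs r aHD)(Suc (vars r xhp) := k) else arrs r aHD)"
        "arrs ?r' aTL = (if ?last then (arrs r aTL)(Suc (vars r xhp) := vars r xra) else arrs r aTL)"
        "vars ?r' xra = (if ?last then Suc (vars r xhp) else vars r xra)"
        "vars ?r' xj = Suc m mod 3" "vars ?r' xk = Suc m div 3" "vars ?r' xc = Suc (Suc m div 3 * nw k)"
        using g j B(3) by (simp_all add: initial_row_step_def Suc_div_mod_3)
      have ext: "heap_extends r ?r'" using res by (simp add: heap_extends_def)
      have extt: "heap_extends t ?r'" using ext B(2) heap_extends_trans unfolding J_def by blast
      have hl: "heap_list r (vars r xra) (replicate (m div 3) k)" using B(2) by (simp add: J_def)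
      note hl' = heap_list_extends[OF hl ext]
      have ptr: "heap_list ?r' (vars ?r' xra) (replicate (Suc m div 3) k)"
      proof (cases ?last)
        case True
        then show ?thesis using hl' hl res by (simp add: Suc_div_mod_3)
      next
        case False
        then show ?thesis using hl' res by (simp add: Suc_div_mod_3)
      qed
      have new: "entry ?r' 0 k m"
      proof (cases "m div 3 \<le> cp k")
        case True
        have "entry_ok 0 k m (Suc (m div 3 * nw k)) (replicate (m div 3) k, [])"
          using entry_ok_initial[OF True] m by (simp add: width_def)
        moreover have "heap_list ?r' 0 []" by simp
        ultimately show ?thesis using True hl' res(1-3) unfolding entry_def Let_def
          by (intro impI exI[of _ "replicate (m div 3) k"] exI[of _ "[]"]) simp
      next
        case False
        then show ?thesis using res(1) by (simp add: entry_def)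
      qed
      have old: "entry ?r' 0 k q" if "q < m" for q
        by (rule entry_cong[OF _ ext]) (use B(2) that res(1-3) in \<open>auto simp: J_def\<close>)
      have tc: "q div 3 \<le> cp k \<longrightarrow> arrs ?r' aTC (k * width + q) = Suc (q div 3 * nw k)" if "q < Suc m" for q
        using B(2) that res(1) by (auto simp: J_def less_Suc_eq)
      have un: "arrs ?r' aTC x = arrs t aTC x \<and> arrs ?r' aTX x = arrs t aTX x \<and> arrs ?r' aTY x = arrs t aTY x"
        if "\<forall>q<Suc m. x \<noteq> k * width + q" for x
        using B(2) that res(1-3) by (auto simp: J_def less_Suc_eq)
      have "J (Suc m) ?r'" unfolding J_def using extt res(8-10) ptr new old tc un by (auto simp: less_Suc_eq)
      then show "J (Suc m) (set_var xq (Suc m) ?r')" by (simp add: J_def heap_extends_def entry_def)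
    qed (simp add: initial_row_step_def)
    have Jw: "J width t2" using J t1 by simp
    have t2: "vars t2 xBi = k * width" "arrs t2 aBS = (arrs t aBS)(k := k * width)" "vars t2 xQ = width"
      using t1 unfolding t2_def by (simp_all add: vars_sem arrs_sem)
    have eq: "sem initial_row t = sem (xBi ::= Plus (Var xBi) (Var xQ)) t2"
      by (simp add: initial_row_def t2_def t1_def)
    have "row u t2" if "u < Suc k" for u
    proof (cases "u = k")
      case True
      then show ?thesis using Jw by (simp add: row_def J_def)
    next
      case False
      have same: "arrs t2 aTC (u * width + q) = arrs t aTC (u * width + q) \<and> arrs t2 aTX (u * width + q) = arrs t aTX (u * width + q)
        \<and> arrs t2 aTY (u * width + q) = arrs t aTY (u * width + q)" if "q < width" for q
        using Jw row_index_eq[OF that, of _ u k] False unfolding J_def by blast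
      have ext: "heap_extends t t2" using Jw by (simp add: J_def)
      have "row u t" using A(2) that False by (simp add: I_def)
      then show ?thesis using same entry_cong[OF _ ext] unfolding row_def by auto
    qed
    then have "\<forall>u<Suc k. row u (set_var xi (Suc k) (sem initial_row t))"
      unfolding eq row_def entry_def by simp
    then show "I (Suc k) (set_var xi (Suc k) (sem initial_row t))"
      using A(2) t2 unfolding I_def eq by (auto simp: less_Suc_eq)
  qed (simp_all add: I_def)
  moreover have "sem (For xi xG initial_row) ?s1 = t" "vars ?s1 xG = N" using d by (simp_all add: t_def initial_tables_def dp_data_def)
  ultimately have "I N t" by simp
  then show ?thesis unfolding I_def row_def
    using table_complete_initial[of _ "\<lambda>q. arrs t aTC (_ * width + q)"] by (auto simp: width_def)
qed

end

definition solve_dp :: cmd where "solve_dp = index_tables ;; initial_tables ;; merge_all"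

context tour_problem
begin

lemma lift_child_correct:
  assumes d: "dp_data s" and ix: "index_ok s" and i: "vars s xi < N - 1" and Bi: "vars s xBi = vars s xi * width"
  shows "\<forall>q<width. arrs (sem lift_child s) aLC q = lifted (vars s xi) (\<lambda>q. arrs s aTC (vars s xi * width + q)) q"
proof -
  let ?i = "vars s xi" and ?T = "\<lambda>q. arrs s aTC (vars s xi * width + q)"
  obtain c where c: "lift_child = For xq xQ c" "c = (xc ::= Arr aTC (Plus (Var xBi) (Var xq)) ;; xv ::= Arr aXX (Var xq) ;;
     Cond (AndE (Var xc) (LessEq (Var xv) (Arr aEC (Var xi))))
       (When (Equal (Var xv) (Num 1)) (xc ::= Plus (Var xc) (Arr aEW (Var xi))) ;;
        When (Equal (Var xv) (Num 2)) (xc ::= Plus (Var xc) (Plus (Arr aEW (Var xi)) (Arr aEW (Var xi)))) ;;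
        Write aLC (Var xq) (Var xc))
       (Write aLC (Var xq) (Num 0)))" by (simp add: lift_child_def)
  define I where "I k t \<longleftrightarrow> (\<forall>q<k. arrs t aLC q = lifted ?i ?T q)" for k t
  have "I (vars s xQ) (sem (For xq xQ c) s)"
  proof (rule sem_For_invariant)
    fix k t assume A: "k < vars s xQ" "I k t" "vars t xq = k" and
      F: "\<And>v. v \<notin> assigned (For xq xQ c) \<Longrightarrow> vars t v = vars s v" "\<And>a. a \<notin> written c \<Longrightarrow> arrs t a = arrs s a"
    have k: "k < width" using A(1) d by (simp add: dp_data_def)
    have f: "vars t xi = ?i" "vars t xBi = ?i * width" "arrs t aTC = arrs s aTC" "arrs t aXX k = charge n (k div 3) (k mod 3)"
      "arrs t aEC ?i = ec ?i" "arrs t aEW ?i = ew ?i"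
      using F(1)[of xi] F(1)[of xBi] F(2)[of aTC] F(2)[of aXX] F(2)[of aEC] F(2)[of aEW] Bi ix d i k
      by (simp_all add: c index_ok_def dp_data_def)
    have ch: "charge n (k div 3) (k mod 3) = 0 \<or> charge n (k div 3) (k mod 3) = 1 \<or> charge n (k div 3) (k mod 3) = 2"
      by (simp add: charge_def)
    have "arrs (sem c t) aLC = (arrs t aLC)(k := lifted ?i ?T k)"
      using f A(3) ch by (auto simp: c lifted_def)
    then show "I (Suc k) (set_var xq (Suc k) (sem c t))" using A(2) by (simp add: I_def less_Suc_eq)
  qed (simp_all add: I_def c)
  then show ?thesis using d by (simp add: I_def c dp_data_def)
qed

lemma find_best_correct:
  fixes s
  defines "t \<equiv> sem find_best s" and "a \<equiv> vars s xa" and "T \<equiv> \<lambda>b. arrs s aTC (vars s xBp + b)" and "LC \<equiv> arrs s aLC"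
  defines "adm \<equiv> \<lambda>b. b \<le> a \<and> b mod 3 \<le> a mod 3 \<and> T b \<noteq> 0 \<and> LC (a - b) \<noteq> 0"
  assumes Q: "vars s xQ = width" and ix: "index_ok s" and a: "a < width"
  shows "vars t xbest \<noteq> 0 \<Longrightarrow> adm (vars t xbq) \<and> vars t xbest = T (vars t xbq) + LC (a - vars t xbq) - 1"
    and "\<And>b. adm b \<Longrightarrow> vars t xbest \<noteq> 0 \<and> vars t xbest \<le> T b + LC (a - b) - 1"
proof -
  let ?s1 = "sem (xbest ::= Num 0) s"
  define I where "I k t \<longleftrightarrow> (vars t xbest \<noteq> 0 \<longrightarrow> adm (vars t xbq) \<and> vars t xbest = T (vars t xbq) + LC (a - vars t xbq) - 1) \<and>
     (\<forall>b<k. adm b \<longrightarrow> vars t xbest \<noteq> 0 \<and> vars t xbest \<le> T b + LC (a - b) - 1)" for k t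
  have "I (vars ?s1 xQ) (sem (For xb xQ find_best_step) ?s1)"
  proof (rule sem_For_invariant)
    fix k t assume A: "k < vars ?s1 xQ" "I k t" "vars t xb = k" and
      F: "\<And>v. v \<notin> assigned (For xb xQ find_best_step) \<Longrightarrow> vars t v = vars ?s1 v" "\<And>a. a \<notin> written find_best_step \<Longrightarrow> arrs t a = arrs ?s1 a"
    have k: "k < width" using A(1) Q by simp
    have f: "vars t xa = a" "arrs t aTC (vars t xBp + k) = T k" "arrs t aLC = LC" "arrs t aJJ k = k mod 3" "arrs t aJJ a = a mod 3"
      using F(1)[of xa] F(1)[of xBp] F(2)[of aTC] F(2)[of aLC] F(2)[of aJJ] ix a k
      by (simp_all add: a_def T_def LC_def index_ok_def)
    let ?t' = "sem find_best_step t"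
    let ?c = "T k + LC (a - k) - 1"
    show "I (Suc k) (set_var xb (Suc k) ?t')"
    proof (cases "adm k")
      case False
      then have "?t' = t" using f A(3) by (auto simp: find_best_step_def adm_def)
      then show ?thesis using A(2) False by (auto simp: I_def less_Suc_eq)
    next
      case True
      then have pos: "?c \<noteq> 0" by (auto simp: adm_def)
      show ?thesis
      proof (cases "vars t xbest = 0 \<or> ?c < vars t xbest")
        case imp: True
        then have "vars ?t' xbest = ?c" "vars ?t' xbq = k"
          using f A(3) True by (auto simp: find_best_step_def adm_def)
        then show ?thesis using A(2) True pos imp by (fastforce simp: I_def less_Suc_eq)
      next
        case noimp: False
        then have "vars ?t' xbest = vars t xbest" "vars ?t' xbq = vars t xbq"
          using f A(3) True by (auto simp: find_best_step_def adm_def)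
        then show ?thesis using A(2) True pos noimp by (auto simp: I_def less_Suc_eq)
      qed
    qed
  qed (simp_all add: I_def)
  then have "I width t" using Q by (simp add: t_def find_best_def)
  then show "vars t xbest \<noteq> 0 \<Longrightarrow> adm (vars t xbq) \<and> vars t xbest = T (vars t xbq) + LC (a - vars t xbq) - 1"
    unfolding I_def by blast
  fix b assume "adm b"
  moreover from this have "b < width" using a by (simp add: adm_def)
  ultimately show "vars t xbest \<noteq> 0 \<and> vars t xbest \<le> T b + LC (a - b) - 1"
    using \<open>I width t\<close> unfolding I_def by blast
qed

lemma build_entry_correct:
  fixes s
  defines "t \<equiv> sem build_entry s" and "a \<equiv> vars s xa" and "b \<equiv> vars s xbq" and "i \<equiv> vars s xi"
  defines "T \<equiv> \<lambda>q. arrs s aTC (i * width + q)"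
  assumes N: "vars s xN = n" and ix: "index_ok s" and i: "i < N - 1" and a: "a < width"
    and B: "vars s xBi = i * width" "vars s xBp = P i * width"
    and best: "vars s xbest \<noteq> 0 \<Longrightarrow> b \<le> a \<and> b mod 3 \<le> a mod 3 \<and> arrs s aTC (P i * width + b) \<noteq> 0 \<and>
       lifted i T (a - b) \<noteq> 0 \<and> vars s xbest = arrs s aTC (P i * width + b) + lifted i T (a - b) - 1 \<and>
       entry s i (P i) b \<and> entry s i i (a - b)"
  shows "heap_extends s t" "entry t (Suc i) (P i) a" "arrs t aTC = (arrs s aTC)(P i * width + a := vars s xbest)"
    "\<And>x. x \<noteq> P i * width + a \<Longrightarrow> arrs t aTX x = arrs s aTX x \<and> arrs t aTY x = arrs s aTY x"
proof -
  let ?x = "P i * width + a"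
  have all: "heap_extends s t \<and> entry t (Suc i) (P i) a \<and> arrs t aTC = (arrs s aTC)(?x := vars s xbest) \<and>
    (\<forall>x. x \<noteq> ?x \<longrightarrow> arrs t aTX x = arrs s aTX x \<and> arrs t aTY x = arrs s aTY x)"
  proof (cases "vars s xbest = 0")
    case True
    then show ?thesis unfolding t_def build_entry_def using B
      by (simp add: heap_extends_def entry_def a_def)
  next
    case False
    note b = best[OF False]
    have "lifted i T (a - b) \<noteq> 0" using b by blast
    then have nz: "T (a - b) \<noteq> 0" by (auto simp: lifted_def split: if_splits)
    obtain X Y where A: "heap_list s (arrs s aTX (P i * width + b)) X" "heap_list s (arrs s aTY (P i * width + b)) Y"
      "entry_ok i (P i) b (arrs s aTC (P i * width + b)) (X, Y)"
      using b unfolding entry_def Let_def by blast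
    obtain X' Y' where A': "heap_list s (arrs s aTX (i * width + (a - b))) X'" "heap_list s (arrs s aTY (i * width + (a - b))) Y'"
      "entry_ok i i (a - b) (T (a - b)) (X', Y')"
      using b nz unfolding entry_def Let_def T_def by blast
    have eo: "entry_ok (Suc i) (P i) a (vars s xbest) (merge_tours (b mod 3) ((a - b) mod 3) (X, Y) (X', Y'))"
    proof -
      have "b + (a - b) = a" using b by simp
      then show ?thesis using entry_ok_merge[where T = T, OF i A(3) A'(3)] b a by (simp add: width_def)
    qed
    define j1 where "j1 = b mod 3"
    define j2 where "j2 = (a - b) mod 3"
    note eo = eo[folded j1_def j2_def]
    define s1 where "s1 = sem choose_lists s"
    have JJ: "arrs s aJJ (a - b) = j2" "arrs s aJJ b = j1" using ix a b by (auto simp: index_ok_def j1_def j2_def)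
    have len: "length X \<le> n" "length X' \<le> n" using A(3) A'(3) by (auto simp: entry_ok_def partial_tour_def)
    have s1: "arrs s1 = arrs s" "vars s1 xhp = vars s xhp" "vars s1 xN = n" "vars s1 xBp = P i * width" "vars s1 xa = a" "vars s1 xbest = vars s xbest"
      using N B by (simp_all add: s1_def choose_lists_def a_def)
    obtain Z1 Z2 where Z: "heap_list s (vars s1 xra) Z1" "heap_list s (vars s1 xrb) Z2" "length Z1 \<le> n"
      "heap_list s (vars s1 xny) (snd (merge_tours j1 j2 (X, Y) (X', Y')))"
      "rev Z1 @ Z2 = fst (merge_tours j1 j2 (X, Y) (X', Y'))"
    proof (cases "j2 = 0")
      case True
      then have "vars s1 xra = arrs s aTX (i * width + (a - b))" "vars s1 xrb = arrs s aTX (P i * width + b)" "vars s1 xny = arrs s aTY (P i * width + b)"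
        using JJ B by (simp_all add: s1_def choose_lists_def a_def[symmetric] b_def[symmetric])
      then show ?thesis by (intro that[of X' X]) (use A A' len True in \<open>simp_all add: merge_tours_def\<close>)
    next
      case nz2: False
      show ?thesis
      proof (cases "j1 = 0")
        case True
        then have "vars s1 xra = arrs s aTX (P i * width + b)" "vars s1 xrb = arrs s aTX (i * width + (a - b))" "vars s1 xny = arrs s aTY (i * width + (a - b))"
          using JJ B nz2 by (simp_all add: s1_def choose_lists_def a_def[symmetric] b_def[symmetric])
        then show ?thesis by (intro that[of X X']) (use A A' len True nz2 in \<open>simp_all add: merge_tours_def\<close>)
      next
        case False
        then have "vars s1 xra = 0" "vars s1 xrb = arrs s aTX (P i * width + b)" "vars s1 xny = arrs s aTX (i * width + (a - b))"
          using JJ B nz2 by (simp_all add: s1_def choose_lists_def a_def[symmetric] b_def[symmetric])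
        then show ?thesis by (intro that[of "[]" X]) (use A A' len False nz2 in \<open>simp_all add: merge_tours_def\<close>)
      qed
    qed
    have "heap_list s1 (vars s1 xra) Z1" "heap_list s1 (vars s1 xrb) Z2" "length Z1 \<le> vars s1 xN"
      using Z s1 by simp_all
    note rv = revapp_correct[OF this]
    define s2 where "s2 = sem revapp s1"
    have s2: "vars s2 xBp = P i * width" "vars s2 xa = a" "vars s2 xbest = vars s xbest" "vars s2 xny = vars s1 xny"
      "arrs s2 aTC = arrs s aTC" "arrs s2 aTX = arrs s aTX" "arrs s2 aTY = arrs s aTY"
      using s1 by (simp_all add: s2_def vars_sem arrs_sem)
    have ext1: "heap_extends s s1" using s1 by (simp add: heap_extends_def)
    have ext: "heap_extends s s2" using heap_extends_trans[OF ext1 rv(2)] by (simp add: s2_def)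
    have t: "t = Store (vars s2) ((arrs s2)(aTX := (arrs s aTX)(?x := vars s2 xrb), aTY := (arrs s aTY)(?x := vars s1 xny),
        aTC := (arrs s aTC)(?x := vars s xbest)))"
      using False s2 by (simp add: t_def build_entry_def s1_def[symmetric] s2_def[symmetric])
    have extt: "heap_extends s t" using ext unfolding t by (simp add: heap_extends_def)
    have "heap_list t (vars s2 xrb) (rev Z1 @ Z2)" using rv(1) unfolding t by (simp add: s2_def)
    moreover note heap_list_extends[OF Z(4) extt]
    ultimately have "entry t (Suc i) (P i) a"
      using eo unfolding entry_def Let_def Z(5) by (intro impI exI conjI) (auto simp: t)
    then show ?thesis using extt unfolding t by simp
  qed
  then show "heap_extends s t" "entry t (Suc i) (P i) a" "arrs t aTC = (arrs s aTC)(?x := vars s xbest)"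
    "\<And>x. x \<noteq> ?x \<Longrightarrow> arrs t aTX x = arrs s aTX x \<and> arrs t aTY x = arrs s aTY x" by blast+
qed

definition tables_ok :: "nat \<Rightarrow> store \<Rightarrow> bool" where
  "tables_ok i t \<longleftrightarrow> (\<forall>u. i \<le> u \<and> u < N \<longrightarrow> (\<forall>q<width. entry t i u q) \<and>
     table_complete i u (\<lambda>q. arrs t aTC (u * width + q)))"

lemma merge_row_correct:
  fixes s defines "t \<equiv> sem merge_row s"
  assumes d: "dp_data s" and ix: "index_ok s" and BS: "\<forall>u<N. arrs s aBS u = u * width"
    and i: "vars s xi = i" "i < N - 1" and tab: "tables_ok i s"
  shows "tables_ok (Suc i) t"
proof -
  define p where "p = P i"
  have p: "i < p" "p < N" using parent[OF i(2)] by (simp_all add: p_def)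
  define s1 where "s1 = sem (xBi ::= Arr aBS (Var xi) ;; xBp ::= Arr aBS (Arr aPR (Var xi))) s"
  define s2 where "s2 = sem lift_child s1"
  have s1: "arrs s1 = arrs s" "vars s1 xi = i" "vars s1 xBi = i * width" "vars s1 xBp = p * width" "vars s1 xhp = vars s xhp"
    using d BS i p by (simp_all add: s1_def dp_data_def p_def)
  have d1: "dp_data s1" by (rule dp_data_cong[OF d]) (auto simp: s1_def)
  have ix1: "index_ok s1" using ix s1 by (simp add: index_ok_def)
  define T where "T u q = arrs s aTC (u * width + q)" for u q
  have LC: "arrs s2 aLC q = lifted i (T i) q" if "q < width" for q
    using lift_child_correct[OF d1 ix1] i s1 that by (simp add: s2_def T_def[abs_def])
  have s2: "arrs s2 aTC = arrs s aTC" "arrs s2 aTX = arrs s aTX" "arrs s2 aTY = arrs s aTY" "arrs s2 aHD = arrs s aHD" "arrs s2 aTL = arrs s aTL"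
    "vars s2 xi = i" "vars s2 xBi = i * width" "vars s2 xBp = p * width" "vars s2 xhp = vars s xhp" "arrs s2 aJJ = arrs s aJJ" "arrs s2 aXX = arrs s aXX"
    using s1 by (simp_all add: s2_def vars_sem arrs_sem)
  have d2: "dp_data s2" by (rule dp_data_cong[OF d1]) (auto simp: s2_def vars_sem arrs_sem)
  have ext2: "heap_extends s s2" using s2 by (simp add: heap_extends_def)
  have ent: "entry s2 i u q" if "i \<le> u" "u < N" "q < width" for u q
    by (rule entry_cong[OF _ ext2]) (use tab that s2 in \<open>auto simp: tables_ok_def\<close>)
  define good where "good r q \<longleftrightarrow> entry r (Suc i) p q \<and> (\<forall>b. b \<le> q \<longrightarrow> b mod 3 \<le> q mod 3 \<longrightarrow> T p b \<noteq> 0 \<longrightarrow>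
      lifted i (T i) (q - b) \<noteq> 0 \<longrightarrow> arrs r aTC (p * width + q) \<noteq> 0 \<and>
      arrs r aTC (p * width + q) \<le> T p b + lifted i (T i) (q - b) - 1)" for r q
  \<comment> \<open>After \<open>k\<close> rounds the \<open>k\<close> largest indices of the parent
    hold new entries and the rest of the tables is as before.\<close>
  define I where "I k r \<longleftrightarrow> heap_extends s2 r \<and>
    (\<forall>u q. q < width \<longrightarrow> (u \<noteq> p \<or> q < width - k) \<longrightarrow> arrs r aTC (u * width + q) = T u q \<and>
       arrs r aTX (u * width + q) = arrs s2 aTX (u * width + q) \<and> arrs r aTY (u * width + q) = arrs s2 aTY (u * width + q)) \<and>
    (\<forall>q<width. width - k \<le> q \<longrightarrow> good r q)" for k r
  define s3 where "s3 = sem (For xq xQ merge_row_step) s2"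
  have "I (vars s2 xQ) s3" unfolding s3_def
  proof (rule sem_For_invariant)
    show "I 0 (set_var xq 0 s2)" by (simp add: I_def heap_extends_def s2 T_def)
  next
    fix k r assume A: "k < vars s2 xQ" "I k r" "vars r xq = k" and
      F: "\<And>v. v \<notin> assigned (For xq xQ merge_row_step) \<Longrightarrow> vars r v = vars s2 v" "\<And>a. a \<notin> written merge_row_step \<Longrightarrow> arrs r a = arrs s2 a"
    have k: "k < width" using A(1) d2 by (simp add: dp_data_def)
    define a where "a = width - 1 - k"
    have a: "a < width" "a = width - Suc k" using k by (auto simp: a_def)
    define r1 where "r1 = set_var xa a r"
    have r1: "arrs r1 = arrs r" "vars r1 xa = a" "vars r1 xQ = width" "vars r1 xBp = p * width" "vars r1 xBi = i * width" "vars r1 xi = i" "vars r1 xN = n" "vars r1 xhp = vars r xhp"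
      using F(1) s2 d2 by (simp_all add: r1_def dp_data_def)
    have ix1: "index_ok r1" using ix F(2)[of aJJ] F(2)[of aXX] s2 by (simp add: index_ok_def r1)
    have Tr: "arrs r aTC (p * width + b) = T p b" "arrs r aTC (i * width + b') = T i b'" if "b \<le> a" "b' < width" for b b'
      using A(2) that a k p unfolding I_def by auto
    have LCr: "arrs r1 aLC b = lifted i (T i) b" if "b < width" for b
      using F(2)[of aLC] LC[OF that] r1 by simp
    define r2 where "r2 = sem find_best r1"
    note fb = find_best_correct[of r1, folded r2_def, unfolded r1(2,4), OF r1(3) ix1 a(1)]
    have r2: "arrs r2 = arrs r" "vars r2 xa = a" "vars r2 xBp = p * width" "vars r2 xBi = i * width" "vars r2 xi = i" "vars r2 xN = n" "vars r2 xhp = vars r xhp"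
      using r1 by (simp_all add: r2_def vars_sem fun_eq_iff arrs_sem)
    have ix2: "index_ok r2" using ix1 by (simp add: index_ok_def r2 r1)
    have ext_r: "heap_extends s2 r2" using A(2) r2 by (simp add: I_def heap_extends_def)
    have best: "vars r2 xbq \<le> a \<and> vars r2 xbq mod 3 \<le> a mod 3 \<and> arrs r2 aTC (P i * width + vars r2 xbq) \<noteq> 0 \<and>
       lifted i (\<lambda>q. arrs r2 aTC (i * width + q)) (a - vars r2 xbq) \<noteq> 0 \<and>
       vars r2 xbest = arrs r2 aTC (P i * width + vars r2 xbq) + lifted i (\<lambda>q. arrs r2 aTC (i * width + q)) (a - vars r2 xbq) - 1 \<and>
       entry r2 i (P i) (vars r2 xbq) \<and> entry r2 i i (a - vars r2 xbq)" if "vars r2 xbest \<noteq> 0"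
    proof -
      let ?b = "vars r2 xbq"
      have b: "?b \<le> a" "?b mod 3 \<le> a mod 3" "T p ?b \<noteq> 0" "lifted i (T i) (a - ?b) \<noteq> 0" "vars r2 xbest = T p ?b + lifted i (T i) (a - ?b) - 1"
        using fb(1)[OF that] Tr(1)[of _ 0] LCr[of "a - ?b"] a width_pos r1 by auto
      have li: "lifted i (\<lambda>q. arrs r2 aTC (i * width + q)) (a - ?b) = lifted i (T i) (a - ?b)"
        using Tr(2)[of 0 "a - ?b"] a r2 by (simp add: lifted_def)
      have lt: "?b < width - k" "?b < width" "a - ?b < width" using b(1) a k by auto
      have oldr: "arrs r2 aTC (u * width + q) = arrs s2 aTC (u * width + q)"
        "arrs r2 aTX (u * width + q) = arrs s2 aTX (u * width + q)"
        "arrs r2 aTY (u * width + q) = arrs s2 aTY (u * width + q)" if "q < width" "u \<noteq> p \<or> q < width - k" for u q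
        using A(2) that unfolding I_def r2(1) s2(1) T_def by auto
      have "entry r2 i p ?b"
        by (rule entry_cong[OF ent[of p ?b] ext_r oldr]) (use p lt in auto)
      moreover have "entry r2 i i (a - ?b)"
        by (rule entry_cong[OF ent[of i "a - ?b"] ext_r oldr]) (use p lt in auto)
      ultimately show ?thesis using b li Tr(1)[of ?b 0] width_pos r2 by (simp add: p_def)
    qed
    define r3 where "r3 = sem build_entry r2"
    have r3eq: "sem merge_row_step r = r3"
      using F(1)[of xQ] d2 A(3) by (simp add: merge_row_step_def r3_def r2_def r1_def a_def dp_data_def)
    note be = build_entry_correct[of r2, folded r3_def, unfolded r2(2,5), OF r2(6) ix2 i(2) a(1) r2(4) r2(3)[unfolded p_def] best, folded p_def]
    have ext: "heap_extends r r3"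
    proof -
      have "heap_extends r r2" by (rule heap_extends_eq) (simp_all add: r2)
      then show ?thesis using be(1) heap_extends_trans by blast
    qed
    have other: "arrs r3 aTC (u * width + q) = arrs r aTC (u * width + q) \<and> arrs r3 aTX (u * width + q) = arrs r aTX (u * width + q) \<and>
      arrs r3 aTY (u * width + q) = arrs r aTY (u * width + q)" if "q < width" "u \<noteq> p \<or> q \<noteq> a" for u q
    proof -
      have "u * width + q \<noteq> p * width + a" using row_index_eq[OF that(1) a(1)] that(2) by blast
      then show ?thesis using be(3,4) r2(1) by simp
    qed
    have "I (Suc k) r3" unfolding I_def
    proof (intro conjI allI impI)
      show "heap_extends s2 r3" using A(2) ext heap_extends_trans unfolding I_def by blast
    next
      fix u q assume q: "q < width" "u \<noteq> p \<or> q < width - Suc k"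
      then have "u \<noteq> p \<or> q \<noteq> a" "u \<noteq> p \<or> q < width - k" using a by auto
      then show "arrs r3 aTC (u * width + q) = T u q" "arrs r3 aTX (u * width + q) = arrs s2 aTX (u * width + q)"
        "arrs r3 aTY (u * width + q) = arrs s2 aTY (u * width + q)"
        using other[of q u] A(2) q unfolding I_def by auto
    next
      fix q assume q: "q < width" "width - Suc k \<le> q"
      show "good r3 q"
      proof (cases "q = a")
        case True
        have "arrs r3 aTC (p * width + a) \<noteq> 0 \<and> arrs r3 aTC (p * width + a) \<le> T p b + lifted i (T i) (a - b) - 1"
          if b: "b \<le> a" "b mod 3 \<le> a mod 3" "T p b \<noteq> 0" "lifted i (T i) (a - b) \<noteq> 0" for b
          using fb(2)[of b] b Tr(1)[of b 0] LCr[of "a - b"] a width_pos be(3) r1 by simp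
        then show ?thesis using be(2) unfolding good_def True by blast
      next
        case False
        then have g: "good r q" using A(2) q a unfolding I_def by auto
        have "arrs r3 aTC (p * width + q) = arrs r aTC (p * width + q)" using other[OF q(1)] False by blast
        moreover have "entry r3 (Suc i) p q"
          by (rule entry_cong[OF _ ext]) (use g other[OF q(1), of p] False in \<open>auto simp: good_def\<close>)
        ultimately show ?thesis using g unfolding good_def by simp
      qed
    qed
    then show "I (Suc k) (set_var xq (Suc k) (sem merge_row_step r))"
      unfolding r3eq by (simp add: I_def heap_extends_def good_def entry_def)
  qed simp
  then have I: "I width s3" using d2 by (simp add: dp_data_def)
  have t: "t = s3" by (simp add: t_def merge_row_def s3_def s2_def s1_def)
  show ?thesis unfolding tables_ok_def
  proof (intro allI impI)
    fix u assume u: "Suc i \<le> u \<and> u < N"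
    show "(\<forall>q<width. entry t (Suc i) u q) \<and> table_complete (Suc i) u (\<lambda>q. arrs t aTC (u * width + q))"
    proof (cases "u = p")
      case True
      have g: "good t q" if "q < width" for q using I that unfolding I_def t by simp
      have "table_complete (Suc i) (P i) (\<lambda>q. arrs t aTC (p * width + q))"
      proof (rule table_complete_merge[OF i(2)])
        show "table_complete i (P i) (T p)" "table_complete i i (T i)" using tab p i(2) by (auto simp: tables_ok_def T_def[abs_def] p_def)
      next
        fix q b assume "q < 3 * (n + 1)" "b \<le> q" "b mod 3 \<le> q mod 3" "T p b \<noteq> 0" "lifted i (T i) (q - b) \<noteq> 0"
        then show "arrs t aTC (p * width + q) \<noteq> 0 \<and> arrs t aTC (p * width + q) \<le> T p b + lifted i (T i) (q - b) - 1"
          using g[of q] unfolding good_def width_def by blast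
      qed
      then show ?thesis using g True by (simp add: good_def p_def)
    next
      case False
      have m: "merged P (Suc i) u = merged P i u" using False by (simp add: p_def)
      have same: "arrs t aTC (u * width + q) = T u q" "arrs t aTX (u * width + q) = arrs s2 aTX (u * width + q)"
        "arrs t aTY (u * width + q) = arrs s2 aTY (u * width + q)" if "q < width" for q
        using I that False unfolding I_def t by auto
      have "entry t i u q" if "q < width" for q
        by (rule entry_cong[OF ent[of u q]]) (use I u that same[OF that] s2 in \<open>auto simp: I_def t T_def\<close>)
      then have "entry t (Suc i) u q" if "q < width" for q
        using that m unfolding entry_def entry_ok_def by simp
      moreover have "table_complete i u (T u)" using tab u by (simp add: tables_ok_def T_def[abs_def])
      then have "table_complete (Suc i) u (\<lambda>q. arrs t aTC (u * width + q))"
        using same(1) tour_index_less unfolding table_complete_def m feasible_tour_def width_def[symmetric] by simp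
      ultimately show ?thesis by blast
    qed
  qed
qed

lemma merge_all_correct:
  assumes d: "dp_data s" and ix: "index_ok s" and BS: "\<forall>u<N. arrs s aBS u = u * width" and tab: "tables_ok 0 s"
  shows "tables_ok (N - 1) (sem merge_all s)"
proof -
  have "tables_ok (vars s xg) (sem (For xi xg merge_row) s)"
  proof (rule sem_For_invariant)
    show "tables_ok 0 (set_var xi 0 s)" using tab by (simp add: tables_ok_def entry_def)
  next
    fix k t assume A: "k < vars s xg" "tables_ok k t" "vars t xi = k" and
      F: "\<And>v. v \<notin> assigned (For xi xg merge_row) \<Longrightarrow> vars t v = vars s v" "\<And>a. a \<notin> written merge_row \<Longrightarrow> arrs t a = arrs s a"
    have dt: "dp_data t" by (rule dp_data_cong[OF d]) (use F in auto)
    have "index_ok t" "\<forall>u<N. arrs t aBS u = u * width" using ix BS F(2) by (simp_all add: index_ok_def)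
    moreover have "k < N - 1" using A(1) d by (simp add: dp_data_def)
    ultimately have "tables_ok (Suc k) (sem merge_row t)" using merge_row_correct[OF dt _ _ A(3) _ A(2)] by blast
    then show "tables_ok (Suc k) (set_var xi (Suc k) (sem merge_row t))" by (simp add: tables_ok_def entry_def)
  qed simp
  then show ?thesis using d by (simp add: merge_all_def dp_data_def)
qed

text \<open>At index \<open>3 * n + 2\<close> all nodes and both ends lie below the root. There the
  tour behind the entry is itself subject to the lower bound, so its cost is exactly the recorded
  one.\<close>

lemma solve_dp_correct:
  assumes d: "dp_data s"
  defines "t \<equiv> sem solve_dp s" and "x \<equiv> (N - 1) * width + (3 * n + 2)"
  shows "feasible_tour L \<Longrightarrow> arrs t aTC x \<noteq> 0 \<and> arrs t aTC x - 1 \<le> tour_cost L"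
    and "arrs t aTC x \<noteq> 0 \<Longrightarrow> \<exists>X Y. heap_list t (arrs t aTX x) X \<and> heap_list t (arrs t aTY x) Y \<and>
       feasible_tour (rev X @ Y) \<and> tour_cost (rev X @ Y) = arrs t aTC x - 1"
    and "arrs t aBS (N - 1) = (N - 1) * width"
proof -
  define s1 where "s1 = sem index_tables s"
  define s2 where "s2 = sem initial_tables s1"
  have t: "t = sem merge_all s2" by (simp add: t_def solve_dp_def s2_def s1_def)
  have ix1: "index_ok s1" using index_tables_correct[OF d] by (simp add: s1_def)
  have d1: "dp_data s1" by (rule dp_data_cong[OF d]) (auto simp: s1_def vars_sem arrs_sem)
  have d2: "dp_data s2" by (rule dp_data_cong[OF d1]) (auto simp: s2_def vars_sem arrs_sem)
  have ix2: "index_ok s2" using ix1 by (simp add: s2_def index_ok_def arrs_sem)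
  note init = initial_tables_correct[OF d1, folded s2_def]
  have tab: "tables_ok (N - 1) t" unfolding t
    by (rule merge_all_correct[OF d2 ix2]) (use init in \<open>auto simp: tables_ok_def\<close>)
  have last: "3 * n + 2 < width" by (simp add: width_def)
  have e: "entry t (N - 1) (N - 1) (3 * n + 2)" and tc: "table_complete (N - 1) (N - 1) (\<lambda>q. arrs t aTC ((N - 1) * width + q))"
    using tab last N_pos unfolding tables_ok_def by auto
  show opt: "arrs t aTC x \<noteq> 0 \<and> arrs t aTC x - 1 \<le> tour_cost L" if "feasible_tour L" for L
    using table_complete_root[OF tc that] unfolding x_def by blast
  show "\<exists>X Y. heap_list t (arrs t aTX x) X \<and> heap_list t (arrs t aTY x) Y \<and>
       feasible_tour (rev X @ Y) \<and> tour_cost (rev X @ Y) = arrs t aTC x - 1" if nz: "arrs t aTC x \<noteq> 0"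
  proof -
    obtain X Y where XY: "heap_list t (arrs t aTX x) X" "heap_list t (arrs t aTY x) Y"
      "entry_ok (N - 1) (N - 1) (3 * n + 2) (arrs t aTC x) (X, Y)"
      using e nz unfolding entry_def Let_def x_def[symmetric] by blast
    then show ?thesis using entry_ok_root[OF XY(3)] opt[of "rev X @ Y"] by (meson le_antisym)
  qed
  show "arrs t aBS (N - 1) = (N - 1) * width" using init N_pos by (simp add: t arrs_sem)
qed

end

section \<open>From encoded instances to arranged trees\<close>

section \<open>Layout of the input\<close>

text \<open>\<open>X i\<close> is the number at position \<open>i\<close> of an encoded instance.\<close>

definition virt_edges :: "(nat \<Rightarrow> nat) \<Rightarrow> nat" where "virt_edges X = X 1"
definition subs_pos :: "(nat \<Rightarrow> nat) \<Rightarrow> nat" where "subs_pos X = 2 + 2 * virt_edges X"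
definition subs_nodes :: "(nat \<Rightarrow> nat) \<Rightarrow> nat" where "subs_nodes X = X (subs_pos X)"
definition edge_pos :: "(nat \<Rightarrow> nat) \<Rightarrow> nat" where "edge_pos X = subs_pos X + 1 + 2 * subs_nodes X"
definition subs_edges :: "(nat \<Rightarrow> nat) \<Rightarrow> nat" where "subs_edges X = X (edge_pos X)"

definition virt_edge :: "(nat \<Rightarrow> nat) \<Rightarrow> nat \<Rightarrow> nat set" where
  "virt_edge X i = {X (2 + 2 * i), X (2 + 2 * i + 1)}"
definition subs_edge :: "(nat \<Rightarrow> nat) \<Rightarrow> nat \<Rightarrow> nat set" where
  "subs_edge X i = {X (edge_pos X + 1 + 4 * i), X (edge_pos X + 1 + 4 * i + 1)}"

text \<open>Stated for the array in memory instead of a list, since the array of the decision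
  procedure contains other numbers after the instance.\<close>

definition input_matches :: "(nat \<Rightarrow> nat) \<Rightarrow> (nat, nat) cvne \<Rightarrow> bool" where
  "input_matches X I \<longleftrightarrow> VR I = {..<X 0} \<and> VS I = {..<subs_nodes X} \<and>
     inj_on (virt_edge X) {..<virt_edges X} \<and> ER I = virt_edge X ` {..<virt_edges X} \<and>
     inj_on (subs_edge X) {..<subs_edges X} \<and> ES I = subs_edge X ` {..<subs_edges X} \<and>
     (\<forall>u<subs_nodes X. node_cap I u = X (subs_pos X + 1 + 2 * u) \<and> node_cost I u = X (subs_pos X + 1 + 2 * u + 1)) \<and>
     (\<forall>i<subs_edges X. edge_cap I (subs_edge X i) = X (edge_pos X + 1 + 4 * i + 2) \<and>
        edge_cost I (subs_edge X i) = X (edge_pos X + 1 + 4 * i + 3))"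

text \<open>The arithmetic conditions under which the programs can be run. Whether the graphs are a
  path and a tree is found out by running them.\<close>

definition raw_ok :: "(nat \<Rightarrow> nat) \<Rightarrow> bool" where
  "raw_ok X \<longleftrightarrow> 0 < X 0 \<and> virt_edges X = X 0 - 1 \<and> 0 < subs_nodes X \<and> subs_edges X = subs_nodes X - 1 \<and>
     (\<forall>e<virt_edges X. virt_edge X e \<subseteq> {..<X 0}) \<and> (\<forall>e<subs_edges X. subs_edge X e \<subseteq> {..<subs_nodes X})"

lemma concat_blocks:
  assumes "\<And>x. x \<in> set xs \<Longrightarrow> length (f x) = k"
  shows "length (concat (map f xs)) = k * length xs"
    and "i < length xs \<Longrightarrow> r < k \<Longrightarrow> concat (map f xs) ! (k * i + r) = f (xs ! i) ! r"
  using assms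
proof (induction xs arbitrary: i)
  case (Cons x xs)
  {
    case 1
    then show ?case using Cons.IH(1) by simp
  next
    case 2
    show ?case
    proof (cases i)
      case 0
      then show ?thesis using 2 by (simp add: nth_append)
    next
      case (Suc i')
      have "concat (map f xs) ! (k * i' + r) = f (xs ! i') ! r" using Cons.IH(2)[of i'] 2 Suc by simp
      moreover have "k * Suc i' + r = length (f x) + (k * i' + r)" using 2 by simp
      ultimately show ?thesis by (simp only: Suc list.map concat.simps nth_append_length_plus nth_Cons_Suc)
    qed
  }
qed auto

lemma lists_edges_nth:
  assumes "lists_edges es E"
  shows "inj_on (\<lambda>i. {fst (es ! i), snd (es ! i)}) {..<length es}"
    "E = (\<lambda>i. {fst (es ! i), snd (es ! i)}) ` {..<length es}"
proof -
  have eq: "map (\<lambda>(u, v). {u, v}) es = map (\<lambda>i. {fst (es ! i), snd (es ! i)}) [0..<length es]"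
    by (rule nth_equalityI) (auto simp: case_prod_beta)
  show "inj_on (\<lambda>i. {fst (es ! i), snd (es ! i)}) {..<length es}"
    "E = (\<lambda>i. {fst (es ! i), snd (es ! i)}) ` {..<length es}"
    using assms unfolding lists_edges_def eq distinct_map set_map by (auto simp: atLeast0LessThan)
qed

lemma encodes_matches:
  assumes "encodes_cvne xs I" and X: "\<And>i. i < length xs \<Longrightarrow> X i = xs ! i"
  shows "input_matches X I" "length xs = edge_pos X + 1 + 4 * subs_edges X"
proof -
  obtain nr ns vs es where e: "VR I = {..<nr}" "VS I = {..<ns}" "lists_edges vs (ER I)" "lists_edges es (ES I)"
    "xs = [nr, length vs] @ concat (map (\<lambda>(a, b). [a, b]) vs) @
             [ns] @ concat (map (\<lambda>u. [node_cap I u, node_cost I u]) [0..<ns]) @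
             [length es] @
             concat (map (\<lambda>(u, v). [u, v, edge_cap I {u, v}, edge_cost I {u, v}]) es)"
    using assms(1) unfolding encodes_cvne_def by blast
  define A where "A = concat (map (\<lambda>(a, b). [a, b]) vs)"
  define B where "B = concat (map (\<lambda>u. [node_cap I u, node_cost I u]) [0..<ns])"
  define C where "C = concat (map (\<lambda>(u, v). [u, v, edge_cap I {u, v}, edge_cost I {u, v}]) es)"
  have xs: "xs = nr # length vs # A @ ns # B @ length es # C" using e(5) by (simp add: A_def B_def C_def)
  have lA: "length A = 2 * length vs" unfolding A_def by (rule concat_blocks) auto
  have lB: "length B = 2 * ns" unfolding B_def using concat_blocks(1)[of "[0..<ns]" "\<lambda>u. [node_cap I u, node_cost I u]" 2] by simp
  have lC: "length C = 4 * length es" unfolding C_def by (rule concat_blocks) auto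
  have nA: "A ! (2 * i) = fst (vs ! i)" "A ! (2 * i + 1) = snd (vs ! i)" if "i < length vs" for i
    using concat_blocks(2)[of vs "\<lambda>(a, b). [a, b]" 2 i 0] concat_blocks(2)[of vs "\<lambda>(a, b). [a, b]" 2 i 1] that
    by (auto simp: A_def case_prod_beta)
  have nB: "B ! (2 * u) = node_cap I u" "B ! (2 * u + 1) = node_cost I u" if "u < ns" for u
    using concat_blocks(2)[of "[0..<ns]" "\<lambda>u. [node_cap I u, node_cost I u]" 2 u 0]
      concat_blocks(2)[of "[0..<ns]" "\<lambda>u. [node_cap I u, node_cost I u]" 2 u 1] that
    by (auto simp: B_def)
  let ?f = "\<lambda>(u, v). [u, v, edge_cap I {u, v}, edge_cost I {u, v}]"
  have nC: "C ! (4 * i) = fst (es ! i)" "C ! (4 * i + 1) = snd (es ! i)"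
    "C ! (4 * i + 2) = edge_cap I {fst (es ! i), snd (es ! i)}" "C ! (4 * i + 3) = edge_cost I {fst (es ! i), snd (es ! i)}"
    if "i < length es" for i
    using concat_blocks(2)[of es ?f 4 i 0] concat_blocks(2)[of es ?f 4 i 1]
      concat_blocks(2)[of es ?f 4 i 2] concat_blocks(2)[of es ?f 4 i 3] that
    by (auto simp: C_def case_prod_beta numeral_2_eq_2 numeral_3_eq_3)
  have len: "length xs = 4 + 2 * length vs + 2 * ns + 4 * length es" using xs lA lB lC by simp
  have 0: "X 0 = nr" "X 1 = length vs" using X[of 0] X[of 1] len xs by auto
  have XA: "X (2 + j) = A ! j" if "j < 2 * length vs" for j
    using X[of "2 + j"] that len lA by (simp add: xs nth_append)
  have ve: "virt_edges X = length vs" using 0 by (simp add: virt_edges_def)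
  have sp: "subs_pos X = 2 + 2 * length vs" using ve by (simp add: subs_pos_def)
  have sn: "subs_nodes X = ns" using X[of "2 + 2 * length vs"] len lA by (simp add: subs_nodes_def sp xs nth_append)
  have XB: "X (subs_pos X + 1 + j) = B ! j" if "j < 2 * ns" for j
  proof -
    have "xs ! (2 + 2 * length vs + 1 + j) = (ns # B @ length es # C) ! Suc j"
      using lA by (simp add: xs nth_append)
    then show ?thesis using X[of "2 + 2 * length vs + 1 + j"] that len lB by (simp add: sp nth_append)
  qed
  have ep: "edge_pos X = 3 + 2 * length vs + 2 * ns" by (simp add: edge_pos_def sp sn)
  have Xe: "X (edge_pos X + j) = (length es # C) ! j" if "j < 1 + 4 * length es" for j
  proof -
    have "xs ! (3 + 2 * length vs + 2 * ns + j) = (ns # B @ length es # C) ! Suc (2 * ns + j)"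
      using lA by (simp add: xs nth_append)
    also have "\<dots> = (length es # C) ! j" using lB by (simp add: nth_append)
    finally show ?thesis using X[of "3 + 2 * length vs + 2 * ns + j"] that len by (simp add: ep)
  qed
  have se: "subs_edges X = length es" using Xe[of 0] by (simp add: subs_edges_def)
  have XC: "X (edge_pos X + 1 + j) = C ! j" if "j < 4 * length es" for j
    using Xe[of "1 + j"] that by (simp add: add.assoc)
  have v: "virt_edge X i = {fst (vs ! i), snd (vs ! i)}" if "i < length vs" for i
    using XA[of "2 * i"] XA[of "2 * i + 1"] nA[OF that] that by (simp add: virt_edge_def)
  have s: "subs_edge X i = {fst (es ! i), snd (es ! i)}" if "i < length es" for i
    using XC[of "4 * i"] XC[of "4 * i + 1"] nC[OF that] that by (simp add: subs_edge_def)
  have "inj_on (virt_edge X) {..<length vs}" "virt_edge X ` {..<length vs} = ER I"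
    using lists_edges_nth[OF e(3)] v inj_on_cong[of "{..<length vs}" "virt_edge X" "\<lambda>i. {fst (vs ! i), snd (vs ! i)}"]
      image_cong[of "{..<length vs}" _ "virt_edge X" "\<lambda>i. {fst (vs ! i), snd (vs ! i)}"] by auto
  moreover have "inj_on (subs_edge X) {..<length es}" "subs_edge X ` {..<length es} = ES I"
    using lists_edges_nth[OF e(4)] s inj_on_cong[of "{..<length es}" "subs_edge X" "\<lambda>i. {fst (es ! i), snd (es ! i)}"]
      image_cong[of "{..<length es}" _ "subs_edge X" "\<lambda>i. {fst (es ! i), snd (es ! i)}"] by auto
  moreover have "node_cap I u = X (subs_pos X + 1 + 2 * u) \<and> node_cost I u = X (subs_pos X + 1 + 2 * u + 1)" if "u < ns" for u
    using XB[of "2 * u"] XB[of "2 * u + 1"] nB[OF that] that by (simp add: add.assoc)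
  moreover have "edge_cap I (subs_edge X i) = X (edge_pos X + 1 + 4 * i + 2) \<and>
        edge_cost I (subs_edge X i) = X (edge_pos X + 1 + 4 * i + 3)" if "i < length es" for i
    using XC[of "4 * i + 2"] XC[of "4 * i + 3"] nC[OF that] that s[OF that] by (simp add: add.assoc)
  ultimately show "input_matches X I" using e(1,2) 0 sn ve se by (auto simp: input_matches_def)
  show "length xs = edge_pos X + 1 + 4 * subs_edges X" using len ep se by simp
qed

lemma blocks_of_list:
  "length zs = k * m \<Longrightarrow> zs = concat (map (\<lambda>i. take k (drop (k * i) zs)) [0..<m])"
proof (induction m arbitrary: zs)
  case (Suc m)
  have "drop k zs = concat (map (\<lambda>i. take k (drop (k * i) (drop k zs))) [0..<m])"
    by (rule Suc.IH) (use Suc.prems in simp)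
  moreover have "[0..<Suc m] = 0 # map Suc [0..<m]" by (simp add: upt_conv_Cons map_Suc_upt del: upt_Suc)
  ultimately show ?case using append_take_drop_id[of k zs] by (simp add: comp_def add.commute del: upt_Suc)
qed simp

lemma take_drop_nth: "i + k \<le> length zs \<Longrightarrow> take k (drop i zs) = map (\<lambda>r. zs ! (i + r)) [0..<k]"
  by (rule nth_equalityI) auto

lemma segment_blocks:
  "a + k * m \<le> length zs \<Longrightarrow>
   take (k * m) (drop a zs) = concat (map (\<lambda>i. map (\<lambda>r. zs ! (a + k * i + r)) [0..<k]) [0..<m])"
proof -
  assume len: "a + k * m \<le> length zs"
  let ?z = "take (k * m) (drop a zs)"
  have "?z = concat (map (\<lambda>i. take k (drop (k * i) ?z)) [0..<m])" by (rule blocks_of_list) (use len in simp)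
  also have "map (\<lambda>i. take k (drop (k * i) ?z)) [0..<m] = map (\<lambda>i. map (\<lambda>r. zs ! (a + k * i + r)) [0..<k]) [0..<m]"
  proof (rule map_cong[OF refl])
    fix i assume "i \<in> set [0..<m]"
    then have "Suc i \<le> m" by simp
    then have "k * Suc i \<le> k * m" by (rule mult_le_mono2)
    then have "k * i + k \<le> k * m" by simp
    then show "take k (drop (k * i) ?z) = map (\<lambda>r. zs ! (a + k * i + r)) [0..<k]"
      using len by (subst take_drop_nth) (auto simp: add.assoc)
  qed
  finally show ?thesis .
qed

text \<open>The list is cut into its segments and edges are taken in the order and orientation in
  which they stand. The decision procedure needs this to turn acceptance into membership in the
  language.\<close>

lemma matches_encodes:
  assumes m: "input_matches X I" and len: "length xs = edge_pos X + 1 + 4 * subs_edges X"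
    and X: "\<And>i. i < length xs \<Longrightarrow> X i = xs ! i"
  shows "encodes_cvne xs I"
proof -
  define vs where "vs = map (\<lambda>i. (X (2 + 2 * i), X (2 + 2 * i + 1))) [0..<virt_edges X]"
  define es where "es = map (\<lambda>i. (X (edge_pos X + 1 + 4 * i), X (edge_pos X + 1 + 4 * i + 1))) [0..<subs_edges X]"
  have "lists_edges vs (ER I)" "lists_edges es (ES I)"
    using m by (auto simp: lists_edges_def vs_def es_def comp_def distinct_map atLeast0LessThan input_matches_def
      virt_edge_def[abs_def] subs_edge_def[abs_def])
  moreover have "xs = [X 0, length vs] @ concat (map (\<lambda>(a, b). [a, b]) vs) @
             [subs_nodes X] @ concat (map (\<lambda>u. [node_cap I u, node_cost I u]) [0..<subs_nodes X]) @
             [length es] @ concat (map (\<lambda>(u, v). [u, v, edge_cap I {u, v}, edge_cost I {u, v}]) es)"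
  proof -
    have ep: "edge_pos X = 3 + 2 * virt_edges X + 2 * subs_nodes X" and sp: "subs_pos X = 2 + 2 * virt_edges X"
      by (simp_all add: edge_pos_def subs_pos_def)
    have l2: "[0..<2] = [0, 1::nat]" and l4: "[0..<4] = [0, 1, 2, 3::nat]" by (simp_all add: upt_rec)
    have "concat (map (\<lambda>(a, b). [a, b]) vs) = concat (map (\<lambda>i. map (\<lambda>r. xs ! (2 + 2 * i + r)) [0..<2]) [0..<virt_edges X])"
      unfolding vs_def l2 map_map by (intro arg_cong[of _ _ concat] map_cong refl) (use len ep in \<open>auto simp: X\<close>)
    then have 1: "concat (map (\<lambda>(a, b). [a, b]) vs) = take (2 * virt_edges X) (drop 2 xs)"
      using segment_blocks[of 2 2 "virt_edges X" xs] len ep by simp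
    have "concat (map (\<lambda>u. [node_cap I u, node_cost I u]) [0..<subs_nodes X]) =
      concat (map (\<lambda>i. map (\<lambda>r. xs ! (subs_pos X + 1 + 2 * i + r)) [0..<2]) [0..<subs_nodes X])"
      unfolding l2 by (intro arg_cong[of _ _ concat] map_cong refl) (use len ep sp m in \<open>auto simp: X input_matches_def\<close>)
    then have 2: "concat (map (\<lambda>u. [node_cap I u, node_cost I u]) [0..<subs_nodes X]) = take (2 * subs_nodes X) (drop (subs_pos X + 1) xs)"
      using segment_blocks[of "subs_pos X + 1" 2 "subs_nodes X" xs] len ep sp by simp
    have "concat (map (\<lambda>(u, v). [u, v, edge_cap I {u, v}, edge_cost I {u, v}]) es) =
      concat (map (\<lambda>i. map (\<lambda>r. xs ! (edge_pos X + 1 + 4 * i + r)) [0..<4]) [0..<subs_edges X])"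
      unfolding l4 es_def map_map by (intro arg_cong[of _ _ concat] map_cong refl)
        (use len m in \<open>auto simp: X input_matches_def subs_edge_def\<close>)
    also have "\<dots> = take (4 * subs_edges X) (drop (edge_pos X + 1) xs)"
      by (rule segment_blocks[symmetric]) (use len in simp)
    finally have 3: "concat (map (\<lambda>(u, v). [u, v, edge_cap I {u, v}, edge_cost I {u, v}]) es) =
      take (4 * subs_edges X) (drop (edge_pos X + 1) xs)" .
    have split: "drop j xs = take l (drop j xs) @ drop (j + l) xs" for j l
      by (metis append_take_drop_id drop_drop add.commute)
    have Cons: "drop j xs = X j # drop (Suc j) xs" if "j < length xs" for j
      using that by (simp add: X Cons_nth_drop_Suc)
    have "xs = drop 0 xs" by simp
    also have "drop 0 xs = X 0 # drop (Suc 0) xs" by (rule Cons) (use len in simp)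
    also have "drop (Suc 0) xs = virt_edges X # drop 2 xs"
      unfolding virt_edges_def One_nat_def numeral_2_eq_2 by (rule Cons) (use len ep in simp)
    also have "drop 2 xs = take (2 * virt_edges X) (drop 2 xs) @ drop (subs_pos X) xs"
      using split[of 2 "2 * virt_edges X"] by (simp add: sp)
    also have "drop (subs_pos X) xs = X (subs_pos X) # drop (subs_pos X + 1) xs"
      unfolding Suc_eq_plus1[symmetric] by (rule Cons) (use len ep sp in simp)
    also have "drop (subs_pos X + 1) xs = take (2 * subs_nodes X) (drop (subs_pos X + 1) xs) @ drop (edge_pos X) xs"
      using split[of "subs_pos X + 1" "2 * subs_nodes X"] by (simp add: edge_pos_def)
    also have "drop (edge_pos X) xs = X (edge_pos X) # drop (edge_pos X + 1) xs"
      unfolding Suc_eq_plus1[symmetric] by (rule Cons) (use len in simp)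
    also have "drop (edge_pos X + 1) xs = take (4 * subs_edges X) (drop (edge_pos X + 1) xs)"
      using len by simp
    finally show ?thesis unfolding 1 2 3
      by (simp add: vs_def es_def subs_nodes_def[symmetric] subs_edges_def[symmetric])
  qed
  moreover have "VR I = {..<X 0}" "VS I = {..<subs_nodes X}" using m by (auto simp: input_matches_def)
  ultimately show ?thesis unfolding encodes_cvne_def by blast
qed

text \<open>Parents come later in the order, so adding the nodes from the root downwards attaches a
  leaf each time. A completed elimination thus certifies a tree.\<close>

lemma (in ordered_tree) arranged_tree_graph:
  assumes "bij_betw Q {..<N} V"
  shows "tree_graph V ((\<lambda>r. {Q r, Q (P r)}) ` {..<N - 1})"
    and "inj_on (\<lambda>r. {Q r, Q (P r)}) {..<N - 1}"
proof -
  have inj: "inj_on Q {..<N}" and im: "Q ` {..<N} = V" using assms by (auto simp: bij_betw_def)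
  have "k < N \<Longrightarrow> tree_graph (Q ` {k..<N}) ((\<lambda>r. {Q r, Q (P r)}) ` {k..<N - 1})" for k
  proof (induction "N - 1 - k" arbitrary: k)
    case 0
    then have "{k..<N} = {N - 1}" by auto
    then show ?case using 0 tree_graph_single by simp
  next
    case (Suc d)
    then have k: "k < N - 1" by simp
    have s: "{k..<N} = insert k {Suc k..<N}" "{k..<N - 1} = insert k {Suc k..<N - 1}" using k by auto
    have "Q k \<notin> Q ` {Suc k..<N}"
    proof
      assume "Q k \<in> Q ` {Suc k..<N}"
      then obtain x where "Suc k \<le> x" "x < N" "Q k = Q x" by auto
      then show False using inj_onD[OF inj, of k x] k by simp
    qed
    moreover have "Q (P k) \<in> Q ` {Suc k..<N}" using parent[OF k] by auto
    moreover have "tree_graph (Q ` {Suc k..<N}) ((\<lambda>r. {Q r, Q (P r)}) ` {Suc k..<N - 1})"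
      using Suc k by auto
    ultimately show ?case unfolding s image_insert by (rule tree_graph_add_leaf[rotated])
  qed
  from this[of 0] show "tree_graph V ((\<lambda>r. {Q r, Q (P r)}) ` {..<N - 1})"
    using N_pos im by (simp add: atLeast0LessThan)
  show "inj_on (\<lambda>r. {Q r, Q (P r)}) {..<N - 1}"
  proof (rule inj_onI)
    fix r s assume *: "r \<in> {..<N - 1}" "s \<in> {..<N - 1}" "{Q r, Q (P r)} = {Q s, Q (P s)}"
    have q: "Q a = Q b \<longleftrightarrow> a = b" if "a < N" "b < N" for a b using inj that by (auto simp: inj_on_def)
    have "r < N" "s < N" "P r < N" "P s < N" "r < P r" "s < P s" using * parent[of r] parent[of s] by auto
    then show "r = s" using *(3) by (auto simp: doubleton_eq_iff q)
  qed
qed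

section \<open>Preparing an instance\<close>

abbreviation (input) "xM \<equiv> 2::nat"
abbreviation (input) "xS \<equiv> 3::nat"
abbreviation (input) "xE \<equiv> 4::nat"
abbreviation (input) "xoC \<equiv> 5::nat"
abbreviation (input) "xoE \<equiv> 6::nat"
abbreviation (input) "xo \<equiv> 35::nat"
abbreviation (input) "xokv \<equiv> 36::nat"
abbreviation (input) "aVO \<equiv> 10::nat"

definition read_header :: cmd where
  "read_header = xN ::= Arr aX (Num 0) ;; xM ::= Arr aX (Num 1) ;;
     xo ::= Plus (Num 2) (Plus (Var xM) (Var xM)) ;; xS ::= Arr aX (Var xo) ;;
     xoC ::= Plus (Var xo) (Num 1) ;; xo ::= Plus (Var xoC) (Plus (Var xS) (Var xS)) ;;
     xE ::= Arr aX (Var xo) ;; xoE ::= Plus (Var xo) (Num 1)"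

definition header_ok :: "store \<Rightarrow> bool" where
  "header_ok s \<longleftrightarrow> (let X = arrs s aX in vars s xN = X 0 \<and> vars s xM = virt_edges X \<and> vars s xS = subs_nodes X \<and>
     vars s xE = subs_edges X \<and> vars s xoC = subs_pos X + 1 \<and> vars s xoE = edge_pos X + 1)"

lemma read_header_correct:
  "header_ok (sem read_header s)" "arrs (sem read_header s) = arrs s"
  by (simp_all add: read_header_def header_ok_def Let_def virt_edges_def subs_pos_def subs_nodes_def
    edge_pos_def subs_edges_def mult_2 add.assoc)

lemma header_ok_cong: "header_ok s \<Longrightarrow> arrs t aX = arrs s aX \<Longrightarrow>
   (\<And>v. v \<in> {xN, xM, xS, xE, xoC, xoE} \<Longrightarrow> vars t v = vars s v) \<Longrightarrow> header_ok t"
  by (simp add: header_ok_def)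

definition load_virtual :: cmd where
  "load_virtual = For xi xM (Write aU (Var xi) (Arr aX (Plus (Num 2) (Plus (Var xi) (Var xi)))) ;;
     Write aW (Var xi) (Arr aX (Plus (Num 3) (Plus (Var xi) (Var xi)))))"

definition setup_virtual :: cmd where
  "setup_virtual = xG ::= Var xN ;; xH ::= Var xM ;; xg ::= Minus (Var xN) (Num 1)"

text \<open>Rooted at one of its ends, a path is eliminated from the other end in order. A path of
  one node has degree 0, hence the test for at most 1.\<close>

definition choose_root :: cmd where
  "choose_root = xr ::= Num 0 ;; For xi xG (When (LessEq (Arr aDG (Var xi)) (Num 1)) (xr ::= Var xi))"

text \<open>The order of the virtual nodes is saved in \<open>aVO\<close> because the substrate is
  arranged in the same arrays afterwards.\<close>

definition check_path :: cmd where
  "check_path = xokv ::= Var xok ;;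
     For xi xg (When (NotE (Equal (Arr aPR (Var xi)) (Plus (Var xi) (Num 1)))) (xokv ::= Num 0)) ;;
     For xi xG (Write aVO (Var xi) (Arr aQ (Var xi)))"

definition load_substrate :: cmd where
  "load_substrate = For xi xE (
     xo ::= Plus (Var xoE) (Plus (Plus (Var xi) (Var xi)) (Plus (Var xi) (Var xi))) ;;
     Write aU (Var xi) (Arr aX (Var xo)) ;; Write aW (Var xi) (Arr aX (Plus (Var xo) (Num 1))))"

definition setup_substrate :: cmd where
  "setup_substrate = xG ::= Var xS ;; xH ::= Var xE ;; xg ::= Minus (Var xS) (Num 1) ;; xr ::= Num 0 ;;
     xo ::= Plus (Var xN) (Num 1) ;; xQ ::= Plus (Var xo) (Plus (Var xo) (Var xo))"

definition normalise :: cmd where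
  "normalise = For xi xG (xv ::= Plus (Var xoC) (Plus (Arr aQ (Var xi)) (Arr aQ (Var xi))) ;;
       Write aNC (Var xi) (Arr aX (Var xv)) ;; Write aNW (Var xi) (Arr aX (Plus (Var xv) (Num 1)))) ;;
     For xi xg (xe ::= Arr aPE (Var xi) ;;
       xv ::= Plus (Var xoE) (Plus (Plus (Var xe) (Var xe)) (Plus (Var xe) (Var xe))) ;;
       Write aEC (Var xi) (Arr aX (Plus (Var xv) (Num 2))) ;; Write aEW (Var xi) (Arr aX (Plus (Var xv) (Num 3))))"

definition arrange_virtual :: cmd where
  "arrange_virtual = degrees ;; choose_root ;; arrange ;; check_path"

definition arrange_substrate :: cmd where
  "arrange_substrate = degrees ;; arrange ;; normalise"

definition prepare :: cmd where
  "prepare = load_virtual ;; setup_virtual ;; arrange_virtual ;; load_substrate ;; setup_substrate ;; arrange_substrate"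

lemma prepare_frames [simp]:
  "assigned load_virtual = {xi}" "written load_virtual = {aU, aW}"
  "assigned setup_virtual = {xG, xH, xg}" "written setup_virtual = {}"
  "assigned choose_root = {xr, xi}" "written choose_root = {}"
  "assigned check_path = {xokv, xi}" "written check_path = {aVO}"
  "assigned load_substrate = {xi, xo}" "written load_substrate = {aU, aW}"
  "assigned setup_substrate = {xG, xH, xg, xr, xo, xQ}" "written setup_substrate = {}"
  "assigned normalise = {xi, xv, xe}" "written normalise = {aNC, aNW, aEC, aEW}"
  "assigned arrange_virtual = {xi, xv, xr, xtl, xok, xe, xp, xokv}"
  "written arrange_virtual = {aDG, aSE, aQ, aPA, aPE, aRK, aPR, aVO}"
  "assigned arrange_substrate = {xi, xv, xtl, xok, xe, xp}"
  "written arrange_substrate = {aDG, aSE, aQ, aPA, aPE, aRK, aPR, aNC, aNW, aEC, aEW}"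
  by (auto simp: load_virtual_def setup_virtual_def choose_root_def check_path_def load_substrate_def
    setup_substrate_def normalise_def arrange_virtual_def arrange_substrate_def)

lemma load_virtual_correct:
  assumes "header_ok s" "e < virt_edges (arrs s aX)"
  shows "arrs (sem load_virtual s) aU e = arrs s aX (2 + 2 * e)" "arrs (sem load_virtual s) aW e = arrs s aX (2 + 2 * e + 1)"
proof -
  define I where "I k t \<longleftrightarrow> (\<forall>e<k. arrs t aU e = arrs s aX (2 + 2 * e) \<and> arrs t aW e = arrs s aX (2 + 2 * e + 1))" for k t
  have "I (vars s xM) (sem load_virtual s)" unfolding load_virtual_def
    by (rule sem_For_invariant) (auto simp: I_def less_Suc_eq mult_2 numeral_2_eq_2 numeral_3_eq_3)
  then show "arrs (sem load_virtual s) aU e = arrs s aX (2 + 2 * e)" "arrs (sem load_virtual s) aW e = arrs s aX (2 + 2 * e + 1)"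
    using assms by (simp_all add: I_def header_ok_def Let_def)
qed

lemma load_substrate_correct:
  assumes "header_ok s" "e < subs_edges (arrs s aX)"
  shows "arrs (sem load_substrate s) aU e = arrs s aX (edge_pos (arrs s aX) + 1 + 4 * e)"
    "arrs (sem load_substrate s) aW e = arrs s aX (edge_pos (arrs s aX) + 1 + 4 * e + 1)"
proof -
  let ?o = "vars s xoE"
  define I where "I k t \<longleftrightarrow> (\<forall>e<k. arrs t aU e = arrs s aX (?o + 4 * e) \<and> arrs t aW e = arrs s aX (?o + 4 * e + 1))" for k t
  have *: "?o + (k + k + (k + k)) = ?o + 4 * k" for k by simp
  have "I (vars s xE) (sem load_substrate s)" unfolding load_substrate_def
    by (rule sem_For_invariant) (auto simp: I_def less_Suc_eq *)
  then show "arrs (sem load_substrate s) aU e = arrs s aX (edge_pos (arrs s aX) + 1 + 4 * e)"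
    "arrs (sem load_substrate s) aW e = arrs s aX (edge_pos (arrs s aX) + 1 + 4 * e + 1)"
    using assms by (simp_all add: I_def header_ok_def Let_def)
qed

lemma choose_root_correct:
  assumes "0 < vars s xG"
  shows "vars (sem choose_root s) xr < vars s xG"
    "v < vars s xG \<Longrightarrow> arrs s aDG v \<le> 1 \<Longrightarrow> arrs s aDG (vars (sem choose_root s) xr) \<le> 1"
proof -
  let ?s1 = "sem (xr ::= Num 0) s" and ?c = "When (LessEq (Arr aDG (Var xi)) (Num 1)) (xr ::= Var xi)"
  define I where "I k t \<longleftrightarrow> vars t xr < vars s xG \<and> ((\<exists>v<k. arrs s aDG v \<le> 1) \<longrightarrow> arrs s aDG (vars t xr) \<le> 1)" for k t
  have "I (vars ?s1 xG) (sem (For xi xG ?c) ?s1)"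
  proof (rule sem_For_invariant)
    fix k t assume A: "k < vars ?s1 xG" "I k t" "vars t xi = k" and F: "\<And>a. a \<notin> written ?c \<Longrightarrow> arrs t a = arrs ?s1 a"
    have "arrs t aDG = arrs s aDG" using F by simp
    then show "I (Suc k) (set_var xi (Suc k) (sem ?c t))" using A by (auto simp: I_def less_Suc_eq)
  qed (use assms in \<open>auto simp: I_def\<close>)
  then have "I (vars s xG) (sem choose_root s)" by (simp add: choose_root_def)
  then show "vars (sem choose_root s) xr < vars s xG"
    "v < vars s xG \<Longrightarrow> arrs s aDG v \<le> 1 \<Longrightarrow> arrs s aDG (vars (sem choose_root s) xr) \<le> 1"
    by (auto simp: I_def)
qed

lemma check_path_correct:
  "vars (sem check_path s) xokv = 1 \<longleftrightarrow> vars s xok = 1 \<and> (\<forall>i<vars s xg. arrs s aPR i = Suc i)"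
  "i < vars s xG \<Longrightarrow> arrs (sem check_path s) aVO i = arrs s aQ i"
proof -
  let ?s1 = "sem (xokv ::= Var xok) s" and ?c = "When (NotE (Equal (Arr aPR (Var xi)) (Plus (Var xi) (Num 1)))) (xokv ::= Num 0)"
  define I where "I k t \<longleftrightarrow> (vars t xokv = 1 \<longleftrightarrow> vars s xok = 1 \<and> (\<forall>i<k. arrs s aPR i = Suc i))" for k t
  define s2 where "s2 = sem (For xi xg ?c) ?s1"
  have "I (vars ?s1 xg) s2" unfolding s2_def
  proof (rule sem_For_invariant)
    fix k t assume A: "I k t" "vars t xi = k" and F: "\<And>a. a \<notin> written ?c \<Longrightarrow> arrs t a = arrs ?s1 a"
    have "arrs t aPR = arrs s aPR" using F by simp
    then show "I (Suc k) (set_var xi (Suc k) (sem ?c t))" using A by (auto simp: I_def less_Suc_eq)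
  qed (auto simp: I_def)
  then have I: "I (vars s xg) s2" by simp
  define J where "J k t \<longleftrightarrow> (\<forall>i<k. arrs t aVO i = arrs s2 aQ i)" for k t
  have "J (vars s2 xG) (sem (For xi xG (Write aVO (Var xi) (Arr aQ (Var xi)))) s2)"
    by (rule sem_For_invariant) (auto simp: J_def less_Suc_eq)
  moreover have "vars s2 xG = vars s xG" "arrs s2 aQ = arrs s aQ" by (simp_all add: s2_def vars_sem arrs_sem)
  moreover have eq: "sem check_path s = sem (For xi xG (Write aVO (Var xi) (Arr aQ (Var xi)))) s2"
    by (simp add: check_path_def s2_def)
  ultimately show "i < vars s xG \<Longrightarrow> arrs (sem check_path s) aVO i = arrs s aQ i" by (simp add: J_def)
  have "vars (sem check_path s) xokv = vars s2 xokv" unfolding eq by (simp add: vars_sem)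
  then show "vars (sem check_path s) xokv = 1 \<longleftrightarrow> vars s xok = 1 \<and> (\<forall>i<vars s xg. arrs s aPR i = Suc i)"
    using I by (simp add: I_def)
qed

lemma degree_eq_card:
  assumes "inj_on (\<lambda>e. {U e, W e}) {..<H}" "\<And>e. e < H \<Longrightarrow> U e \<noteq> W e"
  shows "(\<Sum>e<H. incidence U W e v) = card {f \<in> (\<lambda>e. {U e, W e}) ` {..<H}. v \<in> f}"
proof -
  have "(\<Sum>e<H. incidence U W e v) = (\<Sum>e<H. if v \<in> {U e, W e} then 1 else 0)"
  proof (rule sum.cong[OF refl])
    fix e assume "e \<in> {..<H}"
    then have "U e \<noteq> W e" using assms(2) by simp
    then show "incidence U W e v = (if v \<in> {U e, W e} then 1 else 0)" by (auto simp: incidence_def)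
  qed
  also have "\<dots> = card ({..<H} \<inter> {e. v \<in> {U e, W e}})" by (simp add: sum.If_cases)
  also have "\<dots> = card ((\<lambda>e. {U e, W e}) ` ({..<H} \<inter> {e. v \<in> {U e, W e}}))"
    by (rule card_image[symmetric]) (use assms(1) in \<open>auto intro: inj_on_subset\<close>)
  also have "(\<lambda>e. {U e, W e}) ` ({..<H} \<inter> {e. v \<in> {U e, W e}}) = {f \<in> (\<lambda>e. {U e, W e}) ` {..<H}. v \<in> f}" by auto
  finally show ?thesis .
qed

lemma path_edges_map_upt: "path_edges (map Q [0..<n]) = (\<lambda>r. {Q r, Q (Suc r)}) ` {..<n - 1}"
proof (intro equalityI subsetI)
  fix e assume "e \<in> path_edges (map Q [0..<n])"
  then obtain i where "Suc i < n" "e = {Q i, Q (Suc i)}" by (auto simp: path_edges_def)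
  then show "e \<in> (\<lambda>r. {Q r, Q (Suc r)}) ` {..<n - 1}" by auto
next
  fix e assume "e \<in> (\<lambda>r. {Q r, Q (Suc r)}) ` {..<n - 1}"
  then obtain i where i: "i < n - 1" "e = {Q i, Q (Suc i)}" by auto
  then have "Suc i < length (map Q [0..<n])" "e = {map Q [0..<n] ! i, map Q [0..<n] ! Suc i}" by auto
  then show "e \<in> path_edges (map Q [0..<n])" unfolding path_edges_def by blast
qed

text \<open>An image of full size forces injectivity. This is how an input that passes the
  elimination is seen to list no edge twice.\<close>

lemma inj_on_from_image:
  assumes "f ` {..<H} = g ` {..<G}" "inj_on g {..<G}" "H = (G::nat)"
  shows "inj_on f {..<H::nat}"
  by (rule eq_card_imp_inj_on) (use assms in \<open>auto simp: card_image\<close>)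

lemma arrange_virtual_correct:
  fixes s
  defines "X \<equiv> arrs s aX" and "t \<equiv> sem (load_virtual ;; setup_virtual ;; arrange_virtual) s"
  assumes h: "header_ok s" and raw: "raw_ok X"
  shows "vars t xokv = 1 \<Longrightarrow> distinct (map (arrs t aVO) [0..<X 0]) \<and> set (map (arrs t aVO) [0..<X 0]) = {..<X 0} \<and>
      path_edges (map (arrs t aVO) [0..<X 0]) = virt_edge X ` {..<virt_edges X} \<and> inj_on (virt_edge X) {..<virt_edges X}"
    and "path_graph {..<X 0} (virt_edge X ` {..<virt_edges X}) \<Longrightarrow> inj_on (virt_edge X) {..<virt_edges X} \<Longrightarrow> vars t xokv = 1"
proof -
  define n where "n = X 0"
  define m where "m = virt_edges X"
  have nm: "0 < n" "m = n - 1" using raw by (auto simp: raw_ok_def n_def m_def)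
  define s1 where "s1 = sem (load_virtual ;; setup_virtual) s"
  define U where "U = arrs s1 aU"
  define W where "W = arrs s1 aW"
  have v: "vars s1 xG = n" "vars s1 xH = m" "vars s1 xg = n - 1"
    using h by (simp_all add: s1_def setup_virtual_def vars_sem header_ok_def Let_def n_def m_def X_def)
  have ed: "{U e, W e} = virt_edge X e" if "e < m" for e
    using load_virtual_correct[OF h, folded X_def, of e] that
    by (simp add: U_def W_def s1_def setup_virtual_def virt_edge_def m_def)
  have UW: "\<forall>e<m. U e < n \<and> W e < n"
  proof (intro allI impI)
    fix e assume "e < m"
    then have "{U e, W e} \<subseteq> {..<n}" using ed[of e] raw by (simp add: raw_ok_def n_def m_def)
    then show "U e < n \<and> W e < n" by simp
  qed
  have im: "(\<lambda>e. {U e, W e}) ` {..<m} = virt_edge X ` {..<m}" using ed by (intro image_cong) auto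
  have injeq: "inj_on (\<lambda>e. {U e, W e}) {..<m} = inj_on (virt_edge X) {..<m}" using ed by (intro inj_on_cong) auto
  define s2 where "s2 = sem degrees s1"
  define s3 where "s3 = sem choose_root s2"
  define s4 where "s4 = sem arrange s3"
  have t: "t = sem check_path s4" by (simp add: t_def arrange_virtual_def s4_def s3_def s2_def s1_def)
  have a3: "arrs s3 aU = U" "arrs s3 aW = W" "arrs s3 aDG = arrs s2 aDG" "arrs s3 aSE = arrs s2 aSE"
    "vars s3 xG = n" "vars s3 xH = m" "vars s3 xg = n - 1" "vars s2 xG = n"
    using v by (simp_all add: s3_def s2_def U_def W_def vars_sem arrs_sem)
  have DG: "arrs s2 aDG x = (\<Sum>e<m. incidence U W e x)" "arrs s2 aSE x = (\<Sum>e<m. e * incidence U W e x)" if "x < n" for x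
    using degrees_correct[of s1 x, folded s2_def U_def W_def, unfolded v] UW that a3 by auto
  let ?r = "vars s3 xr"
  have r: "?r < n" using choose_root_correct(1)[of s2] a3(8) nm by (simp add: s3_def)
  note ac = arrange_correct[of s3, folded s4_def, unfolded a3, OF UW r refl DG]
  have a4: "vars s4 xg = n - 1" "vars s4 xG = n" using a3 by (simp_all add: s4_def vars_sem)
  define Q where "Q = arrs s4 aQ"
  have VO: "map (arrs t aVO) [0..<n] = map Q [0..<n]" using check_path_correct(2)[of _ s4] a4 by (simp add: t Q_def)
  have ok: "vars t xokv = 1 \<longleftrightarrow> vars s4 xok = 1 \<and> (\<forall>i<n - 1. arrs s4 aPR i = Suc i)"
    using check_path_correct(1)[of s4] a4 by (simp add: t)
  show "distinct (map (arrs t aVO) [0..<X 0]) \<and> set (map (arrs t aVO) [0..<X 0]) = {..<X 0} \<and>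
      path_edges (map (arrs t aVO) [0..<X 0]) = virt_edge X ` {..<virt_edges X} \<and> inj_on (virt_edge X) {..<virt_edges X}"
    if "vars t xokv = 1"
  proof -
    have P: "vars s4 xok = 1" "\<And>i. i < n - 1 \<Longrightarrow> arrs s4 aPR i = Suc i" using ok that by auto
    then have A: "ordered_tree n (arrs s4 aPR)" "bij_betw Q {..<n} {..<n}"
      "(\<lambda>e. {U e, W e}) ` {..<m} = (\<lambda>j. {Q j, Q (arrs s4 aPR j)}) ` {..<n - 1}"
      using ac(1) nm(2) by (auto simp: Q_def)
    have "(\<lambda>j. {Q j, Q (arrs s4 aPR j)}) ` {..<n - 1} = (\<lambda>j. {Q j, Q (Suc j)}) ` {..<n - 1}"
      using P(2) by (intro image_cong) auto
    then have "path_edges (map Q [0..<n]) = virt_edge X ` {..<m}" using A(3) im by (simp add: path_edges_map_upt)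
    moreover have "inj_on (\<lambda>e. {U e, W e}) {..<m}"
      by (rule inj_on_from_image[OF A(3) ordered_tree.arranged_tree_graph(2)[OF A(1,2)] nm(2)])
    moreover have "distinct (map Q [0..<n])" "set (map Q [0..<n]) = {..<n}"
      using A(2) by (auto simp: distinct_map bij_betw_def atLeast0LessThan)
    ultimately show ?thesis
      unfolding n_def[symmetric] m_def[symmetric] VO injeq by - (intro conjI, assumption+)
  qed
  show "vars t xokv = 1" if pg: "path_graph {..<X 0} (virt_edge X ` {..<virt_edges X})" and inj: "inj_on (virt_edge X) {..<virt_edges X}"
  proof -
    obtain p where p: "p \<noteq> []" "distinct p" "set p = {..<n}" "path_edges p = virt_edge X ` {..<m}"
      using pg unfolding path_graph_def n_def m_def by (elim exE conjE)
    have tg: "tree_graph {..<n} (virt_edge X ` {..<m})" using path_tree_graph[OF p(1,2)] p by simp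
    have inj': "inj_on (\<lambda>e. {U e, W e}) {..<m}" using injeq inj by (simp add: m_def)
    have ok4: "vars s4 xok = 1" using ac(2) tg inj' im by simp
    have "card {U e, W e} = 2" if "e < m" for e
      using tg ed[OF that] that by (auto simp: tree_graph_def simple_graph_def)
    then have ne: "U e \<noteq> W e" if "e < m" for e using that by fastforce
    have deg: "arrs s2 aDG x = card {f \<in> virt_edge X ` {..<m}. x \<in> f}" if "x < n" for x
      using DG(1)[OF that] degree_eq_card[OF inj' ne] a3 im by simp
    have "hd p < n" using p by (metis hd_in_set lessThan_iff)
    then have "arrs s2 aDG ?r \<le> 1"
      using choose_root_correct(2)[of s2 "hd p"] nm a3 deg[of "hd p"] path_degree(2)[OF p(2)] p(4) by (simp add: s3_def)
    then have dr: "card {f \<in> virt_edge X ` {..<m}. ?r \<in> f} \<le> 1" using deg[OF r] by simp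
    have A: "ordered_tree n (arrs s4 aPR)" "bij_betw Q {..<n} {..<n}" "Q (n - 1) = ?r"
      "virt_edge X ` {..<m} = (\<lambda>j. {Q j, Q (arrs s4 aPR j)}) ` {..<n - 1}"
      using ac(1)[OF _ _ ok4 nm(2)] im by (auto simp: Q_def)
    have "arrs s4 aPR i = Suc i" if "i < n - 1" for i
    proof (rule ordered_tree.path_from_degrees[OF A(1) bij_betw_imp_inj_on[OF A(2)] A(4) _ _ that])
      show "card {e \<in> virt_edge X ` {..<m}. x \<in> e} \<le> 2" for x
        using path_degree(1)[OF p(2)] p(4) by simp
      show "card {e \<in> virt_edge X ` {..<m}. Q (n - 1) \<in> e} \<le> 1" using dr A(3) by simp
    qed
    then show ?thesis using ok ok4 by simp
  qed
qed

lemma normalise_correct: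
  assumes "header_ok s"
  shows "r < vars s xG \<Longrightarrow> arrs (sem normalise s) aNC r = arrs s aX (subs_pos (arrs s aX) + 1 + 2 * arrs s aQ r)"
    "r < vars s xG \<Longrightarrow> arrs (sem normalise s) aNW r = arrs s aX (subs_pos (arrs s aX) + 1 + 2 * arrs s aQ r + 1)"
    "r < vars s xg \<Longrightarrow> arrs (sem normalise s) aEC r = arrs s aX (edge_pos (arrs s aX) + 1 + 4 * arrs s aPE r + 2)"
    "r < vars s xg \<Longrightarrow> arrs (sem normalise s) aEW r = arrs s aX (edge_pos (arrs s aX) + 1 + 4 * arrs s aPE r + 3)"
proof -
  let ?c = "xv ::= Plus (Var xoC) (Plus (Arr aQ (Var xi)) (Arr aQ (Var xi))) ;;
       Write aNC (Var xi) (Arr aX (Var xv)) ;; Write aNW (Var xi) (Arr aX (Plus (Var xv) (Num 1)))"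
  let ?d = "xe ::= Arr aPE (Var xi) ;;
       xv ::= Plus (Var xoE) (Plus (Plus (Var xe) (Var xe)) (Plus (Var xe) (Var xe))) ;;
       Write aEC (Var xi) (Arr aX (Plus (Var xv) (Num 2))) ;; Write aEW (Var xi) (Arr aX (Plus (Var xv) (Num 3)))"
  let ?X = "arrs s aX"
  define s1 where "s1 = sem (For xi xG ?c) s"
  define I where "I k t \<longleftrightarrow> (\<forall>r<k. arrs t aNC r = ?X (vars s xoC + (arrs s aQ r + arrs s aQ r)) \<and>
     arrs t aNW r = ?X (vars s xoC + (arrs s aQ r + arrs s aQ r) + 1))" for k t
  have I: "I (vars s xG) s1" unfolding s1_def
    by (rule sem_For_invariant) (auto simp: I_def less_Suc_eq)
  have f: "vars s1 xoE = vars s xoE" "arrs s1 aX = ?X" "arrs s1 aPE = arrs s aPE" "vars s1 xg = vars s xg"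
    by (simp_all add: s1_def vars_sem arrs_sem)
  define J where "J k t \<longleftrightarrow> (\<forall>r<k. arrs t aEC r = ?X (vars s xoE + 4 * arrs s aPE r + 2) \<and>
     arrs t aEW r = ?X (vars s xoE + 4 * arrs s aPE r + 3))" for k t
  have *: "vars s xoE + (k + k + (k + k)) = vars s xoE + 4 * k" for k by simp
  have "J (vars s1 xg) (sem (For xi xg ?d) s1)"
    by (rule sem_For_invariant) (auto simp: J_def less_Suc_eq * f)
  moreover have "sem normalise s = sem (For xi xg ?d) s1" by (simp add: normalise_def s1_def)
  moreover have "arrs (sem (For xi xg ?d) s1) aNC = arrs s1 aNC" "arrs (sem (For xi xg ?d) s1) aNW = arrs s1 aNW"
    by (simp_all add: arrs_sem)
  ultimately show "r < vars s xG \<Longrightarrow> arrs (sem normalise s) aNC r = ?X (subs_pos ?X + 1 + 2 * arrs s aQ r)"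
    "r < vars s xG \<Longrightarrow> arrs (sem normalise s) aNW r = ?X (subs_pos ?X + 1 + 2 * arrs s aQ r + 1)"
    "r < vars s xg \<Longrightarrow> arrs (sem normalise s) aEC r = ?X (edge_pos ?X + 1 + 4 * arrs s aPE r + 2)"
    "r < vars s xg \<Longrightarrow> arrs (sem normalise s) aEW r = ?X (edge_pos ?X + 1 + 4 * arrs s aPE r + 3)"
    using I assms f(4) by (simp_all add: I_def J_def header_ok_def Let_def mult_2)
qed

lemma arrange_substrate_correct:
  fixes s
  defines "X \<equiv> arrs s aX" and "t \<equiv> sem (load_substrate ;; setup_substrate ;; arrange_substrate) s"
  assumes h: "header_ok s" and raw: "raw_ok X"
  shows "vars t xok = 1 \<Longrightarrow> ordered_tree (subs_nodes X) (arrs t aPR) \<and> bij_betw (arrs t aQ) {..<subs_nodes X} {..<subs_nodes X} \<and>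
      subs_edge X ` {..<subs_edges X} = (\<lambda>r. {arrs t aQ r, arrs t aQ (arrs t aPR r)}) ` {..<subs_nodes X - 1} \<and>
      inj_on (subs_edge X) {..<subs_edges X} \<and>
      (\<forall>r<subs_nodes X - 1. \<exists>e<subs_edges X. subs_edge X e = {arrs t aQ r, arrs t aQ (arrs t aPR r)} \<and>
         arrs t aEC r = X (edge_pos X + 1 + 4 * e + 2) \<and> arrs t aEW r = X (edge_pos X + 1 + 4 * e + 3))"
    and "tree_graph {..<subs_nodes X} (subs_edge X ` {..<subs_edges X}) \<Longrightarrow> inj_on (subs_edge X) {..<subs_edges X} \<Longrightarrow> vars t xok = 1"
    and "r < subs_nodes X \<Longrightarrow> arrs t aNC r = X (subs_pos X + 1 + 2 * arrs t aQ r) \<and> arrs t aNW r = X (subs_pos X + 1 + 2 * arrs t aQ r + 1)"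
    and "vars t xG = subs_nodes X" "vars t xg = subs_nodes X - 1" "vars t xQ = 3 * (X 0 + 1)"
proof -
  define n where "n = subs_nodes X"
  define m where "m = subs_edges X"
  have nm: "0 < n" "m = n - 1" using raw by (auto simp: raw_ok_def n_def m_def)
  define s1 where "s1 = sem (load_substrate ;; setup_substrate) s"
  define U where "U = arrs s1 aU"
  define W where "W = arrs s1 aW"
  have v: "vars s1 xG = n" "vars s1 xH = m" "vars s1 xg = n - 1" "vars s1 xr = 0" "vars s1 xQ = 3 * (X 0 + 1)"
    using h by (simp_all add: s1_def setup_substrate_def vars_sem header_ok_def Let_def n_def m_def X_def)
  have h1: "header_ok s1" "arrs s1 aX = X"
    by (rule header_ok_cong[OF h]) (auto simp: s1_def vars_sem arrs_sem X_def)
  have ed: "{U e, W e} = subs_edge X e" if "e < m" for e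
    using load_substrate_correct[OF h, folded X_def, of e] that
    by (simp add: U_def W_def s1_def setup_substrate_def subs_edge_def m_def)
  have UW: "\<forall>e<m. U e < n \<and> W e < n"
  proof (intro allI impI)
    fix e assume "e < m"
    then have "{U e, W e} \<subseteq> {..<n}" using ed[of e] raw by (simp add: raw_ok_def n_def m_def)
    then show "U e < n \<and> W e < n" by simp
  qed
  have im: "(\<lambda>e. {U e, W e}) ` {..<m} = subs_edge X ` {..<m}" using ed by (intro image_cong) auto
  have injeq: "inj_on (\<lambda>e. {U e, W e}) {..<m} = inj_on (subs_edge X) {..<m}" using ed by (intro inj_on_cong) auto
  define s3 where "s3 = sem degrees s1"
  define s4 where "s4 = sem arrange s3"
  have t: "t = sem normalise s4" by (simp add: t_def arrange_substrate_def s4_def s3_def s1_def)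
  have a3: "arrs s3 aU = U" "arrs s3 aW = W" "vars s3 xG = n" "vars s3 xH = m" "vars s3 xg = n - 1" "vars s3 xr = 0"
    using v by (simp_all add: s3_def U_def W_def vars_sem arrs_sem)
  have DG: "arrs s3 aDG x = (\<Sum>e<m. incidence U W e x)" "arrs s3 aSE x = (\<Sum>e<m. e * incidence U W e x)" if "x < n" for x
    using degrees_correct[of s1 x, folded s3_def U_def W_def, unfolded v] UW that by auto
  note ac = arrange_correct[of s3, folded s4_def, unfolded a3, OF UW nm(1) refl DG]
  have a4: "vars s4 xG = n" "vars s4 xg = n - 1" "header_ok s4" "arrs s4 aX = X"
    using a3 by (simp_all add: s4_def vars_sem, intro header_ok_cong[OF h1(1)], auto simp: s4_def s3_def vars_sem arrs_sem h1(2))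
  have at: "arrs t aQ = arrs s4 aQ" "arrs t aPR = arrs s4 aPR" "vars t xok = vars s4 xok" "vars t xG = n" "vars t xg = n - 1" "vars t xQ = vars s1 xQ"
    using a4 by (simp_all add: t vars_sem arrs_sem) (simp add: s4_def s3_def vars_sem)
  note nc = normalise_correct[OF a4(3), folded t, unfolded a4]
  show "vars t xG = subs_nodes X" "vars t xg = subs_nodes X - 1" "vars t xQ = 3 * (X 0 + 1)" using at v by (simp_all add: n_def)
  show "r < subs_nodes X \<Longrightarrow> arrs t aNC r = X (subs_pos X + 1 + 2 * arrs t aQ r) \<and> arrs t aNW r = X (subs_pos X + 1 + 2 * arrs t aQ r + 1)"
    using nc(1,2)[of r] at by (simp add: n_def)
  show "tree_graph {..<subs_nodes X} (subs_edge X ` {..<subs_edges X}) \<Longrightarrow> inj_on (subs_edge X) {..<subs_edges X} \<Longrightarrow> vars t xok = 1"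
    using ac(2) im injeq at by (simp add: n_def m_def)
  assume "vars t xok = 1"
  with ac(1) nm(2) at have A: "ordered_tree n (arrs t aPR)" "bij_betw (arrs t aQ) {..<n} {..<n}"
    "(\<lambda>e. {U e, W e}) ` {..<m} = (\<lambda>j. {arrs t aQ j, arrs t aQ (arrs t aPR j)}) ` {..<n - 1}"
    "\<forall>j<n - 1. arrs s4 aPE j < m \<and> {U (arrs s4 aPE j), W (arrs s4 aPE j)} = {arrs t aQ j, arrs t aQ (arrs t aPR j)}"
    by auto
  have "inj_on (\<lambda>e. {U e, W e}) {..<m}"
    by (rule inj_on_from_image[OF A(3) ordered_tree.arranged_tree_graph(2)[OF A(1,2)] nm(2)])
  moreover have "\<exists>e<m. subs_edge X e = {arrs t aQ r, arrs t aQ (arrs t aPR r)} \<and>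
         arrs t aEC r = X (edge_pos X + 1 + 4 * e + 2) \<and> arrs t aEW r = X (edge_pos X + 1 + 4 * e + 3)" if "r < n - 1" for r
    using A(4) nc(3,4)[of r] that ed[of "arrs s4 aPE r"] by (intro exI[of _ "arrs s4 aPE r"]) auto
  ultimately show "ordered_tree (subs_nodes X) (arrs t aPR) \<and> bij_betw (arrs t aQ) {..<subs_nodes X} {..<subs_nodes X} \<and>
      subs_edge X ` {..<subs_edges X} = (\<lambda>r. {arrs t aQ r, arrs t aQ (arrs t aPR r)}) ` {..<subs_nodes X - 1} \<and>
      inj_on (subs_edge X) {..<subs_edges X} \<and>
      (\<forall>r<subs_nodes X - 1. \<exists>e<subs_edges X. subs_edge X e = {arrs t aQ r, arrs t aQ (arrs t aPR r)} \<and>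
         arrs t aEC r = X (edge_pos X + 1 + 4 * e + 2) \<and> arrs t aEW r = X (edge_pos X + 1 + 4 * e + 3))"
    using A im injeq unfolding n_def m_def by simp
qed

section \<open>Solving an instance\<close>

definition locate :: cmd where
  "locate = xo ::= Plus (Arr aBS (Var xg)) (Plus (Plus (Plus (Var xN) (Var xN)) (Var xN)) (Num 2))"

definition solve :: cmd where "solve = prepare ;; solve_dp ;; locate"

text \<open>The tour alone fixes feasibility and cost of every mapping with these hosts and routes;
  the mapping itself is chosen later, to fit the output.\<close>

definition realises :: "nat \<Rightarrow> (nat \<Rightarrow> nat) \<Rightarrow> (nat \<Rightarrow> nat) \<Rightarrow> nat list \<Rightarrow> (nat, nat) cvne \<Rightarrow> nat \<Rightarrow> nat list \<Rightarrow> bool" where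
  "realises N P Q p I c L \<longleftrightarrow> length L = length p \<and> set L \<subseteq> {..<N} \<and>
     (\<forall>m. (\<forall>i<length p. fst m (p ! i) = Q (L ! i)) \<longrightarrow>
       (\<forall>i. Suc i < length p \<longrightarrow> snd m {p ! i, p ! Suc i} = map Q (tree_path P (N + N) (L ! i) (L ! Suc i))) \<longrightarrow>
       feasible I m \<and> cost I m = c)"

lemma solve_frames [simp]:
  "assigned solve_dp = {xj, xk, xq, xra, xc, xhp, xBi, xi, xa, xbest, xb, xbq, xv, xe, xrb, xny, xz, xBp}"
  "written solve_dp = {aJJ, aXX, aBS, aTC, aTX, aTY, aHD, aTL, aLC}"
  "assigned locate = {xo}" "written locate = {}"
  by (auto simp: solve_dp_def locate_def)

text \<open>The decision procedure runs on unverified graphs and needs the flags to certify a path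
  and a tree, while the optimiser knows its instance and needs the flags to be set. Hence both
  directions, besides optimality.\<close>

lemma solve_correct:
  fixes s
  defines "X \<equiv> arrs s aX" and "t \<equiv> sem solve s"
  defines "c \<equiv> arrs t aTC (vars t xo)" and "p \<equiv> map (arrs t aVO) [0..<X 0]"
    and "Q \<equiv> arrs t aQ" and "P \<equiv> arrs t aPR" and "N \<equiv> subs_nodes X"
  assumes h: "header_ok s" and raw: "raw_ok X"
  shows "vars t xokv = 1 \<and> vars t xok = 1 \<Longrightarrow> input_matches X I \<Longrightarrow> arranged_instance N P I p Q \<and>
      (\<forall>m. feasible I m \<longrightarrow> c \<noteq> 0 \<and> c - 1 \<le> cost I m) \<and>
      (c \<noteq> 0 \<longrightarrow> (\<exists>A B. heap_list t (arrs t aTX (vars t xo)) A \<and> heap_list t (arrs t aTY (vars t xo)) B \<and>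
         realises N P Q p I (c - 1) (rev A @ B)))"
    and "path_to_tree I \<Longrightarrow> input_matches X I \<Longrightarrow> vars t xokv = 1 \<and> vars t xok = 1"
    and "vars t xokv = 1 \<and> vars t xok = 1 \<Longrightarrow> path_graph {..<X 0} (virt_edge X ` {..<virt_edges X}) \<and>
      tree_graph {..<N} (subs_edge X ` {..<subs_edges X}) \<and> inj_on (virt_edge X) {..<virt_edges X} \<and>
      inj_on (subs_edge X) {..<subs_edges X}"
    and "vars t xN = X 0" "vars t xG = N"
proof -
  define sv where "sv = sem (load_virtual ;; setup_virtual ;; arrange_virtual) s"
  define ss where "ss = sem (load_substrate ;; setup_substrate ;; arrange_substrate) sv"
  define sd where "sd = sem solve_dp ss"
  have t: "t = sem locate sd" by (simp add: t_def solve_def prepare_def sd_def ss_def sv_def)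
  have hv: "header_ok sv" "arrs sv aX = X"
    by (rule header_ok_cong[OF h]) (auto simp: sv_def vars_sem arrs_sem X_def)
  note V = arrange_virtual_correct[OF h, folded X_def sv_def, OF raw]
  note S = arrange_substrate_correct[OF hv(1), folded ss_def, unfolded hv(2), OF raw, folded N_def]
  have f: "vars t xokv = vars sv xokv" "vars t xok = vars ss xok" "arrs t aVO = arrs sv aVO" "Q = arrs ss aQ" "P = arrs ss aPR"
    "vars ss xN = vars sv xN" "vars t xG = vars ss xG" "vars t xN = vars sv xN"
    unfolding t Q_def P_def by (simp_all add: vars_sem arrs_sem sd_def ss_def)
  have N0: "vars sv xN = X 0" using hv by (simp add: header_ok_def Let_def)
  show "vars t xN = X 0" "vars t xG = N" using f N0 S(4) by simp_all
  show ok: "vars t xokv = 1 \<and> vars t xok = 1" if I: "path_to_tree I" "input_matches X I"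
  proof -
    have "path_graph {..<X 0} (virt_edge X ` {..<virt_edges X})" "tree_graph {..<N} (subs_edge X ` {..<subs_edges X})"
      "inj_on (virt_edge X) {..<virt_edges X}" "inj_on (subs_edge X) {..<subs_edges X}"
      using I by (simp_all add: path_to_tree_def input_matches_def N_def)
    then show ?thesis using V(2) S(2) f by simp
  qed
  assume "vars t xokv = 1 \<and> vars t xok = 1"
  then have v: "vars sv xokv = 1" "vars ss xok = 1" using f by auto
  note V1 = V(1)[OF v(1)]
  note S1 = S(1)[OF v(2), folded f(4,5)]
  have pv: "distinct p" "set p = {..<X 0}" "path_edges p = virt_edge X ` {..<virt_edges X}" "inj_on (virt_edge X) {..<virt_edges X}"
    using V1 unfolding p_def f(3) by blast+
  have pne: "p \<noteq> []" using pv(2) raw by (auto simp: raw_ok_def)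
  have lp: "length p = X 0" by (simp add: p_def)
  have ot: "ordered_tree N P" and bij: "bij_betw Q {..<N} {..<N}" using S1 by blast+
  show "path_graph {..<X 0} (virt_edge X ` {..<virt_edges X}) \<and>
      tree_graph {..<N} (subs_edge X ` {..<subs_edges X}) \<and> inj_on (virt_edge X) {..<virt_edges X} \<and>
      inj_on (subs_edge X) {..<subs_edges X}"
    using ordered_tree.arranged_tree_graph(1)[OF ot bij] S1 pv pne unfolding path_graph_def by auto
  assume I: "input_matches X I"
  interpret A: arranged_instance N P I p Q
  proof (intro arranged_instance.intro arranged_instance_axioms.intro)
    show "ordered_tree N P" by (rule ot)
    show "p \<noteq> []" "distinct p" by (rule pne, rule pv)
    show "set p = VR I" "path_edges p = ER I" "bij_betw Q {..<N} (VS I)"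
      "ES I = (\<lambda>r. {Q r, Q (P r)}) ` {..<N - 1}"
      using I pv bij S1 by (simp_all add: input_matches_def N_def)
  qed
  have w: "A.width = 3 * (length p + 1)" by (rule A.width_def)
  have "A.dp_data ss" unfolding A.dp_data_def
  proof (intro conjI allI impI)
    show "vars ss xG = N" "vars ss xg = N - 1" "vars ss xN = length p"
      using S(4,5) f N0 lp by simp_all
    show "vars ss xQ = A.width" unfolding w unfolding lp by (rule S(6))
  next
    fix r assume "r < N - 1"
    then obtain e where e: "e < subs_edges X" "subs_edge X e = {Q r, Q (P r)}"
      "arrs ss aEC r = X (edge_pos X + 1 + 4 * e + 2)" "arrs ss aEW r = X (edge_pos X + 1 + 4 * e + 3)" using S1 by blast
    show "arrs ss aPR r = P r" using f by simp
    show "arrs ss aEC r = edge_cap I (A.tree_edge r)" "arrs ss aEW r = edge_cost I (A.tree_edge r)"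
      using I e(1,3,4) unfolding input_matches_def e(2)[symmetric] by simp_all
  next
    fix r assume r: "r < N"
    then have "Q r < N" using bij_betwE[OF bij] by simp
    then show "arrs ss aNC r = node_cap I (Q r)" "arrs ss aNW r = node_cost I (Q r)"
      using S(3)[OF r] I f(4) by (simp_all add: input_matches_def N_def)
  qed
  note D = A.solve_dp_correct[OF this, folded sd_def]
  have x: "vars t xo = (N - 1) * A.width + (3 * length p + 2)"
  proof -
    have "vars sd xg = N - 1" "vars sd xN = length p" using S(5) f N0 lp by (simp_all add: sd_def vars_sem)
    then show ?thesis using D(3) by (simp add: t locate_def)
  qed
  have tt: "arrs t = arrs sd" "vars t xhp = vars sd xhp" by (simp_all add: t locate_def)
  have c: "c = arrs sd aTC ((N - 1) * A.width + (3 * length p + 2))" by (simp add: c_def tt x)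
  show "arranged_instance N P I p Q \<and>
      (\<forall>m. feasible I m \<longrightarrow> c \<noteq> 0 \<and> c - 1 \<le> cost I m) \<and>
      (c \<noteq> 0 \<longrightarrow> (\<exists>Z Z'. heap_list t (arrs t aTX (vars t xo)) Z \<and> heap_list t (arrs t aTY (vars t xo)) Z' \<and>
         realises N P Q p I (c - 1) (rev Z @ Z')))"
  proof (intro conjI allI impI)
    show "arranged_instance N P I p Q" by (rule A.arranged_instance_axioms)
    fix m assume "feasible I m"
    then obtain L where L: "A.feasible_tour L" "A.tour_cost L \<le> cost I m" using A.tour_of_mapping by blast
    show "c \<noteq> 0" "c - 1 \<le> cost I m" using D(1)[OF L(1)] L(2) unfolding c by auto
  next
    assume "c \<noteq> 0"
    then obtain Z Z' where Z: "heap_list t (arrs t aTX (vars t xo)) Z" "heap_list t (arrs t aTY (vars t xo)) Z'"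
      "A.feasible_tour (rev Z @ Z')" "A.tour_cost (rev Z @ Z') = c - 1"
      using D(2) unfolding c tt x by blast
    have "realises N P Q p I (c - 1) (rev Z @ Z')" unfolding realises_def
      using A.mapping_of_tour[OF Z(3)] Z(3,4) by (auto simp: A.feasible_tour_def)
    then show "\<exists>Z Z'. heap_list t (arrs t aTX (vars t xo)) Z \<and> heap_list t (arrs t aTY (vars t xo)) Z' \<and>
         realises N P Q p I (c - 1) (rev Z @ Z')" using Z by blast
  qed
qed

section \<open>Output and running time of the optimiser\<close>

section \<open>Writing the answer\<close>

abbreviation (input) "xoo \<equiv> 37::nat"
abbreviation (input) "xlp \<equiv> 38::nat"
abbreviation (input) "xpb \<equiv> 39::nat"
abbreviation (input) "xaa \<equiv> 40::nat"
abbreviation (input) "xbb \<equiv> 41::nat"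
abbreviation (input) "xT \<equiv> 42::nat"
abbreviation (input) "xn1 \<equiv> 43::nat"
abbreviation (input) "aPOS \<equiv> 24::nat"
abbreviation (input) "aMP \<equiv> 25::nat"
abbreviation (input) "aOUT \<equiv> 26::nat"
abbreviation (input) "aPB \<equiv> 27::nat"

definition push :: "expr \<Rightarrow> cmd" where
  "push e = Write aOUT (Var xoo) e ;; xoo ::= Plus (Var xoo) (Num 1)"

definition answer :: "store \<Rightarrow> nat list" where
  "answer t = map (arrs t aOUT) [0..<vars t xoo]"

lemma answer_cong: "vars t xoo = vars s xoo \<Longrightarrow> arrs t aOUT = arrs s aOUT \<Longrightarrow> answer t = answer s"
  by (simp add: answer_def)

lemma push_simps [simp]:
  "vars (sem (push e) t) = (vars t)(xoo := Suc (vars t xoo))"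
  "a \<noteq> aOUT \<Longrightarrow> arrs (sem (push e) t) a = arrs t a"
  "answer (sem (push e) t) = answer t @ [val e t]"
  "assigned (push e) = {xoo}" "written (push e) = {aOUT}"
  by (simp_all add: push_def answer_def)

lemma length_answer: "length (answer t) = vars t xoo"
  by (simp add: answer_def)

text \<open>Follows the recursion of \<open>tree_path\<close>: nodes left by the first end are
  written at once, nodes left by the second end go on a stack and are written last.\<close>

definition walk_step :: cmd where
  "walk_step = When (NotE (Equal (Var xaa) (Var xbb)))
     (Cond (Less (Var xaa) (Var xbb)) (push (Arr aQ (Var xaa)) ;; xaa ::= Arr aPR (Var xaa))
       (Write aPB (Var xpb) (Arr aQ (Var xbb)) ;; xpb ::= Plus (Var xpb) (Num 1) ;; xbb ::= Arr aPR (Var xbb)))"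

definition pop_step :: cmd where
  "pop_step = When (Var xpb) (xpb ::= Minus (Var xpb) (Num 1) ;; push (Arr aPB (Var xpb)))"

definition write_path :: cmd where
  "write_path = xpb ::= Num 0 ;; For xi xT walk_step ;; push (Arr aQ (Var xaa)) ;; For xi xT pop_step"

text \<open>The length of the route precedes it in the output but is known only afterwards, so a 0
  is reserved and replaced in the end.\<close>

definition write_edge :: cmd where
  "write_edge = xaa ::= Arr aPOS (Var xz) ;; xbb ::= Arr aPOS (Plus (Var xz) (Num 1)) ;;
     push (Arr aVO (Var xz)) ;; push (Arr aVO (Plus (Var xz) (Num 1))) ;; xlp ::= Var xoo ;; push (Num 0) ;;
     write_path ;; Write aOUT (Var xlp) (Minus (Minus (Var xoo) (Var xlp)) (Num 1))"

definition write_mapping :: cmd where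
  "write_mapping = xra ::= Arr aTX (Var xo) ;; xrb ::= Arr aTY (Var xo) ;; revapp ;;
     For xz xN (Write aPOS (Var xz) (Arr aHD (Var xrb)) ;; xrb ::= Arr aTL (Var xrb)) ;;
     For xz xN (Write aMP (Arr aVO (Var xz)) (Arr aQ (Arr aPOS (Var xz)))) ;;
     xoo ::= Num 0 ;; push (Num 1) ;; For xz xN (push (Arr aMP (Var xz))) ;; For xz xn1 write_edge"

lemma write_frames [simp]:
  "assigned walk_step = {xoo, xaa, xpb, xbb}" "written walk_step = {aOUT, aPB}"
  "assigned pop_step = {xpb, xoo}" "written pop_step = {aOUT}"
  "assigned write_path = {xpb, xi, xoo, xaa, xbb}" "written write_path = {aOUT, aPB}"
  "assigned write_edge = {xpb, xi, xoo, xaa, xbb, xlp}" "written write_edge = {aOUT, aPB}"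
  by (auto simp: walk_step_def pop_step_def write_path_def write_edge_def)

lemma tree_path_same: "tree_path P k a a = [a]"
  by (cases k) auto

lemma write_path_correct:
  fixes s defines "Q \<equiv> arrs s aQ" and "P \<equiv> arrs s aPR"
  shows "answer (sem write_path s) = answer s @ map Q (tree_path P (vars s xT) (vars s xaa) (vars s xbb))"
proof -
  let ?T = "vars s xT"
  define rest where "rest t = rev (map (arrs t aPB) [0..<vars t xpb])" for t
  let ?goal = "answer s @ map Q (tree_path P ?T (vars s xaa) (vars s xbb))"
  define s1 where "s1 = sem (xpb ::= Num 0) s"
  \<comment> \<open>Output, route still to be walked and reversed stack always compose the final
    output. The remaining fuel of the route is the number of rounds left.\<close>
  define I where "I k t \<longleftrightarrow> vars t xpb \<le> k \<and>
    answer t @ map Q (tree_path P (?T - k) (vars t xaa) (vars t xbb)) @ rest t = ?goal" for k t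
  define s2 where "s2 = sem (For xi xT walk_step) s1"
  have "I (vars s1 xT) s2" unfolding s2_def
  proof (rule sem_For_invariant)
    show "I 0 (set_var xi 0 s1)" by (simp add: I_def rest_def s1_def answer_def)
  next
    fix k t assume A: "k < vars s1 xT" "I k t" and F: "\<And>a. a \<notin> written walk_step \<Longrightarrow> arrs t a = arrs s1 a"
    have f: "arrs t aQ = Q" "arrs t aPR = P" using F by (simp_all add: s1_def Q_def P_def)
    have T: "?T - k = Suc (?T - Suc k)" using A(1) by (simp add: s1_def)
    let ?a = "vars t xaa" and ?b = "vars t xbb" and ?t' = "sem walk_step t"
    have "I (Suc k) ?t'"
    proof -
      consider "?a = ?b" | "?a < ?b" | "?b < ?a" by linarith
      then show ?thesis
      proof cases
        case 1
        then have "?t' = t" by (simp add: walk_step_def)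
        then show ?thesis using A(2) 1 by (simp add: I_def tree_path_same)
      next
        case 2
        then have r: "vars ?t' xaa = P ?a" "vars ?t' xbb = ?b" "vars ?t' xpb = vars t xpb" "arrs ?t' aPB = arrs t aPB"
          using f by (simp_all add: walk_step_def)
        have "answer ?t' = answer (sem (push (Arr aQ (Var xaa))) t)"
          using 2 by (intro answer_cong) (simp_all add: walk_step_def)
        then have "answer ?t' = answer t @ [Q ?a]" using f by simp
        then show ?thesis using A(2) 2 r by (simp add: I_def T rest_def)
      next
        case 3
        then have r: "vars ?t' xaa = ?a" "vars ?t' xbb = P ?b" "vars ?t' xpb = Suc (vars t xpb)"
          "arrs ?t' aPB = (arrs t aPB)(vars t xpb := Q ?b)" "answer ?t' = answer t"
          using f by (simp_all add: walk_step_def answer_def)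
        then have "rest ?t' = Q ?b # rest t" by (simp add: rest_def)
        then show ?thesis using A(2) 3 r by (simp add: I_def T)
      qed
    qed
    then show "I (Suc k) (set_var xi (Suc k) ?t')" by (simp add: I_def rest_def answer_def)
  qed simp
  then have I: "I ?T s2" by (simp add: s1_def)
  define s3 where "s3 = sem (push (Arr aQ (Var xaa))) s2"
  have "arrs s2 aQ = Q" by (simp add: s2_def s1_def arrs_sem Q_def)
  then have o3: "answer s3 @ rest s3 = ?goal" and pb3: "vars s3 xpb \<le> ?T"
    using I by (simp_all add: s3_def I_def rest_def)
  have T3: "vars s3 xT = ?T" by (simp add: s3_def s2_def s1_def vars_sem)
  define J where "J k t \<longleftrightarrow> vars t xpb = vars s3 xpb - k \<and> answer t @ rest t = ?goal" for k t
  have "J (vars s3 xT) (sem (For xi xT pop_step) s3)"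
  proof (rule sem_For_invariant)
    show "J 0 (set_var xi 0 s3)" using o3 by (simp add: J_def rest_def answer_def)
  next
    fix k t assume A: "J k t"
    let ?t' = "sem pop_step t"
    have "J (Suc k) ?t'"
    proof (cases "vars t xpb")
      case 0
      then have "?t' = t" by (simp add: pop_step_def)
      then show ?thesis using A 0 by (simp add: J_def)
    next
      case (Suc b)
      then have "vars ?t' xpb = b" "arrs ?t' aPB = arrs t aPB" by (simp_all add: pop_step_def)
      moreover have "answer ?t' = answer t @ [arrs t aPB b]"
        using Suc by (simp add: pop_step_def) (simp add: answer_def)
      moreover have "b = vars s3 xpb - Suc k" using A Suc unfolding J_def by linarith
      ultimately show ?thesis using A Suc by (simp add: J_def rest_def)
    qed
    then show "J (Suc k) (set_var xi (Suc k) ?t')" by (auto simp: J_def rest_def answer_def)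
  qed simp
  moreover have "sem write_path s = sem (For xi xT pop_step) s3"
    by (simp add: write_path_def s3_def s2_def s1_def)
  ultimately have "J ?T (sem write_path s)" by (simp only: T3)
  then show ?thesis using pb3 by (auto simp: J_def rest_def)
qed

lemma write_edge_correct:
  fixes s defines "Q \<equiv> arrs s aQ" and "P \<equiv> arrs s aPR" and "z \<equiv> vars s xz"
  defines "path \<equiv> map Q (tree_path P (vars s xT) (arrs s aPOS z) (arrs s aPOS (Suc z)))"
  shows "answer (sem write_edge s) = answer s @ [arrs s aVO z, arrs s aVO (Suc z), length path] @ path"
proof -
  define s1 where "s1 = sem (xaa ::= Arr aPOS (Var xz) ;; xbb ::= Arr aPOS (Plus (Var xz) (Num 1)) ;;
     push (Arr aVO (Var xz)) ;; push (Arr aVO (Plus (Var xz) (Num 1))) ;; xlp ::= Var xoo ;; push (Num 0)) s"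
  have o1: "answer s1 = answer s @ [arrs s aVO z, arrs s aVO (Suc z), 0]"
    by (simp add: s1_def z_def push_def answer_def)
  have v1: "vars s1 xaa = arrs s aPOS z" "vars s1 xbb = arrs s aPOS (Suc z)" "vars s1 xT = vars s xT"
    "arrs s1 aQ = Q" "arrs s1 aPR = P" "vars s1 xlp = length (answer s) + 2"
    by (simp_all add: s1_def z_def Q_def P_def length_answer)
  define s2 where "s2 = sem write_path s1"
  have o2: "answer s2 = answer s @ [arrs s aVO z, arrs s aVO (Suc z), 0] @ path"
    using write_path_correct[of s1] o1 v1 by (simp add: s2_def path_def)
  have lp: "vars s2 xlp = length (answer s) + 2" using v1 by (simp add: s2_def vars_sem)
  have oo: "vars s2 xoo = length (answer s) + 3 + length path" using arg_cong[OF o2, of length] by (simp add: length_answer)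
  let ?n = "length path"
  have "sem write_edge s = sem (Write aOUT (Var xlp) (Minus (Minus (Var xoo) (Var xlp)) (Num 1))) s2"
    by (simp add: write_edge_def s2_def s1_def)
  then have "answer (sem write_edge s) = (answer s2)[vars s2 xlp := ?n]"
    using lp oo by (intro nth_equalityI) (auto simp: answer_def nth_list_update)
  also have "\<dots> = answer s @ [arrs s aVO z, arrs s aVO (Suc z), ?n] @ path"
    unfolding o2 lp by (simp add: list_update_append)
  finally show ?thesis .
qed

lemma write_mapping_correct:
  fixes s defines "Q \<equiv> arrs s aQ" and "P \<equiv> arrs s aPR" and "VO \<equiv> arrs s aVO" and "n \<equiv> vars s xN"
  assumes A: "heap_list s (arrs s aTX (vars s xo)) A" and B: "heap_list s (arrs s aTY (vars s xo)) B"
    and L: "L = rev A @ B" "length L = n" and VO: "inj_on VO {..<n}" and n1: "vars s xn1 = n - 1"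
  shows "\<exists>M. (\<forall>i<n. M (VO i) = Q (L ! i)) \<and> answer (sem write_mapping s) = 1 # map M [0..<n] @
    concat (map (\<lambda>z. let q = map Q (tree_path P (vars s xT) (L ! z) (L ! Suc z)) in [VO z, VO (Suc z), length q] @ q) [0..<n - 1])"
proof -
  define s1 where "s1 = sem (xra ::= Arr aTX (Var xo) ;; xrb ::= Arr aTY (Var xo)) s"
  define s2 where "s2 = sem revapp s1"
  have rv: "heap_list s2 (vars s2 xrb) L" unfolding s2_def L(1)
    by (rule revapp_correct) (use A B L in \<open>auto simp: s1_def n_def\<close>)
  have f2: "vars s2 xN = n" "arrs s2 aQ = Q" "arrs s2 aPR = P" "arrs s2 aVO = VO" "vars s2 xT = vars s xT" "vars s2 xn1 = n - 1"
    using n1 by (simp_all add: s2_def s1_def vars_sem arrs_sem n_def Q_def P_def VO_def)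
  let ?c3 = "Write aPOS (Var xz) (Arr aHD (Var xrb)) ;; xrb ::= Arr aTL (Var xrb)"
  define s3 where "s3 = sem (For xz xN ?c3) s2"
  define I where "I k t \<longleftrightarrow> list_at (arrs s2 aHD) (arrs s2 aTL) (vars t xrb) (drop k L) \<and> (\<forall>i<k. arrs t aPOS i = L ! i)" for k t
  have "I (vars s2 xN) s3" unfolding s3_def
  proof (rule sem_For_invariant)
    show "I 0 (set_var xz 0 s2)" using rv by (simp add: I_def)
  next
    fix k t assume K: "k < vars s2 xN" "I k t" "vars t xz = k" and F: "\<And>a. a \<notin> written ?c3 \<Longrightarrow> arrs t a = arrs s2 a"
    have "drop k L = L ! k # drop (Suc k) L" using K(1) f2(1) L(2) by (intro Cons_nth_drop_Suc[symmetric]) simp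
    moreover have "arrs t aHD = arrs s2 aHD" "arrs t aTL = arrs s2 aTL" using F by simp_all
    ultimately show "I (Suc k) (set_var xz (Suc k) (sem ?c3 t))" using K by (auto simp: I_def less_Suc_eq)
  qed simp
  then have POS: "\<forall>i<n. arrs s3 aPOS i = L ! i" using f2 by (simp add: I_def)
  have f3: "vars s3 xN = n" "arrs s3 aQ = Q" "arrs s3 aPR = P" "arrs s3 aVO = VO" "vars s3 xT = vars s xT" "vars s3 xn1 = n - 1"
    using f2 by (simp_all add: s3_def vars_sem arrs_sem)
  let ?c4 = "Write aMP (Arr aVO (Var xz)) (Arr aQ (Arr aPOS (Var xz)))"
  define s4 where "s4 = sem (For xz xN ?c4) s3"
  define J where "J k t \<longleftrightarrow> (\<forall>i<k. arrs t aMP (VO i) = Q (L ! i))" for k t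
  have "J (vars s3 xN) s4" unfolding s4_def
  proof (rule sem_For_invariant)
    fix k t assume K: "k < vars s3 xN" "J k t" "vars t xz = k" and F: "\<And>a. a \<notin> written ?c4 \<Longrightarrow> arrs t a = arrs s3 a"
    have "arrs t aPOS k = L ! k" "arrs t aVO = VO" "arrs t aQ = Q" using F POS K(1) f3 by simp_all
    moreover have "VO i \<noteq> VO k" if "i < k" for i using inj_onD[OF VO, of i k] that K(1) f3 by auto
    ultimately show "J (Suc k) (set_var xz (Suc k) (sem ?c4 t))" using K by (auto simp: J_def less_Suc_eq)
  qed (simp_all add: J_def)
  then have MP: "\<forall>i<n. arrs s4 aMP (VO i) = Q (L ! i)" using f3 by (simp add: J_def)
  have f4: "vars s4 xN = n" "arrs s4 aQ = Q" "arrs s4 aPR = P" "arrs s4 aVO = VO" "vars s4 xT = vars s xT" "vars s4 xn1 = n - 1" "arrs s4 aPOS = arrs s3 aPOS"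
    using f3 by (simp_all add: s4_def vars_sem arrs_sem)
  define s5 where "s5 = sem (xoo ::= Num 0 ;; push (Num 1)) s4"
  have o5: "answer s5 = [1]" by (simp add: s5_def push_def answer_def)
  have f5: "vars s5 xN = n" "arrs s5 aMP = arrs s4 aMP" using f4 by (simp_all add: s5_def)
  let ?c6 = "push (Arr aMP (Var xz))"
  define s6 where "s6 = sem (For xz xN ?c6) s5"
  define K where "K k t \<longleftrightarrow> answer t = 1 # map (arrs s4 aMP) [0..<k]" for k t
  have "K (vars s5 xN) s6" unfolding s6_def
  proof (rule sem_For_invariant)
    show "K 0 (set_var xz 0 s5)" using o5 by (simp add: K_def answer_def)
  next
    fix k t assume K: "K k t" "vars t xz = k" and F: "\<And>a. a \<notin> written ?c6 \<Longrightarrow> arrs t a = arrs s5 a"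
    have "arrs t aMP = arrs s4 aMP" using F f5 by simp
    then have "answer (sem ?c6 t) = 1 # map (arrs s4 aMP) [0..<Suc k]" using K by (simp add: K_def)
    then show "K (Suc k) (set_var xz (Suc k) (sem ?c6 t))"
      using answer_cong[of "set_var xz (Suc k) (sem ?c6 t)" "sem ?c6 t"] unfolding K_def by simp
  qed simp
  then have o6: "answer s6 = 1 # map (arrs s4 aMP) [0..<n]" using f5 by (simp add: K_def)
  have f6: "arrs s6 aQ = Q" "arrs s6 aPR = P" "arrs s6 aVO = VO" "vars s6 xT = vars s xT" "vars s6 xn1 = n - 1" "arrs s6 aPOS = arrs s3 aPOS"
    using f4 by (simp_all add: s6_def s5_def vars_sem arrs_sem)
  define blk where "blk z = (let q = map Q (tree_path P (vars s xT) (L ! z) (L ! Suc z)) in [VO z, VO (Suc z), length q] @ q)" for z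
  define R where "R k t \<longleftrightarrow> answer t = answer s6 @ concat (map blk [0..<k])" for k t
  have "R (vars s6 xn1) (sem (For xz xn1 write_edge) s6)"
  proof (rule sem_For_invariant)
    show "R 0 (set_var xz 0 s6)" by (simp add: R_def answer_def)
  next
    fix k t assume K: "k < vars s6 xn1" "R k t" "vars t xz = k" and
      F: "\<And>v. v \<notin> assigned (For xz xn1 write_edge) \<Longrightarrow> vars t v = vars s6 v" "\<And>a. a \<notin> written write_edge \<Longrightarrow> arrs t a = arrs s6 a"
    have "vars t xT = vars s xT" "arrs t aQ = Q" "arrs t aPR = P" "arrs t aVO = VO" "arrs t aPOS = arrs s3 aPOS"
      using F f6 by simp_all
    moreover have "arrs s3 aPOS k = L ! k" "arrs s3 aPOS (Suc k) = L ! Suc k" using POS K(1) f6 by simp_all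
    ultimately have "answer (sem write_edge t) = answer t @ blk k"
      using write_edge_correct[of t] K(3) by (simp add: blk_def Let_def)
    then show "R (Suc k) (set_var xz (Suc k) (sem write_edge t))"
      using K(2) answer_cong[of "set_var xz (Suc k) (sem write_edge t)" "sem write_edge t"] by (simp add: R_def)
  qed simp
  moreover have "sem write_mapping s = sem (For xz xn1 write_edge) s6"
    by (simp add: write_mapping_def s6_def s5_def s4_def s3_def s2_def s1_def)
  ultimately have "answer (sem write_mapping s) = 1 # map (arrs s4 aMP) [0..<n] @ concat (map blk [0..<n - 1])"
    using f6 o6 by (simp add: R_def)
  then show ?thesis using MP unfolding blk_def[abs_def] by blast
qed

section \<open>Running time of the solver\<close>

text \<open>Loop bounds may be replaced by larger ones, so that the running time of a piece becomes
  a polynomial in \<open>n\<close> and \<open>N\<close>.\<close>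

lemma runs_env:
  assumes "cmd_ok c" "bounds c \<inter> assigned c = {}" "\<And>y. y \<in> bounds c \<Longrightarrow> vars s y \<le> env y"
  shows "runs L c s (time_bound c env)"
proof -
  have "time_bound c (vars s) \<le> time_bound c env" using assms(3)
  proof (induction c)
    case (For x y c)
    then show ?case by (auto intro!: mult_mono)
  qed (auto intro!: add_mono)
  then show ?thesis using runs_mono[OF runs_time_bound[OF assms(1,2)]] by blast
qed

lemma push_costs [simp]:
  "bounds (push e) = {}" "time_bound (push e) env = expr_time e + 17" "cmd_ok (push e) = expr_ok e"
  by (simp_all add: push_def)

lemmas program_defs = load_virtual_def setup_virtual_def arrange_virtual_def load_substrate_def setup_substrate_def
  arrange_substrate_def degrees_def count_end_def choose_root_def arrange_def peel_def peel_step_def ranks_def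
  check_path_def normalise_def solve_dp_def index_tables_def initial_tables_def initial_row_def initial_row_step_def
  merge_all_def merge_row_def lift_child_def merge_row_step_def find_best_def find_best_step_def build_entry_def
  choose_lists_def revapp_def revapp_step_def locate_def read_header_def write_mapping_def write_edge_def write_path_def
  walk_step_def pop_step_def

text \<open>Turns comparisons of polynomials in \<open>n\<close> and \<open>N\<close> into linear
  arithmetic over their monomials.\<close>

lemma monomials_le:
  fixes n N :: nat
  assumes "0 < n" "0 < N"
  shows "1 \<le> n * n * N" "n \<le> n * n * N" "N \<le> n * n * N" "n * N \<le> n * n * N" "n * n \<le> n * n * N"
  using assms by (simp_all add: Suc_le_eq)

lemma time_read_header: "runs L read_header s 1000"
  by (rule runs_mono[OF runs_env[where env = "\<lambda>_. 0"]]) (simp_all add: program_defs)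

lemma time_solve:
  assumes h: "header_ok s" and raw: "raw_ok (arrs s aX)"
  defines "n \<equiv> arrs s aX 0" and "N \<equiv> subs_nodes (arrs s aX)"
  shows "runs L solve s (10000000 * (n * n * N))"
proof -
  have nN: "0 < n" "0 < N" using raw by (simp_all add: raw_ok_def n_def N_def)
  note mono = monomials_le[OF nN]
  define X where "X = arrs s aX"
  have b: "virt_edges X \<le> n" "subs_edges X \<le> N" using raw by (simp_all add: raw_ok_def n_def N_def X_def)
  have v: "vars s xN = n" "vars s xM = virt_edges X" "vars s xS = N" "vars s xE = subs_edges X"
    using h by (simp_all add: header_ok_def Let_def n_def N_def X_def)
  define s1 where "s1 = sem load_virtual s"
  define s2 where "s2 = sem setup_virtual s1"
  define s3 where "s3 = sem arrange_virtual s2"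
  define s4 where "s4 = sem load_substrate s3"
  define s5 where "s5 = sem setup_substrate s4"
  define s6 where "s6 = sem arrange_substrate s5"
  define s7 where "s7 = sem solve_dp s6"
  note ds = s1_def s2_def s3_def s4_def s5_def s6_def s7_def
  have 1: "runs L load_virtual s (200 + 200 * n)"
    by (rule runs_mono[OF runs_env[where env = "\<lambda>_. n"]]) (use v b in \<open>simp_all add: program_defs\<close>)
  have 2: "runs L setup_virtual s1 100"
    by (rule runs_mono[OF runs_env[where env = "\<lambda>_. 0"]]) (simp_all add: program_defs)
  have v1: "vars s1 xN = n" "vars s1 xM = virt_edges X" using v by (simp_all add: ds vars_sem)
  have 3: "runs L arrange_virtual s2 (2000 + 2000 * n)"
    by (rule runs_mono[OF runs_env[where env = "\<lambda>_. n"]]) (use v1 b in \<open>auto simp: program_defs s2_def\<close>)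
  have v3: "vars s3 xE = subs_edges X" using v by (simp add: ds vars_sem)
  have 4: "runs L load_substrate s3 (200 + 200 * N)"
    by (rule runs_mono[OF runs_env[where env = "\<lambda>_. N"]]) (use v3 b in \<open>simp_all add: program_defs\<close>)
  have 5: "runs L setup_substrate s4 100"
    by (rule runs_mono[OF runs_env[where env = "\<lambda>_. 0"]]) (simp_all add: program_defs)
  have v4: "vars s4 xN = n" "vars s4 xS = N" "vars s4 xE = subs_edges X" using v by (simp_all add: ds vars_sem)
  have v5: "vars s5 xG = N" "vars s5 xg = N - 1" "vars s5 xH = subs_edges X" "vars s5 xN = n" "vars s5 xQ = 3 * (n + 1)"
    using v4 by (simp_all add: s5_def setup_substrate_def)
  have 6: "runs L arrange_substrate s5 (2000 + 2000 * N)"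
    by (rule runs_mono[OF runs_env[where env = "\<lambda>_. N"]]) (use v5 b in \<open>auto simp: program_defs\<close>)
  have v6: "vars s6 xG = N" "vars s6 xg = N - 1" "vars s6 xN = n" "vars s6 xQ = 3 * (n + 1)"
    using v5 by (simp_all add: s6_def vars_sem)
  \<comment> \<open>As \<open>n\<close> is positive, the row width \<open>3 * (n + 1)\<close> is at
    most \<open>6 * n\<close>. The other bounds are \<open>n\<close> for list lengths and at most
    \<open>N\<close> for the loops over the tree.\<close>
  let ?env = "\<lambda>y. if y = xQ then 6 * n else if y = xN then n else N"
  have 7: "runs L solve_dp s6 (1000 + 2000 * n + 2000 * N + 10000 * (n * N) + 10000 * (n * n * N))"
    by (rule runs_mono[OF runs_env[where env = ?env]])
      (use v6 nN in \<open>auto simp: program_defs algebra_simps\<close>)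
  have 8: "runs L locate s7 100"
    by (rule runs_mono[OF runs_env[where env = "\<lambda>_. 0"]]) (simp_all add: program_defs)
  have "runs L solve s ((200 + 200 * n + (100 + (2000 + 2000 * n + (200 + 200 * N + (100 + (2000 + 2000 * N)))))) +
    ((1000 + 2000 * n + 2000 * N + 10000 * (n * N) + 10000 * (n * n * N)) + 100))"
    unfolding solve_def prepare_def
    by (intro runs_Seq) (use 1 2 3 4 5 6 7 8 in \<open>simp_all add: ds\<close>)
  then show ?thesis by (rule runs_mono) (use mono in linarith)
qed

section \<open>The optimisation problem\<close>

definition setup_write :: cmd where
  "setup_write = xT ::= Plus (Var xG) (Var xG) ;; xn1 ::= Minus (Var xN) (Num 1)"

definition solver :: cmd where
  "solver = read_header ;; solve ;; setup_write ;;
     Cond (Arr aTC (Var xo)) write_mapping (xoo ::= Num 0 ;; push (Num 0))"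

text \<open>Both graphs are trees, with one edge less than nodes, and the listings are injective;
  this fixes the edge numbers in the header.\<close>

lemma path_to_tree_raw_ok:
  assumes I: "path_to_tree I" and m: "input_matches X I"
  shows "raw_ok X"
proof -
  have VI: "VR I = {..<X 0}" "VS I = {..<subs_nodes X}" "inj_on (virt_edge X) {..<virt_edges X}"
    "ER I = virt_edge X ` {..<virt_edges X}" "inj_on (subs_edge X) {..<subs_edges X}" "ES I = subs_edge X ` {..<subs_edges X}"
    using m by (simp_all add: input_matches_def)
  obtain p where p: "p \<noteq> []" "distinct p" "set p = VR I" "path_edges p = ER I"
    using I unfolding path_to_tree_def path_graph_def by blast
  have tv: "tree_graph (VR I) (ER I)" using path_tree_graph[OF p(1,2)] p by simp
  have ts: "tree_graph (VS I) (ES I)" using I by (simp add: path_to_tree_def)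
  have "virt_edges X = X 0 - 1" "subs_edges X = subs_nodes X - 1"
    using tree_graph_card_edges[OF tv] tree_graph_card_edges[OF ts] VI by (auto simp: card_image)
  moreover have "0 < X 0" "0 < subs_nodes X" using tv ts VI by (auto simp: tree_graph_def simple_graph_def)
  moreover have "\<forall>e<virt_edges X. virt_edge X e \<subseteq> {..<X 0}" "\<forall>e<subs_edges X. subs_edge X e \<subseteq> {..<subs_nodes X}"
    using tv ts unfolding VI tree_graph_def simple_graph_def by blast+
  ultimately show ?thesis by (simp add: raw_ok_def)
qed

lemma concat_map_cong: "(\<And>x. x \<in> set xs \<Longrightarrow> f x = g x) \<Longrightarrow> concat (map f xs) = concat (map g xs)"
  by (metis map_cong)

lemma solver_correct:
  assumes I: "path_to_tree I" and enc: "encodes_cvne xs I"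
  shows "\<exists>ys. computes_within (RSeq copy_input (RSeq (compile solver) (copy_output aOUT xoo))) xs
     (100000000 * card (VR I) ^ 2 * card (VS I)) ys \<and> is_answer I ys"
proof -
  define s where "s = initial_store xs"
  define X where "X = arrs s aX"
  have X: "X i = xs ! i" if "i < length xs" for i using that by (simp add: X_def s_def initial_store_def)
  have m: "input_matches X I" and len: "length xs = edge_pos X + 1 + 4 * subs_edges X"
    using encodes_matches[OF enc X] by auto
  have raw: "raw_ok X" by (rule path_to_tree_raw_ok[OF I m])
  define n where "n = X 0"
  define N where "N = subs_nodes X"
  have nN: "0 < n" "0 < N" using raw by (simp_all add: raw_ok_def n_def N_def)
  have card: "card (VR I) = n" "card (VS I) = N" using m by (simp_all add: input_matches_def n_def N_def)
  define s1 where "s1 = sem read_header s"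
  have h: "header_ok s1" "arrs s1 aX = X" using read_header_correct[of s] by (simp_all add: s1_def X_def)
  define t where "t = sem solve s1"
  note sol = solve_correct[OF h(1), unfolded h(2), OF raw, folded t_def n_def N_def]
  have ok: "vars t xokv = 1 \<and> vars t xok = 1" by (rule sol(2)[OF I m])
  define c where "c = arrs t aTC (vars t xo)"
  define VO where "VO = arrs t aVO"
  define p where "p = map VO [0..<n]"
  define Q where "Q = arrs t aQ"
  define P where "P = arrs t aPR"
  note S = sol(1)[OF ok m, folded c_def VO_def, folded p_def Q_def P_def]
  have AI: "arranged_instance N P I p Q" using S by blast
  interpret arranged_instance N P I p Q by (rule AI)
  have lp: "length p = n" by (simp add: p_def)
  define t2 where "t2 = sem setup_write t"
  have t2: "arrs t2 = arrs t" "vars t2 xN = n" "vars t2 xT = N + N" "vars t2 xn1 = n - 1" "vars t2 xo = vars t xo" "vars t2 xhp = vars t xhp"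
    using sol(4,5) by (simp_all add: t2_def setup_write_def)
  define u where "u = sem solver s"
  have u: "u = (if c = 0 then sem (xoo ::= Num 0 ;; push (Num 0)) t2 else sem write_mapping t2)"
    by (simp add: u_def solver_def s1_def[symmetric] t_def[symmetric] t2_def[symmetric] c_def t2)
  have main: "is_answer I (answer u) \<and> length (answer u) \<le> 10 * (n * n * N)"
  proof (cases "c = 0")
    case True
    then have "answer u = [0]" by (simp add: u push_def answer_def)
    moreover have "\<not> (\<exists>m. feasible I m)" using S True by blast
    ultimately show ?thesis using nN by (simp add: is_answer_def)
  next
    case False
    then obtain A B where AB: "heap_list t (arrs t aTX (vars t xo)) A" "heap_list t (arrs t aTY (vars t xo)) B"
      "realises N P Q p I (c - 1) (rev A @ B)" using S by blast
    define L where "L = rev A @ B"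
    have L: "length L = n" "set L \<subseteq> {..<N}" using AB(3) lp by (simp_all add: realises_def L_def)
    have inj: "inj_on VO {..<n}" using p(2) by (simp add: p_def distinct_map atLeast0LessThan)
    let ?path = "\<lambda>z. map Q (tree_path P (N + N) (L ! z) (L ! Suc z))"
    obtain M where M: "\<forall>i<n. M (VO i) = Q (L ! i)" "answer u = 1 # map M [0..<n] @
       concat (map (\<lambda>z. let q = ?path z in [VO z, VO (Suc z), length q] @ q) [0..<n - 1])"
      using write_mapping_correct[of t2 A B L] AB L inj False t2
      by (auto simp: L_def u VO_def Q_def P_def)
    obtain m where m1: "\<forall>i<n. fst m (p ! i) = Q (L ! i)"
      and m2: "\<forall>i. Suc i < n \<longrightarrow> snd m {p ! i, p ! Suc i} = ?path i"
      using exists_mapping_of_tour[of L] lp by auto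
    have fm: "feasible I m" "cost I m = c - 1"
      using AB(3) m1 m2 lp unfolding realises_def L_def[symmetric] by blast+
    have "min_cost_feasible I m" unfolding min_cost_feasible_def using fm S by auto
    moreover have "encodes_mapping (map M [0..<n] @
       concat (map (\<lambda>z. let q = ?path z in [VO z, VO (Suc z), length q] @ q) [0..<n - 1])) I m"
      unfolding encodes_mapping_def
    proof (intro exI[of _ "map (\<lambda>z. (VO z, VO (Suc z))) [0..<n - 1]"] conjI)
      let ?vs = "map (\<lambda>z. (VO z, VO (Suc z))) [0..<n - 1]"
      have e: "map (\<lambda>(u, v). {u, v}) ?vs = map (\<lambda>z. {p ! z, p ! Suc z}) [0..<n - 1]" by (simp add: p_def)
      show "lists_edges ?vs (ER I)" unfolding lists_edges_def e
      proof
        show "distinct (map (\<lambda>z. {p ! z, p ! Suc z}) [0..<n - 1])"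
          using path_edges_inj[OF p(2)] lp by (auto simp: distinct_map inj_on_def)
        show "set (map (\<lambda>z. {p ! z, p ! Suc z}) [0..<n - 1]) = ER I"
          unfolding p(4)[symmetric] path_edges_def lp by (auto simp: image_iff)
      qed
      have "M a = fst m a" if a: "a < n" for a
      proof -
        have "set p = {..<n}" using p(3) \<open>input_matches X I\<close> by (simp add: input_matches_def n_def)
        then have "a \<in> set p" using a by simp
        then obtain i where "i < n" "a = p ! i" unfolding in_set_conv_nth lp by (elim exE conjE) simp
        then show ?thesis using M(1) m1 by (simp add: p_def)
      qed
      then have 1: "map M [0..<n] = map (fst m) [0..<card (VR I)]" using card by simp
      have "concat (map (\<lambda>(a, b). [a, b, length (snd m {a, b})] @ snd m {a, b}) ?vs) =
        concat (map (\<lambda>z. [VO z, VO (Suc z), length (snd m {VO z, VO (Suc z)})] @ snd m {VO z, VO (Suc z)}) [0..<n - 1])"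
        by (simp add: comp_def)
      also have "\<dots> = concat (map (\<lambda>z. let q = ?path z in [VO z, VO (Suc z), length q] @ q) [0..<n - 1])"
        by (rule concat_map_cong) (use m2 in \<open>auto simp: p_def Let_def\<close>)
      finally show "map M [0..<n] @ concat (map (\<lambda>z. let q = ?path z in [VO z, VO (Suc z), length q] @ q) [0..<n - 1]) =
        map (fst m) [0..<card (VR I)] @ concat (map (\<lambda>(a, b). [a, b, length (snd m {a, b})] @ snd m {a, b}) ?vs)"
        using 1 by simp
    qed
    moreover have ex: "\<exists>m. feasible I m" by (rule exI) (rule fm(1))
    ultimately have "is_answer I (answer u)" unfolding is_answer_def M(2) if_P[OF ex]
      by - (intro exI conjI, assumption, assumption, rule refl)
    \<comment> \<open>A route has no repeated node, hence at most \<open>N\<close> nodes. The length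
      is bounded because copying the answer to the output is part of the running time.\<close>
    moreover have "length (answer u) \<le> 1 + n + n * (3 + N)"
    proof -
      have "length (?path z) \<le> N" if "Suc z < n" for z
      proof -
        have LN: "L ! z < N" "L ! Suc z < N" using L that nth_mem[of _ L] by (metis Suc_lessD lessThan_iff subsetD)+
        have fuel: "N - 1 - L ! z + (N - 1 - L ! Suc z) \<le> N + N" by simp
        note tp = tree_path_props[OF LN fuel]
        have "card (set (tree_path P (N + N) (L ! z) (L ! Suc z))) \<le> card {..<N}"
          using tp(5) by (intro card_mono) auto
        then show ?thesis using distinct_card[OF tp(4)] by simp
      qed
      then have "(\<Sum>z\<leftarrow>[0..<n - 1]. length (let q = ?path z in [VO z, VO (Suc z), length q] @ q)) \<le> (\<Sum>z\<leftarrow>[0..<n - 1]. 3 + N)"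
        by (intro sum_list_mono) (auto simp: Let_def)
      also have "\<dots> = (n - 1) * (3 + N)" by (simp add: sum_list_triv)
      also have "\<dots> \<le> n * (3 + N)" by simp
      finally show ?thesis unfolding M(2) by (simp add: length_concat comp_def)
    qed
    moreover have "1 + n + n * (3 + N) \<le> 10 * (n * n * N)"
    proof -
      have "1 + n + n * (3 + N) = 1 + 4 * n + n * N" by (simp add: algebra_simps)
      then show ?thesis using monomials_le[OF nN] by linarith
    qed
    ultimately show ?thesis by linarith
  qed
  have "runs (length xs) solver s (1000 + (10000000 * (n * n * N) + (100 + (20000 * (n * n * N)))))"
    unfolding solver_def
  proof (intro runs_Seq)
    show "runs (length xs) read_header s 1000" by (rule time_read_header)
    show "runs (length xs) solve (sem read_header s) (10000000 * (n * n * N))"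
      using time_solve[of s1 "length xs"] h raw unfolding s1_def[symmetric] n_def N_def by simp
    show "runs (length xs) setup_write (sem solve (sem read_header s)) 100"
      by (rule runs_mono[OF runs_env[where env = "\<lambda>_. 0"]]) (simp_all add: setup_write_def)
    have w: "runs (length xs) write_mapping t2 (1000 + 1000 * n + 1000 * (n * N))"
      by (rule runs_mono[OF runs_env[where env = "\<lambda>y. if y = xT then 2 * N else n"]])
        (use t2 in \<open>auto simp: program_defs algebra_simps\<close>)
    have w': "runs (length xs) (xoo ::= Num 0 ;; push (Num 0)) t2 (1000 + 1000 * n + 1000 * (n * N))"
      by (rule runs_mono[OF runs_env[where env = "\<lambda>_. 0"]]) simp_all
    have "runs (length xs) (Cond (Arr aTC (Var xo)) write_mapping (xoo ::= Num 0 ;; push (Num 0))) t2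
       (expr_time (Arr aTC (Var xo)) + 1 + (1000 + 1000 * n + 1000 * (n * N)))"
      by (rule runs_Cond[OF _ w w']) simp
    then show "runs (length xs) (Cond (Arr aTC (Var xo)) write_mapping (xoo ::= Num 0 ;; push (Num 0)))
       (sem setup_write (sem solve (sem read_header s))) (20000 * (n * n * N))"
      unfolding s1_def[symmetric] t_def[symmetric] t2_def[symmetric]
    proof (rule runs_mono)
      have "expr_time (Arr aTC (Var xo)) = 11" by simp
      then show "expr_time (Arr aTC (Var xo)) + 1 + (1000 + 1000 * n + 1000 * (n * N)) \<le> 20000 * (n * n * N)"
        using monomials_le[OF nN] by linarith
    qed
  qed
  from computes_within_compile[OF this[unfolded s_def], of aOUT xoo, folded s_def, folded u_def]
  have cw: "computes_within (RSeq copy_input (RSeq (compile solver) (copy_output aOUT xoo))) xs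
     (8 + 14 * length xs + (1000 + (10000000 * (n * n * N) + (100 + (20000 * (n * n * N))))) + 16 * vars u xoo) (answer u)"
    by (simp add: answer_def)
  have "length xs \<le> 4 + 2 * n + 6 * N"
    using len raw by (simp add: edge_pos_def subs_pos_def raw_ok_def n_def N_def)
  moreover have "vars u xoo \<le> 10 * (n * n * N)" using main by (simp add: length_answer)
  ultimately have "8 + 14 * length xs + (1000 + (10000000 * (n * n * N) + (100 + (20000 * (n * n * N))))) + 16 * vars u xoo
    \<le> 100000000 * (n * n * N)"
    using monomials_le[OF nN] by linarith
  then have "computes_within (RSeq copy_input (RSeq (compile solver) (copy_output aOUT xoo))) xs
     (100000000 * card (VR I) ^ 2 * card (VS I)) (answer u)"
    using cw unfolding computes_within_def card by (fastforce simp: power2_eq_square mult.assoc intro: order_trans)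
  then show ?thesis using main by blast
qed

section \<open>The decision problem on bit strings\<close>

section \<open>Decoding\<close>

text \<open>The state of the decoder: whether a digit is expected next, the number read so far, the
  completed numbers, and whether no error has occurred.\<close>

type_synonym decoder = "bool \<times> nat \<times> nat list \<times> bool"

fun dec_step :: "decoder \<Rightarrow> bool \<Rightarrow> decoder" where
  "dec_step (True, v, out, ok) b = (False, 2 * v + of_bool b, out, ok \<and> \<not> (v = 0 \<and> \<not> b))"
| "dec_step (False, v, out, ok) True = (True, v, out, ok)"
| "dec_step (False, v, out, ok) False = (False, 0, out @ [v], ok)"

definition decode :: "bool list \<Rightarrow> decoder" where
  "decode x = foldl dec_step (False, 0, [], True) x"

definition digits_code :: "nat \<Rightarrow> bool list" where
  "digits_code n = concat (map (\<lambda>b. [True, b]) (binary n))"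

lemma encode_nat_eq: "encode_nat n = digits_code n @ [False]"
  by (simp add: encode_nat_def digits_code_def)

lemma binary_0 [simp]: "binary 0 = []"
  by (subst binary.simps) simp

lemma binary_snoc: "2 * v + of_bool b \<noteq> 0 \<Longrightarrow> binary (2 * v + of_bool b) = binary v @ [b]"
  by (subst binary.simps) auto

lemma decode_snoc: "decode (x @ [b]) = dec_step (decode x) b"
  by (simp add: decode_def)

text \<open>A digit 0 read while the value is 0 would be a leading zero and is an error. Therefore
  an input without errors is literally the code of what has been read, and no other string can be
  accepted.\<close>

lemma decode_sound:
  "decode x = (m, v, out, True) \<Longrightarrow> x = encode_nats out @ digits_code v @ (if m then [True] else [])"
proof (induction x arbitrary: m v out rule: rev_induct)
  case Nil
  then show ?case by (simp add: decode_def encode_nats_def digits_code_def)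
next
  case (snoc b x)
  obtain m' v' out' ok' where d: "decode x = (m', v', out', ok')" by (cases "decode x") auto
  from snoc.prems have st: "dec_step (m', v', out', ok') b = (m, v, out, True)" by (simp add: decode_snoc d)
  show ?case
  proof (cases m')
    case True
    then have eq: "m = False" "v = 2 * v' + of_bool b" "out = out'" "ok'" "2 * v' + of_bool b \<noteq> 0"
      using st by auto
    then have "x = encode_nats out' @ digits_code v' @ [True]" using snoc.IH d True by simp
    then show ?thesis using eq binary_snoc[OF eq(5)] by (simp add: digits_code_def)
  next
    case False
    then have x: "x = encode_nats out' @ digits_code v'" "ok'" using snoc.IH d st by (cases b; simp)+
    show ?thesis using st False x by (cases b) (auto simp: encode_nats_def encode_nat_eq digits_code_def)
  qed
qed

lemma foldl_digits: "foldl dec_step (False, 0, out, True) (digits_code n) = (False, n, out, True)"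
proof (induction n rule: less_induct)
  case (less n)
  show ?case
  proof (cases "n = 0")
    case True
    then show ?thesis by (simp add: digits_code_def)
  next
    case False
    then have "digits_code n = digits_code (n div 2) @ [True, odd n]"
      by (subst digits_code_def, subst binary.simps) (simp add: digits_code_def)
    moreover have "\<not> (n div 2 = 0 \<and> even n)" using False by presburger
    moreover have "2 * (n div 2) + of_bool (odd n) = n" by simp
    ultimately show ?thesis using less[of "n div 2"] False by simp
  qed
qed

lemma decode_encode: "decode (encode_nats zs) = (False, 0, zs, True)"
proof (induction zs rule: rev_induct)
  case (snoc z zs)
  have "foldl dec_step (decode (encode_nats zs)) (encode_nat z) = (False, 0, zs @ [z], True)"
    unfolding snoc encode_nat_eq by (simp add: foldl_digits)
  then show ?case by (simp add: decode_def encode_nats_def)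
qed (simp add: decode_def encode_nats_def)

lemma decode_length: "decode x = (m, v, out, ok) \<Longrightarrow> length out \<le> length x"
proof (induction x arbitrary: m v out ok rule: rev_induct)
  case (snoc b x)
  obtain m' v' out' ok' where d: "decode x = (m', v', out', ok')" by (cases "decode x") auto
  from snoc.prems have "dec_step (m', v', out', ok') b = (m, v, out, ok)" by (simp add: decode_snoc d)
  then show ?case using snoc.IH[OF d] by (cases m'; cases b) auto
qed (simp add: decode_def)

abbreviation (input) "xmode \<equiv> 44::nat"
abbreviation (input) "xval \<equiv> 45::nat"
abbreviation (input) "xcnt \<equiv> 46::nat"
abbreviation (input) "xdok \<equiv> 47::nat"
abbreviation (input) "xres \<equiv> 48::nat"
abbreviation (input) "xrc \<equiv> 49::nat"

text \<open>The numbers overwrite the digits that have already been read.\<close>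

definition decode_step :: cmd where
  "decode_step = xv ::= Arr aX (Var xi) ;;
     Cond (Var xmode)
       (When (AndE (NotE (Var xval)) (NotE (Var xv))) (xdok ::= Num 0) ;;
        xval ::= Plus (Plus (Var xval) (Var xval)) (Var xv) ;; xmode ::= Num 0)
       (Cond (Var xv) (xmode ::= Num 1)
         (Write aX (Var xcnt) (Var xval) ;; xcnt ::= Plus (Var xcnt) (Num 1) ;; xval ::= Num 0))"

definition decode_bits :: cmd where
  "decode_bits = xmode ::= Num 0 ;; xval ::= Num 0 ;; xcnt ::= Num 0 ;; xdok ::= Num 1 ;; For xi 0 decode_step"

lemma decode_step_frames [simp]:
  "assigned decode_step = {xv, xdok, xval, xmode, xcnt}" "written decode_step = {aX}"
  by (auto simp: decode_step_def)

lemma decode_bits_correct: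
  fixes x defines "t \<equiv> sem decode_bits (initial_store (map of_bool x))"
  shows "decode x = (vars t xmode \<noteq> 0, vars t xval, map (arrs t aX) [0..<vars t xcnt], vars t xdok = 1)"
proof -
  define s where "s = initial_store (map of_bool x)"
  define s1 where "s1 = sem (xmode ::= Num 0 ;; xval ::= Num 0 ;; xcnt ::= Num 0 ;; xdok ::= Num 1) s"
  define I where "I k t \<longleftrightarrow> decode (take k x) = (vars t xmode \<noteq> 0, vars t xval, map (arrs t aX) [0..<vars t xcnt], vars t xdok = 1) \<and>
    vars t xcnt \<le> k \<and> (\<forall>i<length x. k \<le> i \<longrightarrow> arrs t aX i = of_bool (x ! i))" for k t
  have "I (vars s1 0) (sem (For xi 0 decode_step) s1)"
  proof (rule sem_For_invariant)
    show "I 0 (set_var xi 0 s1)" by (simp add: I_def s1_def s_def initial_store_def decode_def)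
  next
    fix k t assume A: "k < vars s1 0" "I k t" "vars t xi = k"
    have k: "k < length x" using A(1) by (simp add: s1_def s_def initial_store_def)
    define b where "b = x ! k"
    have take: "take (Suc k) x = take k x @ [b]" using k by (simp add: take_Suc_conv_app_nth b_def)
    have xk: "arrs t aX k = of_bool b" using A(2) k by (simp add: I_def b_def)
    have d: "decode (take (Suc k) x) = dec_step (vars t xmode \<noteq> 0, vars t xval, map (arrs t aX) [0..<vars t xcnt], vars t xdok = 1) b"
      using A(2) unfolding take decode_snoc I_def by simp
    \<comment> \<open>The position written to is not beyond the digit just read, so all digits still
      to be read are intact.\<close>
    have cnt: "vars t xcnt \<le> k" using A(2) by (simp add: I_def)
    have old: "\<forall>i<length x. k \<le> i \<longrightarrow> arrs t aX i = of_bool (x ! i)" using A(2) by (simp add: I_def)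
    let ?t' = "sem decode_step t"
    have "I (Suc k) ?t'"
    proof (cases "vars t xmode = 0")
      case True
      show ?thesis
      proof (cases b)
        case True
        then have "?t' = Store ((vars t)(xv := 1, xmode := 1)) (arrs t)"
          using xk A(3) \<open>vars t xmode = 0\<close> by (simp add: decode_step_def)
        then show ?thesis using d cnt old True \<open>vars t xmode = 0\<close> by (simp add: I_def)
      next
        case False
        then have "?t' = Store ((vars t)(xv := 0, xcnt := Suc (vars t xcnt), xval := 0)) ((arrs t)(aX := (arrs t aX)(vars t xcnt := vars t xval)))"
          using xk A(3) True by (simp add: decode_step_def)
        then show ?thesis using d cnt old False True by (simp add: I_def)
      qed
    next
      case False
      then have "vars ?t' xmode = 0" "vars ?t' xval = 2 * vars t xval + of_bool b" "vars ?t' xcnt = vars t xcnt"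
        "arrs ?t' aX = arrs t aX" "vars ?t' xdok = 1 \<longleftrightarrow> vars t xdok = 1 \<and> \<not> (vars t xval = 0 \<and> \<not> b)"
        using xk A(3) by (simp_all add: decode_step_def)
      then show ?thesis using d cnt old False by (simp add: I_def)
    qed
    then show "I (Suc k) (set_var xi (Suc k) ?t')" by (simp add: I_def)
  qed simp
  moreover have "t = sem (For xi 0 decode_step) s1" by (simp add: t_def decode_bits_def s1_def s_def)
  moreover have "vars s1 0 = length x" by (simp add: s1_def s_def initial_store_def)
  ultimately show ?thesis by (simp add: I_def)
qed

section \<open>The decision problem\<close>

definition check_ranges :: cmd where
  "check_ranges = xrc ::= Num 1 ;;
     For xi xM (When (NotE (AndE (Less (Arr aX (Plus (Num 2) (Plus (Var xi) (Var xi)))) (Var xN))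
         (Less (Arr aX (Plus (Num 3) (Plus (Var xi) (Var xi)))) (Var xN)))) (xrc ::= Num 0)) ;;
     For xi xE (xo ::= Plus (Var xoE) (Plus (Plus (Var xi) (Var xi)) (Plus (Var xi) (Var xi))) ;;
       When (NotE (AndE (Less (Arr aX (Var xo)) (Var xS)) (AndE (Less (Arr aX (Plus (Var xo) (Num 1))) (Var xS))
         (Arr aX (Plus (Var xo) (Num 2)))))) (xrc ::= Num 0)) ;;
     For xi xS (When (NotE (Arr aX (Plus (Var xoC) (Plus (Var xi) (Var xi))))) (xrc ::= Num 0))"

lemma check_ranges_frames [simp]: "assigned check_ranges = {xrc, xi, xo}" "written check_ranges = {}"
  by (auto simp: check_ranges_def)

definition ranges_ok :: "(nat \<Rightarrow> nat) \<Rightarrow> bool" where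
  "ranges_ok X \<longleftrightarrow> (\<forall>i<virt_edges X. virt_edge X i \<subseteq> {..<X 0}) \<and>
     (\<forall>i<subs_edges X. subs_edge X i \<subseteq> {..<subs_nodes X} \<and> 0 < X (edge_pos X + 1 + 4 * i + 2)) \<and>
     (\<forall>u<subs_nodes X. 0 < X (subs_pos X + 1 + 2 * u))"

lemma check_loop:
  fixes T :: "nat \<Rightarrow> bool"
  assumes "x \<notin> assigned c" "xrc \<noteq> x"
    and "\<And>k t. k < vars s y \<Longrightarrow> vars t x = k \<Longrightarrow> (\<And>v. v \<notin> assigned (For x y c) \<Longrightarrow> vars t v = vars s v) \<Longrightarrow>
      (\<And>a. a \<notin> written c \<Longrightarrow> arrs t a = arrs s a) \<Longrightarrow> vars (sem c t) xrc = 1 \<longleftrightarrow> vars t xrc = 1 \<and> T k"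
  shows "vars (sem (For x y c) s) xrc = 1 \<longleftrightarrow> vars s xrc = 1 \<and> (\<forall>k<vars s y. T k)"
proof -
  define I where "I k t \<longleftrightarrow> (vars t xrc = 1 \<longleftrightarrow> vars s xrc = 1 \<and> (\<forall>i<k. T i))" for k t
  have "I (vars s y) (sem (For x y c) s)"
    by (rule sem_For_invariant) (use assms in \<open>auto simp: I_def less_Suc_eq\<close>)
  then show ?thesis by (simp add: I_def)
qed

lemma check_ranges_correct:
  assumes h: "header_ok s"
  shows "vars (sem check_ranges s) xrc = 1 \<longleftrightarrow> ranges_ok (arrs s aX)"
proof -
  let ?X = "arrs s aX"
  let ?c1 = "When (NotE (AndE (Less (Arr aX (Plus (Num 2) (Plus (Var xi) (Var xi)))) (Var xN))
         (Less (Arr aX (Plus (Num 3) (Plus (Var xi) (Var xi)))) (Var xN)))) (xrc ::= Num 0)"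
  let ?c2 = "xo ::= Plus (Var xoE) (Plus (Plus (Var xi) (Var xi)) (Plus (Var xi) (Var xi))) ;;
       When (NotE (AndE (Less (Arr aX (Var xo)) (Var xS)) (AndE (Less (Arr aX (Plus (Var xo) (Num 1))) (Var xS))
         (Arr aX (Plus (Var xo) (Num 2)))))) (xrc ::= Num 0)"
  let ?c3 = "When (NotE (Arr aX (Plus (Var xoC) (Plus (Var xi) (Var xi))))) (xrc ::= Num 0)"
  define s1 where "s1 = sem (xrc ::= Num 1) s"
  define s2 where "s2 = sem (For xi xM ?c1) s1"
  define s3 where "s3 = sem (For xi xE ?c2) s2"
  have v: "vars s xN = ?X 0" "vars s xM = virt_edges ?X" "vars s xS = subs_nodes ?X" "vars s xE = subs_edges ?X"
    "vars s xoC = subs_pos ?X + 1" "vars s xoE = edge_pos ?X + 1"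
    using h by (simp_all add: header_ok_def Let_def)
  have v1: "vars s1 y = vars s y" if "y \<noteq> xrc" for y using that by (simp add: s1_def)
  have a: "arrs s1 = arrs s" "arrs s2 = arrs s" "arrs s3 = arrs s"
    by (simp_all add: s1_def s2_def s3_def fun_eq_iff arrs_sem)
  have v2: "vars s2 y = vars s y" if "y \<notin> {xrc, xi}" for y using that v1 by (simp add: s2_def vars_sem)
  have v3: "vars s3 y = vars s y" if "y \<notin> {xrc, xi, xo}" for y using that v2 by (simp add: s3_def vars_sem)
  have m: "2 + (k + k) = 2 + 2 * k" "3 + (k + k) = 2 + 2 * k + 1" "k + k + (k + k) = 4 * k" for k :: nat by simp_all
  have 1: "vars s2 xrc = 1 \<longleftrightarrow> vars s1 xrc = 1 \<and> (\<forall>k<vars s1 xM. virt_edge ?X k \<subseteq> {..<?X 0})"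
    unfolding s2_def
  proof (rule check_loop)
    fix k t assume "vars t xi = k" and F: "\<And>v. v \<notin> assigned (For xi xM ?c1) \<Longrightarrow> vars t v = vars s1 v"
      "\<And>a. a \<notin> written ?c1 \<Longrightarrow> arrs t a = arrs s1 a"
    moreover have "vars t xN = ?X 0" "arrs t aX = ?X" using F v v1 a by simp_all
    ultimately show "vars (sem ?c1 t) xrc = 1 \<longleftrightarrow> vars t xrc = 1 \<and> virt_edge ?X k \<subseteq> {..<?X 0}"
      by (simp add: virt_edge_def m del: add_2_eq_Suc add_2_eq_Suc')
  qed simp_all
  have 2: "vars s3 xrc = 1 \<longleftrightarrow> vars s2 xrc = 1 \<and> (\<forall>k<vars s2 xE. subs_edge ?X k \<subseteq> {..<subs_nodes ?X} \<and> 0 < ?X (edge_pos ?X + 1 + 4 * k + 2))"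
    unfolding s3_def
  proof (rule check_loop)
    fix k t assume "vars t xi = k" and F: "\<And>v. v \<notin> assigned (For xi xE ?c2) \<Longrightarrow> vars t v = vars s2 v"
      "\<And>a. a \<notin> written ?c2 \<Longrightarrow> arrs t a = arrs s2 a"
    moreover have "vars t xS = subs_nodes ?X" "vars t xoE = edge_pos ?X + 1" "arrs t aX = ?X" using F v v2 a by simp_all
    ultimately show "vars (sem ?c2 t) xrc = 1 \<longleftrightarrow> vars t xrc = 1 \<and> subs_edge ?X k \<subseteq> {..<subs_nodes ?X} \<and> 0 < ?X (edge_pos ?X + 1 + 4 * k + 2)"
      by (simp add: subs_edge_def m)
  qed simp_all
  have 3: "vars (sem (For xi xS ?c3) s3) xrc = 1 \<longleftrightarrow> vars s3 xrc = 1 \<and> (\<forall>k<vars s3 xS. 0 < ?X (subs_pos ?X + 1 + 2 * k))"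
  proof (rule check_loop)
    fix k t assume "vars t xi = k" and F: "\<And>v. v \<notin> assigned (For xi xS ?c3) \<Longrightarrow> vars t v = vars s3 v"
      "\<And>a. a \<notin> written ?c3 \<Longrightarrow> arrs t a = arrs s3 a"
    moreover have "vars t xoC = subs_pos ?X + 1" "arrs t aX = ?X" using F v v3 a by simp_all
    ultimately show "vars (sem ?c3 t) xrc = 1 \<longleftrightarrow> vars t xrc = 1 \<and> 0 < ?X (subs_pos ?X + 1 + 2 * k)"
      by (simp add: mult_2)
  qed simp_all
  have "sem check_ranges s = sem (For xi xS ?c3) s3" by (simp add: check_ranges_def s3_def s2_def s1_def)
  then show ?thesis using 1 2 3 v v1 v2 v3 by (simp add: ranges_ok_def s1_def)
qed

text \<open>Numbers in the header are given in binary and may be exponential in the input length.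
  The comparison of \<open>xcnt\<close> with the size of the layout therefore precedes all loops
  that such numbers bound.\<close>

definition decider :: cmd where
  "decider = decode_bits ;; read_header ;; xres ::= Num 0 ;;
     When (AndE (Equal (Var xdok) (Num 1)) (AndE (NotE (Var xmode)) (AndE (NotE (Var xval))
         (AndE (Equal (Var xcnt) (Plus (Plus (Var xoE) (Plus (Plus (Var xE) (Var xE)) (Plus (Var xE) (Var xE)))) (Num 1)))
         (AndE (Var xN) (AndE (Var xS) (AndE (Equal (Var xM) (Minus (Var xN) (Num 1))) (Equal (Var xE) (Minus (Var xS) (Num 1))))))))))
       (check_ranges ;;
        When (Equal (Var xrc) (Num 1))
          (solve ;;
           When (AndE (Equal (Var xokv) (Num 1)) (AndE (Equal (Var xok) (Num 1)) (AndE (Arr aTC (Var xo))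
               (LessEq (Minus (Arr aTC (Var xo)) (Num 1)) (Arr aX (Minus (Var xcnt) (Num 1)))))))
             (xres ::= Num 1))) ;;
     Write aOUT (Num 0) (Var xres) ;; xoo ::= Num 1"

lemma decide_frames: "xcnt \<notin> assigned solve" "xres \<notin> assigned solve" "aX \<notin> written solve"
  by (simp_all add: solve_def prepare_def)

definition accepts :: "(nat \<Rightarrow> nat) \<Rightarrow> nat \<Rightarrow> bool" where
  "accepts X \<Gamma> \<longleftrightarrow> raw_ok X \<and> ranges_ok X \<and>
     (\<exists>I m. path_to_tree I \<and> input_matches X I \<and> feasible I m \<and> cost I m \<le> \<Gamma>)"

lemma matching_instance:
  assumes raw: "raw_ok X" and ran: "ranges_ok X"
    and p: "path_graph {..<X 0} (virt_edge X ` {..<virt_edges X})" and t: "tree_graph {..<subs_nodes X} (subs_edge X ` {..<subs_edges X})"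
    and inj: "inj_on (virt_edge X) {..<virt_edges X}" "inj_on (subs_edge X) {..<subs_edges X}"
  shows "\<exists>I. path_to_tree I \<and> input_matches X I"
proof -
  \<comment> \<open>Capacities and costs are functions of edges as sets; inverting the injective
    listing finds the record of an edge.\<close>
  define ix where "ix e = the_inv_into {..<subs_edges X} (subs_edge X) e" for e
  have ix: "ix (subs_edge X i) = i" if "i < subs_edges X" for i
    unfolding ix_def using the_inv_into_f_f[OF inj(2)] that by simp
  define I where "I = \<lparr>VR = {..<X 0}, ER = virt_edge X ` {..<virt_edges X}, VS = {..<subs_nodes X},
    ES = subs_edge X ` {..<subs_edges X}, node_cap = (\<lambda>u. X (subs_pos X + 1 + 2 * u)),
    edge_cap = (\<lambda>e. X (edge_pos X + 1 + 4 * ix e + 2)), node_cost = (\<lambda>u. X (subs_pos X + 1 + 2 * u + 1)),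
    edge_cost = (\<lambda>e. X (edge_pos X + 1 + 4 * ix e + 3))\<rparr>"
  have "input_matches X I" using inj ix by (simp add: input_matches_def I_def)
  moreover have "tree_graph (VR I) (ER I)"
  proof -
    obtain q where "q \<noteq> []" "distinct q" "set q = {..<X 0}" "path_edges q = virt_edge X ` {..<virt_edges X}"
      using p unfolding path_graph_def by (elim exE conjE)
    then show ?thesis using path_tree_graph[of q] by (simp add: I_def)
  qed
  then have "path_to_tree I" unfolding path_to_tree_def valid_cvne_def
    using p t ran ix by (simp add: I_def tree_graph_def ranges_ok_def)
  ultimately show ?thesis by blast
qed

lemma matching_ranges_ok:
  assumes "path_to_tree I" "input_matches X I"
  shows "ranges_ok X"
  unfolding ranges_ok_def
proof (intro conjI allI impI)
  have raw: "raw_ok X" by (rule path_to_tree_raw_ok[OF assms])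
  have val: "valid_cvne I" using assms by (simp add: path_to_tree_def)
  fix i
  show "i < virt_edges X \<Longrightarrow> virt_edge X i \<subseteq> {..<X 0}" "i < subs_edges X \<Longrightarrow> subs_edge X i \<subseteq> {..<subs_nodes X}"
    using raw by (simp_all add: raw_ok_def)
  show "0 < X (edge_pos X + 1 + 4 * i + 2)" if i: "i < subs_edges X"
  proof -
    have "subs_edge X i \<in> ES I" using assms(2) i by (simp add: input_matches_def)
    then have "0 < edge_cap I (subs_edge X i)" using val by (simp add: valid_cvne_def)
    then show ?thesis using assms(2) i by (simp add: input_matches_def)
  qed
  show "0 < X (subs_pos X + 1 + 2 * i)" if i: "i < subs_nodes X"
  proof -
    have "i \<in> VS I" using assms(2) i by (simp add: input_matches_def)
    then have "0 < node_cap I i" using val by (simp add: valid_cvne_def)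
    then show ?thesis using assms(2) i by (simp add: input_matches_def)
  qed
qed

text \<open>From left to right, the flags certify the graphs, so the numbers in memory define an
  instance, and the tour found yields a mapping within the budget. Conversely a mapping within the
  budget bounds the entry by optimality.\<close>

lemma solve_accepts:
  fixes s defines "X \<equiv> arrs s aX" and "t \<equiv> sem solve s"
  assumes h: "header_ok s" and raw: "raw_ok X" and ran: "ranges_ok X"
  shows "vars t xokv = 1 \<and> vars t xok = 1 \<and> arrs t aTC (vars t xo) \<noteq> 0 \<and> arrs t aTC (vars t xo) - 1 \<le> \<Gamma> \<longleftrightarrow> accepts X \<Gamma>"
    (is "?l \<longleftrightarrow> _")
proof
  note S = solve_correct[OF h, folded X_def t_def, OF raw]
  assume l: ?l
  then have ok: "vars t xokv = 1 \<and> vars t xok = 1" by blast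
  obtain I where I: "path_to_tree I" "input_matches X I"
    using matching_instance[OF raw ran] S(3)[OF ok] by blast
  define c where "c = arrs t aTC (vars t xo)"
  define p where "p = map (arrs t aVO) [0..<X 0]"
  note S1 = S(1)[OF ok I(2), folded c_def p_def]
  then have AI: "arranged_instance (subs_nodes X) (arrs t aPR) I p (arrs t aQ)" by blast
  obtain A B where R: "realises (subs_nodes X) (arrs t aPR) (arrs t aQ) p I (c - 1) (rev A @ B)"
    using S1 l unfolding c_def[symmetric] by blast
  obtain m where "feasible I m" "cost I m = c - 1"
    using arranged_instance.exists_mapping_of_tour[OF AI, of "rev A @ B"] R unfolding realises_def by blast
  moreover have "c - 1 \<le> \<Gamma>" using l by (simp add: c_def)
  ultimately have "feasible I m" "cost I m \<le> \<Gamma>" by simp_all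
  then show "accepts X \<Gamma>" unfolding accepts_def using I raw ran by blast
next
  note S = solve_correct[OF h, folded X_def t_def, OF raw]
  assume "accepts X \<Gamma>"
  then obtain I m where I: "path_to_tree I" "input_matches X I" "feasible I m" "cost I m \<le> \<Gamma>"
    unfolding accepts_def by blast
  have ok: "vars t xokv = 1 \<and> vars t xok = 1" by (rule S(2)[OF I(1,2)])
  then show ?l using S(1)[OF ok I(2)] I(3,4) by (meson order_trans)
qed

text \<open>The layout has to fit the decoded numbers exactly, with one more for the budget, so that
  cells behind them, which still contain digits, have no influence.\<close>

lemma accepted_language:
  assumes d: "decode x = (m, v, map X [0..<cnt], ok)"
  shows "x \<in> C_path_to_tree \<longleftrightarrow> ok \<and> \<not> m \<and> v = 0 \<and> cnt = edge_pos X + 1 + 4 * subs_edges X + 1 \<and> accepts X (X (cnt - 1))"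
    (is "_ \<longleftrightarrow> ?r")
proof
  assume "x \<in> C_path_to_tree"
  then obtain xs \<Gamma> I m' where x: "x = encode_nats (xs @ [\<Gamma>])" and I: "path_to_tree I" "encodes_cvne xs I"
    and m': "feasible I m'" "cost I m' \<le> \<Gamma>" unfolding C_path_to_tree_def by blast
  have e: "m = False" "v = 0" "ok = True" "map X [0..<cnt] = xs @ [\<Gamma>]" using d decode_encode[of "xs @ [\<Gamma>]"] x by auto
  have cnt: "cnt = length xs + 1" using arg_cong[OF e(4), of length] by simp
  have nth: "X i = (xs @ [\<Gamma>]) ! i" if "i < cnt" for i using arg_cong[OF e(4), of "\<lambda>l. l ! i"] that by simp
  have Xi: "X i = xs ! i" if "i < length xs" for i using nth[of i] that cnt by (simp add: nth_append)
  have G: "X (cnt - 1) = \<Gamma>" using nth[of "length xs"] cnt by simp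
  note em = encodes_matches[OF I(2) Xi]
  have "accepts X (X (cnt - 1))" unfolding accepts_def G
    using path_to_tree_raw_ok[OF I(1) em(1)] matching_ranges_ok[OF I(1) em(1)] I(1) em(1) m' by blast
  then show ?r using e(1-3) cnt em(2) by simp
next
  assume r: ?r
  then have x: "x = encode_nats (map X [0..<cnt])" using decode_sound[of x False 0 "map X [0..<cnt]"] d by (simp add: digits_code_def)
  define xs where "xs = map X [0..<cnt - 1]"
  have "cnt = Suc (cnt - 1)" using r by simp
  then have "[0..<cnt] = [0..<cnt - 1] @ [cnt - 1]" by (metis upt_Suc_append zero_le)
  then have x2: "x = encode_nats (xs @ [X (cnt - 1)])" using x by (simp add: xs_def)
  obtain I m' where I: "path_to_tree I" "input_matches X I" "feasible I m'" "cost I m' \<le> X (cnt - 1)"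
    using r unfolding accepts_def by blast
  have len: "length xs = edge_pos X + 1 + 4 * subs_edges X" using r by (simp add: xs_def)
  have "X i = xs ! i" if "i < length xs" for i using that unfolding xs_def length_map by (simp del: upt_Suc)
  then have "encodes_cvne xs I" using matches_encodes[OF I(2)] len by blast
  then show "x \<in> C_path_to_tree" unfolding C_path_to_tree_def using x2 I by blast
qed

lemma decider_correct:
  fixes x defines "s \<equiv> initial_store (map of_bool x)" and "L \<equiv> length x"
  shows "vars (sem decider s) xoo = 1" "arrs (sem decider s) aOUT 0 = of_bool (x \<in> C_path_to_tree)"
    "runs L decider s (20000000 * (L * L * L) + 20000000)"
proof -
  define t0 where "t0 = sem decode_bits s"
  define X where "X = arrs t0 aX"
  define cnt where "cnt = vars t0 xcnt"
  have d: "decode x = (vars t0 xmode \<noteq> 0, vars t0 xval, map X [0..<cnt], vars t0 xdok = 1)"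
    using decode_bits_correct[of x] by (simp add: t0_def X_def cnt_def s_def)
  have cntL: "cnt \<le> L" using decode_length[OF d] by (simp add: L_def)
  define t1 where "t1 = sem (xres ::= Num 0) (sem read_header t0)"
  have h1: "header_ok t1" "arrs t1 aX = X"
    using read_header_correct[of t0] by (simp_all add: t1_def X_def header_ok_def Let_def)
  have v1: "vars t1 xdok = vars t0 xdok" "vars t1 xmode = vars t0 xmode" "vars t1 xval = vars t0 xval" "vars t1 xcnt = cnt" "vars t1 xres = 0"
    by (simp_all add: t1_def read_header_def cnt_def)
  have hv: "vars t1 xN = X 0" "vars t1 xM = virt_edges X" "vars t1 xS = subs_nodes X" "vars t1 xE = subs_edges X" "vars t1 xoE = edge_pos X + 1"
    using h1 by (simp_all add: header_ok_def Let_def)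
  obtain g1 where g1: "g1 = AndE (Equal (Var xdok) (Num 1)) (AndE (NotE (Var xmode)) (AndE (NotE (Var xval))
         (AndE (Equal (Var xcnt) (Plus (Plus (Var xoE) (Plus (Plus (Var xE) (Var xE)) (Plus (Var xE) (Var xE)))) (Num 1)))
         (AndE (Var xN) (AndE (Var xS) (AndE (Equal (Var xM) (Minus (Var xN) (Num 1))) (Equal (Var xE) (Minus (Var xS) (Num 1)))))))))"
    by blast
  obtain g3 where g3: "g3 = AndE (Equal (Var xokv) (Num 1)) (AndE (Equal (Var xok) (Num 1)) (AndE (Arr aTC (Var xo))
               (LessEq (Minus (Arr aTC (Var xo)) (Num 1)) (Arr aX (Minus (Var xcnt) (Num 1))))))"
    by blast
  define c3 where "c3 = solve ;; When g3 (xres ::= Num 1)"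
  define c2 where "c2 = check_ranges ;; When (Equal (Var xrc) (Num 1)) c3"
  have dec: "decider = decode_bits ;; read_header ;; xres ::= Num 0 ;; When g1 c2 ;; Write aOUT (Num 0) (Var xres) ;; xoo ::= Num 1"
    by (simp add: decider_def g1 g3 c2_def c3_def)
  define shape where "shape \<longleftrightarrow> vars t0 xdok = 1 \<and> vars t0 xmode = 0 \<and> vars t0 xval = 0 \<and>
    cnt = edge_pos X + 1 + 4 * subs_edges X + 1 \<and> 0 < X 0 \<and> 0 < subs_nodes X \<and> virt_edges X = X 0 - 1 \<and> subs_edges X = subs_nodes X - 1"
  have g1v: "val g1 t1 = 0 \<longleftrightarrow> \<not> shape" unfolding g1 using v1 hv by (auto simp: shape_def)
  define t2 where "t2 = sem check_ranges t1"
  have "header_ok t2" by (rule header_ok_cong[OF h1(1)]) (auto simp: t2_def vars_sem arrs_sem)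
  moreover have "arrs t2 aX = X" "vars t2 xcnt = cnt" "vars t2 xres = 0"
    using h1 v1 by (simp_all add: t2_def vars_sem arrs_sem)
  ultimately have h2: "header_ok t2" "arrs t2 aX = X" "vars t2 xcnt = cnt" "vars t2 xres = 0" by blast+
  have rc: "vars t2 xrc = 1 \<longleftrightarrow> ranges_ok X" using check_ranges_correct[OF h1(1)] h1(2) by (simp add: t2_def)
  define t3 where "t3 = sem solve t2"
  have h3: "arrs t3 aX = X" "vars t3 xcnt = cnt" "vars t3 xres = 0"
    using h2 decide_frames by (simp_all add: t3_def vars_sem arrs_sem)
  have raw: "raw_ok X" if "shape" "ranges_ok X" using that by (auto simp: shape_def ranges_ok_def raw_ok_def)
  have g3v: "val g3 t3 = 0 \<longleftrightarrow> \<not> accepts X (X (cnt - 1))" if "shape" "ranges_ok X"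
    using solve_accepts[OF h2(1), unfolded h2(2), OF raw[OF that] that(2), folded t3_def, of "X (cnt - 1)"] h3
    by (auto simp: g3)
  define t4 where "t4 = sem (When g1 c2) t1"
  have r4: "vars t4 xres = of_bool (shape \<and> ranges_ok X \<and> accepts X (X (cnt - 1)))"
  proof (cases shape)
    case False
    then have "t4 = t1" using g1v by (simp add: t4_def)
    then show ?thesis using False v1 by simp
  next
    case True
    then have t4: "t4 = sem (When (Equal (Var xrc) (Num 1)) c3) t2" using g1v by (simp add: t4_def c2_def t2_def)
    show ?thesis
    proof (cases "ranges_ok X")
      case False
      then have "t4 = t2" using rc by (simp add: t4)
      then show ?thesis using False h2 by simp
    next
      case ran: True
      then have "t4 = sem (When g3 (xres ::= Num 1)) t3" using rc by (simp add: t4 c3_def t3_def)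
      then show ?thesis using g3v[OF True ran] True ran h3 by simp
    qed
  qed
  have "x \<in> C_path_to_tree \<longleftrightarrow> shape \<and> ranges_ok X \<and> accepts X (X (cnt - 1))"
    using accepted_language[OF d] by (auto simp: shape_def accepts_def raw_ok_def)
  then have r: "vars t4 xres = of_bool (x \<in> C_path_to_tree)" using r4 by simp
  have fin: "sem decider s = sem (Write aOUT (Num 0) (Var xres) ;; xoo ::= Num 1) t4"
    by (simp add: dec t4_def t1_def t0_def)
  show "vars (sem decider s) xoo = 1" "arrs (sem decider s) aOUT 0 = of_bool (x \<in> C_path_to_tree)"
    unfolding fin using r by simp_all
  let ?C = "L * L * L"
  have mono: "L \<le> ?C" by (cases L) auto
  have "vars s 0 = L" by (simp add: s_def initial_store_def L_def)
  then have R0: "runs L decode_bits s (1000 + 1000 * L)"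
    by (intro runs_mono[OF runs_env[where env = "\<lambda>_. L"]]) (simp_all add: decode_bits_def decode_step_def)
  have Rs: "runs L Skip t T" if "1 \<le> T" for t T
    by (rule runs_mono[OF runs_env[where env = "\<lambda>_. 0"]]) (use that in simp_all)
  have R1: "runs L (When g1 c2) t1 (expr_time g1 + 1 + (11000000 * ?C + 10000))"
  proof (rule runs_Cond)
    show "expr_ok g1" by (simp add: g1)
    show "runs L Skip t1 (11000000 * ?C + 10000)" by (rule Rs) simp
    assume "val g1 t1 \<noteq> 0"
    then have shape: shape by (rule contrapos_np) (rule g1v[THEN iffD2])
    \<comment> \<open>The layout consists of no more than \<open>L\<close> numbers and counts all
      nodes and edges, so every loop bound is at most \<open>L\<close>, and the time of the solver
      becomes cubic in the input length.\<close>
    have nL: "X 0 \<le> L" "subs_nodes X \<le> L" "virt_edges X \<le> L" "subs_edges X \<le> L"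
      using shape cntL by (auto simp: shape_def edge_pos_def subs_pos_def)
    have cube: "X 0 * X 0 * subs_nodes X \<le> ?C" by (intro mult_mono nL) auto
    have Rc: "runs L check_ranges t1 (1000 + 1000 * L)"
      by (rule runs_mono[OF runs_env[where env = "\<lambda>_. L"]]) (use hv nL in \<open>auto simp: check_ranges_def\<close>)
    have R3: "runs L c3 t2 (10000000 * ?C + 1000)" if "vars t2 xrc = 1"
    proof -
      have raw: "raw_ok (arrs t2 aX)" using raw[OF shape] rc that h2(2) by simp
      have "runs L solve t2 (10000000 * ?C)"
        by (rule runs_mono[OF time_solve[OF h2(1) raw]]) (use cube h2(2) in simp)
      moreover have "runs L (When g3 (xres ::= Num 1)) t3 1000"
        by (rule runs_mono[OF runs_env[where env = "\<lambda>_. 0"]]) (simp_all add: g3)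
      ultimately show ?thesis unfolding c3_def t3_def by (intro runs_Seq)
    qed
    have "runs L (When (Equal (Var xrc) (Num 1)) c3) t2 (expr_time (Equal (Var xrc) (Num 1)) + 1 + (10000000 * ?C + 1000))"
      by (rule runs_Cond) (use R3 Rs in auto)
    then have "runs L c2 t1 ((1000 + 1000 * L) + (expr_time (Equal (Var xrc) (Num 1)) + 1 + (10000000 * ?C + 1000)))"
      unfolding c2_def using Rc by (intro runs_Seq) (simp_all add: t2_def)
    then show "runs L c2 t1 (11000000 * ?C + 10000)"
    proof (rule runs_mono)
      have "expr_time (Equal (Var xrc) (Num 1)) = 11" by simp
      then show "(1000 + 1000 * L) + (expr_time (Equal (Var xrc) (Num 1)) + 1 + (10000000 * ?C + 1000)) \<le> 11000000 * ?C + 10000"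
        using mono by linarith
    qed
  qed
  have R2: "runs L (Write aOUT (Num 0) (Var xres) ;; xoo ::= Num 1) t4 1000"
    by (rule runs_mono[OF runs_env[where env = "\<lambda>_. 0"]]) simp_all
  have Ra: "runs L (xres ::= Num 0) (sem read_header t0) 1000"
    by (rule runs_mono[OF runs_env[where env = "\<lambda>_. 0"]]) simp_all
  have "runs L decider s ((1000 + 1000 * L) + (1000 + (1000 + ((expr_time g1 + 1 + (11000000 * ?C + 10000)) + 1000))))"
    unfolding dec
    by (intro runs_Seq R0 time_read_header Ra[unfolded t0_def] R1[unfolded t1_def t0_def] R2[unfolded t4_def t1_def t0_def])
  then show "runs L decider s (20000000 * ?C + 20000000)"
  proof (rule runs_mono)
    have "expr_time g1 \<le> 1000" by (simp add: g1)
    then show "(1000 + 1000 * L) + (1000 + (1000 + ((expr_time g1 + 1 + (11000000 * ?C + 10000)) + 1000))) \<le> 20000000 * ?C + 20000000"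
      using mono by linarith
  qed
qed

lemma C_path_to_tree_in_P: "C_path_to_tree \<in> class_P"
  unfolding class_P_def
proof (intro CollectI exI allI)
  fix x :: "bool list"
  let ?s = "initial_store (map of_bool x)" and ?L = "length x"
  let ?p = "RSeq copy_input (RSeq (compile decider) (copy_output aOUT xoo))"
  note D = decider_correct[of x]
  have "computes_within ?p (map of_bool x) (8 + 14 * ?L + (20000000 * (?L * ?L * ?L) + 20000000) + 16 * 1) [of_bool (x \<in> C_path_to_tree)]"
    using computes_within_compile[of "map of_bool x" decider _ aOUT xoo, unfolded length_map, OF D(3)] D(1,2) by simp
  moreover have "8 + 14 * ?L + (20000000 * (?L * ?L * ?L) + 20000000) + 16 * 1 \<le> 30000000 * ?L ^ 3 + 30000000"
  proof -
    have "?L \<le> ?L * ?L * ?L" by (cases ?L) auto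
    then show ?thesis unfolding power3_eq_cube by linarith
  qed
  ultimately show "computes_within ?p (map of_bool x) (30000000 * ?L ^ 3 + 30000000) [of_bool (x \<in> C_path_to_tree)]"
    unfolding computes_within_def using order_trans by blast
qed

theorem theorem7:
  shows "C_path_to_tree \<in> class_P \<and>
    (\<exists>p C. \<forall>I xs. path_to_tree I \<and> encodes_cvne xs I \<longrightarrow>
       (\<exists>ys. computes_within p xs (C * card (VR I) ^ 2 * card (VS I)) ys \<and> is_answer I ys))"
  using C_path_to_tree_in_P solver_correct by blast

end
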